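(* Let $f\colon\mathbb{C}\to\mathbb{C}$ be given by $f(z)=e^z+z$. Then there is an infinite sequence $(U_j)_{j=1}^{\infty}$ of pairwise disjoint simply-connected domains $U_j\subset\mathbb{C}$ such that $f^{-1}(U_j)$ is connected for all $j$.
   Context: A domain is a non-empty connected open subset of $\mathbb{C}$. *)

theory Defs
  imports "HOL-Complex_Analysis.Complex_Analysis" "HOL-Library.Disjoint_Sets"
begin

definition plane_domain :: "complex set \<Rightarrow> bool" where
  "plane_domain U \<longleftrightarrow> U \<noteq> {} \<and> open U \<and> connected U"

end

theory Submission
  imports Defs
begin

text \<open>
  The domains are not given by formulas; they are built in infinitely many steps, in the manner
  of the lakes of Wada. Write \<open>expid z = exp z + z\<close>. Fix infinitely many disjoint
  cells and look for homeomorphisms \<open>\<phi> n\<close> of the plane such that, for each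
  \<open>i\<close>, the preimages of the \<open>i\<close>-th cell under \<open>\<phi> n\<close>
  increase with \<open>n\<close>. The unions \<open>U i\<close> of these preimages are disjoint,
  and as increasing unions of open simply connected sets they are simply connected domains. For
  the preimage of \<open>U i\<close> under \<open>expid\<close> to be connected it is enough
  that any two of its points taken from a countable dense set get joined at some stage, because
  the components of an open set are open. So everything reduces to one stage
  (\<open>join_two_points\<close>): given two points \<open>p\<close> and \<open>q\<close> over
  a cell, find a homeomorphism \<open>\<Psi>\<close> mapping the cell into itself, leaving the
  other cells alone, such that \<open>p\<close> and \<open>q\<close> lie in one component of the
  preimage of the cell under \<open>\<Psi> \<circ> \<phi> \<circ> expid\<close>.

  A stage uses the covering properties of \<open>F = \<phi> \<circ> expid\<close>. The critical
  points of \<open>expid\<close> are the simple points \<open>cpt k = (2k+1)\<pi>i\<close>, and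
  their values are distinct; the images of these values under \<open>\<phi>\<close> are called
  tips. Components of preimages of bounded sets are bounded, so curves avoiding the tips lift
  uniquely. After the tips have been moved off an annulus around the circle of logarithmic
  radius 11/5, the points \<open>p\<close> and \<open>q\<close> are linked by a finite chain of
  edges, an edge being a lift of the part of this circle outside the cell
  (\<open>initial_chain\<close>). This rests on the connectedness of a collar of a component of
  the preimage of a disc, a consequence of Janiszewski's theorem
  (\<open>connected_comp_collar\<close>).

  Edges are removed one at a time (\<open>join_by_edges\<close>). If each edge is followed by
  another edge of the set, the edges form cycles and any one of them is redundant. Otherwise
  some edge from \<open>a0\<close> to \<open>b0\<close> is followed by a sheet \<open>aR\<close>
  at which no edge of the set starts. All sheets in question lie in the component of the
  preimage of a large disc that contains the origin, and the critical point \<open>cpt (int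
  M)\<close> with \<open>M\<close> large is reached from each of them along a spiral. On the
  other side of this critical point there is a component on which \<open>expid\<close> is
  injective. Untwisting the spiral and moving the tip radially inwards puts it next to
  \<open>aR\<close> (\<open>outer_step\<close>); then the tip is pulled across the circle
  (\<open>pull_tip\<close>). This disturbs only the two sheets at the critical point, hence no
  edge of the set, and the lift along the circle that starts at \<open>a0\<close> now runs
  through \<open>b0\<close>, enters the sheet \<open>aR\<close>, changes to the injective sheet
  at the slit, and stays there for a full turn. Below the circle it therefore tends to the
  critical point at two angles differing by \<open>2\<pi>\<close>. Twisting the tip to the right
  angle and pushing it out into the cell joins \<open>a0\<close> and \<open>b0\<close> through
  the critical point (\<open>remove_edge\<close>).
\<close>

section \<open>Lifting through the map exp z + z\<close>

definition expid :: "complex \<Rightarrow> complex" where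
  "expid z = exp z + z"

definition cpt :: "int \<Rightarrow> complex" where
  "cpt k = Complex 0 ((2 * of_int k + 1) * pi)"

definition cval :: "int \<Rightarrow> complex" where
  "cval k = Complex (-1) ((2 * of_int k + 1) * pi)"

lemma expid_has_field_derivative [derivative_intros]:
  "(expid has_field_derivative exp z + 1) (at z within S)"
  unfolding expid_def by (auto intro!: derivative_eq_intros)

lemma holomorphic_on_expid: "expid holomorphic_on S"
  unfolding expid_def by (intro holomorphic_intros)

lemma continuous_on_expid: "continuous_on S expid"
  using holomorphic_on_expid holomorphic_on_imp_continuous_on by blast

lemma expid_crit_iff: "exp z + 1 = 0 \<longleftrightarrow> z \<in> range cpt"
proof -
  have "exp z + 1 = 0 \<longleftrightarrow> exp z = exp (\<i> * pi)"
    by (simp add: add_eq_0_iff2)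
  also have "\<dots> \<longleftrightarrow> (\<exists>n::int. z = \<i> * pi + (of_int (2 * n) * pi) * \<i>)"
    by (rule exp_eq)
  also have "\<dots> \<longleftrightarrow> z \<in> range cpt"
    by (auto simp: cpt_def complex_eq_iff image_iff algebra_simps)
  finally show ?thesis .
qed

lemma expid_cpt: "expid (cpt k) = cval k"
proof -
  have "exp (cpt k) + 1 = 0" using expid_crit_iff by blast
  then have "exp (cpt k) = -1" by (simp add: add_eq_0_iff2)
  then show ?thesis by (simp add: expid_def cpt_def cval_def complex_eq_iff)
qed

lemma inj_cval: "inj cval"
  by (auto simp: inj_def cval_def)

text \<open>
  The open mapping theorem needs only that \<open>expid\<close> is not constant: its values at
  \<open>0\<close> and \<open>2\<pi>i\<close> differ.
\<close>

lemma open_expid_image: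
  assumes "open U" shows "open (expid ` U)"
proof (rule open_mapping_thm[of expid UNIV])
  have "expid 0 \<noteq> expid (2 * pi * \<i>)"
    by (auto simp: expid_def)
  then show "\<not> expid constant_on UNIV" unfolding constant_on_def by (metis UNIV_I)
qed (use assms holomorphic_on_expid in auto)

lemma open_vimage_expid: "open V \<Longrightarrow> open {z. expid z \<in> V}"
  using open_vimage[OF _ continuous_on_expid[of UNIV]] by (simp add: vimage_def)

lemma expid_locally_injective:
  assumes "exp z + 1 \<noteq> 0"
  obtains r where "r > 0" "inj_on expid (ball z r)"
proof -
  have "deriv expid z \<noteq> 0"
    using assms by (metis DERIV_imp_deriv expid_has_field_derivative)
  then show ?thesis
    using holomorphic_on_expid[of UNIV] has_complex_derivative_locally_injective[of expid UNIV z] that by auto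
qed

text \<open>
  On the lines \<open>Im z = \<plusminus>2\<pi>k\<close> the imaginary part of \<open>expid
  z\<close> equals that of \<open>z\<close>, so a connected set on which \<open>expid\<close> is
  bounded cannot cross such a line far out. Within a horizontal strip \<open>exp z\<close>
  dominates to the right and \<open>z\<close> to the left. This lemma replaces properness, which
  \<open>expid\<close> does not have: its fibres are infinite.
\<close>

lemma bounded_if_expid_bounded:
  assumes "connected Z" and R: "\<And>z. z \<in> Z \<Longrightarrow> cmod (expid z) \<le> R"
  shows "bounded Z"
proof (cases "Z = {}")
  case False
  then obtain z0 where z0: "z0 \<in> Z" by auto
  obtain k :: nat where k: "real k > max R (\<bar>Im z0\<bar>)" using reals_Archimedean2 by blast
  \<comment> \<open>On these lines \<open>exp z\<close> is real.\<close>
  define Y where "Y = 2 * pi * real k"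
  have "pi > 1" using pi_gt3 by simp
  have kY: "real k \<le> Y" unfolding Y_def using mult_right_mono[of 1 "2 * pi" "real k"] pi_gt3 by simp
  have off: "Im z \<noteq> Y" "Im z \<noteq> -Y" if "z \<in> Z" for z
  proof -
    have "sin (2 * real k * pi) = 0" by (rule sin_2npi)
    then have s: "sin Y = 0" unfolding Y_def by (simp add: mult_ac)
    have "cmod (expid z) \<ge> \<bar>Im (expid z)\<bar>" by (rule abs_Im_le_cmod)
    moreover have "Im z = Y \<or> Im z = -Y \<Longrightarrow> \<bar>Im (expid z)\<bar> = Y"
      using s kY by (auto simp: expid_def Im_exp)
    ultimately have "Im z = Y \<or> Im z = -Y \<Longrightarrow> Y \<le> R" using R[OF that] by force
    then show "Im z \<noteq> Y" "Im z \<noteq> -Y" using k kY by auto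
  qed
  have conn: "connected (Im ` Z)"
    using assms(1) by (intro connected_continuous_image continuous_intros)
  have Im: "\<bar>Im z\<bar> < Y" if "z \<in> Z" for z
  proof (rule ccontr)
    assume "\<not> \<bar>Im z\<bar> < Y"
    then consider "Im z \<ge> Y" | "Im z \<le> -Y" by linarith
    then show False
    proof cases
      case 1
      then have "Y \<in> Im ` Z" using connectedD_interval[OF conn, of "Im z0" "Im z" Y] z0 that k kY by auto
      then show False using off(1) by (metis imageE)
    next
      case 2
      then have "-Y \<in> Im ` Z" using connectedD_interval[OF conn, of "Im z" "Im z0" "-Y"] z0 that k kY by auto
      then show False using off(2) by (metis imageE)
    qed
  qed
  have R0: "R \<ge> 0" using R[OF z0] norm_ge_zero order_trans by blast
  have "\<bar>Re z\<bar> \<le> 2 + 2 * R + 2 * Y" if "z \<in> Z" for z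
  proof (cases "Re z \<ge> 0")
    case True
    have "exp (Re z) = cmod (expid z - z)" by (simp add: expid_def)
    also have "\<dots> \<le> R + (\<bar>Re z\<bar> + \<bar>Im z\<bar>)"
      by (meson R[OF that] add_mono cmod_le norm_triangle_ineq4 order_trans)
    finally have "exp (Re z) \<le> R + Re z + Y" using Im[OF that] True by simp
    moreover have "1 + Re z + (Re z)\<^sup>2 / 2 \<le> exp (Re z)" using exp_lower_Taylor_quadratic[OF True] .
    ultimately have "(Re z)\<^sup>2 \<le> 2 * (R + Y)" by simp
    also have "\<dots> \<le> (1 + 2 * (R + Y))\<^sup>2"
    proof -
      have "0 \<le> R + Y" using R0 kY by simp
      then have "1 + 2 * (R + Y) \<le> (1 + 2 * (R + Y))\<^sup>2" by (intro self_le_power) auto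
      then show ?thesis by simp
    qed
    finally have "Re z \<le> 1 + 2 * (R + Y)" by (meson power2_le_imp_le R0 kY True add_nonneg_nonneg of_nat_0_le_iff order_trans zero_le_one mult_nonneg_nonneg zero_le_numeral)
    then show ?thesis using True by simp
  next
    case False
    have "\<bar>Re z\<bar> \<le> cmod (expid z - exp z)" by (simp add: expid_def abs_Re_le_cmod)
    also have "\<dots> \<le> R + exp (Re z)" using R[OF that] norm_triangle_ineq4[of "expid z" "exp z"] by simp
    also have "\<dots> \<le> R + 1" using False by simp
    finally show ?thesis using kY R0 by simp
  qed
  then have "cmod z \<le> 2 + 2 * R + 2 * Y + Y" if "z \<in> Z" for z
    using that Im[OF that] cmod_le[of z] by (smt (verit, best))
  then show ?thesis unfolding bounded_iff by blast
qed auto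

lemma closure_component_in_open:
  fixes S :: "complex set"
  assumes "open S" "z \<in> closure (connected_component_set S a)" "z \<in> S"
  shows "z \<in> connected_component_set S a"
proof -
  have "open (connected_component_set S z)" "z \<in> connected_component_set S z"
    using assms by (auto simp: open_connected_component)
  then have "connected_component_set S z \<inter> connected_component_set S a \<noteq> {}"
    using assms(2) open_Int_closure_eq_empty by blast
  then show ?thesis
    using \<open>z \<in> connected_component_set S z\<close> connected_component_overlap by blast
qed

lemma finite_uniform_radius:
  fixes P :: "'a \<Rightarrow> real \<Rightarrow> bool"
  assumes "finite A" "\<And>z. z \<in> A \<Longrightarrow> \<exists>r>0. P z r" "\<And>z r s. P z r \<Longrightarrow> 0 < s \<Longrightarrow> s \<le> r \<Longrightarrow> P z s"
  shows "\<exists>r>0. \<forall>z\<in>A. P z r"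
  using assms(1,2)
proof (induction rule: finite_induct)
  case empty
  show ?case by (intro exI[of _ 1]) auto
next
  case (insert x F)
  then obtain r where r: "r > 0" "\<forall>z\<in>F. P z r" by auto
  obtain s where s: "s > 0" "P x s" using insert.prems by blast
  show ?case
    by (rule exI[of _ "min r s"]) (use r s assms(3) in \<open>auto intro: assms(3)\<close>)
qed

text \<open>
  A component of the preimage of a bounded open set is bounded, so the fibres in it are finite
  and it maps properly onto its image; without critical points it is a covering.
\<close>

lemma covering_space_component:
  fixes V :: "complex set"
  assumes V: "open V" "connected V" "bounded V" and z0: "expid z0 \<in> V"
    and Z: "Z = connected_component_set {z. expid z \<in> V} z0"
    and nocrit: "\<And>z. z \<in> Z \<Longrightarrow> exp z + 1 \<noteq> 0"
  shows "covering_space Z expid V"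
proof
  have oS: "open {z. expid z \<in> V}" using V(1) by (rule open_vimage_expid)
  have oZ: "open Z" unfolding Z using oS by (rule open_connected_component)
  have z0Z: "z0 \<in> Z" using z0 Z by auto
  have ZV: "expid z \<in> V" if "z \<in> Z" for z
    using that connected_component_subset[of "{z. expid z \<in> V}" z0] unfolding Z by auto
  obtain R where R: "\<And>w. w \<in> V \<Longrightarrow> cmod w \<le> R" using V(3) unfolding bounded_iff by blast
  have bZ: "bounded Z"
    by (rule bounded_if_expid_bounded[of _ R]) (use R ZV in \<open>auto simp: Z\<close>)
  have clZ: "z \<in> Z" if "z \<in> closure Z" "expid z \<in> V" for z
    using closure_component_in_open[OF oS] that unfolding Z by auto
  have cpt: "compact (closure Z)" using bZ by (simp add: compact_closure)
  show "continuous_on Z expid" by (rule continuous_on_expid)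
  have op: "open (expid ` Z)" using oZ by (rule open_expid_image)
  have clo: "closed (expid ` closure Z)"
    by (intro compact_imp_closed compact_continuous_image continuous_on_expid cpt)
  have "V \<subseteq> expid ` Z"
  proof (rule ccontr)
    assume *: "\<not> V \<subseteq> expid ` Z"
    have "open (V - expid ` closure Z)" using V(1) clo by (simp add: open_Diff)
    moreover have "V \<subseteq> expid ` Z \<union> (V - expid ` closure Z)" using clZ by auto
    moreover have "expid ` Z \<inter> (V - expid ` closure Z) \<inter> V = {}" using closure_subset by fastforce
    moreover have "expid ` Z \<inter> V \<noteq> {}" using z0Z ZV by auto
    moreover have "(V - expid ` closure Z) \<inter> V \<noteq> {}" using * clZ by auto
    ultimately show False using V(2) op unfolding connected_def by blast
  qed
  then show "expid ` Z = V" using ZV by auto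
  fix w assume w: "w \<in> V"
  define A where "A = {z \<in> Z. expid z = w}"
  have isol: "\<exists>r>0. inj_on expid (ball z r) \<and> ball z r \<subseteq> Z" if "z \<in> Z" for z
  proof -
    obtain r where r: "r > 0" "inj_on expid (ball z r)" using expid_locally_injective[OF nocrit[OF \<open>z \<in> Z\<close>]] by blast
    obtain s where s: "s > 0" "ball z s \<subseteq> Z" using oZ \<open>z \<in> Z\<close> open_contains_ball by blast
    have "ball z (min r s) \<subseteq> ball z r" "ball z (min r s) \<subseteq> ball z s" by auto
    then show ?thesis
      using r s inj_on_subset by (intro exI[of _ "min r s"]) (auto intro: inj_on_subset)
  qed
  have finA: "finite A"
  proof (rule ccontr)
    assume inf: "infinite A"
    have "bounded A" using bZ by (rule bounded_subset) (auto simp: A_def)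
    then obtain l where l: "l islimpt A" using inf closure_subset compact_closure
      by (metis compact_eq_Bolzano_Weierstrass)
    have "closed {z. expid z = w}"
      by (intro closed_Collect_eq continuous_on_expid continuous_intros)
    then have "expid l = w"
      using l islimpt_subset[of l A "{z. expid z = w}"] closed_limpt by (auto simp: A_def)
    moreover have "l \<in> closure Z"
      using l islimpt_subset[of l A Z] closure_def by (auto simp: A_def)
    ultimately have "l \<in> Z" using clZ w by auto
    then obtain r where r: "r > 0" "inj_on expid (ball l r)" using isol by blast
    obtain y where "y \<in> A" "y \<noteq> l" "dist y l < r"
      using l r(1) unfolding islimpt_approachable by blast
    then show False
      using r \<open>expid l = w\<close> unfolding inj_on_def A_def by (force simp: dist_commute)
  qed
  have "\<exists>d>0. \<forall>z\<in>A. inj_on expid (ball z d) \<and> ball z d \<subseteq> Z \<and> (\<forall>y\<in>A. y \<noteq> z \<longrightarrow> 2 * d \<le> dist z y)"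
  proof (rule finite_uniform_radius[OF finA])
    fix z assume z: "z \<in> A"
    obtain r where r: "r > 0" "inj_on expid (ball z r)" "ball z r \<subseteq> Z" using isol z by (auto simp: A_def)
    obtain e where e: "e > 0" "\<forall>y\<in>A. y \<noteq> z \<longrightarrow> e \<le> dist z y"
      using finite_set_avoid[OF finA, of z] by auto
    have "ball z (min r (e/2)) \<subseteq> ball z r" by auto
    moreover have "2 * min r (e/2) \<le> dist z y" if "y \<in> A" "y \<noteq> z" for y
      using e that by (smt (verit, best) field_sum_of_halves)
    ultimately show "\<exists>r>0. inj_on expid (ball z r) \<and> ball z r \<subseteq> Z \<and> (\<forall>y\<in>A. y \<noteq> z \<longrightarrow> 2 * r \<le> dist z y)"
      using r e inj_on_subset by (intro exI[of _ "min r (e/2)"]) (auto intro: inj_on_subset)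
  next
    fix z r s assume *: "inj_on expid (ball z r) \<and> ball z r \<subseteq> Z \<and> (\<forall>y\<in>A. y \<noteq> z \<longrightarrow> 2 * r \<le> dist z y)" "s \<le> (r::real)"
    then have "ball z s \<subseteq> ball z r" by auto
    then show "inj_on expid (ball z s) \<and> ball z s \<subseteq> Z \<and> (\<forall>y\<in>A. y \<noteq> z \<longrightarrow> 2 * s \<le> dist z y)"
      using * inj_on_subset by fastforce
  qed
  then obtain d where d: "d > 0" "\<And>z. z \<in> A \<Longrightarrow> inj_on expid (ball z d)" "\<And>z. z \<in> A \<Longrightarrow> ball z d \<subseteq> Z"
     "\<And>z y. z \<in> A \<Longrightarrow> y \<in> A \<Longrightarrow> y \<noteq> z \<Longrightarrow> 2 * d \<le> dist z y" by blast
  define C where "C = closure Z - (\<Union>z\<in>A. ball z d)"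
  have "compact C" unfolding C_def by (intro compact_diff cpt) auto
  then have clC: "closed (expid ` C)"
    by (intro compact_imp_closed compact_continuous_image continuous_on_expid)
  have wC: "w \<notin> expid ` C"
    using clZ w d(1) by (force simp: C_def A_def)
  define T where "T = (V \<inter> (\<Inter>z\<in>A. expid ` ball z d)) - expid ` C"
  have oT: "open T"
    unfolding T_def using finA clC V(1) open_expid_image by (intro open_Diff open_Int open_INT) auto
  have wT: "w \<in> T" unfolding T_def using w wC d(1) by (force simp: A_def)
  define sh where "sh z = ball z d \<inter> {y. expid y \<in> T}" for z
  show "\<exists>T. w \<in> T \<and> openin (top_of_set V) T \<and>
         (\<exists>v. \<Union> v = Z \<inter> expid -` T \<and> (\<forall>u\<in>v. openin (top_of_set Z) u) \<and> pairwise disjnt v \<and>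
           (\<forall>u\<in>v. \<exists>q. homeomorphism u T expid q))"
  proof (intro exI conjI)
    show "w \<in> T" by fact
    show "openin (top_of_set V) T" using oT by (intro open_subset) (auto simp: T_def)
    show "\<Union> (sh ` A) = Z \<inter> expid -` T"
    proof
      show "\<Union> (sh ` A) \<subseteq> Z \<inter> expid -` T" using d(3) by (auto simp: sh_def)
      show "Z \<inter> expid -` T \<subseteq> \<Union> (sh ` A)"
      proof
        fix y assume y: "y \<in> Z \<inter> expid -` T"
        then have "y \<notin> C" by (auto simp: T_def)
        then show "y \<in> \<Union> (sh ` A)" using y closure_subset by (auto simp: C_def sh_def)
      qed
    qed
    have osh: "open (sh z)" for z
      unfolding sh_def by (intro open_Int open_vimage_expid oT) auto
    then show "\<forall>u\<in>sh ` A. openin (top_of_set Z) u"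
      using d(3) by (auto simp: sh_def intro!: open_subset)
    show "pairwise disjnt (sh ` A)"
    proof (clarsimp simp: pairwise_def)
      fix z y assume "z \<in> A" "y \<in> A" "sh z \<noteq> sh y"
      then have "2 * d \<le> dist z y" using d(4) by metis
      then show "disjnt (sh z) (sh y)"
        unfolding disjnt_def sh_def by (auto simp: dist_commute) (smt (verit) dist_triangle dist_commute)
    qed
    show "\<forall>u\<in>sh ` A. \<exists>q. homeomorphism u T expid q"
    proof clarify
      fix z assume z: "z \<in> A"
      have "inj_on expid (sh z)" using d(2)[OF z] by (rule inj_on_subset) (auto simp: sh_def)
      then obtain q where "homeomorphism (sh z) (expid ` sh z) expid q"
        using invariance_of_domain_homeomorphism[OF osh continuous_on_expid] by (metis dual_order.refl)
      moreover have "T \<subseteq> expid ` ball z d" using z by (auto simp: T_def)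
      then have "expid ` sh z = T" unfolding sh_def by blast
      ultimately show "\<exists>q. homeomorphism (sh z) T expid q" by auto
    qed
  qed
qed

lemma expid_lift_unique:
  fixes s s' :: "'a::topological_space \<Rightarrow> complex"
  assumes "connected U" "continuous_on U s" "continuous_on U s'"
    and eq: "\<And>u. u \<in> U \<Longrightarrow> expid (s u) = expid (s' u)"
    and nocrit: "\<And>u. u \<in> U \<Longrightarrow> exp (s u) + 1 \<noteq> 0"
    and "u0 \<in> U" "s u0 = s' u0" "u \<in> U"
  shows "s u = s' u"
proof -
  let ?E = "{u \<in> U. s u = s' u}"
  have "closedin (top_of_set U) ?E"
  proof -
    have "?E = U \<inter> (\<lambda>u. s u - s' u) -` {0}" by auto
    then show ?thesis
      using assms(2,3) by (auto intro!: continuous_closedin_preimage continuous_intros)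
  qed
  moreover have "openin (top_of_set U) ?E"
  proof (subst openin_subopen, clarify)
    fix v assume v: "v \<in> U" "s v = s' v"
    obtain r where r: "r > 0" "inj_on expid (ball (s v) r)" using expid_locally_injective[OF nocrit[OF v(1)]] by blast
    let ?T = "(U \<inter> s -` ball (s v) r) \<inter> (U \<inter> s' -` ball (s v) r)"
    have "openin (top_of_set U) ?T"
      using assms(2,3) by (intro openin_Int continuous_openin_preimage_gen) auto
    moreover have "v \<in> ?T" using v r by auto
    moreover have "?T \<subseteq> ?E" using r(2) eq by (auto simp: inj_on_def)
    ultimately show "\<exists>T. openin (top_of_set U) T \<and> v \<in> T \<and> T \<subseteq> ?E" by blast
  qed
  ultimately have "?E = {} \<or> ?E = U" using assms(1) connected_clopen by blast
  then show ?thesis using assms by blast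
qed

lemma homeo_UNIV:
  assumes "homeomorphism UNIV UNIV \<phi> \<phi>i"
  shows "\<And>x. \<phi>i (\<phi> x) = x" "\<And>x. \<phi> (\<phi>i x) = x" "\<And>S. continuous_on S \<phi>" "\<And>S. continuous_on S \<phi>i" "inj \<phi>"
  using assms unfolding homeomorphism_def by (auto intro: continuous_on_subset inj_on_inverseI)

text \<open>
  Only the component through the starting point has to be free of critical points. Lifting along
  a sheet that avoids a critical point is possible even if the base set contains the critical
  value.
\<close>

lemma lift_through_component:
  fixes g :: "'a::real_normed_vector \<Rightarrow> complex"
  assumes hom: "homeomorphism UNIV UNIV \<phi> \<phi>i"
    and V: "open V" "connected V" "bounded V"
    and U: "convex U" "u0 \<in> U" "continuous_on U g" "g ` U \<subseteq> V"
    and z0: "\<phi> (expid z0) = g u0"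
    and nocrit: "\<And>z. z \<in> connected_component_set {z. \<phi> (expid z) \<in> V} z0 \<Longrightarrow> exp z + 1 \<noteq> 0"
  obtains s where "continuous_on U s" "s u0 = z0" "\<And>u. u \<in> U \<Longrightarrow> \<phi> (expid (s u)) = g u"
proof -
  note h = homeo_UNIV[OF hom]
  have eq: "\<phi>i ` V = {w. \<phi> w \<in> V}" using h by (auto simp: image_iff) (metis h(1))
  have "open (\<phi>i ` V)"
    unfolding eq using open_vimage[OF V(1) h(3)] by (simp add: vimage_def)
  moreover have "connected (\<phi>i ` V)" using V(2) h(4) by (intro connected_continuous_image)
  moreover have "bounded (\<phi>i ` V)"
  proof (rule bounded_subset)
    show "bounded (\<phi>i ` closure V)"
      using V(3) by (intro compact_imp_bounded compact_continuous_image h(4)) (simp add: compact_closure)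
    show "\<phi>i ` V \<subseteq> \<phi>i ` closure V" using closure_subset by blast
  qed
  moreover have e0: "expid z0 \<in> \<phi>i ` V" unfolding eq using z0 U by auto
  moreover have "{z. expid z \<in> \<phi>i ` V} = {z. \<phi> (expid z) \<in> V}" unfolding eq by simp
  ultimately have cov: "covering_space (connected_component_set {z. expid z \<in> \<phi>i ` V} z0) expid (\<phi>i ` V)"
    using nocrit by (intro covering_space_component[OF _ _ _ e0]) auto
  obtain s where "continuous_on U s" "s \<in> U \<rightarrow> connected_component_set {z. expid z \<in> \<phi>i ` V} z0"
    "s u0 = z0" "\<And>y. y \<in> U \<Longrightarrow> expid (s y) = (\<phi>i \<circ> g) y"
  proof (rule covering_space_lift_strong[OF cov, of z0 u0 U "\<phi>i \<circ> g"])
    show "z0 \<in> connected_component_set {z. expid z \<in> \<phi>i ` V} z0" using e0 by auto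
    show "simply_connected U" using U by (simp add: convex_imp_simply_connected)
    show "locally path_connected U" using U by (simp add: convex_imp_locally_path_connected)
    show "continuous_on U (\<phi>i \<circ> g)" using U h(4) by (intro continuous_on_compose) auto
    show "\<phi>i \<circ> g \<in> U \<rightarrow> \<phi>i ` V" using U by auto
    show "(\<phi>i \<circ> g) u0 = expid z0" using z0 h(1) by (metis comp_apply)
  qed (use U in auto)
  then show ?thesis using that h(2) by auto
qed

abbreviation component :: "complex set \<Rightarrow> complex \<Rightarrow> complex set" where
  "component S a \<equiv> connected_component_set S a"

lemma tipfree_noncrit:
  assumes "\<phi> (expid z) \<notin> \<phi> ` range cval"
  shows "exp z + 1 \<noteq> 0"
  using assms expid_crit_iff[of z] expid_cpt by auto

lemma open_vimage_homeo:
  fixes \<phi> \<phi>i :: "complex \<Rightarrow> complex"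
  assumes "homeomorphism UNIV UNIV \<phi> \<phi>i" "open V"
  shows "open {z. \<phi> (expid z) \<in> V}"
  using open_vimage[OF assms(2) continuous_on_compose[OF continuous_on_expid homeo_UNIV(3)[OF assms(1)]]]
  by (simp add: vimage_def)

lemma continuous_on_homeo_expid:
  fixes \<phi> \<phi>i :: "complex \<Rightarrow> complex"
  assumes "homeomorphism UNIV UNIV \<phi> \<phi>i"
  shows "continuous_on S (\<lambda>z. \<phi> (expid z))"
  using continuous_on_compose2[OF homeo_UNIV(3)[OF assms, of UNIV] continuous_on_expid] by auto

lemma open_image_homeo_expid:
  fixes \<phi> \<phi>i :: "complex \<Rightarrow> complex"
  assumes "homeomorphism UNIV UNIV \<phi> \<phi>i" "open U"
  shows "open ((\<lambda>z. \<phi> (expid z)) ` U)"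
proof -
  have "(\<lambda>z. \<phi> (expid z)) ` U = \<phi>i -` (expid ` U)"
  proof (rule set_eqI)
    fix x
    have "x = \<phi> (expid z) \<longleftrightarrow> \<phi>i x = expid z" for z
      using homeo_UNIV(1,2)[OF assms(1)] by metis
    then show "x \<in> (\<lambda>z. \<phi> (expid z)) ` U \<longleftrightarrow> x \<in> \<phi>i -` (expid ` U)" by (simp add: image_iff)
  qed
  then show ?thesis
    using open_vimage[OF open_expid_image[OF assms(2)] homeo_UNIV(4)[OF assms(1)]] by simp
qed

lemma bounded_if_homeo_bounded:
  fixes \<phi> \<phi>i :: "complex \<Rightarrow> complex"
  assumes "homeomorphism UNIV UNIV \<phi> \<phi>i" "connected Z" "bounded V" "\<And>z. z \<in> Z \<Longrightarrow> \<phi> (expid z) \<in> V"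
  shows "bounded Z"
proof -
  have "bounded (\<phi>i ` closure V)"
    using assms(3) by (intro compact_imp_bounded compact_continuous_image homeo_UNIV(4)[OF assms(1)]) (simp add: compact_closure)
  then obtain R where R: "\<And>w. w \<in> \<phi>i ` closure V \<Longrightarrow> cmod w \<le> R" unfolding bounded_iff by blast
  show ?thesis
  proof (rule bounded_if_expid_bounded[OF assms(2), of R])
    fix z assume "z \<in> Z"
    then have "\<phi> (expid z) \<in> closure V" using assms(4) closure_subset by blast
    then have "expid z \<in> \<phi>i ` closure V" by (metis homeo_UNIV(1)[OF assms(1)] image_eqI)
    then show "cmod (expid z) \<le> R" by (rule R)
  qed
qed

lemma lift_tipfree:
  fixes g :: "'a::real_normed_vector \<Rightarrow> complex" and \<phi> \<phi>i :: "complex \<Rightarrow> complex"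
  assumes hom: "homeomorphism UNIV UNIV \<phi> \<phi>i"
    and V: "open V" "connected V" "bounded V" "V \<inter> \<phi> ` range cval = {}"
    and U: "convex U" "u0 \<in> U" "continuous_on U g" "g ` U \<subseteq> V"
    and z0: "\<phi> (expid z0) = g u0"
  obtains s where "continuous_on U s" "s u0 = z0" "\<And>u. u \<in> U \<Longrightarrow> \<phi> (expid (s u)) = g u"
proof (rule lift_through_component[OF hom V(1-3) U z0])
  fix z assume "z \<in> component {z. \<phi> (expid z) \<in> V} z0"
  then have "\<phi> (expid z) \<in> V" using connected_component_subset by blast
  then show "exp z + 1 \<noteq> 0" using V(4) by (intro tipfree_noncrit[of \<phi>]) auto
qed (use that in auto)

lemma lift_unique:
  fixes s s' :: "'a::topological_space \<Rightarrow> complex"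
  assumes "homeomorphism UNIV UNIV \<phi> \<phi>i" "connected U" "continuous_on U s" "continuous_on U s'"
    and eq: "\<And>u. u \<in> U \<Longrightarrow> \<phi> (expid (s u)) = \<phi> (expid (s' u))"
    and "\<And>u. u \<in> U \<Longrightarrow> \<phi> (expid (s u)) \<notin> \<phi> ` range cval"
    and "u0 \<in> U" "s u0 = s' u0" "u \<in> U"
  shows "s u = s' u"
proof (rule expid_lift_unique[OF assms(2-4) _ _ assms(7-9)])
  fix v assume v: "v \<in> U"
  show "expid (s v) = expid (s' v)" using eq[OF v] homeo_UNIV(5)[OF assms(1)] by (simp add: inj_eq)
  show "exp (s v) + 1 \<noteq> 0" using assms(6)[OF v] by (rule tipfree_noncrit)
qed

lemma finite_cval_bounded:
  assumes "bounded B" shows "finite {t \<in> range cval. t \<in> B}"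
proof -
  obtain R where R: "\<And>w. w \<in> B \<Longrightarrow> cmod w \<le> R" using assms unfolding bounded_iff by blast
  have "{k. cval k \<in> B} \<subseteq> {- \<lceil>R\<rceil> - 1 .. \<lceil>R\<rceil> + 1}"
  proof clarify
    fix k assume "cval k \<in> B"
    then have "\<bar>(2 * real_of_int k + 1) * pi\<bar> \<le> R" using R abs_Im_le_cmod[of "cval k"] by (force simp: cval_def)
    moreover have "\<bar>2 * real_of_int k + 1\<bar> * 1 \<le> \<bar>2 * real_of_int k + 1\<bar> * pi"
      using pi_gt3 by (intro mult_left_mono) auto
    ultimately have "\<bar>2 * real_of_int k + 1\<bar> \<le> R" by (simp add: abs_mult)
    then have "\<bar>real_of_int k\<bar> \<le> R + 1" by linarith
    then show "k \<in> {- \<lceil>R\<rceil> - 1 .. \<lceil>R\<rceil> + 1}" by (simp; linarith)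
  qed
  then have "finite {k. cval k \<in> B}" using finite_subset by blast
  moreover have "{t \<in> range cval. t \<in> B} = cval ` {k. cval k \<in> B}" by auto
  ultimately show ?thesis by simp
qed

lemma finite_tips_bounded:
  fixes \<phi> \<phi>i :: "complex \<Rightarrow> complex"
  assumes "homeomorphism UNIV UNIV \<phi> \<phi>i" "bounded B"
  shows "finite {t \<in> \<phi> ` range cval. t \<in> B}"
proof -
  have "bounded (\<phi>i ` closure B)"
    using assms(2) by (intro compact_imp_bounded compact_continuous_image homeo_UNIV(4)[OF assms(1)]) (simp add: compact_closure)
  then have "finite (\<phi> ` {t \<in> range cval. t \<in> \<phi>i ` closure B})" by (intro finite_imageI finite_cval_bounded)
  moreover have "{t \<in> \<phi> ` range cval. t \<in> B} \<subseteq> \<phi> ` {t \<in> range cval. t \<in> \<phi>i ` closure B}"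
  proof clarify
    fix k assume "\<phi> (cval k) \<in> B"
    then have "\<phi> (cval k) \<in> closure B" using closure_subset by blast
    then have "\<phi>i (\<phi> (cval k)) \<in> \<phi>i ` closure B" by (rule imageI)
    then have "cval k \<in> \<phi>i ` closure B" by (simp add: homeo_UNIV(1)[OF assms(1)])
    then show "\<phi> (cval k) \<in> \<phi> ` {t \<in> range cval. t \<in> \<phi>i ` closure B}" by blast
  qed
  ultimately show ?thesis using finite_subset by blast
qed

lemma countable_expid_fibre: "countable {z. expid z = w}"
proof -
  have nc: "\<not> (\<lambda>z. expid z - w) constant_on UNIV"
  proof
    assume "(\<lambda>z. expid z - w) constant_on UNIV"
    then have "expid 0 - w = expid (2 * pi * \<i>) - w" unfolding constant_on_def by (metis UNIV_I)
    then show False by (auto simp: expid_def)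
  qed
  have "(\<lambda>z. expid z - w) holomorphic_on UNIV"
    by (intro holomorphic_intros holomorphic_on_expid)
  then have "countable {z\<in>UNIV. expid z - w = 0}"
    using nc by (intro holomorphic_countable_zeros) auto
  then show ?thesis by simp
qed

text \<open>
  The inner part \<open>X\<close> of the component \<open>D\<close> is compact, and by the
  maximum principle for the open map its complement has no bounded component; so the complement
  of \<open>X\<close> is connected. Janiszewski's theorem, applied to \<open>X\<close> and the
  complement of \<open>D\<close>, gives the connectedness of the collar although
  \<open>D\<close> need not be simply connected a priori.
\<close>

lemma connected_comp_collar:
  fixes \<phi> \<phi>i :: "complex \<Rightarrow> complex"
  assumes hom: "homeomorphism UNIV UNIV \<phi> \<phi>i" and r: "r < R" and D: "D = component {z. cmod (\<phi> (expid z)) < R} z0"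
  shows "open {z \<in> D. r < cmod (\<phi> (expid z))}" "connected {z \<in> D. r < cmod (\<phi> (expid z))}"
proof -
  let ?F = "\<lambda>z. \<phi> (expid z)"
  have cF: "continuous_on S ?F" for S by (rule continuous_on_homeo_expid[OF hom])
  have oS: "open {z. cmod (?F z) < R}" using open_vimage_homeo[OF hom open_ball[of 0 R]] by (simp add: ball_def)
  have oD: "open D" unfolding D using oS by (rule open_connected_component)
  have cD: "connected D" unfolding D by simp
  have DR: "cmod (?F z) < R" if "z \<in> D" for z using that connected_component_subset unfolding D by blast
  have bD: "bounded D"
    by (rule bounded_if_homeo_bounded[OF hom cD, of "ball 0 R"]) (use DR in auto)
  show "open {z \<in> D. r < cmod (?F z)}"
  proof -
    have "open {z. r < cmod (?F z)}" by (intro open_Collect_less continuous_intros cF)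
    then show ?thesis using oD by (simp add: Collect_conj_eq open_Int)
  qed
  define X where "X = {z \<in> D. cmod (?F z) \<le> r}"
  have clX: "closed X"
  proof -
    have 1: "closed {z. cmod (?F z) \<le> r}" by (intro closed_Collect_le continuous_intros cF)
    have "X = closure D \<inter> {z. cmod (?F z) \<le> r}"
      using closure_component_in_open[OF oS] r closure_subset[of D] unfolding X_def D by auto
    then show ?thesis using 1 by auto
  qed
  have cX: "compact X" using clX bD by (simp add: compact_eq_bounded_closed X_def bounded_subset Collect_restrict)
  have unb: "\<not> bounded (component (-X) y0)" if "y0 \<in> -X" for y0
  proof
    assume b: "bounded (component (-X) y0)"
    let ?Y = "component (-X) y0"
    have oY: "open ?Y" using clX by (intro open_connected_component) auto
    have YX: "?Y \<subseteq> -X" by (rule connected_component_subset)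
    have y0: "y0 \<in> ?Y" using that by auto
    have "compact (closure ?Y)" using b by (simp add: compact_closure)
    moreover have "closure ?Y \<noteq> {}" using y0 closure_subset by blast
    moreover have "continuous_on (closure ?Y) (\<lambda>z. cmod (?F z))" by (intro continuous_intros cF)
    ultimately obtain y1 where y1: "y1 \<in> closure ?Y" "\<And>y. y \<in> closure ?Y \<Longrightarrow> cmod (?F y) \<le> cmod (?F y1)"
      using continuous_attains_sup by metis
    have "y1 \<notin> ?Y"
    proof
      assume "y1 \<in> ?Y"
      then have "?F y1 \<in> ?F ` ?Y" "open (?F ` ?Y)" using open_image_homeo_expid[OF hom oY] by auto
      then obtain e where e: "e > 0" "cball (?F y1) e \<subseteq> ?F ` ?Y" using open_contains_cball by blast
      \<comment> \<open>A point of the open image with larger modulus.\<close>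
      define w where "w = ?F y1 + of_real e * (if ?F y1 = 0 then 1 else sgn (?F y1))"
      have "w \<in> cball (?F y1) e" using e by (simp add: w_def dist_norm norm_mult norm_sgn)
      then obtain y where y: "y \<in> ?Y" "?F y = w" using e by auto
      have "cmod w = cmod (?F y1) + e"
      proof (cases "?F y1 = 0")
        case False
        have "w = (of_real (1 + e / cmod (?F y1))) * ?F y1" using False
          by (simp add: w_def sgn_div_norm algebra_simps scaleR_conv_of_real divide_simps)
        then have "cmod w = (1 + e / cmod (?F y1)) * cmod (?F y1)"
          using e False by (simp add: norm_mult del: of_real_add)
        then show ?thesis using False by (simp add: distrib_right)
      qed (use e in \<open>simp add: w_def\<close>)
      moreover have "y \<in> closure ?Y" using y(1) closure_subset by blast
      then have "cmod w \<le> cmod (?F y1)" using y1(2)[of y] y(2) by simp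
      ultimately show False using e by simp
    qed
    moreover have "y1 \<in> ?Y" if "y1 \<in> -X"
      by (rule closure_component_in_open[OF _ y1(1) that]) (use clX in \<open>simp add: open_Compl\<close>)
    ultimately have y1X: "y1 \<in> X" by blast
    then have "y1 \<in> D" "cmod (?F y1) \<le> r" by (auto simp: X_def)
    then have "D \<inter> ?Y \<noteq> {}" using open_Int_closure_eq_empty[OF oD, of ?Y] y1(1) by blast
    then obtain y where y: "y \<in> ?Y" "y \<in> D" by blast
    then have "y \<in> closure ?Y" using closure_subset by blast
    then have "cmod (?F y) \<le> cmod (?F y1)" using y1(2)[of y] by simp
    then have "y \<in> X" using y \<open>cmod (?F y1) \<le> r\<close> by (simp add: X_def)
    then show False using YX y by blast
  qed
  have "connected (-X)"
  proof (subst connected_iff_connected_component_eq, intro ballI)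
    fix x y assume "x \<in> -X" "y \<in> -X"
    then show "component (-X) x = component (-X) y"
      using unb cX by (intro cobounded_unique_unbounded_component) (auto simp: compact_imp_bounded)
  qed
  then have "connected (- (X \<union> - D))"
  proof (intro Janiszewski_connected)
    have "X \<inter> - D = {}" by (auto simp: X_def)
    then show "connected (X \<inter> - D)" by simp
  qed (use cX oD cD in auto)
  moreover have "- (X \<union> - D) = {z \<in> D. r < cmod (?F z)}" by (auto simp: X_def)
  ultimately show "connected {z \<in> D. r < cmod (?F z)}" by simp
qed

text \<open>
  Over an annulus free of critical values a single lift of the exponential already sweeps out a
  path-connected set: take the logarithm of the image of a path and compare lifts. This is how
  the connectedness of collars turns into statements about sheets.
\<close>

lemma orbit_parametrised:
  fixes \<phi> \<phi>i :: "complex \<Rightarrow> complex"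
  assumes hom: "homeomorphism UNIV UNIV \<phi> \<phi>i"
    and P: "P = {u. Re u \<in> J}"
    and h: "homeomorphism (exp ` P) A h h'" and A: "A \<inter> \<phi> ` range cval = {}"
    and L: "continuous_on P L" "\<And>u. u \<in> P \<Longrightarrow> \<phi> (expid (L u)) = h (exp u)"
    and S: "path_connected S" "\<And>z. z \<in> S \<Longrightarrow> \<phi> (expid z) \<in> A"
    and z: "u1 \<in> P" "L u1 \<in> S" "z2 \<in> S"
  shows "\<exists>u2\<in>P. L u2 = z2"
proof -
  let ?F = "\<lambda>z. \<phi> (expid z)"
  obtain \<gamma> where \<gamma>: "path \<gamma>" "path_image \<gamma> \<subseteq> S" "pathstart \<gamma> = L u1" "pathfinish \<gamma> = z2"
    using S z unfolding path_connected_def by metis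
  have \<gamma>S: "\<gamma> t \<in> S" if "t \<in> {0..1}" for t using \<gamma>(2) that by (auto simp: path_image_def)
  define q where "q t = h' (?F (\<gamma> t))" for t
  have hF: "h' (h x) = x" if "x \<in> exp ` P" for x using homeomorphism_apply1[OF h that] .
  have hF': "h' y \<in> exp ` P" "h (h' y) = y" if "y \<in> A" for y
    using homeomorphism_apply2[OF h that] homeomorphism_image2[OF h] that by auto
  have cq: "continuous_on {0..1} q"
    unfolding q_def
  proof (rule continuous_on_compose2[OF homeomorphism_cont2[OF h]])
    show "continuous_on {0..1} (\<lambda>t. ?F (\<gamma> t))"
      using \<gamma>(1) continuous_on_compose2[OF continuous_on_homeo_expid[OF hom, of UNIV]] unfolding path_def by auto
    show "(\<lambda>t. ?F (\<gamma> t)) ` {0..1} \<subseteq> A" using \<gamma>S S(2) by auto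
  qed
  have qP: "q t \<in> exp ` P" if "t \<in> {0..1}" for t unfolding q_def using hF' \<gamma>S[OF that] S(2) by auto
  obtain l where l: "continuous_on {0..1} l" "\<And>t. t \<in> {0..1} \<Longrightarrow> q t = exp (l t)"
    using continuous_logarithm_on_contractible[OF cq] qP convex_imp_contractible[of "{0..1::real}"]
    by (metis convex_closed_interval convex_real_interval(5) exp_not_eq_zero imageE)
  define l' where "l' t = l t + (u1 - l 0)" for t
  have g0: "\<gamma> 0 = L u1" "\<gamma> 1 = z2" using \<gamma> by (auto simp: pathstart_def pathfinish_def)
  have "exp (l 0) = exp u1"
    using l(2)[of 0] hF[of "exp u1"] z(1) L(2)[OF z(1)] by (simp add: q_def g0)
  then have l': "q t = exp (l' t)" if "t \<in> {0..1}" for t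
    using l(2)[OF that] by (simp add: l'_def exp_add exp_diff)
  have l'P: "l' t \<in> P" if t: "t \<in> {0..1}" for t
  proof -
    obtain u where "u \<in> P" "exp (l' t) = exp u" using qP[OF t] l'[OF t] by auto
    then have "exp (Re (l' t)) = exp (Re u)" by (metis norm_exp_eq_Re)
    then show ?thesis using \<open>u \<in> P\<close> by (simp add: P)
  qed
  have "(L \<circ> l') 1 = \<gamma> 1"
  proof (rule lift_unique[OF hom, of "{0..1::real}" "L \<circ> l'" \<gamma> 0])
    have "continuous_on {0..1} l'" unfolding l'_def by (intro continuous_intros l)
    then show "continuous_on {0..1} (L \<circ> l')"
      using L(1) l'P by (intro continuous_on_compose) (auto intro: continuous_on_subset)
    show "continuous_on {0..1} \<gamma>" using \<gamma>(1) by (simp add: path_def)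
    show eq: "?F ((L \<circ> l') t) = ?F (\<gamma> t)" if "t \<in> {0..1}" for t
      using L(2)[OF l'P[OF that]] l'[OF that] hF'(2) S(2)[OF \<gamma>S[OF that]] by (metis comp_apply q_def)
    show "?F ((L \<circ> l') t) \<notin> \<phi> ` range cval" if "t \<in> {0..1}" for t
      using eq[OF that] S(2)[OF \<gamma>S[OF that]] A by auto
    show "(L \<circ> l') 0 = \<gamma> 0" by (simp add: l'_def g0)
  qed auto
  then show ?thesis using l'P[of 1] g0 by auto
qed

text \<open>
  The critical points are simple, so near each of them \<open>expid\<close> is the square of a
  local coordinate, up to a constant.
\<close>

lemma expid_at_most_two_near_cpt:
  obtains \<rho> where "\<rho> > 0" "\<And>a b d. \<lbrakk>a \<in> ball (cpt k) \<rho>; b \<in> ball (cpt k) \<rho>; d \<in> ball (cpt k) \<rho>;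
     expid a = expid b; expid b = expid d\<rbrakk> \<Longrightarrow> a = b \<or> b = d \<or> a = d"
proof -
  let ?c = "cpt k"
  have d1: "deriv expid = (\<lambda>z. exp z + 1)" by (intro ext DERIV_imp_deriv expid_has_field_derivative)
  have d2: "deriv (deriv expid) = exp" unfolding d1 by (intro ext DERIV_imp_deriv derivative_eq_intros) auto
  have c0: "exp ?c + 1 = 0" using expid_crit_iff by blast
  obtain g r where g: "0 < r" "g holomorphic_on ball ?c r"
     "\<And>w. w \<in> ball ?c r \<Longrightarrow> expid w - expid ?c = ((w - ?c) * g w) ^ 2" "\<And>w. w \<in> ball ?c r \<Longrightarrow> g w \<noteq> 0"
  proof (rule holomorphic_factor_order_of_zero_strong[OF holomorphic_on_expid[of UNIV], of ?c 2])
    show "(deriv ^^ 2) expid ?c \<noteq> 0" by (simp add: numeral_2_eq_2 d2)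
    show "(deriv ^^ i) expid ?c = 0" if "0 < i" "i < 2" for i
    proof -
      have "i = 1" using that by auto
      then show ?thesis using c0 by (simp add: d1)
    qed
  qed auto
  define q where "q w = (w - ?c) * g w" for w
  have hq: "q holomorphic_on ball ?c r" unfolding q_def by (intro holomorphic_intros g)
  have "(g has_field_derivative deriv g ?c) (at ?c)"
    using g by (intro holomorphic_derivI[of g "ball ?c r"]) auto
  then have "(q has_field_derivative g ?c) (at ?c)"
    unfolding q_def by (auto intro!: derivative_eq_intros)
  then have "deriv q ?c \<noteq> 0" using g by (simp add: DERIV_imp_deriv)
  then obtain s where s: "s > 0" "ball ?c s \<subseteq> ball ?c r" "inj_on q (ball ?c s)"
    using has_complex_derivative_locally_injective[OF hq, of ?c] g(1) by auto
  show ?thesis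
  proof (rule that[OF s(1)])
    fix a b d assume *: "a \<in> ball ?c s" "b \<in> ball ?c s" "d \<in> ball ?c s" "expid a = expid b" "expid b = expid d"
    have sq: "expid w - expid ?c = (q w)\<^sup>2" if "w \<in> ball ?c s" for w
      using g(3)[of w] that s(2) by (auto simp: q_def)
    have "(q a)\<^sup>2 = (q b)\<^sup>2" "(q b)\<^sup>2 = (q d)\<^sup>2" using sq * by metis+
    then have "q a = q b \<or> q b = q d \<or> q a = q d" by (auto simp: power2_eq_iff)
    then show "a = b \<or> b = d \<or> a = d" using s(3) * by (auto simp: inj_on_def)
  qed
qed

text \<open>
  The fibre of \<open>expid\<close> is countable, hence some small circle around
  \<open>c\<close> avoids it, and on that circle the values keep a positive distance from the
  value at \<open>c\<close>.
\<close>

lemma small_components: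
  fixes \<phi> \<phi>i :: "complex \<Rightarrow> complex"
  assumes hom: "homeomorphism UNIV UNIV \<phi> \<phi>i" and "\<rho> > 0"
  obtains e where "e > 0" "component {z. dist (\<phi> (expid z)) (\<phi> (expid c)) < e} c \<subseteq> ball c \<rho>"
proof -
  let ?F = "\<lambda>z. \<phi> (expid z)"
  have "countable ((\<lambda>z. dist c z) ` {z. expid z = expid c})" using countable_expid_fibre by blast
  moreover have "uncountable {0<..<\<rho>}" using \<open>\<rho> > 0\<close> by (simp add: uncountable_open_interval)
  ultimately have "\<not> {0<..<\<rho>} \<subseteq> (\<lambda>z. dist c z) ` {z. expid z = expid c}" using countable_subset by blast
  then obtain \<rho>' where \<rho>': "0 < \<rho>'" "\<rho>' < \<rho>" "\<And>z. expid z = expid c \<Longrightarrow> dist c z \<noteq> \<rho>'"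
    by fastforce
  have "compact (sphere c \<rho>')" "sphere c \<rho>' \<noteq> {}" using \<rho>' by auto
  moreover have "continuous_on (sphere c \<rho>') (\<lambda>z. dist (?F z) (?F c))"
    by (intro continuous_intros continuous_on_homeo_expid[OF hom])
  ultimately obtain z1 where z1: "z1 \<in> sphere c \<rho>'" "\<And>z. z \<in> sphere c \<rho>' \<Longrightarrow> dist (?F z1) (?F c) \<le> dist (?F z) (?F c)"
    using continuous_attains_inf by metis
  define e where "e = dist (?F z1) (?F c)"
  have "?F z1 \<noteq> ?F c" using \<rho>'(3)[of z1] z1(1) homeo_UNIV(5)[OF hom] by (auto simp: inj_eq)
  then have "e > 0" by (simp add: e_def)
  moreover have "component {z. dist (?F z) (?F c) < e} c \<subseteq> ball c \<rho>'"
  proof (rule ccontr)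
    assume *: "\<not> component {z. dist (?F z) (?F c) < e} c \<subseteq> ball c \<rho>'"
    have "c \<in> component {z. dist (?F z) (?F c) < e} c" using \<open>e > 0\<close> by auto
    then have "component {z. dist (?F z) (?F c) < e} c \<inter> frontier (ball c \<rho>') \<noteq> {}"
      using * centre_in_ball[of c \<rho>'] \<rho>'(1) by (intro connected_Int_frontier) blast+
    then obtain z where z: "z \<in> component {z. dist (?F z) (?F c) < e} c" "z \<in> frontier (ball c \<rho>')" by blast
    then have "z \<in> sphere c \<rho>'" using \<rho>'(1) by (metis frontier_ball)
    moreover have "dist (?F z) (?F c) < e" using z(1) connected_component_subset by blast
    ultimately show False using z1(2)[of z] by (simp add: e_def)
  qed
  moreover have "ball c \<rho>' \<subseteq> ball c \<rho>" using \<rho>' by auto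
  ultimately show ?thesis using that by blast
qed

lemma component_mono_eq:
  assumes "connected S" "S \<subseteq> T" "a \<in> S" "b \<in> S" shows "b \<in> component T a"
  using assms unfolding connected_component_def mem_Collect_eq by blast

lemma component_superset:
  assumes "connected S" "S \<subseteq> T" "a \<in> S" "a \<in> component T b" shows "S \<subseteq> component T b"
proof -
  have "S \<subseteq> component T a" using connected_component_maximal[OF assms(3,1,2)] .
  then show ?thesis using connected_component_eq[OF assms(4)] by simp
qed

lemma uncountable_open_set:
  fixes S :: "complex set"
  assumes "open S" "S \<noteq> {}" shows "uncountable S"
proof -
  obtain a r where "r > 0" "ball a r \<subseteq> S" using assms open_contains_ball by blast
  then show ?thesis using uncountable_ball countable_subset by blast
qed

section \<open>The two sheets at a critical point\<close>

text \<open>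
  Over the punctured disc the component is swept out by one lift of the exponential. By the
  local form of \<open>expid\<close> at the critical point, two of three values of this lift a
  turn apart coincide somewhere, and hence everywhere by uniqueness of lifts. So the lift has
  period \<open>4\<pi>i\<close>, which leaves at most two sheets; and it tends to the critical
  point over the centre.
\<close>

lemma disc_two_sheets:
  fixes \<phi> \<phi>i h h' :: "complex \<Rightarrow> complex"
  assumes hom: "homeomorphism UNIV UNIV \<phi> \<phi>i"
    and V: "open V" "bounded V" and h: "homeomorphism (ball 0 1) V h h'"
    and h0: "h 0 = \<phi> (cval k)" and tip: "\<And>t. t \<in> \<phi> ` range cval \<Longrightarrow> t \<in> V \<Longrightarrow> t = h 0"
    and Vt: "Vt = component {z. \<phi> (expid z) \<in> V} (cpt k)"
  shows "\<And>z. z \<in> Vt \<Longrightarrow> \<phi> (expid z) = h 0 \<Longrightarrow> z = cpt k"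
    and "\<And>a b d. a \<in> Vt \<Longrightarrow> b \<in> Vt \<Longrightarrow> d \<in> Vt \<Longrightarrow> \<phi> (expid a) = \<phi> (expid b) \<Longrightarrow> \<phi> (expid b) = \<phi> (expid d)
           \<Longrightarrow> a = b \<or> b = d \<or> a = d"
proof -
  let ?F = "\<lambda>z. \<phi> (expid z)"
  let ?c = "cpt k"
  have Fc: "?F ?c = h 0" using h0 by (simp add: expid_cpt)
  have h0V: "h 0 \<in> V" using homeomorphism_image1[OF h] by (metis centre_in_ball imageI zero_less_one)
  have hinj: "h x = h y \<Longrightarrow> x \<in> ball 0 1 \<Longrightarrow> y \<in> ball 0 1 \<Longrightarrow> x = y" for x y
    using homeomorphism_apply1[OF h] by metis
  have oh: "open (h ` U)" if "open U" "U \<subseteq> ball 0 1" for U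
    using homeomorphism_imp_open_map[OF h, of U] that V(1) by (simp add: openin_open_eq)
  define P where "P = {u. Re u \<in> {..<0::real}}"
  have expP: "exp ` P = ball 0 1 - {0}"
  proof
    show "exp ` P \<subseteq> ball 0 1 - {0}" by (auto simp: P_def)
    show "ball 0 1 - {0} \<subseteq> exp ` P"
    proof
      fix \<zeta> :: complex assume "\<zeta> \<in> ball 0 1 - {0}"
      then have "exp (Ln \<zeta>) = \<zeta>" "Ln \<zeta> \<in> P" by (auto simp: P_def)
      then show "\<zeta> \<in> exp ` P" by (metis imageI)
    qed
  qed
  define V0 where "V0 = h ` (ball 0 1 - {0})"
  have hV0: "homeomorphism (exp ` P) V0 h h'"
    unfolding V0_def expP by (rule homeomorphism_of_subsets[OF h]) auto
  have V0eq: "V0 = V - {h 0}"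
    unfolding V0_def using homeomorphism_image1[OF h] hinj by auto
  have oV0: "open V0" unfolding V0eq using V(1) by (simp add: open_delete)
  have convP: "convex P" unfolding P_def by (simp add: convex_halfspace_Re_lt)
  have ch: "continuous_on P (\<lambda>u. h (exp u))"
    by (rule continuous_on_compose2[OF homeomorphism_cont1[OF hV0]]) (auto intro!: continuous_intros)
  have imV0: "(\<lambda>u. h (exp u)) ` P = V0" using homeomorphism_image1[OF hV0] by auto
  have cV0: "connected V0"
    using connected_continuous_image[OF ch] convP by (simp add: imV0 convex_connected)
  have bV0: "bounded V0" using V(2) V0eq by (auto intro: bounded_subset)
  have tV0: "V0 \<inter> \<phi> ` range cval = {}" using tip V0eq by auto
  have oVt: "open Vt" unfolding Vt by (intro open_connected_component open_vimage_homeo[OF hom] V)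
  have cVt: "connected Vt" unfolding Vt by simp
  have cinVt: "?c \<in> Vt" using Fc h0V by (simp add: Vt)
  have VtV: "?F z \<in> V" if "z \<in> Vt" for z using that connected_component_subset unfolding Vt by blast
  define Z0 where "Z0 = Vt - {z. expid z = cval k}"
  have Z0eq: "z \<in> Z0 \<longleftrightarrow> z \<in> Vt \<and> ?F z \<noteq> h 0" for z
    using homeo_UNIV(5)[OF hom] h0 by (auto simp: Z0_def inj_eq)
  have pZ0: "path_connected Z0"
    unfolding Z0_def using oVt cVt countable_expid_fibre by (intro path_connected_open_diff_countable) auto
  have Z0V0: "?F z \<in> V0" if "z \<in> Z0" for z using that VtV Z0eq V0eq by auto
  have Z0dense: "\<exists>z\<in>N. z \<in> Z0" if "open N" "y \<in> N" "y \<in> Vt" for N y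
  proof -
    have "open (N \<inter> Vt)" "N \<inter> Vt \<noteq> {}" using that oVt by auto
    then have "uncountable (N \<inter> Vt)" using uncountable_open_set by blast
    then have "\<not> N \<inter> Vt \<subseteq> {z. expid z = cval k}" using countable_expid_fibre countable_subset by blast
    then show ?thesis by (auto simp: Z0_def)
  qed
  define Nb where "Nb \<eta> = component {z. ?F z \<in> h ` ball 0 \<eta>} ?c" for \<eta>
  have small: "\<exists>\<eta>. 0 < \<eta> \<and> \<eta> \<le> 1 \<and> Nb \<eta> \<subseteq> ball ?c \<rho>" if \<rho>0: "\<rho> > 0" for \<rho>
  proof -
    obtain e where e: "e > 0" "component {z. dist (?F z) (?F ?c) < e} ?c \<subseteq> ball ?c \<rho>"
      using small_components[OF hom \<rho>0] by blast
    have "continuous_on (ball 0 1) h" using h homeomorphism_cont1 by blast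
    then have "isCont h 0" by (simp add: continuous_on_eq_continuous_at)
    then obtain d where d: "d > 0" "\<And>x. dist x 0 < d \<Longrightarrow> dist (h x) (h 0) < e"
      unfolding continuous_at_eps_delta using e by blast
    have "{z. ?F z \<in> h ` ball 0 (min d 1)} \<subseteq> {z. dist (?F z) (?F ?c) < e}" using d Fc by auto
    then have "Nb (min d 1) \<subseteq> ball ?c \<rho>" unfolding Nb_def using e(2) connected_component_mono by blast
    then show ?thesis using d by (intro exI[of _ "min d 1"]) auto
  qed
  have Nbo: "open (Nb \<eta>)" "?c \<in> Nb \<eta>" if "0 < \<eta>" "\<eta> \<le> 1" for \<eta>
  proof -
    have "open (h ` ball 0 \<eta>)" using that by (intro oh) auto
    then show "open (Nb \<eta>)" unfolding Nb_def by (intro open_connected_component open_vimage_homeo[OF hom])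
    show "?c \<in> Nb \<eta>" using that Fc by (auto simp: Nb_def intro: image_eqI[of _ _ 0])
  qed
  have NbF: "?F z \<in> h ` ball 0 \<eta>" if "z \<in> Nb \<eta>" for z \<eta>
    using that connected_component_subset unfolding Nb_def by blast
  obtain \<rho> where \<rho>: "\<rho> > 0" "\<And>a b d. \<lbrakk>a \<in> ball ?c \<rho>; b \<in> ball ?c \<rho>; d \<in> ball ?c \<rho>;
     expid a = expid b; expid b = expid d\<rbrakk> \<Longrightarrow> a = b \<or> b = d \<or> a = d"
    using expid_at_most_two_near_cpt by blast
  obtain \<eta> where \<eta>: "0 < \<eta>" "\<eta> \<le> 1" "Nb \<eta> \<subseteq> ball ?c \<rho>" using small[OF \<rho>(1)] by blast
  obtain zs where zs: "zs \<in> Nb \<eta>" "zs \<in> Z0" using Z0dense[OF Nbo[OF \<eta>(1,2)] cinVt] by auto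
  obtain \<zeta> where \<zeta>: "\<zeta> \<in> ball 0 \<eta>" "?F zs = h \<zeta>" using NbF[OF zs(1)] by auto
  have "\<zeta> \<noteq> 0" using zs(2) \<zeta>(2) Z0eq by auto
  define us where "us = Ln \<zeta>"
  have us: "us \<in> P" "Re us < ln \<eta>" "exp us = \<zeta>"
  proof -
    show "Re us < ln \<eta>" using \<open>\<zeta> \<noteq> 0\<close> \<zeta> \<eta>(1) by (simp add: us_def)
    then show "us \<in> P" using \<eta> by (auto simp: P_def intro: less_le_trans)
  qed (use \<open>\<zeta> \<noteq> 0\<close> in \<open>simp add: us_def\<close>)
  obtain L where L: "continuous_on P L" "L us = zs" "\<And>u. u \<in> P \<Longrightarrow> ?F (L u) = h (exp u)"
  proof (rule lift_tipfree[OF hom oV0 cV0 bV0 tV0 convP us(1) ch])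
    show "?F zs = h (exp us)" using us \<zeta> by simp
  qed (use imV0 in auto)
  have LV0: "?F (L u) \<in> V0" if "u \<in> P" for u using L(3)[OF that] imV0 that by auto
  have convP': "convex {u. Re u < ln s}" for s by (rule convex_halfspace_Re_lt)
  have LN: "L u \<in> Nb s" if s: "0 < s" "s \<le> 1" and u1: "L u1 \<in> Nb s" "Re u1 < ln s" and "Re u < ln s" for s u1 u
  proof -
    have sub: "{u. Re u < ln s} \<subseteq> P" using s by (auto simp: P_def intro: less_le_trans)
    have "connected (L ` {u. Re u < ln s})"
      using sub L(1) convP' by (intro connected_continuous_image) (auto intro: continuous_on_subset convex_connected)
    moreover have "L ` {u. Re u < ln s} \<subseteq> {z. ?F z \<in> h ` ball 0 s}"
    proof clarify
      fix v assume v: "Re v < ln s"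
      then have "exp (Re v) < exp (ln s)" by simp
      then have "exp v \<in> ball 0 s" using s(1) by simp
      then show "?F (L v) \<in> h ` ball 0 s" using L(3) sub v by auto
    qed
    ultimately have "L ` {u. Re u < ln s} \<subseteq> Nb s"
      unfolding Nb_def using u1 by (intro component_superset[of _ _ "L u1"]) (auto simp: Nb_def)
    then show ?thesis using that by auto
  qed
  have shift: "u + 2 * pi * \<i> * of_int n \<in> P" if "u \<in> P" for u n using that by (simp add: P_def)
  have ex: "exp (u + 2 * pi * \<i> * of_int n) = exp u" for u n
    by (simp add: exp_add exp_integer_2pi mult_ac)
  have per: "L (u + 4 * pi * \<i>) = L u" if u: "u \<in> P" for u
  proof -
    have s: "us + 2 * pi * \<i> * of_int n \<in> P" for n using shift us(1) by blast
    have "L (us + 2 * pi * \<i> * of_int n) \<in> ball ?c \<rho>" for n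
      using LN[OF \<eta>(1,2), of us "us + 2 * pi * \<i> * of_int n"] zs us L(2) \<eta>(3) by auto
    moreover have "expid (L (us + 2 * pi * \<i> * of_int n)) = expid zs" for n
    proof -
      have "?F (L (us + 2 * pi * \<i> * of_int n)) = ?F (L us)" using L(3) s us(1) ex by simp
      then show ?thesis using homeo_UNIV(5)[OF hom] L(2) by (simp add: inj_eq)
    qed
    ultimately have "L (us + 2 * pi * \<i> * of_int 0) = L (us + 2 * pi * \<i> * of_int 1) \<or>
      L (us + 2 * pi * \<i> * of_int 1) = L (us + 2 * pi * \<i> * of_int 2) \<or>
      L (us + 2 * pi * \<i> * of_int 0) = L (us + 2 * pi * \<i> * of_int 2)"
      using \<rho>(2) by metis
    then consider "L us = L (us + 2 * pi * \<i>)" | "L (us + 2 * pi * \<i>) = L (us + 2 * pi * \<i> + 2 * pi * \<i>)"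
       | "L us = L (us + 4 * pi * \<i>)" by (auto simp: algebra_simps)
    then show ?thesis
    proof cases
      have gen: "L (v + a) = L v"
        if a: "a = 2 * pi * \<i> * of_int m" and v0: "v0 \<in> P" "L (v0 + a) = L v0" and v: "v \<in> P" for a m v0 v
      proof (rule lift_unique[OF hom, of P "\<lambda>v. L (v + a)" L v0])
        show "continuous_on P (\<lambda>v. L (v + a))"
        proof (rule continuous_on_compose2[OF L(1)])
          show "(\<lambda>v. v + a) ` P \<subseteq> P" by (auto simp: a P_def)
        qed (intro continuous_intros)
        show "?F (L (w + a)) = ?F (L w)" if "w \<in> P" for w using L(3) shift ex that by (simp add: a)
        show "?F (L (w + a)) \<notin> \<phi> ` range cval" if "w \<in> P" for w
          using LV0[OF shift[OF that, of m]] tV0 by (auto simp: a)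
      qed (use L convP v0 v in \<open>auto intro: convex_connected\<close>)
      have four: "u + 4 * pi * \<i> = (u + 2 * pi * \<i>) + 2 * pi * \<i>" by simp
      have s1: "w + 2 * pi * \<i> \<in> P" if "w \<in> P" for w using shift[OF that, of 1] by simp
      {
        case 1
        then have "L (v + 2 * pi * \<i>) = L v" if "v \<in> P" for v
          using gen[of "2 * pi * \<i>" 1 us v] us(1) that by simp
        then show ?thesis using four u s1 by metis
      next
        case 2
        then have "L (v + 2 * pi * \<i>) = L v" if "v \<in> P" for v
          using gen[of "2 * pi * \<i>" 1 "us + 2 * pi * \<i>" v] us(1) s1 that by simp
        then show ?thesis using four u s1 by metis
      next
        case 3
        then show ?thesis using gen[of "4 * pi * \<i>" 2 us u] us(1) u by simp
      }
    qed
  qed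
  have orb: "\<exists>u\<in>P. L u = z" if "z \<in> Z0" for z
    by (rule orbit_parametrised[OF hom P_def hV0 tV0 L(1,3) pZ0 Z0V0 us(1)]) (use that zs L(2) in auto)
  show "z = ?c" if z: "z \<in> Vt" "?F z = h 0" for z
  proof (rule ccontr)
    assume "z \<noteq> ?c"
    define \<rho>' where "\<rho>' = dist z ?c / 2"
    have "\<rho>' > 0" using \<open>z \<noteq> ?c\<close> by (simp add: \<rho>'_def)
    then obtain s where s: "0 < s" "s \<le> 1" "Nb s \<subseteq> ball ?c \<rho>'" using small by blast
    obtain y where y: "y \<in> Nb s" "y \<in> Z0" using Z0dense[OF Nbo[OF s(1,2)] cinVt] by auto
    then obtain u1 where u1: "u1 \<in> P" "L u1 = y" using orb by blast
    have lt: "Re u < ln s" if uP: "u \<in> P" "?F (L u) \<in> h ` ball 0 s" for u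
    proof -
      obtain x where x: "x \<in> ball 0 s" "h (exp u) = h x" using uP L(3)[OF uP(1)] by auto
      have "x \<in> ball 0 1" using x(1) s(2) by auto
      moreover have "exp u \<in> ball 0 1" using uP(1) expP by blast
      ultimately have "exp u = x" using hinj[OF x(2)] by blast
      then have "exp (Re u) < s" using x by auto
      then show ?thesis using s(1) by (metis exp_gt_zero ln_exp ln_less_cancel_iff)
    qed
    have "Re u1 < ln s" using lt[OF u1(1)] u1(2) NbF y by auto
    have oN: "open (Vt \<inter> {z. ?F z \<in> h ` ball 0 s} \<inter> ball z \<rho>')"
      using s oVt by (intro open_Int open_vimage_homeo[OF hom] oh) auto
    have zin: "z \<in> Vt \<inter> {z. ?F z \<in> h ` ball 0 s} \<inter> ball z \<rho>'"
      using z s \<open>\<rho>' > 0\<close> by (auto intro: image_eqI[of _ _ 0])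
    then obtain x where x: "x \<in> Z0" "?F x \<in> h ` ball 0 s" "dist z x < \<rho>'"
      using Z0dense[OF oN zin z(1)] by auto
    obtain u where u: "u \<in> P" "L u = x" using orb x by blast
    have "x \<in> Nb s" using LN[OF s(1,2), of u1 u] y u1 \<open>Re u1 < ln s\<close> lt[OF u(1)] u x by auto
    then have "dist ?c x < \<rho>'" using s by auto
    then show False using x(3) dist_triangle2[of z ?c x] by (simp add: \<rho>'_def dist_commute)
  qed
  note only = this
  show "a = b \<or> b = d \<or> a = d" if abd: "a \<in> Vt" "b \<in> Vt" "d \<in> Vt" "?F a = ?F b" "?F b = ?F d" for a b d
  proof (cases "?F a = h 0")
    case True
    then show ?thesis using only abd by metis
  next
    case False
    then have "a \<in> Z0" "b \<in> Z0" "d \<in> Z0" using abd Z0eq by auto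
    then obtain ua ub ud where u: "ua \<in> P" "L ua = a" "ub \<in> P" "L ub = b" "ud \<in> P" "L ud = d" using orb by metis
    have "h (exp ua) = h (exp ub)" "h (exp ub) = h (exp ud)" using abd u L(3) by metis+
    then have e: "exp ua = exp ub" "exp ub = exp ud"
      using u hinj expP by (metis DiffD1 imageI)+
    obtain m n :: int where m: "ua = ub + (of_int (2 * m) * pi) * \<i>" and n: "ub = ud + (of_int (2 * n) * pi) * \<i>"
      using e by (metis exp_eq)
    have period: "L (v + of_int j * (4 * pi * \<i>)) = L v" if "v \<in> P" for v j
    proof -
      have nat: "w \<in> P \<Longrightarrow> L (w + of_nat j * (4 * pi * \<i>)) = L w" for w j
      proof (induction j)
        case (Suc j)
        have "w + of_nat j * (4 * pi * \<i>) \<in> P" using Suc.prems by (simp add: P_def)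
        then show ?case using per[of "w + of_nat j * (4 * pi * \<i>)"] Suc by (simp add: algebra_simps)
      qed auto
      show ?thesis
      proof (cases "j \<ge> 0")
        case True
        then show ?thesis using nat[OF that, of "nat j"] by simp
      next
        case False
        then have "v + of_int j * (4 * pi * \<i>) \<in> P" using that by (simp add: P_def)
        from nat[OF this, of "nat (-j)"] False show ?thesis by (simp add: algebra_simps)
      qed
    qed
    consider "even m" | "even n" | "even (m + n)" by auto
    then show ?thesis
    proof cases
      case 1
      then obtain j where "m = 2 * j" by (rule evenE)
      then have "L ua = L ub" using period[OF u(3), of j] by (simp add: m mult_ac)
      then show ?thesis using u by simp
    next
      case 2
      then obtain j where "n = 2 * j" by (rule evenE)
      then have "L ub = L ud" using period[OF u(5), of j] by (simp add: n mult_ac)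
      then show ?thesis using u by simp
    next
      case 3
      then obtain j where j: "m + n = 2 * j" by (rule evenE)
      have "ua = ud + (of_int (2 * (m + n)) * pi) * \<i>" by (simp add: m n algebra_simps)
      then have "ua = ud + of_int j * (4 * pi * \<i>)" using j by (simp add: mult_ac)
      then have "L ua = L ud" using period[OF u(5), of j] by simp
      then show ?thesis using u by simp
    qed
  qed
qed

section \<open>Central components of preimages of discs\<close>

text \<open>
  The critical point \<open>cpt (int M)\<close> lies on the imaginary axis at height \<open>ht
  M\<close>, and \<open>rad M\<close> is the modulus of its value.
\<close>

definition ht :: "nat \<Rightarrow> real" where "ht M = (2 * real M + 1) * pi"

definition rad :: "nat \<Rightarrow> real" where "rad M = sqrt (1 + (ht M)\<^sup>2)"

lemma ht_pos: "ht M > 0" by (simp add: ht_def)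

lemma cmod_cval: "cmod (cval k) = sqrt (1 + ((2 * of_int k + 1) * pi)\<^sup>2)"
  by (simp add: cval_def cmod_def)

lemma cmod_cval_nat: "cmod (cval (int M)) = rad M"
  by (simp add: cmod_cval rad_def ht_def)

lemma cmod_expid_imaginary: "(cmod (expid (Complex 0 y)))\<^sup>2 = 1 + y\<^sup>2 + 2 * y * sin y"
proof -
  have "(cmod (expid (Complex 0 y)))\<^sup>2 = (cos y)\<^sup>2 + (y + sin y)\<^sup>2"
    unfolding cmod_power2 by (simp add: expid_def Re_exp Im_exp add.commute)
  also have "\<dots> = ((sin y)\<^sup>2 + (cos y)\<^sup>2) + y\<^sup>2 + 2 * y * sin y"
    by (simp add: power2_sum)
  finally show ?thesis by simp
qed

lemma sin_ht: "sin (ht M - t) = sin t" "sin (ht M + t) = - sin t" "cos (ht M) = -1" "sin (ht M) = 0"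
proof -
  have s: "sin (ht M) = 0" using sin_npi[of "2 * M + 1"] by (simp add: ht_def algebra_simps)
  have c: "cos (ht M) = -1" using cos_npi[of "2 * M + 1"] by (simp add: ht_def algebra_simps)
  show "sin (ht M - t) = sin t" "sin (ht M + t) = - sin t" by (simp_all add: sin_diff sin_add s c)
  show "cos (ht M) = -1" "sin (ht M) = 0" by fact+
qed

lemma expid_imaginary_segment:
  assumes "\<bar>y\<bar> < ht M" shows "cmod (expid (Complex 0 y)) < rad M"
proof -
  have *: "y\<^sup>2 + 2 * y * sin y < (ht M)\<^sup>2" if "0 \<le> y" "y < ht M" for y
  proof -
    define t where "t = ht M - y"
    have t: "t > 0" using that by (simp add: t_def)
    have "sin y = sin t" using sin_ht(1)[of M t] by (simp add: t_def)
    then have "sin y \<le> t" using sin_x_le_x[of t] t by simp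
    then have "2 * y * sin y \<le> 2 * y * t" using that by (intro mult_left_mono) auto
    moreover have "y\<^sup>2 + 2 * y * t < (y + t)\<^sup>2" using t by (simp add: power2_sum)
    ultimately show ?thesis by (simp add: t_def)
  qed
  have "y\<^sup>2 + 2 * y * sin y < (ht M)\<^sup>2"
    using *[of "\<bar>y\<bar>"] assms by (cases "y \<ge> 0") auto
  then have "(cmod (expid (Complex 0 y)))\<^sup>2 < 1 + (ht M)\<^sup>2"
    unfolding cmod_expid_imaginary by simp
  then show ?thesis unfolding rad_def by (simp add: real_less_rsqrt)
qed

text \<open>
  Just above the critical point the modulus drops below \<open>rad M\<close> again, because
  \<open>\<bar>expid (iy)\<bar>\<^sup>2 = 1 + y\<^sup>2 + 2 y sin y\<close> and the sine is
  negative there. So the disc of radius \<open>rad M\<close> has a preimage component touching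
  the critical point from above.
\<close>

lemma expid_above_cpt:
  obtains t0 where "t0 > 0" "\<And>t. 0 < t \<Longrightarrow> t < t0 \<Longrightarrow> cmod (expid (Complex 0 (ht M + t))) < rad M"
proof
  define t0 where "t0 = min 1 (1 / (ht M + 1))"
  show "t0 > 0" using ht_pos[of M] by (simp add: t0_def)
  fix t :: real assume t: "0 < t" "t < t0"
  have t1: "t < 1" using t(2) by (simp add: t0_def)
  have t2: "t * (ht M + 1) < 1" using t(2) ht_pos[of M] by (simp add: t0_def field_simps)
  have "(\<Sum>m<3. sin_coeff m * t ^ m) = t" by (simp add: eval_nat_numeral sin_coeff_def)
  then have "\<bar>sin t - t\<bar> \<le> t ^ 3 / 6"
    using Maclaurin_sin_bound[of t 3] t by (simp add: fact_numeral field_simps)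
  then have "sin t \<ge> t - t ^ 3 / 6" by linarith
  then have "(ht M + t) * (t - t ^ 3 / 6) \<le> (ht M + t) * sin t"
    using ht_pos[of M] t by (intro mult_left_mono) auto
  moreover have "(ht M + t) * t < 3"
  proof -
    have "(ht M + t) * t \<le> (ht M + 1) * t" using t t1 by (intro mult_right_mono) auto
    then show ?thesis using t2 by (simp add: mult.commute)
  qed
  then have "t\<^sup>2 * ((ht M + t) * t) < t\<^sup>2 * 3" using t by (intro mult_strict_left_mono) auto
  moreover have "(ht M + t) * (t - t ^ 3 / 6) = ht M * t + t\<^sup>2 - t\<^sup>2 * ((ht M + t) * t) / 6"
    by (simp add: field_simps power2_eq_square power3_eq_cube)
  ultimately have "2 * (ht M * t) + t\<^sup>2 < 2 * ((ht M + t) * sin t)"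
    by linarith
  then have "(cmod (expid (Complex 0 (ht M + t))))\<^sup>2 < 1 + (ht M)\<^sup>2"
    unfolding cmod_expid_imaginary sin_ht by (simp add: power2_sum algebra_simps)
  then show "cmod (expid (Complex 0 (ht M + t))) < rad M" unfolding rad_def by (simp add: real_less_rsqrt)
qed

lemma rad_le_on_line:
  assumes "Im z = ht M" shows "rad M \<le> cmod (expid z)"
proof -
  have e: "Re (expid z) = Re z - exp (Re z)" "Im (expid z) = ht M"
    using assms sin_ht(3,4)[of M] by (auto simp: expid_def Re_exp Im_exp)
  have "1 \<le> exp (Re z) - Re z" using exp_ge_add_one_self[of "Re z"] by linarith
  then have "1 \<le> (exp (Re z) - Re z)\<^sup>2" by (rule one_le_power)
  then have "1 \<le> (Re (expid z))\<^sup>2" by (simp add: e power2_commute)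
  with e(2)   show ?thesis unfolding rad_def cmod_def by simp
qed

text \<open>
  The discs of radius \<open>rad M\<close> are the largest open discs around the origin not
  containing the critical value \<open>cval (int M)\<close>. All critical points over such a
  disc lie in the component of the origin, since the modulus of \<open>expid\<close> stays small
  on the segment of the imaginary axis below \<open>cpt (int M)\<close>; the other components
  are mapped injectively.
\<close>

definition central :: "nat \<Rightarrow> complex set" where
  "central M = component {z. cmod (expid z) < rad M} 0"

lemma imaginary_in_central:
  assumes "\<bar>y\<bar> < ht M" shows "Complex 0 y \<in> central M"
  unfolding central_def
proof (rule component_mono_eq)
  show "connected ((\<lambda>y. Complex 0 y) ` {-ht M<..<ht M})"
    unfolding Complex_eq by (intro connected_continuous_image continuous_intros) auto
  show "(\<lambda>y. Complex 0 y) ` {-ht M<..<ht M} \<subseteq> {z. cmod (expid z) < rad M}"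
    using expid_imaginary_segment by auto
  show "0 \<in> (\<lambda>y. Complex 0 y) ` {-ht M<..<ht M}"
    using ht_pos[of M] by (auto intro!: image_eqI[of _ _ 0] simp: zero_complex.code)
  show "Complex 0 y \<in> (\<lambda>y. Complex 0 y) ` {-ht M<..<ht M}" using assms by (intro imageI) (simp add: abs_less_iff)
qed

text \<open>
  On the line \<open>Im z = ht M\<close> the modulus of \<open>expid\<close> is at least
  \<open>rad M\<close>, so this line separates.
\<close>

lemma above_not_central:
  assumes "Im z > ht M" shows "z \<notin> central M"
proof
  assume z: "z \<in> central M"
  have "connected (Im ` central M)"
    unfolding central_def by (intro connected_continuous_image continuous_intros) auto
  moreover have "0 \<in> Im ` central M"
    using imaginary_in_central[of 0 M] ht_pos[of M] by (auto intro!: image_eqI[of _ _ "Complex 0 0"])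
  ultimately have "ht M \<in> Im ` central M"
    using connectedD_interval[of "Im ` central M" 0 "Im z" "ht M"] z assms ht_pos[of M] by auto
  then obtain y where y: "y \<in> central M" "Im y = ht M" by auto
  then have "cmod (expid y) < rad M" unfolding central_def using connected_component_subset by blast
  then show False using rad_le_on_line[OF y(2)] by simp
qed

lemma crit_in_central:
  assumes "exp z + 1 = 0" "cmod (expid z) < rad M" shows "z \<in> central M"
proof -
  obtain k where k: "z = cpt k" using assms(1) expid_crit_iff by auto
  have "cmod (cval k) < rad M" using assms(2) by (simp add: k expid_cpt)
  then have "((2 * of_int k + 1) * pi)\<^sup>2 < (ht M)\<^sup>2" by (simp add: cmod_cval rad_def)
  then have "\<bar>(2 * of_int k + 1) * pi\<bar> < ht M" using ht_pos[of M]
    by (metis abs_of_pos abs_square_less_1 power2_less_imp_less abs_ge_zero power2_abs)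
  then show ?thesis unfolding k cpt_def by (rule imaginary_in_central)
qed

text \<open>
  Such a component contains no critical point, so the disc lifts to it. This section and
  \<open>expid\<close> are inverse to each other by uniqueness of lifts.
\<close>

lemma inj_on_noncentral:
  assumes "cmod (expid x) < rad M" "x \<notin> central M"
  shows "inj_on expid (component {z. cmod (expid z) < rad M} x)"
proof -
  let ?S = "{z. cmod (expid z) < rad M}"
  define X where "X = component ?S x"
  have Xx: "x \<in> X" using assms by (simp add: X_def)
  have XS: "X \<subseteq> ?S" unfolding X_def by (rule connected_component_subset)
  have nocrit: "exp z + 1 \<noteq> 0" if "z \<in> X" for z
  proof
    assume "exp z + 1 = 0"
    then have "z \<in> central M" using crit_in_central XS that by auto
    then have "component ?S z = component ?S 0" unfolding central_def by (rule connected_component_eq)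
    moreover have "component ?S z = X" using that unfolding X_def by (rule connected_component_eq)
    ultimately show False using Xx assms(2) by (simp add: central_def)
  qed
  have S: "?S = {z. id (expid z) \<in> ball 0 (rad M)}" by auto
  obtain s where s: "continuous_on (ball 0 (rad M)) s" "s (expid x) = x"
     "\<And>u. u \<in> ball 0 (rad M) \<Longrightarrow> id (expid (s u)) = u"
  proof (rule lift_through_component[of id id "ball 0 (rad M)" "ball 0 (rad M)" "expid x" "\<lambda>u. u" x])
    show "homeomorphism UNIV UNIV id (id::complex\<Rightarrow>complex)" by (simp add: homeomorphism_def)
    show "exp z + 1 \<noteq> 0" if "z \<in> component {z. id (expid z) \<in> ball 0 (rad M)} x" for z
    proof (rule nocrit)
      show "z \<in> X" using that unfolding X_def S .
    qed
  qed (use assms in auto)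
  have sX: "s ` ball 0 (rad M) \<subseteq> X"
    unfolding X_def
  proof (rule component_superset[of _ _ x])
    show "connected (s ` ball 0 (rad M))" using s(1) by (intro connected_continuous_image) auto
    show "s ` ball 0 (rad M) \<subseteq> ?S" using s(3) by auto
    show "x \<in> s ` ball 0 (rad M)" using s(2) assms by (auto intro: image_eqI[of _ _ "expid x"])
  qed (use assms in auto)
  have "s (expid y) = y" if "y \<in> X" for y
  proof (rule expid_lift_unique[of X "\<lambda>y. s (expid y)" "\<lambda>y. y" x])
    show "connected X" by (simp add: X_def)
    show "continuous_on X (\<lambda>y. s (expid y))"
      by (rule continuous_on_compose2[OF s(1) continuous_on_expid]) (use XS in auto)
    show "expid (s (expid u)) = expid u" if "u \<in> X" for u using s(3)[of "expid u"] XS that by auto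
    show "exp (s (expid u)) + 1 \<noteq> 0" if "u \<in> X" for u
      using nocrit[of "s (expid u)"] sX XS that by (auto simp: image_subset_iff)
  qed (use Xx s(2) that in auto)
  then show ?thesis unfolding X_def[symmetric] by (metis inj_onI)
qed

lemma rad_strict_mono: "M < N \<Longrightarrow> rad M < rad N"
proof -
  assume "M < N"
  then have "ht M < ht N" unfolding ht_def by (intro mult_strict_right_mono) auto
  then have "(ht M)\<^sup>2 < (ht N)\<^sup>2" using ht_pos[of M] by (intro power_strict_mono) auto
  then show ?thesis by (simp add: rad_def)
qed

lemma rad_mono: "M \<le> N \<Longrightarrow> rad M \<le> rad N"
  using rad_strict_mono[of M N] by (cases "M = N") auto

lemma rad_gt: "rad M > real M"
proof -
  have "(2 * real M + 1) * 1 \<le> (2 * real M + 1) * pi" using pi_gt3 by (intro mult_left_mono) auto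
  then have "real M < ht M" unfolding ht_def using of_nat_0_le_iff[of M] by (smt (verit))
  also have "ht M = sqrt ((ht M)\<^sup>2)" using ht_pos[of M] by simp
  also have "\<dots> \<le> rad M" unfolding rad_def by (rule real_sqrt_le_mono) simp
  finally show ?thesis .
qed

lemma eventually_central: "\<exists>M0. \<forall>M\<ge>M0. z \<in> central M"
proof -
  have "bounded (expid ` closed_segment 0 z)"
    by (intro compact_imp_bounded compact_continuous_image continuous_on_expid) auto
  then obtain R where "\<forall>w\<in>expid ` closed_segment 0 z. cmod w \<le> R" unfolding bounded_iff by auto
  then have R: "\<And>y. y \<in> closed_segment 0 z \<Longrightarrow> cmod (expid y) \<le> R" by simp
  obtain M0 :: nat where M0: "R < real M0" using reals_Archimedean2 by blast
  have "z \<in> central M" if "M \<ge> M0" for M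
    unfolding central_def
  proof (rule component_mono_eq[of "closed_segment 0 z"])
    show "closed_segment 0 z \<subseteq> {z. cmod (expid z) < rad M}"
    proof clarify
      fix y assume "y \<in> closed_segment 0 z"
      then show "cmod (expid y) < rad M" using R[of y] M0 rad_gt[of M0] rad_mono[OF that] by linarith
    qed
  qed auto
  then show ?thesis by blast
qed

lemma cval_moduli:
  assumes "t \<in> range cval" shows "cmod t \<in> range rad"
proof -
  obtain k where k: "t = cval k" using assms by auto
  show ?thesis
  proof (cases "k \<ge> 0")
    case True
    then show ?thesis using cmod_cval_nat[of "nat k"] k by (metis nat_0_le rangeI)
  next
    case False
    have "cmod t = rad (nat (- k - 1))"
      using False by (simp add: k cmod_cval rad_def ht_def power2_eq_square algebra_simps)
    then show ?thesis by auto
  qed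
qed

section \<open>Homeomorphisms of the plane\<close>

text \<open>
  Far out the modulus is preserved. Then the moduli of distant tips are still those of the
  critical values, and the large central components are the same for \<open>\<phi> \<circ>
  expid\<close> as for \<open>expid\<close>.
\<close>

definition plane_homeo :: "(complex \<Rightarrow> complex) \<Rightarrow> bool" where
  "plane_homeo \<phi> \<longleftrightarrow> (\<exists>\<phi>i. homeomorphism UNIV UNIV \<phi> \<phi>i) \<and>
     (\<exists>r. \<forall>w. r \<le> cmod w \<or> r \<le> cmod (\<phi> w) \<longrightarrow> cmod (\<phi> w) = cmod w)"

lemma plane_homeo_comp:
  assumes "plane_homeo \<phi>" "plane_homeo \<psi>" shows "plane_homeo (\<psi> \<circ> \<phi>)"
proof -
  obtain \<phi>i r \<psi>i s where *: "homeomorphism UNIV UNIV \<phi> \<phi>i" "\<And>w. r \<le> cmod w \<or> r \<le> cmod (\<phi> w) \<Longrightarrow> cmod (\<phi> w) = cmod w"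
    "homeomorphism UNIV UNIV \<psi> \<psi>i" "\<And>w. s \<le> cmod w \<or> s \<le> cmod (\<psi> w) \<Longrightarrow> cmod (\<psi> w) = cmod w"
    using assms unfolding plane_homeo_def by metis
  have "homeomorphism UNIV UNIV (\<psi> \<circ> \<phi>) (\<phi>i \<circ> \<psi>i)" using *(1,3) by (rule homeomorphism_compose)
  moreover have "cmod ((\<psi> \<circ> \<phi>) w) = cmod w" if "max r s \<le> cmod w \<or> max r s \<le> cmod ((\<psi> \<circ> \<phi>) w)" for w
    using that *(2)[of w] *(4)[of "\<phi> w"] by auto
  ultimately show ?thesis unfolding plane_homeo_def by blast
qed

lemma plane_homeo_id: "plane_homeo id"
  unfolding plane_homeo_def by (auto intro!: exI[of _ id] simp: homeomorphism_def)

lemma plane_homeo_inverse: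
  assumes "homeomorphism UNIV UNIV \<phi> \<phi>i" "plane_homeo \<phi>" shows "plane_homeo \<phi>i"
proof -
  obtain r where r: "\<And>w. r \<le> cmod w \<or> r \<le> cmod (\<phi> w) \<Longrightarrow> cmod (\<phi> w) = cmod w"
    using assms(2) unfolding plane_homeo_def by metis
  have "cmod (\<phi>i w) = cmod w" if "r \<le> cmod w \<or> r \<le> cmod (\<phi>i w)" for w
    using r[of "\<phi>i w"] that by (auto simp: homeo_UNIV(2)[OF assms(1)])
  then show ?thesis using homeomorphism_symD[OF assms(1)] unfolding plane_homeo_def by blast
qed

lemma plane_homeo_supported:
  assumes "homeomorphism UNIV UNIV \<phi> \<phi>i" "bounded S" "\<And>w. w \<notin> S \<Longrightarrow> \<phi> w = w"
  shows "plane_homeo \<phi>"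
proof -
  obtain r where r: "\<And>w. w \<in> S \<Longrightarrow> cmod w < r" using assms(2) bounded_pos_less by metis
  have "cmod (\<phi> w) = cmod w" if "r \<le> cmod w \<or> r \<le> cmod (\<phi> w)" for w
  proof -
    have out: "\<phi> y = y" if "r \<le> cmod y" for y using assms(3)[of y] r[of y] that by force
    show ?thesis
      using that out[of w] out[of "\<phi> w"] homeo_UNIV(5)[OF assms(1)] by (auto simp: inj_eq)
  qed
  then show ?thesis using assms(1) unfolding plane_homeo_def by blast
qed

lemma move_points:
  assumes S: "open S" "connected S" "bounded S" and K: "finite K"
    "\<And>i. i \<in> K \<Longrightarrow> x i \<in> S \<and> y i \<in> S" "pairwise (\<lambda>i j. x i \<noteq> x j \<and> y i \<noteq> y j) K"
  obtains \<phi> \<phi>i :: "complex \<Rightarrow> complex" where "homeomorphism UNIV UNIV \<phi> \<phi>i" "plane_homeo \<phi>" "\<And>i. i \<in> K \<Longrightarrow> \<phi> (x i) = y i"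
    "\<And>w. w \<notin> S \<Longrightarrow> \<phi> w = w" "\<And>w. w \<notin> S \<Longrightarrow> \<phi>i w = w" "\<And>w. w \<in> S \<Longrightarrow> \<phi> w \<in> S" "\<And>w. w \<in> S \<Longrightarrow> \<phi>i w \<in> S"
proof -
  obtain \<phi> \<phi>i where *: "homeomorphism UNIV UNIV \<phi> \<phi>i" "\<And>i. i \<in> K \<Longrightarrow> \<phi>(x i) = y i" "{w. \<not> (\<phi> w = w \<and> \<phi>i w = w)} \<subseteq> S"
  proof (cases "S = {}")
    case True
    then show ?thesis using K that[of id id] by (auto simp: homeomorphism_def)
  next
    case False
    show ?thesis
    proof (rule homeomorphism_moving_points_exists[of S UNIV K x y])
      show "UNIV \<subseteq> affine hull S" using affine_hull_open[OF S(1) False] by simp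
    qed (use S K that in auto)
  qed
  have 1: "\<phi> w = w" "\<phi>i w = w" if "w \<notin> S" for w using *(3) that by auto
  note h = homeo_UNIV[OF *(1)]
  have 2: "\<phi> w \<in> S" if "w \<in> S" for w
    using 1(2)[of "\<phi> w"] h(1)[of w] that by metis
  have 3: "\<phi>i w \<in> S" if "w \<in> S" for w
    using 1(1)[of "\<phi>i w"] h(2)[of w] that by metis
  show ?thesis by (rule that[OF *(1) plane_homeo_supported[OF *(1) S(3) 1(1)] *(2) 1 2 3])
qed

definition twist :: "(real \<Rightarrow> real) \<Rightarrow> complex \<Rightarrow> complex" where
  "twist \<tau> w = w * cis (\<tau> (ln (cmod w)))"

lemma cmod_twist [simp]: "cmod (twist \<tau> w) = cmod w"
  by (simp add: twist_def norm_mult)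

lemma twist_exp: "twist \<tau> (exp u) = exp (u + \<i> * \<tau> (Re u))"
  by (simp add: twist_def exp_add cis_conv_exp)

lemma twist_id: "\<tau> (ln (cmod w)) = 0 \<Longrightarrow> twist \<tau> w = w"
  by (simp add: twist_def)

lemma continuous_patch:
  fixes g :: "complex \<Rightarrow> complex"
  assumes "continuous_on (-{0}) g" "\<And>w. cmod w < e \<Longrightarrow> g w = w" "e > 0"
  shows "continuous_on UNIV g"
proof -
  have "continuous_on (ball 0 e) g"
    using continuous_on_id by (rule continuous_on_cong[THEN iffD1, rotated 2]) (use assms(2) in auto)
  then have "continuous_on (ball 0 e \<union> -{0}) g"
    using assms(1) by (intro continuous_on_open_Un) auto
  moreover have "ball 0 e \<union> -{0} = (UNIV::complex set)" using assms(3) by auto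
  ultimately show ?thesis by simp
qed

lemma continuous_on_twist:
  assumes "continuous_on UNIV \<tau>" "\<And>l. l \<le> 0 \<Longrightarrow> \<tau> l = 0"
  shows "continuous_on UNIV (twist \<tau>)"
proof (rule continuous_patch[of _ 1])
  have "continuous_on (-{0::complex}) (\<lambda>w. \<tau> (ln (cmod w)))"
    by (rule continuous_on_compose2[OF assms(1)]) (auto intro!: continuous_intros)
  then show "continuous_on (-{0}) (twist \<tau>)"
    unfolding twist_def by (intro continuous_intros) 
  show "twist \<tau> w = w" if "cmod w < 1" for w
  proof (cases "w = 0")
    case False
    then show ?thesis using that assms(2) by (intro twist_id) auto
  qed (simp add: twist_def)
qed auto

lemma plane_homeo_twist:
  assumes "continuous_on UNIV \<tau>" "\<And>l. l \<le> 0 \<Longrightarrow> \<tau> l = 0"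
  shows "homeomorphism UNIV UNIV (twist \<tau>) (twist (\<lambda>l. - \<tau> l))" "plane_homeo (twist \<tau>)"
proof -
  have tt: "twist \<sigma> (twist \<rho> w) = w * (cis (\<rho> (ln (cmod w))) * cis (\<sigma> (ln (cmod w))))" for \<sigma> \<rho> w
    unfolding twist_def[of \<sigma> "twist \<rho> w"] cmod_twist by (simp add: twist_def)
  have "twist (\<lambda>l. - \<tau> l) (twist \<tau> w) = w" "twist \<tau> (twist (\<lambda>l. - \<tau> l) w) = w" for w
    by (simp_all add: tt cis_mult)
  moreover have "continuous_on UNIV (twist \<tau>)" "continuous_on UNIV (twist (\<lambda>l. - \<tau> l))"
    using assms by (auto intro!: continuous_on_twist continuous_intros)
  ultimately show h: "homeomorphism UNIV UNIV (twist \<tau>) (twist (\<lambda>l. - \<tau> l))"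
    by (intro homeomorphismI) auto
  then show "plane_homeo (twist \<tau>)" unfolding plane_homeo_def by auto
qed

text \<open>
  A piecewise linear change of the logarithmic radius that is the identity outside
  \<open>{a..d}\<close> and for \<open>x = 1\<close> sends \<open>b\<close> to
  \<open>b'\<close>; it interpolates to the identity at \<open>x = 0\<close>. In this form, with
  \<open>max\<close> and \<open>min\<close>, the inverse has a formula of the same kind.
\<close>

definition outw :: "real \<Rightarrow> real \<Rightarrow> real \<Rightarrow> real \<Rightarrow> real \<Rightarrow> real \<Rightarrow> real" where
  "outw a b b' d x l = max l (min (a + (l - a) * (1 + x * ((b' - b) / (b - a)))) (d - (d - l) * (1 - x * ((b' - b) / (d - b)))))"

definition inw :: "real \<Rightarrow> real \<Rightarrow> real \<Rightarrow> real \<Rightarrow> real \<Rightarrow> real \<Rightarrow> real" where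
  "inw a b b' d x l = min l (max (a + (l - a) / (1 + x * ((b' - b) / (b - a)))) (d - (d - l) / (1 - x * ((b' - b) / (d - b)))))"

lemma slopes:
  fixes a b b' d x :: real
  assumes "a < b" "b < b'" "b' < d" "0 \<le> x" "x \<le> 1"
  shows "1 \<le> 1 + x * ((b' - b) / (b - a))" "0 < 1 - x * ((b' - b) / (d - b))" "1 - x * ((b' - b) / (d - b)) \<le> 1"
proof -
  show "1 \<le> 1 + x * ((b' - b) / (b - a))" "1 - x * ((b' - b) / (d - b)) \<le> 1" using assms by auto
  have "x * ((b' - b) / (d - b)) \<le> 1 * ((b' - b) / (d - b))" using assms by (intro mult_right_mono) auto
  also have "\<dots> < 1" using assms by auto
  finally show "0 < 1 - x * ((b' - b) / (d - b))" by simp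
qed

lemma out_in_inverse:
  fixes a d p q l :: real
  assumes "p > 0" "q > 0"
  shows "max m (min (a + (m - a) * p) (d - (d - m) * q)) = l \<longleftrightarrow>
         m = min l (max (a + (l - a) / p) (d - (d - l) / q))"
proof -
  have 1: "a + (m - a) * p \<le> l \<longleftrightarrow> m \<le> a + (l - a) / p" "l \<le> a + (m - a) * p \<longleftrightarrow> a + (l - a) / p \<le> m"
    using assms by (auto simp: field_simps)
  have 2: "d - (d - m) * q \<le> l \<longleftrightarrow> m \<le> d - (d - l) / q" "l \<le> d - (d - m) * q \<longleftrightarrow> d - (d - l) / q \<le> m"
    using assms by (auto simp: field_simps)
  have "max m (min (a + (m - a) * p) (d - (d - m) * q)) \<le> l \<longleftrightarrow> m \<le> min l (max (a + (l - a) / p) (d - (d - l) / q))"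
    by (simp only: max.bounded_iff min_le_iff_disj min.bounded_iff le_max_iff_disj 1(1) 2(1))
  moreover have "l \<le> max m (min (a + (m - a) * p) (d - (d - m) * q)) \<longleftrightarrow> min l (max (a + (l - a) / p) (d - (d - l) / q)) \<le> m"
    by (simp only: max.bounded_iff min_le_iff_disj min.bounded_iff le_max_iff_disj 1(2) 2(2))
  ultimately show ?thesis by (simp only: order_eq_iff[of _ l] order_eq_iff[of m])
qed

lemma outw_inw:
  assumes "a < b" "b < b'" "b' < d" "0 \<le> x" "x \<le> 1"
  shows "outw a b b' d x (inw a b b' d x l) = l" "inw a b b' d x (outw a b b' d x l) = l"
proof -
  have p: "0 < 1 + x * ((b' - b) / (b - a))" using slopes(1)[OF assms] by linarith
  note * = out_in_inverse[OF p slopes(2)[OF assms]]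
  show "outw a b b' d x (inw a b b' d x l) = l" unfolding outw_def * inw_def by (rule refl)
  have "l = inw a b b' d x (outw a b b' d x l)"
    unfolding inw_def *[symmetric] outw_def by (rule refl)
  then show "inw a b b' d x (outw a b b' d x l) = l" by (rule sym)
qed

lemma outw_ge: "l \<le> outw a b b' d x l" by (simp add: outw_def)

lemma outw_strict_mono:
  assumes "a < b" "b < b'" "b' < d" "0 \<le> x" "x \<le> 1" "l < m"
  shows "outw a b b' d x l < outw a b b' d x m"
proof -
  have "(l - a) * p < (m - a) * p" "(d - m) * q < (d - l) * q" if "p > 0" "q > 0" for p q
    using that assms by auto
  from this[of "1 + x * ((b' - b) / (b - a))" "1 - x * ((b' - b) / (d - b))"]
  show ?thesis using assms(6) slopes[OF assms(1-5)] unfolding outw_def by linarith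
qed

lemma outw_fix:
  assumes "a < b" "b < b'" "b' < d" "0 \<le> x" "x \<le> 1" "l \<le> a \<or> d \<le> l"
  shows "outw a b b' d x l = l"
proof -
  note sl = slopes[OF assms(1-5)]
  have A: "a + (l - a) * p \<le> l" if "l \<le> a" "p \<ge> 1" for p
  proof -
    have "(a - l) * 1 \<le> (a - l) * p" using that by (intro mult_left_mono) auto
    then show ?thesis by (simp add: algebra_simps)
  qed
  have B: "d - (d - l) * q \<le> l" if "d \<le> l" "q \<le> 1" for q
  proof -
    have "(l - d) * q \<le> (l - d) * 1" using that by (intro mult_left_mono) auto
    then show ?thesis by (simp add: algebra_simps)
  qed
  show ?thesis
    using assms(6) A[OF _ sl(1)] B[OF _ sl(3)] unfolding outw_def by (auto simp: max_def min_def)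
qed

lemma outw_0: "a < b \<Longrightarrow> b < b' \<Longrightarrow> b' < d \<Longrightarrow> outw a b b' d 0 l = l"
  by (simp add: outw_def)

lemma outw_1:
  assumes "a < b" "b < b'" "b' < d" shows "outw a b b' d 1 b = b'"
proof -
  have "a + (b - a) * (1 + 1 * ((b' - b) / (b - a))) = b'" using assms by (simp add: distrib_left)
  moreover have "d - (d - b) * (1 - 1 * Y) = b + (d - b) * Y" for Y by (simp add: algebra_simps)
  then have "d - (d - b) * (1 - 1 * ((b' - b) / (d - b))) = b'" using assms by simp
  ultimately show ?thesis unfolding outw_def using assms by simp
qed

lemma continuous_on_outw_inw:
  assumes "a < b" "b < b'" "b' < d" "continuous_on S x" "continuous_on S l" "\<And>w. w \<in> S \<Longrightarrow> 0 \<le> x w \<and> x w \<le> (1::real)"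
  shows "continuous_on S (\<lambda>w. outw a b b' d (x w) (l w))" "continuous_on S (\<lambda>w. inw a b b' d (x w) (l w))"
proof -
  have nz: "1 + x w * ((b' - b) / (b - a)) \<noteq> 0" "1 - x w * ((b' - b) / (d - b)) \<noteq> 0" if "w \<in> S" for w
    using slopes(1,2)[OF assms(1-3), of "x w"] assms(6)[OF that] by linarith+
  have c: "b - a \<noteq> 0" "d - b \<noteq> 0" using assms(1-3) by auto
  show "continuous_on S (\<lambda>w. outw a b b' d (x w) (l w))"
    unfolding outw_def by (intro continuous_intros assms(4,5) c)
  show "continuous_on S (\<lambda>w. inw a b b' d (x w) (l w))"
    unfolding inw_def by (intro continuous_intros assms(4,5) c ballI nz)
qed

definition radial :: "(complex \<Rightarrow> real \<Rightarrow> real) \<Rightarrow> complex \<Rightarrow> complex" where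
  "radial H w = w * of_real (exp (H w (ln (cmod w)) - ln (cmod w)))"

lemma ln_cmod_radial: "w \<noteq> 0 \<Longrightarrow> ln (cmod (radial H w)) = H w (ln (cmod w))"
  by (simp add: radial_def norm_mult ln_mult)

lemma radial_eq: "w \<noteq> 0 \<Longrightarrow> radial H w = of_real (exp (H w (ln (cmod w)))) * (w / of_real (cmod w))"
  by (simp add: radial_def exp_diff)

lemma radial_id: "H w (ln (cmod w)) = ln (cmod w) \<Longrightarrow> radial H w = w"
  by (simp add: radial_def)

lemma radial_0 [simp]: "radial H 0 = 0" by (simp add: radial_def)

text \<open>
  The amount of the push may depend on the direction. As a radial map preserves directions, the
  inverse is obtained direction by direction.
\<close>

lemma radial_homeo:
  assumes par: "a < b" "b < b'" "b' < d"
    and lam: "continuous_on (-{0}) dr" "\<And>w. 0 \<le> dr w \<and> dr w \<le> 1" "\<And>w c. c > 0 \<Longrightarrow> dr (of_real c * w) = dr w"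
  defines "\<phi> \<equiv> radial (\<lambda>w. outw a b b' d (dr w))" and "\<phi>i \<equiv> radial (\<lambda>w. inw a b b' d (dr w))"
  shows "homeomorphism UNIV UNIV \<phi> \<phi>i" "plane_homeo \<phi>"
proof -
  have lr: "dr (radial H w) = dr w" for H w
    unfolding radial_def by (subst mult.commute) (simp add: lam(3))
  have nz: "radial H w \<noteq> 0" if "w \<noteq> 0" for H w using that by (simp add: radial_def)
  have oi: "outw a b b' d (dr w) (inw a b b' d (dr w) l) = l" "inw a b b' d (dr w) (outw a b b' d (dr w) l) = l" for w l
    using outw_inw[OF par] lam(2) by auto
  have inv1: "\<phi>i (\<phi> w) = w" for w
  proof (cases "w = 0")
    case False
    have "\<phi>i (\<phi> w) = \<phi> w * of_real (exp (ln (cmod w) - outw a b b' d (dr w) (ln (cmod w))))"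
      unfolding \<phi>i_def by (subst radial_def) (simp add: \<phi>_def lr ln_cmod_radial False oi)
    then show ?thesis by (simp add: \<phi>_def radial_def mult.assoc flip: of_real_mult exp_add)
  qed (simp add: \<phi>_def \<phi>i_def)
  have inv2: "\<phi> (\<phi>i w) = w" for w
  proof (cases "w = 0")
    case False
    have "\<phi> (\<phi>i w) = \<phi>i w * of_real (exp (ln (cmod w) - inw a b b' d (dr w) (ln (cmod w))))"
      unfolding \<phi>_def by (subst radial_def) (simp add: \<phi>i_def lr ln_cmod_radial False oi)
    then show ?thesis by (simp add: \<phi>i_def radial_def mult.assoc flip: of_real_mult exp_add)
  qed (simp add: \<phi>_def \<phi>i_def)
  have ofix: "outw a b b' d (dr w) l = l" if "l \<le> a \<or> d \<le> l" for w l
    using outw_fix[OF par] lam(2) that by auto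
  have ifix: "inw a b b' d (dr w) l = l" if "l \<le> a \<or> d \<le> l" for w l
    using oi(2)[of w l] ofix[OF that] by simp
  have small: "\<phi> w = w" "\<phi>i w = w" if "cmod w < exp a" for w
  proof -
    have "w = 0 \<or> ln (cmod w) \<le> a" using that by (metis less_eq_real_def ln_exp ln_less_cancel_iff norm_le_zero_iff linorder_not_le exp_gt_zero)
    then consider "w = 0" | "ln (cmod w) \<le> a" by blast
    then show "\<phi> w = w" "\<phi>i w = w" unfolding \<phi>_def \<phi>i_def by (cases; simp add: radial_id ofix ifix)+
  qed
  have cl: "continuous_on (-{0}) (\<lambda>w::complex. ln (cmod w))" by (auto intro!: continuous_intros)
  have "continuous_on (-{0}) \<phi>" unfolding \<phi>_def radial_def
    using continuous_on_outw_inw(1)[OF par lam(1) cl] lam(2) cl by (intro continuous_intros) auto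
  then have c1: "continuous_on UNIV \<phi>" using small by (intro continuous_patch[of _ "exp a"]) auto
  have "continuous_on (-{0}) \<phi>i" unfolding \<phi>i_def radial_def
    using continuous_on_outw_inw(2)[OF par lam(1) cl] lam(2) cl by (intro continuous_intros) auto
  then have c2: "continuous_on UNIV \<phi>i" using small by (intro continuous_patch[of _ "exp a"]) auto
  show h: "homeomorphism UNIV UNIV \<phi> \<phi>i"
    using inv1 inv2 c1 c2 by (intro homeomorphismI) auto
  have "\<phi> w = w" if "w \<notin> ball 0 (exp d)" for w
  proof -
    have "d \<le> ln (cmod w)" using that
      by (smt (verit) dist_0_norm exp_gt_zero exp_le_cancel_iff exp_ln mem_ball norm_le_zero_iff zero_less_norm_iff)
    then show ?thesis unfolding \<phi>_def by (intro radial_id ofix) auto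
  qed
  then show "plane_homeo \<phi>" by (intro plane_homeo_supported[OF h, of "ball 0 (exp d)"]) auto
qed

section \<open>Sheets over a circle and their edges\<close>

abbreviation lev :: "complex \<Rightarrow> real" where "lev w \<equiv> ln (cmod w)"

abbreviation tips :: "(complex \<Rightarrow> complex) \<Rightarrow> complex set" where "tips \<phi> \<equiv> \<phi> ` range cval"

definition strip :: "real \<Rightarrow> real \<Rightarrow> complex set" where "strip a b = {u. a < Re u \<and> Re u < b}"

definition ann :: "real \<Rightarrow> real \<Rightarrow> complex set" where "ann a b = {w. exp a < cmod w \<and> cmod w < exp b}"

text \<open>
  The standard cell, a piece of a sector: its levels, that is logarithmic radii, lie between 2
  and 3, and its directions have cosine larger than \<open>\<kappa>\<close>.
\<close>

definition cell :: "real \<Rightarrow> complex set" where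
  "cell \<kappa> = {w. w \<noteq> 0 \<and> 2 < lev w \<and> lev w < 3 \<and> \<kappa> * cmod w < Re w}"

definition ccell :: "real \<Rightarrow> complex set" where
  "ccell \<kappa> = {w. w \<noteq> 0 \<and> 2 \<le> lev w \<and> lev w \<le> 3 \<and> \<kappa> * cmod w \<le> Re w}"

text \<open>
  An annulus around the circle of level 11/5 contains no tip. The levels from 1 to 12/5 leave
  room below the circle for pulling a tip in and for the twist.
\<close>

definition gap :: "(complex \<Rightarrow> complex) \<Rightarrow> bool" where
  "gap \<phi> \<longleftrightarrow> (\<forall>t\<in>tips \<phi>. t \<noteq> 0 \<longrightarrow> \<not> (1 \<le> lev t \<and> lev t \<le> 12/5))"

definition same :: "(complex \<Rightarrow> complex) \<Rightarrow> real \<Rightarrow> complex \<Rightarrow> complex \<Rightarrow> bool" where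
  "same \<phi> \<kappa> x y \<longleftrightarrow> connected_component {z. \<phi> (expid z) \<in> cell \<kappa>} x y"

text \<open>
  The point \<open>b\<close> is reached from \<open>a\<close> by lifting the arc of the circle
  of level 11/5 from angle \<open>s\<close> to angle \<open>t\<close>. The level lies inside the
  cell and inside the gap.
\<close>

definition arclift :: "(complex \<Rightarrow> complex) \<Rightarrow> real \<Rightarrow> real \<Rightarrow> complex \<Rightarrow> complex \<Rightarrow> bool" where
  "arclift \<phi> s t a b \<longleftrightarrow> (\<exists>l. continuous_on {s..t} l \<and> (\<forall>x\<in>{s..t}. \<phi> (expid (l x)) = exp (Complex (11/5) x)) \<and> l s = a \<and> l t = b)"

abbreviation edge :: "(complex \<Rightarrow> complex) \<Rightarrow> real \<Rightarrow> complex \<Rightarrow> complex \<Rightarrow> bool" where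
  "edge \<phi> \<theta> \<equiv> arclift \<phi> \<theta> (2 * pi - \<theta>)"

text \<open>
  Being in one component over the cell, generated together with the edges in \<open>L\<close>.
  The aim is to shrink \<open>L\<close> to the empty set.
\<close>

definition link :: "(complex \<Rightarrow> complex) \<Rightarrow> real \<Rightarrow> (complex \<times> complex) set \<Rightarrow> (complex \<times> complex) set" where
  "link \<phi> \<kappa> L = ({(x, y). same \<phi> \<kappa> x y} \<union> L \<union> L\<inverse>)\<^sup>*"

lemma continuous_on_Complex [continuous_intros]:
  "continuous_on S f \<Longrightarrow> continuous_on S g \<Longrightarrow> continuous_on S (\<lambda>x. Complex (f x) (g x))"
  unfolding Complex_eq by (intro continuous_intros)

lemma lev_less_iff: "w \<noteq> 0 \<Longrightarrow> lev w < b \<longleftrightarrow> cmod w < exp b"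
  by (metis exp_gt_zero ln_exp ln_less_cancel_iff zero_less_norm_iff)

lemma less_lev_iff: "w \<noteq> 0 \<Longrightarrow> b < lev w \<longleftrightarrow> exp b < cmod w"
  by (metis exp_gt_zero ln_exp ln_less_cancel_iff zero_less_norm_iff)

lemma lev_le_iff: "w \<noteq> 0 \<Longrightarrow> lev w \<le> b \<longleftrightarrow> cmod w \<le> exp b"
  using less_lev_iff by (metis linorder_not_le)

lemma le_lev_iff: "w \<noteq> 0 \<Longrightarrow> b \<le> lev w \<longleftrightarrow> exp b \<le> cmod w"
  using lev_less_iff by (metis linorder_not_le)

lemma lev_exp [simp]: "lev (exp u) = Re u" by simp

lemma ann_iff: "w \<in> ann a b \<longleftrightarrow> w \<noteq> 0 \<and> a < lev w \<and> lev w < b"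
  unfolding ann_def using lev_less_iff[of w b] less_lev_iff[of w a]
  by (metis (mono_tags, lifting) exp_gt_zero mem_Collect_eq norm_zero order_less_not_sym)

lemma exp_strip: "exp ` strip a b = ann a b"
proof
  show "exp ` strip a b \<subseteq> ann a b" by (auto simp: strip_def ann_def)
  show "ann a b \<subseteq> exp ` strip a b"
  proof
    fix w assume w: "w \<in> ann a b"
    then have "w = exp (Ln w)" "Ln w \<in> strip a b" by (auto simp: ann_iff strip_def)
    then show "w \<in> exp ` strip a b" by blast
  qed
qed

lemma convex_strip: "convex (strip a b)"
proof -
  have "strip a b = {u. Re u > a} \<inter> {u. Re u < b}" by (auto simp: strip_def)
  then show ?thesis by (simp add: convex_Int convex_halfspace_Re_lt convex_halfspace_Re_gt)
qed

lemma ann_props: "open (ann a b)" "connected (ann a b)" "bounded (ann a b)"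
proof -
  show "open (ann a b)" unfolding ann_def by (intro open_Collect_conj open_Collect_less continuous_intros)
  show "connected (ann a b)" unfolding exp_strip[symmetric]
    by (intro connected_continuous_image continuous_intros convex_connected convex_strip)
  show "bounded (ann a b)" by (rule bounded_subset[of "ball 0 (exp b)"]) (auto simp: ann_def)
qed

lemma strip_lift:
  fixes \<phi> \<phi>i :: "complex \<Rightarrow> complex"
  assumes hom: "homeomorphism UNIV UNIV \<phi> \<phi>i" and tf: "ann a b \<inter> tips \<phi> = {}"
    and u0: "u0 \<in> strip a b" "\<phi> (expid z0) = exp u0"
  obtains L where "continuous_on (strip a b) L" "L u0 = z0" "\<And>u. u \<in> strip a b \<Longrightarrow> \<phi> (expid (L u)) = exp u"
proof (rule lift_tipfree[OF hom ann_props tf convex_strip u0(1), of exp z0])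
  show "continuous_on (strip a b) exp" by (intro continuous_intros)
  show "exp ` strip a b \<subseteq> ann a b" using exp_strip by simp
qed (use that u0 in auto)

lemma gap_ann: "gap \<phi> \<Longrightarrow> 1 \<le> a \<Longrightarrow> b \<le> 12/5 \<Longrightarrow> ann a b \<inter> tips \<phi> = {}"
  unfolding gap_def by (auto simp: ann_iff)

lemma open_cell: "open (cell \<kappa>)"
proof -
  have "cell \<kappa> = ann 2 3 \<inter> {w. \<kappa> * cmod w < Re w}" by (auto simp: cell_def ann_iff)
  moreover have "open {w. \<kappa> * cmod w < Re w}" by (intro open_Collect_less continuous_intros)
  ultimately show ?thesis using ann_props(1)[of 2 3] by auto
qed

lemma exp_in_cell: "exp u \<in> cell \<kappa> \<longleftrightarrow> 2 < Re u \<and> Re u < 3 \<and> \<kappa> < cos (Im u)"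
proof -
  have "\<kappa> * exp (Re u) < exp (Re u) * cos (Im u) \<longleftrightarrow> \<kappa> < cos (Im u)"
    by (subst mult.commute) simp
  then show ?thesis by (auto simp: cell_def Re_exp)
qed

lemma lift_unique_interval:
  fixes \<phi> \<phi>i :: "complex \<Rightarrow> complex" and l m :: "real \<Rightarrow> complex"
  assumes hom: "homeomorphism UNIV UNIV \<phi> \<phi>i" and g: "gap \<phi>"
    and "continuous_on {s..t} l" "\<And>x. x \<in> {s..t} \<Longrightarrow> \<phi> (expid (l x)) = exp (Complex (11/5) x)"
    and "continuous_on {s..t} m" "\<And>x. x \<in> {s..t} \<Longrightarrow> \<phi> (expid (m x)) = exp (Complex (11/5) x)"
    and "x0 \<in> {s..t}" "l x0 = m x0" "x \<in> {s..t}"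
  shows "l x = m x"
proof (rule lift_unique[OF hom, of "{s..t}" l m x0])
  show "\<phi> (expid (l x)) \<notin> tips \<phi>" if "x \<in> {s..t}" for x
  proof -
    have "exp (Complex (11/5) x) \<in> ann 1 (12/5)" by (simp add: ann_def)
    then show ?thesis using gap_ann[OF g, of 1 "12/5"] assms(4)[OF that] by auto
  qed
qed (use assms in auto)

lemma arclift_unique_right:
  assumes "homeomorphism UNIV UNIV \<phi> \<phi>i" "gap \<phi>" "s \<le> t" "arclift \<phi> s t a b" "arclift \<phi> s t a b'"
  shows "b = b'"
proof -
  from assms(4) obtain l where l: "continuous_on {s..t} l" "\<And>x. x \<in> {s..t} \<Longrightarrow> \<phi> (expid (l x)) = exp (Complex (11/5) x)"
    "l s = a" "l t = b" unfolding arclift_def by auto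
  from assms(5) obtain m where m: "continuous_on {s..t} m" "\<And>x. x \<in> {s..t} \<Longrightarrow> \<phi> (expid (m x)) = exp (Complex (11/5) x)"
    "m s = a" "m t = b'" unfolding arclift_def by auto
  have "l t = m t"
    by (rule lift_unique_interval[OF assms(1,2) l(1,2) m(1,2), of s]) (use l m assms(3) in auto)
  then show ?thesis using l m by simp
qed

lemma arclift_unique_left:
  assumes "homeomorphism UNIV UNIV \<phi> \<phi>i" "gap \<phi>" "s \<le> t" "arclift \<phi> s t a b" "arclift \<phi> s t a' b"
  shows "a = a'"
proof -
  from assms(4) obtain l where l: "continuous_on {s..t} l" "\<And>x. x \<in> {s..t} \<Longrightarrow> \<phi> (expid (l x)) = exp (Complex (11/5) x)"
    "l s = a" "l t = b" unfolding arclift_def by auto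
  from assms(5) obtain m where m: "continuous_on {s..t} m" "\<And>x. x \<in> {s..t} \<Longrightarrow> \<phi> (expid (m x)) = exp (Complex (11/5) x)"
    "m s = a'" "m t = b" unfolding arclift_def by auto
  have "l s = m s"
    by (rule lift_unique_interval[OF assms(1,2) l(1,2) m(1,2), of t]) (use l m assms(3) in auto)
  then show ?thesis using l m by simp
qed

lemma strip_lift_arclift:
  assumes "continuous_on (strip a b) L" "\<And>u. u \<in> strip a b \<Longrightarrow> \<phi> (expid (L u)) = exp u" "a < 11/5" "11/5 < b"
  shows "arclift \<phi> s t (L (Complex (11/5) (s + 2 * pi * of_int n))) (L (Complex (11/5) (t + 2 * pi * of_int n)))"
proof -
  have i: "Complex (11/5) x \<in> strip a b" for x using assms(3,4) by (simp add: strip_def)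
  show ?thesis unfolding arclift_def
  proof (intro exI[of _ "\<lambda>x. L (Complex (11/5) (x + 2 * pi * of_int n))"] conjI ballI refl)
    show "continuous_on {s..t} (\<lambda>x. L (Complex (11/5) (x + 2 * pi * of_int n)))"
    proof (rule continuous_on_compose2[OF assms(1)])
      show "(\<lambda>x. Complex (11/5) (x + 2 * pi * of_int n)) ` {s..t} \<subseteq> strip a b" using i by blast
    qed (intro continuous_intros)
    fix x
    have "exp (Complex (11/5) (x + 2 * pi * of_int n)) = exp (Complex (11/5) x)"
      by (rule complex_eqI) (simp_all add: Re_exp Im_exp sin_cos_eq_iff sin_add cos_add cos_int_2pin sin_int_2pin)
    then show "\<phi> (expid (L (Complex (11/5) (x + 2 * pi * of_int n)))) = exp (Complex (11/5) x)"
      using assms(2)[OF i] by simp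
  qed
qed

lemma arclift_exists:
  fixes \<phi> \<phi>i :: "complex \<Rightarrow> complex"
  assumes hom: "homeomorphism UNIV UNIV \<phi> \<phi>i" "gap \<phi>" and a: "\<phi> (expid a) = exp (Complex (11/5) s)"
  obtains b where "arclift \<phi> s t a b"
proof -
  obtain L where L: "continuous_on (strip 1 (12/5)) L" "L (Complex (11/5) s) = a"
     "\<And>u. u \<in> strip 1 (12/5) \<Longrightarrow> \<phi> (expid (L u)) = exp u"
    using strip_lift[OF hom(1) gap_ann[OF hom(2)], of 1 "12/5" "Complex (11/5) s" a] a
    by (auto simp: strip_def)
  show ?thesis
    using that[of "L (Complex (11/5) t)"] strip_lift_arclift[OF L(1,3), where n = 0 and s = s and t = t] L(2) by auto
qed

lemma arclift_same:
  assumes "arclift \<phi> (-\<theta>) \<theta> a b" "0 \<le> \<theta>" "\<theta> \<le> pi" "\<kappa> < cos \<theta>"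
  shows "same \<phi> \<kappa> a b"
proof -
  obtain l where l: "continuous_on {-\<theta>..\<theta>} l" "\<And>x. x \<in> {-\<theta>..\<theta>} \<Longrightarrow> \<phi> (expid (l x)) = exp (Complex (11/5) x)" "l (-\<theta>) = a" "l \<theta> = b"
    using assms(1) unfolding arclift_def by auto
  have "cos \<theta> \<le> cos x" if "x \<in> {-\<theta>..\<theta>}" for x
  proof -
    have "cos \<theta> \<le> cos \<bar>x\<bar>" using that assms(3) by (intro cos_monotone_0_pi_le) auto
    then show ?thesis by simp
  qed
  then have "l ` {-\<theta>..\<theta>} \<subseteq> {z. \<phi> (expid z) \<in> cell \<kappa>}"
    using l(2) assms(4) by (auto simp: exp_in_cell) (meson atLeastAtMost_iff less_le_trans)
  moreover have "connected (l ` {-\<theta>..\<theta>})" using l(1) by (intro connected_continuous_image) auto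
  moreover have "a \<in> l ` {-\<theta>..\<theta>}" "b \<in> l ` {-\<theta>..\<theta>}" using l assms(2) by auto
  ultimately show ?thesis unfolding same_def using component_mono_eq by blast
qed

lemma same_sym: "same \<phi> \<kappa> x y \<Longrightarrow> same \<phi> \<kappa> y x"
  unfolding same_def by (rule connected_component_sym)

lemma same_trans: "same \<phi> \<kappa> x y \<Longrightarrow> same \<phi> \<kappa> y z \<Longrightarrow> same \<phi> \<kappa> x z"
  unfolding same_def by (rule connected_component_trans)

lemma sym_link: "(x, y) \<in> link \<phi> \<kappa> L \<Longrightarrow> (y, x) \<in> link \<phi> \<kappa> L"
proof -
  have "sym ({(x, y). same \<phi> \<kappa> x y} \<union> L \<union> L\<inverse>)" by (auto simp: sym_def same_sym)
  then have "sym (link \<phi> \<kappa> L)" unfolding link_def by (rule sym_rtrancl)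
  then show "(x, y) \<in> link \<phi> \<kappa> L \<Longrightarrow> (y, x) \<in> link \<phi> \<kappa> L" by (rule symD)
qed

lemma link_trans: "(x, y) \<in> link \<phi> \<kappa> L \<Longrightarrow> (y, z) \<in> link \<phi> \<kappa> L \<Longrightarrow> (x, z) \<in> link \<phi> \<kappa> L"
  unfolding link_def by (rule rtrancl_trans)

lemma link_refl: "(x, x) \<in> link \<phi> \<kappa> L" by (simp add: link_def)

lemma link_same: "same \<phi> \<kappa> x y \<Longrightarrow> (x, y) \<in> link \<phi> \<kappa> L" unfolding link_def by auto

lemma link_edge: "(x, y) \<in> L \<Longrightarrow> (x, y) \<in> link \<phi> \<kappa> L" unfolding link_def by auto

lemma link_closed:
  assumes "(p, q) \<in> link \<phi> \<kappa> L"
    and "\<And>x y. same \<phi> \<kappa> x y \<Longrightarrow> (x, y) \<in> link \<phi>' \<kappa> L'" "\<And>x y. (x, y) \<in> L \<Longrightarrow> (x, y) \<in> link \<phi>' \<kappa> L'"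
  shows "(p, q) \<in> link \<phi>' \<kappa> L'"
  using assms(1) unfolding link_def[of \<phi>]
proof (induction rule: rtrancl_induct)
  case base
  show ?case by (rule link_refl)
next
  case (step y z)
  then have "(y, z) \<in> link \<phi>' \<kappa> L'" using assms(2,3) sym_link by auto
  with step.IH show ?case by (rule link_trans)
qed

lemma link_mono: "L \<subseteq> L' \<Longrightarrow> (p, q) \<in> link \<phi> \<kappa> L \<Longrightarrow> (p, q) \<in> link \<phi> \<kappa> L'"
  by (erule link_closed) (auto intro: link_same link_edge)

text \<open>
  Passing to the next edge is injective by uniqueness of lifts, so on a finite set it is a
  permutation. The cycle through \<open>e\<close> then links the ends of \<open>e\<close>
  through the remaining edges.
\<close>

lemma redundant_edge:
  fixes L :: "(complex \<times> complex) set"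
  assumes hom: "homeomorphism UNIV UNIV \<phi> \<phi>i" "gap \<phi>" and th: "0 < \<theta>" "\<theta> < pi" "\<kappa> < cos \<theta>"
    and L: "finite L" "\<And>a b. (a, b) \<in> L \<Longrightarrow> edge \<phi> \<theta> a b"
    and closed: "\<And>a b a'. (a, b) \<in> L \<Longrightarrow> arclift \<phi> (-\<theta>) \<theta> b a' \<Longrightarrow> \<exists>b'. (a', b') \<in> L"
    and e: "e \<in> L"
  shows "e \<in> link \<phi> \<kappa> (L - {e})"
proof -
  have "\<forall>f\<in>L. \<exists>g\<in>L. arclift \<phi> (-\<theta>) \<theta> (snd f) (fst g)"
  proof
    fix f assume f: "f \<in> L"
    then have "edge \<phi> \<theta> (fst f) (snd f)" using L(2) by simp
    then obtain l where "\<forall>x\<in>{\<theta>..2 * pi - \<theta>}. \<phi> (expid (l x)) = exp (Complex (11/5) x)" "l (2 * pi - \<theta>) = snd f"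
      unfolding arclift_def by auto
    moreover have "2 * pi - \<theta> \<in> {\<theta>..2 * pi - \<theta>}" using th by auto
    ultimately have "\<phi> (expid (snd f)) = exp (Complex (11/5) (2 * pi - \<theta>))" by metis
    also have "\<dots> = exp (Complex (11/5) (-\<theta>))" by (rule complex_eqI) (simp_all add: Re_exp Im_exp)
    finally obtain a' where a': "arclift \<phi> (-\<theta>) \<theta> (snd f) a'" using arclift_exists[OF hom] by blast
    then obtain b' where "(a', b') \<in> L" using closed[of "fst f" "snd f"] f by auto
    then show "\<exists>g\<in>L. arclift \<phi> (-\<theta>) \<theta> (snd f) (fst g)" using a' by force
  qed
  then obtain N where N: "\<And>f. f \<in> L \<Longrightarrow> N f \<in> L" "\<And>f. f \<in> L \<Longrightarrow> arclift \<phi> (-\<theta>) \<theta> (snd f) (fst (N f))" by metis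
  have inj: "f = g" if "f \<in> L" "g \<in> L" "N f = N g" for f g
  proof -
    have "snd f = snd g"
      by (rule arclift_unique_left[OF hom _ N(2)[OF that(1)]]) (use N(2)[OF that(2)] that th in auto)
    moreover have "edge \<phi> \<theta> (fst f) (snd f)" "edge \<phi> \<theta> (fst g) (snd g)"
      using that L(2)[of "fst f" "snd f"] L(2)[of "fst g" "snd g"] by simp_all
    then have "fst f = fst g"
      using arclift_unique_left[OF hom, of \<theta> "2 * pi - \<theta>" "fst f" "snd f" "fst g"] th calculation by simp
    ultimately show ?thesis by (simp add: prod_eq_iff)
  qed
  have it: "(N ^^ i) e \<in> L" for i by (induction i) (auto simp: e N(1))
  have "\<not> inj_on (\<lambda>i. (N ^^ i) e) UNIV"
  proof
    assume "inj_on (\<lambda>i. (N ^^ i) e) UNIV"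
    then have "infinite (range (\<lambda>i. (N ^^ i) e))" by (simp add: finite_image_iff)
    moreover have "range (\<lambda>i. (N ^^ i) e) \<subseteq> L" using it by auto
    ultimately show False using finite_subset[OF _ L(1)] by simp
  qed
  then obtain i j where ij: "i < j" "(N ^^ i) e = (N ^^ j) e" unfolding inj_on_def by (metis UNIV_I nat_neq_iff)
  have cyc: "(N ^^ i) e = (N ^^ (i + k)) e \<Longrightarrow> e = (N ^^ k) e" for i k
  proof (induction i)
    case (Suc i)
    then have "N ((N ^^ i) e) = N ((N ^^ (i + k)) e)" by simp
    then have "(N ^^ i) e = (N ^^ (i + k)) e" by (rule inj[OF it it])
    then show ?case by (rule Suc.IH)
  qed auto
  define k where "k = (LEAST k. 0 < k \<and> (N ^^ k) e = e)"
  have "0 < j - i \<and> (N ^^ (j - i)) e = e" using cyc[of i "j - i"] ij by simp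
  then have k: "0 < k" "(N ^^ k) e = e" unfolding k_def by (metis (mono_tags, lifting) LeastI)+
  have k3: "(N ^^ i) e \<noteq> e" if "0 < i" "i < k" for i using not_less_Least[OF that(2)[unfolded k_def]] that(1) by simp
  have ch: "0 < i \<Longrightarrow> i \<le> k \<Longrightarrow> (snd e, fst ((N ^^ i) e)) \<in> link \<phi> \<kappa> (L - {e})" for i
  proof (induction i)
    case (Suc i)
    have sm: "same \<phi> \<kappa> (snd ((N ^^ i) e)) (fst ((N ^^ Suc i) e))"
      using arclift_same[OF N(2)[OF it[of i]]] th by simp
    show ?case
    proof (cases "i = 0")
      case True
      then show ?thesis using sm by (simp add: link_same)
    next
      case False
      then have "(snd e, fst ((N ^^ i) e)) \<in> link \<phi> \<kappa> (L - {e})" using Suc by simp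
      moreover have "(N ^^ i) e \<in> L - {e}" using False k3[of i] Suc.prems it by auto
      then have "(fst ((N ^^ i) e), snd ((N ^^ i) e)) \<in> link \<phi> \<kappa> (L - {e})" by (intro link_edge) simp
      ultimately have "(snd e, snd ((N ^^ i) e)) \<in> link \<phi> \<kappa> (L - {e})" by (rule link_trans)
      then show ?thesis by (rule link_trans[OF _ link_same[OF sm]])
    qed
  qed auto
  from ch[OF k(1)] k(2) have "(snd e, fst e) \<in> link \<phi> \<kappa> (L - {e})" by simp
  then have "(fst e, snd e) \<in> link \<phi> \<kappa> (L - {e})" by (rule sym_link)
  then show ?thesis by simp
qed

lemma locally_constant_connected:
  fixes S :: "'a::topological_space set"
  assumes "connected S" "\<And>a. a \<in> S \<Longrightarrow> \<exists>T. open T \<and> a \<in> T \<and> (\<forall>x\<in>T \<inter> S. P x = P a)" "p \<in> S" "q \<in> S" "P p"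
  shows "P q"
proof (rule ccontr)
  assume "\<not> P q"
  obtain T where T: "\<And>a. a \<in> S \<Longrightarrow> open (T a) \<and> a \<in> T a \<and> (\<forall>x\<in>T a \<inter> S. P x = P a)" using assms(2) by metis
  let ?A = "\<Union>a\<in>{a\<in>S. P a}. T a" and ?B = "\<Union>a\<in>{a\<in>S. \<not> P a}. T a"
  have "open ?A" "open ?B" using T by auto
  moreover have "S \<subseteq> ?A \<union> ?B" using T by blast
  moreover have "?A \<inter> ?B \<inter> S = {}" using T by blast
  moreover have "?A \<inter> S \<noteq> {}" "?B \<inter> S \<noteq> {}" using T assms(3-5) \<open>\<not> P q\<close> by blast+
  ultimately show False using assms(1) unfolding connected_def by blast
qed

text \<open>
  The collar of the component is swept out by one lift of the exponential, so the two points
  differ by finitely many turns around the circle, and each turn is one edge followed by an arc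
  inside the cell.
\<close>

lemma chain_in_component:
  fixes \<phi> \<phi>i :: "complex \<Rightarrow> complex"
  assumes hom: "homeomorphism UNIV UNIV \<phi> \<phi>i" "gap \<phi>" and th: "0 < \<theta>" "\<theta> < pi" "0 < \<kappa>" "\<kappa> < cos \<theta>"
    and z: "\<phi> (expid z) \<in> cell \<kappa>" "\<phi> (expid z') \<in> cell \<kappa>"
       "connected_component {y. cmod (\<phi> (expid y)) < exp (47/20)} z z'"
  obtains L where "finite L" "\<And>a b. (a, b) \<in> L \<Longrightarrow> edge \<phi> \<theta> a b" "(z, z') \<in> link \<phi> \<kappa> L"
proof -
  let ?F = "\<lambda>z. \<phi> (expid z)"
  let ?D = "component {y. cmod (?F y) < exp (47/20)} z"
  define S where "S = {y \<in> ?D. exp 2 < cmod (?F y)}"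
  have "open S" "connected S" unfolding S_def
    by (rule connected_comp_collar[OF hom(1), of "exp 2" "exp (47/20)"]; simp)+
  then have pS: "path_connected S" by (simp add: connected_open_path_connected)
  have D: "cmod (?F y) < exp (47/20)" if "y \<in> ?D" for y using that connected_component_subset by blast
  have zD: "z \<in> ?D" "z' \<in> ?D" using z(3) connected_component_refl_eq connected_component_in by auto
  have bx: "exp 2 < cmod w" if "w \<in> cell \<kappa>" for w using that less_lev_iff[of w 2] by (auto simp: cell_def)
  have zS: "z \<in> S" "z' \<in> S" using zD bx z by (auto simp: S_def)
  have SA: "?F y \<in> ann 2 (47/20)" if "y \<in> S" for y using that D by (auto simp: S_def ann_def)
  have tf: "ann 2 (47/20) \<inter> tips \<phi> = {}" by (rule gap_ann[OF hom(2)]) auto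
  define P where "P = strip 2 (47/20)"
  define u where "u = Ln (?F z)"
  have eu: "exp u = ?F z" using z(1) by (simp add: u_def cell_def)
  have uP: "u \<in> P" using SA[OF zS(1)] by (simp add: P_def strip_def u_def ann_iff)
  obtain L where L: "continuous_on P L" "L u = z" "\<And>u. u \<in> P \<Longrightarrow> ?F (L u) = exp u"
    using strip_lift[OF hom(1) tf uP[unfolded P_def] eu[symmetric]] unfolding P_def by blast
  have "\<exists>u2\<in>P. L u2 = z'"
  proof (rule orbit_parametrised[OF hom(1), of P "{2<..<47/20}" "ann 2 (47/20)" "\<lambda>w. w" "\<lambda>w. w" L S u z'])
    show "homeomorphism (exp ` P) (ann 2 (47/20)) (\<lambda>w. w) (\<lambda>w. w)"
      unfolding P_def exp_strip by (rule homeomorphism_ident)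
    show "P = {u. Re u \<in> {2<..<47/20}}" by (auto simp: P_def strip_def)
  qed (use tf L pS SA uP zS in auto)
  then obtain u' where u': "u' \<in> P" "L u' = z'" by blast
  define \<delta> where "\<delta> = arccos \<kappa>"
  have k1: "\<kappa> < 1" using th(4) cos_le_one[of \<theta>] by linarith
  have d: "\<theta> < \<delta>" "\<delta> \<le> pi"
  proof -
    have "arccos (cos \<theta>) < arccos \<kappa>" using th k1 by (intro arccos_less_arccos) auto
    then show "\<theta> < \<delta>" using th by (simp add: arccos_cos \<delta>_def)
    show "\<delta> \<le> pi" unfolding \<delta>_def using th k1 by (intro arccos_ubound) auto
  qed
  have cosd: "\<kappa> < cos x \<longleftrightarrow> \<bar>x\<bar> < \<delta>" if "\<bar>x\<bar> \<le> pi" for x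
  proof -
    have "cos x = cos \<bar>x\<bar>" by simp
    moreover have "\<kappa> = cos \<delta>" unfolding \<delta>_def using th k1 by simp
    ultimately show ?thesis using cos_mono_less_eq[of \<delta> "\<bar>x\<bar>"] that d th by auto
  qed
  define B where "B n s = L (Complex (11/5) (s + 2 * pi * of_int n))" for n :: int and s
  have sameB: "\<exists>n. same \<phi> \<kappa> (L v) (B n \<theta>)" if v: "v \<in> P" "?F (L v) \<in> cell \<kappa>" for v
  proof -
    obtain n :: int where n: "\<bar>Im v - 2 * pi * of_int n\<bar> \<le> pi"
    proof
      have "\<bar>Im v / (2 * pi) - of_int (round (Im v / (2 * pi)))\<bar> \<le> 1/2"
        using of_int_round_abs_le by (metis abs_minus_commute)
      then have "\<bar>Im v / (2 * pi) - of_int (round (Im v / (2 * pi)))\<bar> * (2 * pi) \<le> 1/2 * (2 * pi)"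
        by (intro mult_right_mono) auto
      moreover have "Im v - 2 * pi * of_int (round (Im v / (2 * pi))) = (Im v / (2 * pi) - of_int (round (Im v / (2 * pi)))) * (2 * pi)"
        by (simp add: left_diff_distrib)
      ultimately show "\<bar>Im v - 2 * pi * of_int (round (Im v / (2 * pi)))\<bar> \<le> pi"
        by (simp only: abs_mult) simp
    qed
    have per: "cos (x - 2 * pi * of_int n) = cos x" for x
      by (simp add: cos_diff cos_int_2pin sin_int_2pin)
    have "\<kappa> < cos (Im v)" using v L(3) exp_in_cell by auto
    then have vd: "\<bar>Im v - 2 * pi * of_int n\<bar> < \<delta>" using cosd[OF n] per by simp
    define R where "R = P \<inter> {w. Im w < 2 * pi * of_int n + \<delta>} \<inter> {w. Im w > 2 * pi * of_int n - \<delta>}"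
    have "convex R" unfolding R_def P_def
      by (intro convex_Int convex_strip convex_halfspace_Im_lt convex_halfspace_Im_gt)
    have RP: "R \<subseteq> P" by (auto simp: R_def)
    have "v \<in> R" using v vd by (auto simp: R_def)
    have "Complex (11/5) (\<theta> + 2 * pi * of_int n) \<in> R" using d th by (auto simp: R_def P_def strip_def)
    moreover have "connected (L ` R)"
      using \<open>convex R\<close> L(1) RP by (intro connected_continuous_image) (auto intro: continuous_on_subset convex_connected)
    moreover have "L ` R \<subseteq> {z. ?F z \<in> cell \<kappa>}"
    proof clarify
      fix x assume x: "x \<in> R"
      then have "\<bar>Im x - 2 * pi * of_int n\<bar> < \<delta>" by (auto simp: R_def)
      then have "\<kappa> < cos (Im x)" using cosd[of "Im x - 2 * pi * of_int n"] d per by auto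
      then show "?F (L x) \<in> cell \<kappa>" using x L(3) by (auto simp: R_def P_def strip_def exp_in_cell)
    qed
    ultimately have "same \<phi> \<kappa> (L v) (B n \<theta>)"
      unfolding same_def B_def using \<open>v \<in> R\<close> by (intro component_mono_eq[simplified mem_Collect_eq]) auto
    then show ?thesis by blast
  qed
  obtain n where n: "same \<phi> \<kappa> z (B n \<theta>)" using sameB[OF uP] L(2) z(1) by auto
  obtain n' where n': "same \<phi> \<kappa> z' (B n' \<theta>)" using sameB[OF u'(1)] u'(2) z(2) by auto
  define E where "E = (\<lambda>j. (B j \<theta>, B j (2 * pi - \<theta>))) ` {min n n'..max n n'}"
  have arc: "arclift \<phi> s t (B j s) (B j t)" for s t j
    unfolding B_def by (rule strip_lift_arclift[OF L(1)[unfolded P_def] L(3)]) (auto simp: P_def)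
  have BB: "B j (2 * pi - \<theta>) = B (j + 1) (-\<theta>)" for j by (simp add: B_def algebra_simps)
  have link1: "(B j \<theta>, B (j + 1) \<theta>) \<in> link \<phi> \<kappa> E" if "min n n' \<le> j" "j \<le> max n n'" for j
  proof -
    have "(B j \<theta>, B j (2 * pi - \<theta>)) \<in> link \<phi> \<kappa> E" using that by (intro link_edge) (auto simp: E_def)
    moreover have "same \<phi> \<kappa> (B (j + 1) (-\<theta>)) (B (j + 1) \<theta>)"
      using arclift_same[OF arc[of "-\<theta>" \<theta> "j + 1"]] th by simp
    then have "(B (j + 1) (-\<theta>), B (j + 1) \<theta>) \<in> link \<phi> \<kappa> E" by (rule link_same)
    ultimately show ?thesis unfolding BB by (rule link_trans)
  qed
  have up: "j \<le> max n n' \<longrightarrow> (B (min n n') \<theta>, B j \<theta>) \<in> link \<phi> \<kappa> E" if "min n n' \<le> j" for j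
    using that
  proof (induction j rule: int_ge_induct)
    case base
    show ?case by (simp add: link_refl)
  next
    case (step i)
    show ?case
    proof
      assume "i + 1 \<le> max n n'"
      then have "i \<le> max n n'" by simp
      then show "(B (min n n') \<theta>, B (i + 1) \<theta>) \<in> link \<phi> \<kappa> E"
        using step by (intro link_trans[OF _ link1[of i]]) auto
    qed
  qed
  have "(B (min n n') \<theta>, B n \<theta>) \<in> link \<phi> \<kappa> E" "(B (min n n') \<theta>, B n' \<theta>) \<in> link \<phi> \<kappa> E" using up by auto
  then have "(B n \<theta>, B n' \<theta>) \<in> link \<phi> \<kappa> E" by (rule link_trans[OF sym_link])
  then have "(z, z') \<in> link \<phi> \<kappa> E"
    by (rule link_trans[OF link_same[OF n] link_trans[OF _ link_same[OF same_sym[OF n']]]])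
  moreover have "finite E" by (simp add: E_def)
  moreover have "edge \<phi> \<theta> a b" if "(a, b) \<in> E" for a b using that arc by (auto simp: E_def)
  ultimately show ?thesis using that by blast
qed

text \<open>
  Being linked to \<open>p\<close> by finitely many edges is a locally constant property on the
  preimage of the union of disc and cell, since it is constant on components over the disc and
  over the cell; no counting of the passages between the two is needed.
\<close>

lemma initial_chain:
  fixes \<phi> \<phi>i :: "complex \<Rightarrow> complex"
  assumes hom: "homeomorphism UNIV UNIV \<phi> \<phi>i" "gap \<phi>" and th: "0 < \<theta>" "\<theta> < pi" "0 < \<kappa>" "\<kappa> < cos \<theta>"
    and pq: "\<phi> (expid p) \<in> cell \<kappa>" "\<phi> (expid q) \<in> cell \<kappa>"
       "connected_component {y. \<phi> (expid y) \<in> ball 0 (exp (47/20)) \<union> cell \<kappa>} p q"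
  obtains L where "finite L" "\<And>a b. (a, b) \<in> L \<Longrightarrow> edge \<phi> \<theta> a b" "(p, q) \<in> link \<phi> \<kappa> L"
proof -
  let ?F = "\<lambda>z. \<phi> (expid z)"
  define eqv where "eqv x y \<longleftrightarrow> (\<exists>L. finite L \<and> (\<forall>(a, b)\<in>L. edge \<phi> \<theta> a b) \<and> (x, y) \<in> link \<phi> \<kappa> L)" for x y
  have eqv_trans: "eqv x z" if "eqv x y" "eqv y z" for x y z
  proof -
    obtain L1 L2 where L: "finite L1" "\<forall>(a, b)\<in>L1. edge \<phi> \<theta> a b" "(x, y) \<in> link \<phi> \<kappa> L1"
      "finite L2" "\<forall>(a, b)\<in>L2. edge \<phi> \<theta> a b" "(y, z) \<in> link \<phi> \<kappa> L2" using \<open>eqv x y\<close> \<open>eqv y z\<close> unfolding eqv_def by auto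
    have "(x, y) \<in> link \<phi> \<kappa> (L1 \<union> L2)" "(y, z) \<in> link \<phi> \<kappa> (L1 \<union> L2)"
      using link_mono[OF _ L(3), of "L1 \<union> L2"] link_mono[OF _ L(6), of "L1 \<union> L2"] by auto
    then have "(x, z) \<in> link \<phi> \<kappa> (L1 \<union> L2)" by (rule link_trans)
    moreover have "\<forall>(a, b)\<in>L1 \<union> L2. edge \<phi> \<theta> a b" using L(2,5) by auto
    ultimately show ?thesis unfolding eqv_def using L(1,4) by (intro exI[of _ "L1 \<union> L2"]) auto
  qed
  have eqv_same: "eqv x y" if "same \<phi> \<kappa> x y" for x y
    unfolding eqv_def using link_same[OF that] by (intro exI[of _ "{}"]) auto
  define ball' where "ball' = {y. cmod (?F y) < exp (47/20)}"
  have eqv_ball: "eqv x y" if "?F x \<in> cell \<kappa>" "?F y \<in> cell \<kappa>" "connected_component ball' x y" for x y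
    using chain_in_component[OF hom th that(1,2) that(3)[unfolded ball'_def]] unfolding eqv_def by (metis case_prodI2)
  define T where "T = {y. ?F y \<in> ball 0 (exp (47/20)) \<union> cell \<kappa>}"
  define Pr where "Pr y \<longleftrightarrow> (\<exists>z. ?F z \<in> cell \<kappa> \<and> eqv p z \<and> (same \<phi> \<kappa> z y \<or> connected_component ball' z y))" for y
  have incell: "?F y \<in> cell \<kappa>" if "same \<phi> \<kappa> x y" for x y
    using connected_component_in[OF that[unfolded same_def]] by simp
  have Pcell: "Pr y \<Longrightarrow> same \<phi> \<kappa> y y' \<Longrightarrow> Pr y'" for y y'
  proof -
    assume "Pr y" and s: "same \<phi> \<kappa> y y'"
    have y: "?F y \<in> cell \<kappa>" using incell[OF same_sym[OF s]] .
    obtain z where z: "?F z \<in> cell \<kappa>" "eqv p z" "same \<phi> \<kappa> z y \<or> connected_component ball' z y" using \<open>Pr y\<close> unfolding Pr_def by blast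
    then have "eqv z y" using eqv_same[of z y] eqv_ball[OF z(1) y] by blast
    then have "eqv p y" by (rule eqv_trans[OF z(2)])
    then show "Pr y'" unfolding Pr_def using y s by blast
  qed
  have Pball: "Pr y \<Longrightarrow> connected_component ball' y y' \<Longrightarrow> Pr y'" for y y'
  proof -
    assume "Pr y" and s: "connected_component ball' y y'"
    obtain z where z: "?F z \<in> cell \<kappa>" "eqv p z" "same \<phi> \<kappa> z y \<or> connected_component ball' z y" using \<open>Pr y\<close> unfolding Pr_def by blast
    show "Pr y'"
    proof (cases "same \<phi> \<kappa> z y")
      case True
      then have "eqv p y" "?F y \<in> cell \<kappa>" using eqv_trans[OF z(2) eqv_same] incell by blast+
      then show ?thesis unfolding Pr_def using s by blast
    next
      case False
      then have "connected_component ball' z y'" using z(3) s connected_component_trans by blast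
      then show ?thesis unfolding Pr_def using z by blast
    qed
  qed
  have ocell: "open (cell \<kappa>)" by (rule open_cell)
  have ob: "open ball'" unfolding ball'_def using open_vimage_homeo[OF hom(1), of "ball 0 (exp (47/20))"] by simp
  have oF: "open {z. ?F z \<in> cell \<kappa>}" by (rule open_vimage_homeo[OF hom(1) ocell])
  have "Pr q"
  proof (rule locally_constant_connected[of "component T p" Pr p q])
    show "connected (component T p)" by simp
    show "p \<in> component T p" using pq(1) by (simp add: T_def)
    show "q \<in> component T p" using pq(3) by (simp add: T_def)
    have "same \<phi> \<kappa> p p" using pq(1) by (simp add: same_def)
    then show "Pr p" unfolding Pr_def using pq(1) eqv_same by blast
    fix a assume "a \<in> component T p"
    then have "a \<in> T" using connected_component_subset by blast
    then consider "a \<in> ball'" | "?F a \<in> cell \<kappa>" by (auto simp: T_def ball'_def)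
    then show "\<exists>U. open U \<and> a \<in> U \<and> (\<forall>x\<in>U \<inter> component T p. Pr x = Pr a)"
    proof cases
      case 1
      have "Pr x = Pr a" if "x \<in> component ball' a" for x
        using that Pball connected_component_sym by (metis mem_Collect_eq)
      moreover have "open (component ball' a)" "a \<in> component ball' a" using ob 1 open_connected_component by auto
      ultimately show ?thesis by blast
    next
      case 2
      have "Pr x = Pr a" if "x \<in> component {z. ?F z \<in> cell \<kappa>} a" for x
        using that Pcell same_sym unfolding same_def by (metis mem_Collect_eq)
      moreover have "open (component {z. ?F z \<in> cell \<kappa>} a)" "a \<in> component {z. ?F z \<in> cell \<kappa>} a"
        using oF 2 open_connected_component by auto
      ultimately show ?thesis by blast
    qed
  qed
  then obtain z where z: "?F z \<in> cell \<kappa>" "eqv p z" "same \<phi> \<kappa> z q \<or> connected_component ball' z q" unfolding Pr_def by blast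
  then have "eqv z q" using eqv_same[of z q] eqv_ball[OF z(1) pq(2)] by blast
  then have "eqv p q" by (rule eqv_trans[OF z(2)])
  then show ?thesis using that unfolding eqv_def by auto
qed

section \<open>Bringing a distant critical value near a given sheet\<close>

text \<open>
  If \<open>c\<close> is the only point of its component over \<open>w\<close>, then convergence
  of the images to \<open>w\<close> within the component forces convergence to \<open>c\<close>,
  by compactness.
\<close>

lemma tendsto_in_component:
  fixes \<phi> \<phi>i :: "complex \<Rightarrow> complex"
  assumes hom: "homeomorphism UNIV UNIV \<phi> \<phi>i" and V: "open V" "bounded V" "w \<in> V"
    and only: "\<And>z. z \<in> component {z. \<phi> (expid z) \<in> V} c \<Longrightarrow> \<phi> (expid z) = w \<Longrightarrow> z = c"
    and ev: "\<forall>\<^sub>F x in G. g x \<in> component {z. \<phi> (expid z) \<in> V} c" and lim: "((\<lambda>x. \<phi> (expid (g x))) \<longlongrightarrow> w) G"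
  shows "(g \<longlongrightarrow> c) G"
proof (rule topological_tendstoI)
  fix N assume N: "open N" "c \<in> N"
  let ?F = "\<lambda>z. \<phi> (expid z)" let ?Vt = "component {z. ?F z \<in> V} c"
  have VtV: "?F z \<in> V" if "z \<in> ?Vt" for z using that connected_component_subset by blast
  have "bounded ?Vt" by (rule bounded_if_homeo_bounded[OF hom _ V(2)]) (use VtV in auto)
  then have "compact (closure ?Vt - N)" using N by (intro compact_diff) (simp add: compact_closure)
  then have "closed (?F ` (closure ?Vt - N))"
    by (intro compact_imp_closed compact_continuous_image continuous_on_homeo_expid[OF hom])
  moreover have "w \<notin> ?F ` (closure ?Vt - N)"
  proof
    assume "w \<in> ?F ` (closure ?Vt - N)"
    then obtain z where z: "z \<in> closure ?Vt" "z \<notin> N" "?F z = w" by auto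
    then have "z \<in> ?Vt" using closure_component_in_open[OF open_vimage_homeo[OF hom V(1)], of z c] V(3) by auto
    then show False using only z N by auto
  qed
  ultimately have "\<forall>\<^sub>F x in G. ?F (g x) \<in> - ?F ` (closure ?Vt - N)"
    using topological_tendstoD[OF lim, of "- ?F ` (closure ?Vt - N)"] by (simp add: open_Compl)
  then show "\<forall>\<^sub>F x in G. g x \<in> N"
    using ev
  proof eventually_elim
    case (elim x)
    then show ?case using closure_subset[of ?Vt] by blast
  qed
qed

lemma thin_sector_avoids:
  fixes B :: "complex set"
  assumes "finite B" "\<And>x. exp (Complex x y) \<notin> B"
  shows "\<exists>e>0. \<forall>u. \<bar>Im u - y\<bar> < e \<longrightarrow> exp u \<notin> B"
proof -
  have "\<exists>e>0. \<forall>t\<in>B. \<forall>u. \<bar>Im u - y\<bar> < e \<longrightarrow> exp u \<noteq> t"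
  proof (rule finite_uniform_radius[OF assms(1)])
    fix t assume t: "t \<in> B"
    show "\<exists>e>0. \<forall>u. \<bar>Im u - y\<bar> < e \<longrightarrow> exp u \<noteq> t"
    proof (cases "t = 0")
      case False
      have "cis y \<noteq> sgn t"
      proof
        assume "cis y = sgn t"
        then have "exp (Complex (lev t) y) = t" using False
          by (simp add: exp_eq_polar sgn_div_norm scaleR_conv_of_real)
        then show False using assms(2)[of "lev t"] t by auto
      qed
      moreover have "open {x. cis x \<noteq> sgn t}" by (intro open_Collect_neq continuous_intros)
      ultimately obtain e where e: "e > 0" "ball y e \<subseteq> {x. cis x \<noteq> sgn t}"
        by (metis (mono_tags, lifting) mem_Collect_eq open_contains_ball)
      have "exp u \<noteq> t" if "\<bar>Im u - y\<bar> < e" for u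
      proof
        assume "exp u = t"
        then have "sgn t = cis (Im u)"
          by (auto simp: exp_eq_polar sgn_div_norm norm_mult scaleR_conv_of_real)
        then show False using e(2) that by (auto simp: dist_real_def subset_iff abs_minus_commute)
      qed
      then show ?thesis using e(1) by blast
    qed (auto intro: exI[of _ 1])
  qed auto
  then show ?thesis by blast
qed

text \<open>
  A thin disc around the radial segment of direction \<open>y\<close>, parametrised by the unit
  disc. Level 31/10, where a distant tip will be brought, corresponds to the centre; level 11/5
  to \<open>Re \<zeta> = -9/19\<close>; and level 3/2, where the tip will be pulled, to
  \<open>Re \<zeta> = -16/19\<close>.
\<close>

definition lens :: "real \<Rightarrow> real \<Rightarrow> complex \<Rightarrow> complex" where
  "lens y e \<zeta> = exp (Complex (31/10 + 19/10 * Re \<zeta>) (y + e * Im \<zeta>))"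

lemma lens_homeo:
  assumes "0 < e" "e \<le> 1"
  obtains h' where "homeomorphism (ball 0 1) (lens y e ` ball 0 1) (lens y e) h'"
    "\<And>U. open U \<Longrightarrow> U \<subseteq> ball 0 1 \<Longrightarrow> open (lens y e ` U)" "bounded (lens y e ` ball 0 1)"
    "inj_on (lens y e) (ball 0 1)" "continuous_on UNIV (lens y e)"
proof -
  have c: "continuous_on S (lens y e)" for S unfolding lens_def by (intro continuous_intros)
  have inj: "inj_on (lens y e) (ball 0 1)"
  proof (rule inj_onI)
    fix a b assume ab: "a \<in> ball (0::complex) 1" "b \<in> ball 0 1" "lens y e a = lens y e b"
    have "\<bar>Im a\<bar> < 1" "\<bar>Im b\<bar> < 1" using ab abs_Im_le_cmod[of a] abs_Im_le_cmod[of b] by auto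
    have d: "\<bar>e * Im a - e * Im b\<bar> < 2 * pi"
    proof -
      have "\<bar>e * (Im a - Im b)\<bar> \<le> 1 * 2" unfolding abs_mult
        using assms \<open>\<bar>Im a\<bar> < 1\<close> \<open>\<bar>Im b\<bar> < 1\<close> by (intro mult_mono) auto
      then show ?thesis using pi_gt3 by (simp add: right_diff_distrib)
    qed
    have "Complex (31/10 + 19/10 * Re a) (y + e * Im a) = Complex (31/10 + 19/10 * Re b) (y + e * Im b)"
    proof (rule exp_complex_eqI)
      show "exp (Complex (31/10 + 19/10 * Re a) (y + e * Im a)) = exp (Complex (31/10 + 19/10 * Re b) (y + e * Im b))"
        using ab(3) unfolding lens_def .
    qed (use d in simp)
    then show "a = b" using assms by (simp add: complex_eq_iff)
  qed
  obtain h' where h': "homeomorphism (ball 0 1) (lens y e ` ball 0 1) (lens y e) h'"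
    using invariance_of_domain_homeomorphism[OF open_ball c _ inj] by auto
  have "open (lens y e ` U)" if "open U" "U \<subseteq> ball 0 1" for U
    using that by (intro invariance_of_domain c) (auto intro: inj_on_subset[OF inj])
  moreover have "bounded (lens y e ` ball 0 1)"
    by (rule bounded_subset[of "lens y e ` cball 0 1"])
       (auto intro!: compact_imp_bounded compact_continuous_image c)
  ultimately show ?thesis using that h' inj c by blast
qed

lemma lev_lens: "lev (lens y e \<zeta>) = 31/10 + 19/10 * Re \<zeta>"
  by (simp add: lens_def)

lemma lens_real: "lens y e (of_real x) = exp (Complex (31/10 + 19/10 * x) y)"
  by (simp add: lens_def)

lemma open_exp_image: "open U \<Longrightarrow> open (exp ` U :: complex set)"
proof (rule open_mapping_thm[of exp UNIV])
  show "\<not> exp constant_on (UNIV :: complex set)"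
  proof
    assume "exp constant_on (UNIV :: complex set)"
    then have "exp (0::complex) = exp 1" unfolding constant_on_def by (metis UNIV_I)
    then have "cmod (exp 0) = cmod (exp 1)" by simp
    then show False by (simp only: norm_exp_eq_Re) simp
  qed
qed (auto intro: holomorphic_intros)

lemma norm_preserving_less:
  assumes "\<And>w. r0 \<le> cmod w \<or> r0 \<le> cmod (\<phi> w) \<Longrightarrow> cmod (\<phi> w) = cmod w" "r0 \<le> R"
  shows "cmod (\<phi> w) < R \<longleftrightarrow> cmod w < R"
  using assms(1)[of w] assms(2) by (smt (verit))

lemma tips_moduli:
  assumes r0: "\<And>w. r0 \<le> cmod w \<or> r0 \<le> cmod (\<phi> w) \<Longrightarrow> cmod (\<phi> w) = cmod w" "r0 \<le> rad j"
    and t: "t \<in> tips \<phi>" "rad j < cmod t"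
  shows "rad (Suc j) \<le> cmod t"
proof -
  obtain v where v: "t = \<phi> v" "v \<in> range cval" using t by auto
  then have "cmod t = cmod v" using r0(1)[of v] r0(2) t(2) by auto
  then obtain i where "cmod t = rad i" using cval_moduli[OF v(2)] by auto
  moreover have "j < i" using t(2) rad_mono[of i j] calculation by (cases "j < i") auto
  ultimately show ?thesis using rad_mono[of "Suc j" i] by simp
qed

lemma rad_pos: "rad j > 0" using rad_gt[of j] by (smt (verit) of_nat_0_le_iff)

text \<open>
  Near the critical point the lift stays in the component over a small disc around the tip, and
  there it must tend to the critical point as its image tends to the tip.
\<close>

lemma tip_approach:
  fixes \<phi> \<phi>i :: "complex \<Rightarrow> complex"
  assumes hom: "homeomorphism UNIV UNIV \<phi> \<phi>i"
    and r0: "\<And>w. r0 \<le> cmod w \<or> r0 \<le> cmod (\<phi> w) \<Longrightarrow> cmod (\<phi> w) = cmod w" "r0 \<le> rad N"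
    and M: "M = Suc N" and l0: "l0 = ln (rad N)" and l1: "l1 = ln (rad M)"
  obtains \<rho> where "\<rho> > 0" "\<And>z. z \<in> ball (cpt (int M)) \<rho> \<Longrightarrow> rad N < cmod (\<phi> (expid z))"
    "\<And>L u2. continuous_on (strip l0 l1) L \<Longrightarrow> (\<And>u. u \<in> strip l0 l1 \<Longrightarrow> \<phi> (expid (L u)) = exp u) \<Longrightarrow>
       u2 \<in> strip l0 l1 \<Longrightarrow> L u2 \<in> ball (cpt (int M)) \<rho> \<Longrightarrow>
       \<exists>uc. exp uc = \<phi> (cval (int M)) \<and> Re uc = l1 \<and> (L \<longlongrightarrow> cpt (int M)) (at uc within strip l0 l1)"
proof -
  let ?F = "\<lambda>z. \<phi> (expid z)"
  let ?c = "cpt (int M)"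
  have r0M: "r0 \<le> rad M" using r0(2) rad_mono[of N M] by (simp add: M)
  define w where "w = \<phi> (cval (int M))"
  have cw: "cmod w = rad M" unfolding w_def using r0(1)[of "cval (int M)"] r0M by (simp add: cmod_cval_nat)
  have w0: "w \<noteq> 0" using cw rad_pos[of M] by auto
  have Fc: "?F ?c = w" by (simp add: w_def expid_cpt)
  have "finite {t \<in> tips \<phi>. t \<in> ball w 1}" by (rule finite_tips_bounded[OF hom]) auto
  then have "open (ball w 1 - ({t \<in> tips \<phi>. t \<in> ball w 1} - {w}))" by (intro open_Diff finite_imp_closed) auto
  moreover have "exp (Ln w) \<in> ball w 1 - ({t \<in> tips \<phi>. t \<in> ball w 1} - {w})" using w0 by auto
  ultimately obtain \<eta>1 where \<eta>1: "\<eta>1 > 0" "\<And>u. dist u (Ln w) < \<eta>1 \<Longrightarrow> exp u \<in> ball w 1 - ({t \<in> tips \<phi>. t \<in> ball w 1} - {w})"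
    using isCont_exp[of "Ln w"] unfolding continuous_at_open
    by (metis (no_types, lifting) isCont_exp continuous_at_open open_dist)
  define \<eta> where "\<eta> = min \<eta>1 1"
  have \<eta>: "0 < \<eta>" "\<eta> \<le> 1" "\<eta> \<le> \<eta>1" using \<eta>1 by (auto simp: \<eta>_def)
  define h where "h \<zeta> = exp (Ln w + of_real \<eta> * \<zeta>)" for \<zeta>
  have ch: "continuous_on T h" for T unfolding h_def by (intro continuous_intros)
  have inh: "inj_on h (ball 0 1)"
  proof (rule inj_onI)
    fix a b assume ab: "a \<in> ball (0::complex) 1" "b \<in> ball 0 1" "h a = h b"
    have "Ln w + of_real \<eta> * a = Ln w + of_real \<eta> * b"
    proof (rule exp_complex_eqI)
      show "exp (Ln w + of_real \<eta> * a) = exp (Ln w + of_real \<eta> * b)" using ab(3) by (simp only: h_def)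
      have "\<bar>Im a\<bar> < 1" "\<bar>Im b\<bar> < 1" using ab abs_Im_le_cmod[of a] abs_Im_le_cmod[of b] by auto
      then have "\<bar>\<eta> * (Im a - Im b)\<bar> \<le> 1 * 2" unfolding abs_mult using \<eta> by (intro mult_mono) auto
      then show "\<bar>Im (Ln w + of_real \<eta> * a) - Im (Ln w + of_real \<eta> * b)\<bar> < 2 * pi"
        using pi_gt3 by (simp add: right_diff_distrib)
    qed
    then show "a = b" using \<eta> by simp
  qed
  define V where "V = h ` ball 0 1"
  obtain h' where h': "homeomorphism (ball 0 1) V h h'"
    using invariance_of_domain_homeomorphism[OF open_ball ch _ inh] unfolding V_def by auto
  have oV: "open V" unfolding V_def using inh by (intro invariance_of_domain ch) auto
  have VB: "V \<subseteq> ball w 1 - ({t \<in> tips \<phi>. t \<in> ball w 1} - {w})"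
  proof -
    have "h \<zeta> \<in> ball w 1 - ({t \<in> tips \<phi>. t \<in> ball w 1} - {w})" if "\<zeta> \<in> ball 0 1" for \<zeta>
    proof -
      have "dist (Ln w + of_real \<eta> * \<zeta>) (Ln w) = \<eta> * cmod \<zeta>" using \<eta> by (simp add: dist_norm norm_mult)
      also have "\<dots> < \<eta> * 1" using that \<eta> by (intro mult_strict_left_mono) auto
      finally show ?thesis unfolding h_def using \<eta>1(2) \<eta>(3) by auto
    qed
    then show ?thesis unfolding V_def by (rule image_subsetI)
  qed
  have bV: "bounded V" using VB by (meson bounded_ball bounded_subset Diff_subset subset_trans)
  have h0: "h 0 = w" using w0 by (simp add: h_def)
  define Vt where "Vt = component {z. ?F z \<in> V} ?c"
  have only: "z = ?c" if "z \<in> Vt" "?F z = w" for z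
    
  proof (rule disc_two_sheets(1)[OF hom oV bV h' _ _ Vt_def that(1)])
    show "h 0 = \<phi> (cval (int M))" "?F z = h 0" using h0 that(2) by (simp_all add: w_def)
    show "t = h 0" if "t \<in> tips \<phi>" "t \<in> V" for t using that VB h0 by auto
  qed
  have wV: "w \<in> V" unfolding V_def using h0 by (metis centre_in_ball imageI zero_less_one)
  have oVt: "open Vt" unfolding Vt_def by (intro open_connected_component open_vimage_homeo[OF hom oV])
  have cVt: "?c \<in> Vt" using wV Fc by (simp add: Vt_def)
  have "open (Vt \<inter> {z. rad N < cmod (?F z)})"
    using oVt by (intro open_Int open_Collect_less continuous_intros continuous_on_homeo_expid[OF hom]) auto
  moreover have "?c \<in> Vt \<inter> {z. rad N < cmod (?F z)}"
    using cVt Fc cw rad_strict_mono[of N M] by (simp add: M)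
  ultimately obtain \<rho> where \<rho>: "\<rho> > 0" "ball ?c \<rho> \<subseteq> Vt \<inter> {z. rad N < cmod (?F z)}" using open_contains_ball by blast
  show ?thesis
  proof (rule that[OF \<rho>(1)])
    show "rad N < cmod (?F z)" if "z \<in> ball ?c \<rho>" for z using that \<rho>(2) by blast
    fix L u2 assume L: "continuous_on (strip l0 l1) L" "\<And>u. u \<in> strip l0 l1 \<Longrightarrow> ?F (L u) = exp u"
      and u2: "u2 \<in> strip l0 l1" "L u2 \<in> ball ?c \<rho>"
    have uV: "L u2 \<in> Vt" using u2(2) \<rho>(2) by blast
    note u2 = u2(1)
  have "exp u2 \<in> V"
  proof -
    have "L u2 \<in> {z. ?F z \<in> V}" using connected_component_subset uV unfolding Vt_def by (rule subsetD)
    then show ?thesis using L(2)[OF u2] by simp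
  qed
  then obtain \<zeta> where \<zeta>: "\<zeta> \<in> ball 0 1" "exp u2 = exp (Ln w + of_real \<eta> * \<zeta>)" unfolding V_def h_def by auto
  then obtain n :: int where n: "u2 = Ln w + of_real \<eta> * \<zeta> + (of_int (2 * n) * pi) * \<i>" by (metis exp_eq)
  define uc where "uc = Ln w + (of_int (2 * n) * pi) * \<i>"
  have euc: "exp (x + (of_int (2 * n) * pi) * \<i>) = exp x" for x by (metis exp_eq)
  have "exp uc = exp (Ln w)" by (simp only: uc_def euc)
  then have uc: "exp uc = w" "Re uc = l1" using w0 cw by (simp_all add: uc_def l1)
  define H where "H = ball uc \<eta> \<inter> strip l0 l1"
  have "dist uc u2 = \<eta> * cmod \<zeta>" using \<eta> by (simp add: n uc_def dist_norm norm_mult)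
  also have "\<dots> < \<eta> * 1" using \<zeta> \<eta> by (intro mult_strict_left_mono) auto
  finally have u2H: "u2 \<in> H" using u2 by (simp add: H_def)
  have LH: "L ` H \<subseteq> Vt"
    unfolding Vt_def
  proof (rule component_superset[of _ _ "L u2"])
    show "connected (L ` H)"
      unfolding H_def using L(1)
      by (intro connected_continuous_image convex_connected convex_Int convex_strip convex_ball) (auto intro: continuous_on_subset)
    show "L ` H \<subseteq> {z. ?F z \<in> V}"
    proof clarify
      fix u assume u: "u \<in> H"
      define x where "x = (u - uc) / of_real \<eta>"
      have "cmod x < 1" using u \<eta> by (simp add: x_def H_def dist_norm norm_divide norm_minus_commute)
      moreover have "u = (Ln w + of_real \<eta> * x) + (of_int (2 * n) * pi) * \<i>" using \<eta> by (simp add: x_def uc_def)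
      then have "exp u = h x" unfolding h_def using euc by metis
      ultimately show "?F (L u) \<in> V" using L(2)[of u] u by (auto simp: H_def V_def)
    qed
    show "L u2 \<in> L ` H" using u2H by auto
    show "L u2 \<in> component {z. ?F z \<in> V} ?c" using uV by (simp add: Vt_def)
  qed
  have "(L \<longlongrightarrow> ?c) (at uc within strip l0 l1)"
  proof (rule tendsto_in_component[OF hom oV bV wV])
    show "z = ?c" if "z \<in> component {z. ?F z \<in> V} ?c" "?F z = w" for z using only that by (simp add: Vt_def)
    have "\<forall>\<^sub>F u in at uc within strip l0 l1. dist u uc < \<eta>" unfolding eventually_at using \<eta>(1) by blast
    moreover have "\<forall>\<^sub>F u in at uc within strip l0 l1. u \<in> strip l0 l1" by (simp add: eventually_at_filter)
    ultimately have evH: "\<forall>\<^sub>F u in at uc within strip l0 l1. u \<in> H"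
      by eventually_elim (simp add: H_def dist_commute)
    then show "\<forall>\<^sub>F u in at uc within strip l0 l1. L u \<in> component {z. ?F z \<in> V} ?c"
      by eventually_elim (use LH in \<open>auto simp: Vt_def\<close>)
    have "(exp \<longlongrightarrow> exp uc) (at uc within strip l0 l1)" by (intro tendsto_intros)
    moreover have "\<forall>\<^sub>F u in at uc within strip l0 l1. ?F (L u) = exp u"
      using evH by eventually_elim (use L(2) in \<open>auto simp: H_def\<close>)
    ultimately show "((\<lambda>u. ?F (L u)) \<longlongrightarrow> w) (at uc within strip l0 l1)"
      using uc(1) by (simp add: tendsto_cong)
  qed
  then show "\<exists>uc. exp uc = \<phi> (cval (int M)) \<and> Re uc = l1 \<and> (L \<longlongrightarrow> ?c) (at uc within strip l0 l1)"
    using uc unfolding w_def by blast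
  qed
qed

text \<open>
  The collar of the central component is swept out by one lift of the exponential, and the
  points of the imaginary axis just below the critical point belong to this collar. So the lift
  starting at any \<open>z0\<close> comes close to the critical point, possibly after many
  turns.
\<close>

lemma spiral_to_tip:
  fixes \<phi> \<phi>i :: "complex \<Rightarrow> complex"
  assumes hom: "homeomorphism UNIV UNIV \<phi> \<phi>i"
    and r0: "\<And>w. r0 \<le> cmod w \<or> r0 \<le> cmod (\<phi> w) \<Longrightarrow> cmod (\<phi> w) = cmod w" "r0 \<le> rad N"
    and M: "M = Suc N" and l0: "l0 = ln (rad N)" and l1: "l1 = ln (rad M)"
    and z0: "z0 \<in> central M" "\<phi> (expid z0) = exp u0" "u0 \<in> strip l0 l1"
  obtains L uc where "continuous_on (strip l0 l1) L" "L u0 = z0"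
    "\<And>u. u \<in> strip l0 l1 \<Longrightarrow> \<phi> (expid (L u)) = exp u"
    "exp uc = \<phi> (cval (int M))" "Re uc = l1" "(L \<longlongrightarrow> cpt (int M)) (at uc within strip l0 l1)"
proof -
  let ?F = "\<lambda>z. \<phi> (expid z)"
  let ?c = "cpt (int M)"
  obtain \<rho> where \<rho>: "\<rho> > 0" "\<And>z. z \<in> ball ?c \<rho> \<Longrightarrow> rad N < cmod (?F z)"
    "\<And>L u2. continuous_on (strip l0 l1) L \<Longrightarrow> (\<And>u. u \<in> strip l0 l1 \<Longrightarrow> ?F (L u) = exp u) \<Longrightarrow>
       u2 \<in> strip l0 l1 \<Longrightarrow> L u2 \<in> ball ?c \<rho> \<Longrightarrow>
       \<exists>uc. exp uc = \<phi> (cval (int M)) \<and> Re uc = l1 \<and> (L \<longlongrightarrow> ?c) (at uc within strip l0 l1)"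
    using tip_approach[OF hom r0 M l0 l1] by metis
  have e0: "exp l0 = rad N" "exp l1 = rad M" unfolding l0 l1 using rad_pos by auto
  have r0M: "r0 \<le> rad M" using r0(2) rad_mono[of N M] by (simp add: M)
  have eqC: "{z. cmod (?F z) < rad M} = {z. cmod (expid z) < rad M}"
    using norm_preserving_less[OF r0(1) r0M] by auto
  have tf: "ann l0 l1 \<inter> tips \<phi> = {}"
    using tips_moduli[OF r0] by (fastforce simp: ann_def e0 M)
  obtain L where L: "continuous_on (strip l0 l1) L" "L u0 = z0" "\<And>u. u \<in> strip l0 l1 \<Longrightarrow> ?F (L u) = exp u"
    using strip_lift[OF hom tf z0(3,2)] by blast
  define S where "S = {z \<in> central M. rad N < cmod (?F z)}"
  have Cdef: "central M = component {z. cmod (?F z) < rad M} 0" by (simp add: central_def eqC)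
  have "open S" "connected S" unfolding S_def
    by (rule connected_comp_collar[OF hom rad_strict_mono Cdef]; simp add: M)+
  then have pS: "path_connected S" by (simp add: connected_open_path_connected)
  have SA: "?F z \<in> ann l0 l1" if "z \<in> S" for z
  proof -
    have "z \<in> {z. cmod (?F z) < rad M}" using that connected_component_subset unfolding S_def Cdef by blast
    then show ?thesis using that by (simp add: S_def ann_def e0)
  qed
  have z0S: "z0 \<in> S" using z0 by (simp add: S_def strip_def e0(1)[symmetric])
  define s where "s = min (\<rho> / 2) (ht M)"
  have s: "0 < s" "s < \<rho>" "s \<le> ht M" using \<rho> ht_pos[of M] by (auto simp: s_def)
  define z1 where "z1 = Complex 0 (ht M - s)"
  have "dist ?c z1 = s" using s by (simp add: z1_def cpt_def ht_def dist_norm cmod_def)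
  then have z1: "z1 \<in> ball ?c \<rho>" using s by simp
  have "z1 \<in> central M" unfolding z1_def by (rule imaginary_in_central) (use s ht_pos[of M] in auto)
  then have z1S: "z1 \<in> S" using \<rho>(2)[OF z1] by (simp add: S_def)
  have "\<exists>u2\<in>strip l0 l1. L u2 = z1"
  proof (rule orbit_parametrised[OF hom, of "strip l0 l1" "{l0<..<l1}" "ann l0 l1" "\<lambda>w. w" "\<lambda>w. w" L S u0 z1])
    show "homeomorphism (exp ` strip l0 l1) (ann l0 l1) (\<lambda>w. w) (\<lambda>w. w)"
      unfolding exp_strip by (rule homeomorphism_ident)
    show "strip l0 l1 = {u. Re u \<in> {l0<..<l1}}" by (auto simp: strip_def)
    show "u0 \<in> strip l0 l1" by fact
  qed (use tf L pS SA z0S z1S in auto)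
  then obtain u2 where u2: "u2 \<in> strip l0 l1" "L u2 = z1" by blast
  then obtain uc where "exp uc = \<phi> (cval (int M))" "Re uc = l1" "(L \<longlongrightarrow> ?c) (at uc within strip l0 l1)"
    using \<rho>(3)[OF L(1,3) u2(1)] z1 by auto
  then show ?thesis using that L by blast
qed

text \<open>
  The analogue of the previous lemma on the other side of the critical point. Here the lift can
  be shifted by a multiple of \<open>2\<pi>i\<close> so as to tend to the critical point at a
  prescribed logarithm \<open>uc\<close> of the tip.
\<close>

lemma spiral_outside:
  fixes \<phi> \<phi>i :: "complex \<Rightarrow> complex"
  assumes hom: "homeomorphism UNIV UNIV \<phi> \<phi>i"
    and r0: "\<And>w. r0 \<le> cmod w \<or> r0 \<le> cmod (\<phi> w) \<Longrightarrow> cmod (\<phi> w) = cmod w" "r0 \<le> rad N"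
    and M: "M = Suc N" and l0: "l0 = ln (rad N)" and l1: "l1 = ln (rad M)"
    and uc: "exp uc = \<phi> (cval (int M))"
  obtains L where "continuous_on (strip l0 l1) L" "\<And>u. u \<in> strip l0 l1 \<Longrightarrow> L u \<notin> central M"
    "\<And>u. u \<in> strip l0 l1 \<Longrightarrow> \<phi> (expid (L u)) = exp u" "(L \<longlongrightarrow> cpt (int M)) (at uc within strip l0 l1)"
proof -
  let ?F = "\<lambda>z. \<phi> (expid z)"
  let ?c = "cpt (int M)"
  obtain \<rho> where \<rho>: "\<rho> > 0" "\<And>z. z \<in> ball ?c \<rho> \<Longrightarrow> rad N < cmod (?F z)"
    "\<And>L u2. continuous_on (strip l0 l1) L \<Longrightarrow> (\<And>u. u \<in> strip l0 l1 \<Longrightarrow> ?F (L u) = exp u) \<Longrightarrow>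
       u2 \<in> strip l0 l1 \<Longrightarrow> L u2 \<in> ball ?c \<rho> \<Longrightarrow>
       \<exists>uc. exp uc = \<phi> (cval (int M)) \<and> Re uc = l1 \<and> (L \<longlongrightarrow> ?c) (at uc within strip l0 l1)"
    using tip_approach[OF hom r0 M l0 l1] by metis
  have e0: "exp l0 = rad N" "exp l1 = rad M" unfolding l0 l1 using rad_pos by auto
  have r0M: "r0 \<le> rad M" using r0(2) rad_mono[of N M] by (simp add: M)
  have lessM: "cmod (?F z) < rad M \<longleftrightarrow> cmod (expid z) < rad M" for z
    using norm_preserving_less[OF r0(1) r0M] by auto
  have tf: "ann l0 l1 \<inter> tips \<phi> = {}"
    using tips_moduli[OF r0] by (fastforce simp: ann_def e0 M)
  obtain t0 where t0: "t0 > 0" "\<And>t. 0 < t \<Longrightarrow> t < t0 \<Longrightarrow> cmod (expid (Complex 0 (ht M + t))) < rad M"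
    using expid_above_cpt[of M] by blast
  define s where "s = min (\<rho> / 2) (t0 / 2)"
  have s: "0 < s" "s < \<rho>" "s < t0" using \<rho> t0(1) by (auto simp: s_def)
  define z2 where "z2 = Complex 0 (ht M + s)"
  have "dist ?c z2 = s" using s by (simp add: z2_def cpt_def ht_def dist_norm cmod_def)
  then have z2: "z2 \<in> ball ?c \<rho>" using s by simp
  have z2n: "z2 \<notin> central M" unfolding z2_def by (rule above_not_central) (use s in simp)
  have F2: "rad N < cmod (?F z2)" "cmod (?F z2) < rad M"
    using \<rho>(2)[OF z2] lessM t0(2) s by (auto simp: z2_def)
  define u2 where "u2 = Ln (?F z2)"
  have F20: "?F z2 \<noteq> 0" using F2(1) rad_pos[of N] by (metis norm_zero not_less_iff_gr_or_eq)
  have u2: "?F z2 = exp u2" "u2 \<in> strip l0 l1"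
    using F20 F2 by (auto simp: u2_def strip_def less_lev_iff lev_less_iff e0)
  obtain L where L: "continuous_on (strip l0 l1) L" "L u2 = z2" "\<And>u. u \<in> strip l0 l1 \<Longrightarrow> ?F (L u) = exp u"
    using strip_lift[OF hom tf u2(2,1)] by blast
  obtain uc' where uc': "exp uc' = \<phi> (cval (int M))" "Re uc' = l1" "(L \<longlongrightarrow> ?c) (at uc' within strip l0 l1)"
    using \<rho>(3)[OF L(1,3) u2(2)] z2 L(2) by auto
  obtain n :: int where n: "uc' = uc + (of_int (2 * n) * pi) * \<i>" using uc uc'(1) by (metis exp_eq)
  let ?p = "(of_int (2 * n) * pi) * \<i> :: complex"
  have ep: "exp (x + ?p) = exp x" for x by (metis exp_eq)
  have sp: "x + ?p \<in> strip l0 l1 \<longleftrightarrow> x \<in> strip l0 l1" for x by (simp add: strip_def)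
  have notin: "L u \<notin> central M" if u: "u \<in> strip l0 l1" for u
  proof
    assume c: "L u \<in> central M"
    have "L ` strip l0 l1 \<subseteq> central M" unfolding central_def
    proof (rule component_superset)
      show "connected (L ` strip l0 l1)"
        by (intro connected_continuous_image L convex_connected convex_strip)
      show "L ` strip l0 l1 \<subseteq> {z. cmod (expid z) < rad M}"
      proof (rule image_subsetI)
        fix v assume v: "v \<in> strip l0 l1"
        then have "cmod (?F (L v)) < exp l1" using L(3)[OF v] by (simp add: strip_def)
        then show "L v \<in> {z. cmod (expid z) < rad M}" using lessM e0 by simp
      qed
      show "L u \<in> L ` strip l0 l1" using u by simp
      show "L u \<in> component {z. cmod (expid z) < rad M} 0" using c by (simp add: central_def)
    qed
    then show False using u2(2) L(2) z2n by auto
  qed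
  show ?thesis
  proof (rule that[of "\<lambda>u. L (u + ?p)"])
    show "continuous_on (strip l0 l1) (\<lambda>u. L (u + ?p))"
      by (rule continuous_on_compose2[OF L(1)]) (auto intro!: continuous_intros simp: strip_def)
    show "?F (L (u + ?p)) = exp u" if "u \<in> strip l0 l1" for u using L(3)[of "u + ?p"] that by (simp only: sp ep)
    show "L (u + ?p) \<notin> central M" if "u \<in> strip l0 l1" for u using notin that sp by blast
    show "((\<lambda>u. L (u + ?p)) \<longlongrightarrow> ?c) (at uc within strip l0 l1)"
    proof (rule filterlim_compose[OF uc'(3)])
      have "((\<lambda>u. u + ?p) \<longlongrightarrow> uc + ?p) (at uc within strip l0 l1)" by (intro tendsto_intros)
      moreover have "\<forall>\<^sub>F u in at uc within strip l0 l1. u + ?p \<in> strip l0 l1 \<and> u + ?p \<noteq> uc'"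
        unfolding eventually_at_filter by (rule always_eventually) (use sp n in auto)
      ultimately show "LIM u at uc within strip l0 l1. u + ?p :> at uc' within strip l0 l1"
        unfolding filterlim_at using n by simp
    qed
  qed
qed

text \<open>
  The curve that follows the slit radially up to level \<open>lm\<close> and then turns towards
  \<open>uc\<close> is mapped by \<open>T\<close> to a radial segment in \<open>V\<close>. Its
  lift is connected and tends to the critical point, so it lies in the component of the critical
  point over \<open>V\<close>.
\<close>

lemma lens_reached:
  fixes \<phi> \<phi>i T Ti :: "complex \<Rightarrow> complex" and s :: "real \<Rightarrow> complex" and \<tau> lf :: "real \<Rightarrow> real"
  assumes hom: "homeomorphism UNIV UNIV \<phi> \<phi>i" "homeomorphism UNIV UNIV T Ti" and tf: "ann l0 l1 \<inter> tips \<phi> = {}"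
    and L: "continuous_on (strip l0 l1) L" "\<And>u. u \<in> strip l0 l1 \<Longrightarrow> \<phi> (expid (L u)) = exp u"
      "(L \<longlongrightarrow> c) (at uc within strip l0 l1)"
    and s: "continuous_on {1<..<l1} s" "\<And>l. l \<in> {1<..<l1} \<Longrightarrow> \<phi> (expid (s l)) = exp (Complex l y)"
    and lm: "3 < l0" "l0 < lm" "lm < l1" "s lm = L (Complex lm y)"
    and \<tau>: "continuous_on UNIV \<tau>" "\<And>l. l \<le> lm \<Longrightarrow> \<tau> l = 0" "uc = Complex l1 (y - \<tau> l1)"
    and lf: "continuous_on UNIV lf" "lf 0 = l1" "\<And>x. x \<in> {-1<..<0} \<Longrightarrow> 1 < lf x \<and> lf x < l1" "lf (-(9/19)) = 11/5"
    and T: "\<And>x. x \<in> {-1<..<0} \<Longrightarrow> T (exp (Complex (lf x) (y - \<tau> (lf x)))) \<in> V"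
    and V: "open V" "T (\<phi> (expid c)) \<in> V"
  shows "s (11/5) \<in> component {z. T (\<phi> (expid z)) \<in> V} c"
proof -
  have hom2: "homeomorphism UNIV UNIV (T \<circ> \<phi>) (\<phi>i \<circ> Ti)" using hom by (rule homeomorphism_compose)
  have inS: "Complex l x \<in> strip l0 l1 \<longleftrightarrow> l0 < l \<and> l < l1" for l x by (simp add: strip_def)
  have agree: "s l = L (Complex l y)" if "l \<in> {l0<..<l1}" for l
  proof (rule lift_unique[OF hom(1), of "{l0<..<l1}" s "\<lambda>l. L (Complex l y)" lm])
    show "continuous_on {l0<..<l1} s" using s(1) by (rule continuous_on_subset) (use lm in auto)
    show "continuous_on {l0<..<l1} (\<lambda>l. L (Complex l y))"
      by (rule continuous_on_compose2[OF L(1)]) (auto intro!: continuous_intros simp: inS)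
    fix u assume u: "u \<in> {l0<..<l1}"
    then show "\<phi> (expid (s u)) = \<phi> (expid (L (Complex u y)))" using s(2)[of u] L(2)[of "Complex u y"] lm by (auto simp: inS)
    have "exp (Complex u y) \<in> ann l0 l1" using u by (simp add: ann_def)
    then show "\<phi> (expid (s u)) \<notin> tips \<phi>" using s(2)[of u] u lm tf by auto
  qed (use lm that in auto)
  define k where "k l = (if l \<le> lm then s l else L (Complex l (y - \<tau> l)))" for l
  have k1: "k l = s l" if "l \<in> {1<..<lm}" for l using that by (simp add: k_def)
  have k2: "k l = L (Complex l (y - \<tau> l))" if "l \<in> {l0<..<l1}" for l
    using that agree[of l] \<tau>(2)[of l] by (auto simp: k_def)
  have ck1: "continuous_on {1<..<lm} k"
  proof (subst continuous_on_cong[OF refl k1])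
    show "continuous_on {1<..<lm} s" by (rule continuous_on_subset[OF s(1)]) (use lm in auto)
  qed
  have cc: "continuous_on {l0<..<l1} (\<lambda>l. L (Complex l (y - \<tau> l)))"
  proof (rule continuous_on_compose2[OF L(1)])
    show "continuous_on {l0<..<l1} (\<lambda>l. Complex l (y - \<tau> l))"
      by (intro continuous_intros continuous_on_subset[OF \<tau>(1)]) auto
  qed (auto simp: inS)
  have ck2: "continuous_on {l0<..<l1} k"
    using cc by (subst continuous_on_cong[OF refl k2])
  have "continuous_on ({1<..<lm} \<union> {l0<..<l1}) k"
    by (intro continuous_on_open_Un ck1 ck2) auto
  moreover have "{1<..<lm} \<union> {l0<..<l1} = {1<..<l1}" using lm by auto
  ultimately have ck: "continuous_on {1<..<l1} k" by simp
  have Fk: "\<phi> (expid (k l)) = exp (Complex l (y - \<tau> l))" if l: "l \<in> {1<..<l1}" for l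
  proof (cases "l \<le> lm")
    case True
    then show ?thesis using s(2)[OF l] \<tau>(2) by (simp add: k_def)
  next
    case False
    then show ?thesis using L(2)[of "Complex l (y - \<tau> l)"] lm l by (simp add: k_def inS)
  qed
  define g where "g x = k (lf x)" for x
  have cg: "continuous_on {-1<..<0} g" unfolding g_def
    by (rule continuous_on_compose2[OF ck continuous_on_subset[OF lf(1)]]) (use lf(3) in auto)
  have gV: "T (\<phi> (expid (g x))) \<in> V" if "x \<in> {-1<..<0}" for x
    using Fk[of "lf x"] lf(3)[OF that] T[OF that] by (simp add: g_def)
  have "open (component {z. T (\<phi> (expid z)) \<in> V} c)"
    using open_vimage_homeo[OF hom2 V(1)] by (intro open_connected_component) simp
  moreover have "c \<in> component {z. T (\<phi> (expid z)) \<in> V} c" using V(2) by simp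
  moreover have lim: "(g \<longlongrightarrow> c) (at_left 0)"
  proof -
    have lfl: "(lf \<longlongrightarrow> l1) (at_left 0)"
      using lf(1,2) by (metis UNIV_I continuous_on_def filterlim_at_split tendsto_within_subset top_greatest)
    have "isCont \<tau> l1" using \<tau>(1) continuous_on_eq_continuous_at[OF open_UNIV] by auto
    then have "((\<lambda>x. \<tau> (lf x)) \<longlongrightarrow> \<tau> l1) (at_left 0)" using lfl by (rule isCont_tendsto_compose)
    then have "((\<lambda>x. Complex (lf x) (y - \<tau> (lf x))) \<longlongrightarrow> uc) (at_left 0)"
      unfolding \<tau>(3) by (intro tendsto_intros lfl)
    moreover have neg: "\<forall>\<^sub>F x in at_left 0. x \<in> {-1<..<0::real}"
      using eventually_at_left_real[of "-1" 0] by simp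
    moreover have "\<forall>\<^sub>F x in at_left 0. l0 < lf x" using lfl lm by (intro order_tendstoD(1)[OF lfl]) auto
    ultimately have "LIM x at_left 0. Complex (lf x) (y - \<tau> (lf x)) :> at uc within strip l0 l1"
      unfolding filterlim_at
    proof (intro conjI)
      assume a: "\<forall>\<^sub>F x in at_left 0. x \<in> {-1<..<0::real}" "\<forall>\<^sub>F x in at_left 0. l0 < lf x"
      show "\<forall>\<^sub>F x in at_left 0. Complex (lf x) (y - \<tau> (lf x)) \<in> strip l0 l1 \<and> Complex (lf x) (y - \<tau> (lf x)) \<noteq> uc"
        using a by eventually_elim (use lf(3) in \<open>force simp: inS \<tau>(3)\<close>)
    qed
    then have "((\<lambda>x. L (Complex (lf x) (y - \<tau> (lf x)))) \<longlongrightarrow> c) (at_left 0)"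
      by (rule filterlim_compose[OF L(3)])
    moreover have "\<forall>\<^sub>F x in at_left 0. L (Complex (lf x) (y - \<tau> (lf x))) = g x"
      using neg \<open>\<forall>\<^sub>F x in at_left 0. l0 < lf x\<close> by eventually_elim (use lf(3) k2 in \<open>auto simp: g_def\<close>)
    ultimately show ?thesis by (simp add: tendsto_cong)
  qed
  ultimately have "\<forall>\<^sub>F x in at_left 0. g x \<in> component {z. T (\<phi> (expid z)) \<in> V} c" using topological_tendstoD by blast
  moreover have "\<forall>\<^sub>F x in at_left 0. x \<in> {-1<..<0::real}" using eventually_at_left_real[of "-1" 0] by simp
  ultimately have "\<forall>\<^sub>F x in at_left (0::real). x \<in> {-1<..<0} \<and> g x \<in> component {z. T (\<phi> (expid z)) \<in> V} c" by eventually_elim simp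
  then obtain x where x: "x \<in> {-1<..<0}" "g x \<in> component {z. T (\<phi> (expid z)) \<in> V} c"
    by (metis (mono_tags, lifting) eventually_happens' trivial_limit_at_left_real)
  have "g ` {-1<..<0} \<subseteq> component {z. T (\<phi> (expid z)) \<in> V} c"
  proof (rule component_superset)
    show "connected (g ` {-1<..<0})" by (intro connected_continuous_image cg) auto
    show "g x \<in> g ` {-1<..<0}" using x by simp
    show "g ` {-1<..<0} \<subseteq> {z. T (\<phi> (expid z)) \<in> V}" by (rule image_subsetI) (use gV in simp)
  qed (rule x)
  moreover have "g (-(9/19)) = s (11/5)" unfolding g_def lf(4) using k1[of "11/5"] lm by simp
  moreover have "g (-(9/19)) \<in> g ` {-1<..<0}" by (rule imageI) simp
  ultimately show ?thesis by (metis subsetD)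
qed

lemma lift_line:
  fixes \<phi> \<phi>i :: "complex \<Rightarrow> complex"
  assumes hom: "homeomorphism UNIV UNIV \<phi> \<phi>i"
    and e: "0 < e" "\<And>u. a < Re u \<Longrightarrow> Re u < b \<Longrightarrow> \<bar>Im u - y\<bar> < e \<Longrightarrow> exp u \<notin> tips \<phi>"
    and l: "a < l" "l < b" "\<phi> (expid z0) = exp (Complex l y)"
  obtains s where "continuous_on {a<..<b} s" "s l = z0"
    "\<And>x. x \<in> {a<..<b} \<Longrightarrow> \<phi> (expid (s x)) = exp (Complex x y)"
proof -
  define B where "B = strip a b \<inter> {u. Im u < y + e} \<inter> {u. Im u > y - e}"
  have cB: "convex B" unfolding B_def
    by (intro convex_Int convex_strip convex_halfspace_Im_lt convex_halfspace_Im_gt)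
  have "open (strip a b)" unfolding strip_def by (intro open_Collect_conj open_Collect_less continuous_intros)
  then have oB: "open B" unfolding B_def by (intro open_Int open_halfspace_Im_lt open_halfspace_Im_gt)
  have inB: "Complex x y \<in> B" if "x \<in> {a<..<b}" for x using that e by (simp add: B_def strip_def)
  show ?thesis
  proof (rule lift_tipfree[OF hom, of "exp ` B" "{a<..<b}" l "\<lambda>x. exp (Complex x y)" z0])
    show "open (exp ` B)" using oB by (rule open_exp_image)
    show "connected (exp ` B)" by (intro connected_continuous_image continuous_intros convex_connected cB)
    show "bounded (exp ` B)"
      by (rule bounded_subset[of "ball 0 (exp b)"]) (auto simp: B_def strip_def)
    have "exp u \<notin> tips \<phi>" if "u \<in> B" for u using e(2)[of u] that by (simp add: B_def strip_def abs_less_iff)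
    then show "exp ` B \<inter> tips \<phi> = {}" by blast
    show "continuous_on {a<..<b} (\<lambda>x. exp (Complex x y))" by (intro continuous_intros)
    show "(\<lambda>x. exp (Complex x y)) ` {a<..<b} \<subseteq> exp ` B" using inB by (intro image_subsetI) simp
  qed (use l that in auto)
qed

lemma generic_direction:
  assumes "finite B" "a < b" "-pi \<le> a" "b \<le> pi"
  obtains y where "a < y" "y < b" "\<And>x. exp (Complex x y) \<notin> B"
proof -
  have "infinite ({a<..<b} - Arg ` B)" using assms by (simp add: infinite_Ioo)
  then obtain y where y: "y \<in> {a<..<b}" "y \<notin> Arg ` B" by (metis finite.emptyI Diff_iff ex_in_conv)
  have "exp (Complex x y) \<notin> B" for x
  proof
    assume "exp (Complex x y) \<in> B"
    moreover have "Arg (exp (Complex x y)) = y"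
    proof (rule Arg_unique)
      show "of_real (exp x) * exp (\<i> * of_real y) = exp (Complex x y)"
        by (simp only: exp_eq_polar[of "Complex x y"] cis_conv_exp complex.sel)
    qed (use y(1) assms in auto)
    ultimately show False using y(2) by (metis imageI)
  qed
  then show ?thesis using that y by auto
qed

text \<open>
  Any compact curve to the origin has bounded image, so finitely many points lie in a common
  central component.
\<close>

lemma central_all:
  assumes "finite A"
  obtains N where "A \<subseteq> central (Suc N)" "r \<le> rad N"
proof -
  have "\<forall>\<^sub>F n in sequentially. \<forall>z\<in>A. z \<in> central n"
    using eventually_central by (intro eventually_ball_finite assms) (auto simp: eventually_sequentially)
  then obtain N1 where N1: "\<And>n. n \<ge> N1 \<Longrightarrow> A \<subseteq> central n" unfolding eventually_sequentially by blast
  define N where "N = max N1 (nat \<lceil>r\<rceil>)"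
  have "r \<le> real (nat \<lceil>r\<rceil>)" by (rule real_nat_ceiling_ge)
  also have "\<dots> \<le> real N" by (simp add: N_def)
  finally have "r \<le> real N" .
  then have "r \<le> rad N" using rad_gt[of N] by linarith
  moreover have "A \<subseteq> central (Suc N)" using N1[of "Suc N"] by (simp add: N_def)
  ultimately show ?thesis using that by blast
qed

text \<open>
  The twist straightens a spiral between the levels \<open>lm\<close> and \<open>l1\<close>; the
  radial compression brings level \<open>l1\<close> down to 31/10. Levels up to 3, and in
  particular the cell and the circle of the edges, are not touched.
\<close>

lemma twist_push:
  fixes \<tau> :: "real \<Rightarrow> real"
  assumes \<tau>: "continuous_on UNIV \<tau>" "\<And>l. l \<le> lm \<Longrightarrow> \<tau> l = 0" and lm: "3 < lm" "31/10 < l1" "l1 < d"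
  obtains T Ti where "homeomorphism UNIV UNIV T Ti" "plane_homeo T" "\<And>w. lev w \<le> 3 \<Longrightarrow> T w = w"
    "\<And>w. 3 < lev w \<Longrightarrow> 3 < lev (T w)" "\<And>w. d \<le> lev w \<Longrightarrow> lev (T w) = lev w"
    "\<And>u. T (exp u) = exp (Complex (inw 3 (31/10) l1 d 1 (Re u)) (Im u + \<tau> (Re u)))"
proof -
  define f where "f = radial (\<lambda>w. outw 3 (31/10) l1 d ((\<lambda>_. 1) w))"
  define g where "g = radial (\<lambda>w. inw 3 (31/10) l1 d ((\<lambda>_. 1) w))"
  have par: "3 < (31/10::real)" "31/10 < l1" "l1 < d" using lm by auto
  have fg: "homeomorphism UNIV UNIV f g" "plane_homeo f" unfolding f_def g_def
    by (rule radial_homeo[OF par]; simp)+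
  have gf: "homeomorphism UNIV UNIV g f" "plane_homeo g"
    using homeomorphism_symD[OF fg(1)] plane_homeo_inverse[OF fg] by auto
  have \<tau>0: "\<And>l. l \<le> 0 \<Longrightarrow> \<tau> l = 0" using \<tau>(2) lm(1) by simp
  note tw = plane_homeo_twist[OF \<tau>(1) \<tau>0]
  let ?i = "inw 3 (31/10) l1 d 1" and ?o = "outw 3 (31/10) l1 d 1"
  have oi: "?o (?i l) = l" "?i (?o l) = l" for l using outw_inw[OF par] by simp_all
  have ofix: "?o l = l" if "l \<le> 3 \<or> d \<le> l" for l using outw_fix[OF par] that by simp
  have ifix: "?i l = l" if "l \<le> 3 \<or> d \<le> l" for l using oi(2)[of l] ofix[OF that] by simp
  have tw0: "twist \<tau> w \<noteq> 0 \<longleftrightarrow> w \<noteq> 0" for w by (metis cmod_twist norm_eq_zero)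
  define T where "T = g \<circ> twist \<tau>"
  have lv: "lev (T w) = ?i (lev w)" if "w \<noteq> 0" for w
    unfolding T_def g_def using tw0 that by (simp add: ln_cmod_radial)
  have nz: "w \<noteq> 0" if "3 < lev w" for w :: complex using that by auto
  show ?thesis
  proof (rule that[of T])
    show "homeomorphism UNIV UNIV T (twist (\<lambda>l. - \<tau> l) \<circ> f)"
      unfolding T_def using tw(1) gf(1) by (rule homeomorphism_compose)
    show "plane_homeo T" unfolding T_def using tw(2) gf(2) by (rule plane_homeo_comp)
    show "T w = w" if "lev w \<le> 3" for w
    proof -
      have "twist \<tau> w = w" using \<tau>(2)[of "lev w"] that lm by (intro twist_id) simp
      then show ?thesis unfolding T_def g_def by (simp add: radial_id ifix that)
    qed
    show "3 < lev (T w)" if "3 < lev w" for w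
    proof (rule ccontr)
      assume "\<not> 3 < lev (T w)"
      then have "?o (?i (lev w)) = ?i (lev w)" using lv[OF nz[OF that]] by (intro ofix) simp
      then show False using oi(1)[of "lev w"] \<open>\<not> 3 < lev (T w)\<close> lv[OF nz[OF that]] that by simp
    qed
    show "lev (T w) = lev w" if "d \<le> lev w" for w
    proof -
      have "w \<noteq> 0" using that lm by auto
      then show ?thesis using lv ifix that by simp
    qed
    fix u
    have "T (exp u) = g (exp (u + \<i> * \<tau> (Re u)))" by (simp add: T_def twist_exp)
    also have "\<dots> = of_real (exp (?i (Re u))) * (exp (u + \<i> * \<tau> (Re u)) / of_real (exp (Re u)))"
      unfolding g_def by (subst radial_eq) (simp_all)
    also have "\<dots> = exp (Complex (?i (Re u)) (Im u + \<tau> (Re u)))"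
      by (simp add: exp_eq_polar)
    finally show "T (exp u) = exp (Complex (?i (Re u)) (Im u + \<tau> (Re u)))" .
  qed
qed

text \<open>
  A distant tip is brought to level 31/10, in a direction \<open>y\<close> away from the cell,
  in such a way that its critical point lies between the sheet \<open>LR\<close> through
  \<open>aR\<close> and a sheet \<open>LX\<close> that closes up after one turn. The closed
  sheet lies outside the central component that contains \<open>A\<close>, so it is different
  from all sheets of interest.
\<close>

lemma outer_step:
  fixes \<phi> \<phi>i :: "complex \<Rightarrow> complex"
  assumes hom: "homeomorphism UNIV UNIV \<phi> \<phi>i" "plane_homeo \<phi>" "gap \<phi>"
    and A: "finite A" "aR \<in> A" "\<phi> (expid aR) = exp (Complex (11/5) \<theta>)" and \<theta>: "0 < \<theta>" "\<theta> < pi / 2"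
  obtains T Ti y e k LR LX where
    "homeomorphism UNIV UNIV T Ti" "plane_homeo T" "\<And>w. lev w \<le> 3 \<Longrightarrow> T w = w" "\<And>w. 3 < lev w \<Longrightarrow> 3 < lev (T w)"
    "pi / 2 < y" "y < pi" "0 < e" "e < 1/4" "e < y - pi / 2"
    "T (\<phi> (cval k)) = lens y e 0" "\<And>t. t \<in> tips (T \<circ> \<phi>) \<Longrightarrow> t \<in> lens y e ` ball 0 1 \<Longrightarrow> t = lens y e 0"
    "continuous_on (strip 1 (12/5)) LR" "\<And>u. u \<in> strip 1 (12/5) \<Longrightarrow> \<phi> (expid (LR u)) = exp u"
    "LR (Complex (11/5) \<theta>) = aR" "LR (Complex (11/5) y) \<in> component {z. T (\<phi> (expid z)) \<in> lens y e ` ball 0 1} (cpt k)"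
    "continuous_on (strip 1 (12/5)) LX" "\<And>u. u \<in> strip 1 (12/5) \<Longrightarrow> \<phi> (expid (LX u)) = exp u"
    "\<And>u. u \<in> strip 1 (12/5) \<Longrightarrow> LX (u + 2 * pi * \<i>) = LX u"
    "LX (Complex (11/5) y) \<in> component {z. T (\<phi> (expid z)) \<in> lens y e ` ball 0 1} (cpt k)" "LX (Complex (11/5) \<theta>) \<notin> A"
proof -
  let ?F = "\<lambda>z. \<phi> (expid z)"
  obtain r0 where r0: "\<And>w. r0 \<le> cmod w \<or> r0 \<le> cmod (\<phi> w) \<Longrightarrow> cmod (\<phi> w) = cmod w"
    using hom(2) unfolding plane_homeo_def by metis
  obtain N where N: "A \<subseteq> central (Suc N)" "max r0 (exp 8) \<le> rad N" using central_all[OF A(1)] .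
  have r0N: "r0 \<le> rad N" and e8: "exp 8 \<le> rad N" using N(2) by auto
  define M where "M = Suc N"
  let ?c = "cpt (int M)"
  define w where "w = \<phi> (cval (int M))"
  define l0 l1 l2 where "l0 = ln (rad N)" and "l1 = ln (rad M)" and "l2 = ln (rad (Suc M))"
  have e0: "exp l0 = rad N" "exp l1 = rad M" "exp l2 = rad (Suc M)" unfolding l0_def l1_def l2_def using rad_pos by auto
  have l0: "8 \<le> l0" using e8 e0(1) by (metis exp_le_cancel_iff)
  have l01: "l0 < l1" "l1 < l2" using rad_strict_mono[of N M] rad_strict_mono[of M "Suc M"] e0
    by (metis M_def exp_less_cancel_iff lessI)+
  have r0M: "r0 \<le> rad M" using r0N rad_mono[of N M] by (simp add: M_def)
  have lessM: "cmod (?F z) < rad M \<longleftrightarrow> cmod (expid z) < rad M" for z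
    using norm_preserving_less[OF r0 r0M] by auto
  have tf: "ann l0 l1 \<inter> tips \<phi> = {}"
    using tips_moduli[OF r0 r0N] by (fastforce simp: ann_def e0 M_def)
  have tf2: "lev t \<le> l0 \<or> lev t = l1 \<or> l2 \<le> lev t" if t: "t \<in> tips \<phi>" "t \<noteq> 0" for t
  proof -
    have a: "rad N < cmod t \<Longrightarrow> rad M \<le> cmod t" using tips_moduli[OF r0 r0N t(1)] by (simp add: M_def)
    have b: "rad M < cmod t \<Longrightarrow> rad (Suc M) \<le> cmod t" using tips_moduli[OF r0 r0M t(1)] .
    consider "cmod t \<le> rad N" | "cmod t = rad M" | "rad (Suc M) \<le> cmod t" using a b by linarith
    then show ?thesis
      by cases (use t(2) lev_le_iff[of t l0] le_lev_iff[of t l2] e0 in \<open>auto simp: l1_def\<close>)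
  qed
  have cw: "cmod w = rad M" unfolding w_def using r0[of "cval (int M)"] r0M by (simp add: cmod_cval_nat)
  have w0: "w \<noteq> 0" using cw rad_pos[of M] by auto
  have levw: "lev w = l1" using cw by (simp add: l1_def)
  define lm where "lm = (l0 + l1) / 2"
  have lm: "l0 < lm" "lm < l1" using l01 by (auto simp: lm_def)
  define d where "d = (l1 + l2) / 2"
  have d: "l1 < d" "d < l2" using l01 by (auto simp: d_def)
  \<comment> \<open>A direction without small tips, so that the slit can be followed radially up to level \<open>l1\<close>.\<close>
  define B where "B = {t \<in> tips \<phi>. t \<in> cball 0 (rad N)}"
  have fB: "finite B" unfolding B_def by (rule finite_tips_bounded[OF hom(1)]) simp
  obtain y where y: "pi / 2 < y" "y < pi" "\<And>x. exp (Complex x y) \<notin> B"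
    by (rule generic_direction[OF fB, of "pi / 2" pi]) auto
  obtain e1 where e1: "e1 > 0" "\<And>u. \<bar>Im u - y\<bar> < e1 \<Longrightarrow> exp u \<notin> B" using thin_sector_avoids[OF fB y(3)] by blast
  have line_free: "exp u \<notin> tips \<phi>" if "1 < Re u" "Re u < l1" "\<bar>Im u - y\<bar> < e1" for u
  proof
    assume u: "exp u \<in> tips \<phi>"
    then have "Re u \<le> l0" using tf2[OF u] that(2) l01 by auto
    then have "exp u \<in> B" using u by (simp add: B_def e0(1)[symmetric])
    then show False using e1(2)[OF that(3)] by simp
  qed
  have tf1: "ann 1 (12/5) \<inter> tips \<phi> = {}" by (rule gap_ann[OF hom(3)]) auto
  have in1: "Complex (11/5) x \<in> strip 1 (12/5)" for x by (simp add: strip_def)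
  obtain LR where LR: "continuous_on (strip 1 (12/5)) LR" "LR (Complex (11/5) \<theta>) = aR"
    "\<And>u. u \<in> strip 1 (12/5) \<Longrightarrow> ?F (LR u) = exp u"
    using strip_lift[OF hom(1) tf1 in1 A(3)] by blast
  obtain sR where sR: "continuous_on {1<..<l1} sR" "sR (11/5) = LR (Complex (11/5) y)"
    "\<And>x. x \<in> {1<..<l1} \<Longrightarrow> ?F (sR x) = exp (Complex x y)"
    by (rule lift_line[OF hom(1) e1(1) line_free _ _ LR(3)[OF in1]]) (use l0 l01 in auto)
  have "sR lm \<in> central M"
  proof -
    have "sR ` {1<..<l1} \<union> (\<lambda>x. LR (Complex (11/5) x)) ` UNIV \<subseteq> central M"
      unfolding central_def
    proof (rule component_superset)
      show "connected (sR ` {1<..<l1} \<union> (\<lambda>x. LR (Complex (11/5) x)) ` UNIV)"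
      proof (rule connected_Un)
        show "connected (sR ` {1<..<l1})" by (intro connected_continuous_image sR) auto
        show "connected ((\<lambda>x. LR (Complex (11/5) x)) ` UNIV)"
          by (intro connected_continuous_image continuous_on_compose2[OF LR(1)] continuous_intros) (auto simp: in1)
        have "sR (11/5) \<in> sR ` {1<..<l1}" using l0 l01 by auto
        then show "sR ` {1<..<l1} \<inter> (\<lambda>x. LR (Complex (11/5) x)) ` UNIV \<noteq> {}" using sR(2) by auto
      qed
      have "cmod (?F (sR x)) < exp l1" if "x \<in> {1<..<l1}" for x using sR(3)[OF that] that by simp
      moreover have "cmod (?F (LR (Complex (11/5) x))) < exp l1" for x using LR(3)[OF in1] l0 l01 by simp
      ultimately show "sR ` {1<..<l1} \<union> (\<lambda>x. LR (Complex (11/5) x)) ` UNIV \<subseteq> {z. cmod (expid z) < rad M}"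
        using lessM e0(2) by auto
      show "aR \<in> sR ` {1<..<l1} \<union> (\<lambda>x. LR (Complex (11/5) x)) ` UNIV" using LR(2) by auto
      show "aR \<in> component {z. cmod (expid z) < rad M} 0" using N(1) A(2) unfolding central_def M_def by blast
    qed
    moreover have "lm \<in> {1<..<l1}" using lm l0 by auto
    ultimately show ?thesis by blast
  qed
  then obtain L uc where L: "continuous_on (strip l0 l1) L" "L (Complex lm y) = sR lm"
    "\<And>u. u \<in> strip l0 l1 \<Longrightarrow> ?F (L u) = exp u"
    "exp uc = w" "Re uc = l1" "(L \<longlongrightarrow> ?c) (at uc within strip l0 l1)"
    using spiral_to_tip[OF hom(1) r0 r0N M_def l0_def l1_def, of "sR lm" "Complex lm y"] sR(3)[of lm] lm l0
    unfolding w_def by (auto simp: strip_def)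
  \<comment> \<open>The lift arrives at angle \<open>Im uc\<close>; the twist turns this angle into \<open>y\<close>, the direction of the slit.\<close>
  define \<tau> where "\<tau> l = (y - Im uc) * max 0 (min 1 ((l - lm) / (l1 - lm)))" for l
  have c\<tau>: "continuous_on UNIV \<tau>" unfolding \<tau>_def using lm by (intro continuous_intros) auto
  have \<tau>0: "\<tau> l = 0" if "l \<le> lm" for l
  proof -
    have "(l - lm) / (l1 - lm) \<le> 0" using that lm by (simp add: divide_nonpos_pos)
    then show ?thesis by (simp add: \<tau>_def)
  qed
  have \<tau>1: "\<tau> l1 = y - Im uc" using lm by (simp add: \<tau>_def)
  have uc: "uc = Complex l1 (y - \<tau> l1)" using L(5) \<tau>1 by (simp add: complex_eq_iff)
  obtain T Ti where T: "homeomorphism UNIV UNIV T Ti" "plane_homeo T" "\<And>w. lev w \<le> 3 \<Longrightarrow> T w = w"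
    "\<And>w. 3 < lev w \<Longrightarrow> 3 < lev (T w)" "\<And>w. d \<le> lev w \<Longrightarrow> lev (T w) = lev w"
    "\<And>u. T (exp u) = exp (Complex (inw 3 (31/10) l1 d 1 (Re u)) (Im u + \<tau> (Re u)))"
    by (rule twist_push[of \<tau> lm l1 d, OF c\<tau> \<tau>0]) (use lm l0 d in auto)
  have par: "3 < (31/10::real)" "31/10 < l1" "l1 < d" using l0 l01 d by auto
  have o31: "outw 3 (31/10) l1 d 1 (31/10) = l1" by (rule outw_1[OF par])
  have i31: "inw 3 (31/10) l1 d 1 l1 = 31/10" using outw_inw(2)[OF par, of 1 "31/10"] o31 by simp
  have ereal: "lens y e 0 = exp (Complex (31/10) y)" for e by (simp add: lens_def)
  have Tw: "T w = exp (Complex (31/10) y)"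
    using T(6)[of uc] L(4) uc by (simp add: i31)
  define B2 where "B2 = {t \<in> tips (T \<circ> \<phi>). t \<in> cball 0 (exp 5)} - {T w}"
  have fB2: "finite B2" unfolding B2_def
    using finite_tips_bounded[OF homeomorphism_compose[OF hom(1) T(1)], of "cball 0 (exp 5)"] by simp
  have "exp (Complex x y) \<notin> B2" for x
  proof
    assume a: "exp (Complex x y) \<in> B2"
    then obtain t where t: "t \<in> tips \<phi>" "exp (Complex x y) = T t" "t \<noteq> w" unfolding B2_def by auto
    have x5: "x \<le> 5" using a by (simp add: B2_def)
    have T0: "T 0 = 0" using T(3)[of 0] by simp
    have t0: "t \<noteq> 0" using t(2) T0 by auto
    have "lev (T t) = x" using t(2) by (metis complex.sel(1) lev_exp)
    then have "\<not> d \<le> lev t" using T(5)[of t] x5 l0 l01 d by auto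
    then consider "lev t \<le> l0" | "lev t = l1" using tf2[OF t(1) t0] d by linarith
    then show False
    proof cases
      case 1
      have te: "t = exp (Ln t)" using t0 by simp
      have R: "Re (Ln t) = lev t" using t0 by simp
      have "T t = exp (Complex (inw 3 (31/10) l1 d 1 (lev t)) (Im (Ln t)))"
        using T(6)[of "Ln t"] te R \<tau>0[of "lev t"] 1 lm by simp
      then have "exp (Complex x y) = exp (Complex (inw 3 (31/10) l1 d 1 (lev t)) (Im (Ln t)))" using t(2) by simp
      then obtain n :: int where "Complex x y = Complex (inw 3 (31/10) l1 d 1 (lev t)) (Im (Ln t)) + (of_int (2 * n) * pi) * \<i>"
        by (metis exp_eq)
      then have "Complex (lev t) y = Ln t + (of_int (2 * n) * pi) * \<i>" using R by (simp add: complex_eq_iff)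
      then have "exp (Complex (lev t) y) = exp (Ln t)" by (metis exp_eq)
      then have "exp (Complex (lev t) y) = t" using te by simp
      moreover have "t \<in> B" using t(1) 1 t0 lev_le_iff[of t l0] e0 by (simp add: B_def)
      ultimately show False using y(3) by metis
    next
      case 2
      have te: "t = exp (Ln t)" using t0 by simp
      have R: "Re (Ln t) = l1" using t0 2 by simp
      have "T t = exp (Complex (31/10) (Im (Ln t) + \<tau> l1))" using T(6)[of "Ln t"] te R i31 by simp
      then have "exp (Complex x y) = exp (Complex (31/10) (Im (Ln t) + \<tau> l1))" using t(2) by simp
      then obtain n :: int where n: "Complex x y = Complex (31/10) (Im (Ln t) + \<tau> l1) + (of_int (2 * n) * pi) * \<i>"
        by (metis exp_eq)
      then have "x = 31/10" by (simp add: complex_eq_iff)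
      then have "T t = T w" unfolding t(2)[symmetric] Tw by (simp only:)
      then show False using t(3) homeo_UNIV(1)[OF T(1)] by metis
    qed
  qed
  then obtain e2 where e2: "e2 > 0" "\<And>u. \<bar>Im u - y\<bar> < e2 \<Longrightarrow> exp u \<notin> B2" using thin_sector_avoids[OF fB2] by blast
  define e where "e = min (1/8) (min e2 ((y - pi / 2) / 2))"
  have e: "0 < e" "e < 1/4" "e \<le> e2" "e < y - pi / 2" using e2 y(1) by (auto simp: e_def min_def)
  let ?V = "lens y e ` ball 0 1"
  have oV: "open ?V" 
  proof (rule lens_homeo[of e y])
    fix h' assume "\<And>U. open U \<Longrightarrow> U \<subseteq> ball 0 1 \<Longrightarrow> open (lens y e ` U)"
    from this[OF open_ball subset_refl] show "open ?V" .
  qed (use e in auto)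
  have onlytip: "t = lens y e 0" if t: "t \<in> tips (T \<circ> \<phi>)" "t \<in> ?V" for t
  proof (rule ccontr)
    assume ne: "t \<noteq> lens y e 0"
    obtain \<zeta> where \<zeta>: "t = lens y e \<zeta>" "cmod \<zeta> < 1" using t(2) by auto
    have b: "\<bar>Re \<zeta>\<bar> < 1" "\<bar>Im \<zeta>\<bar> < 1" using abs_Re_le_cmod[of \<zeta>] abs_Im_le_cmod[of \<zeta>] \<zeta>(2) by auto
    have "cmod t \<le> exp 5" using b by (simp add: \<zeta>(1) lens_def)
    then have "t \<in> B2" using t(1) ne Tw ereal by (simp add: B2_def)
    moreover have "\<bar>e * Im \<zeta>\<bar> < e2"
    proof -
      have "\<bar>e * Im \<zeta>\<bar> = e * \<bar>Im \<zeta>\<bar>" using e by (simp add: abs_mult)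
      also have "\<dots> < e * 1" using b e by (intro mult_strict_left_mono) auto
      finally show ?thesis using e by simp
    qed
    ultimately show False using e2(2)[of "Complex (31/10 + 19/10 * Re \<zeta>) (y + e * Im \<zeta>)"] \<zeta>(1) by (simp add: lens_def)
  qed
  define lf where "lf x = outw 3 (31/10) l1 d 1 (31/10 + 19/10 * x)" for x
  have clf: "continuous_on UNIV lf" unfolding lf_def by (intro continuous_on_outw_inw par continuous_intros) auto
  have lf0: "lf 0 = l1" using o31 by (simp add: lf_def)
  have lfin: "1 < lf x \<and> lf x < l1" if "x \<in> {-1<..<0}" for x
    using outw_ge[of "31/10 + 19/10 * x" 3 "31/10" l1 d 1] outw_strict_mono[OF par, of 1 "31/10 + 19/10 * x" "31/10"] that o31
    by (simp add: lf_def)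
  have lfq: "lf (-(9/19)) = 11/5" using outw_fix[OF par, of 1 "11/5"] by (simp add: lf_def)
  have TV: "T (exp (Complex (lf x) (y - \<tau> (lf x)))) \<in> ?V" if "x \<in> {-1<..<0}" for x
  proof -
    have "T (exp (Complex (lf x) (y - \<tau> (lf x)))) = lens y e (of_real x)"
      using outw_inw(2)[OF par, of 1 "31/10 + 19/10 * x"] by (simp add: T(6) lens_real lf_def)
    then show ?thesis using that by (intro image_eqI[of _ _ "of_real x"]) auto
  qed
  have TcV: "T (?F ?c) \<in> ?V"
  proof -
    have "T (?F ?c) = lens y e 0" using Tw ereal by (simp add: expid_cpt w_def)
    then show ?thesis by (intro image_eqI[of _ _ 0]) auto
  qed
  have l03: "3 < l0" using l0 by simp
  have reach: "s (11/5) \<in> component {z. T (?F z) \<in> ?V} ?c"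
    if "continuous_on (strip l0 l1) K" "\<And>u. u \<in> strip l0 l1 \<Longrightarrow> ?F (K u) = exp u"
      "(K \<longlongrightarrow> ?c) (at uc within strip l0 l1)" "continuous_on {1<..<l1} s"
      "\<And>l. l \<in> {1<..<l1} \<Longrightarrow> ?F (s l) = exp (Complex l y)" "s lm = K (Complex lm y)" for K s
    by (rule lens_reached[OF hom(1) T(1) tf that(1-5) l03 lm that(6) c\<tau> \<tau>0 uc clf lf0 lfin lfq TV oV TcV])
  have R: "LR (Complex (11/5) y) \<in> component {z. T (?F z) \<in> ?V} ?c"
    using reach[OF L(1,3,6) sR(1,3)] L(2) sR(2) by simp
  \<comment> \<open>Beyond the critical point \<open>expid\<close> is injective on a whole component, so the lift has period \<open>2\<pi>i\<close>.\<close>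
  obtain K where K: "continuous_on (strip l0 l1) K" "\<And>u. u \<in> strip l0 l1 \<Longrightarrow> K u \<notin> central M"
    "\<And>u. u \<in> strip l0 l1 \<Longrightarrow> ?F (K u) = exp u" "(K \<longlongrightarrow> ?c) (at uc within strip l0 l1)"
    using spiral_outside[OF hom(1) r0 r0N M_def l0_def l1_def] L(4) unfolding w_def by blast
  have inm: "Complex lm y \<in> strip l0 l1" using lm by (simp add: strip_def)
  obtain sX where sX: "continuous_on {1<..<l1} sX" "sX lm = K (Complex lm y)"
    "\<And>x. x \<in> {1<..<l1} \<Longrightarrow> ?F (sX x) = exp (Complex x y)"
    by (rule lift_line[of \<phi> \<phi>i e1 1 l1 y, OF hom(1) e1(1) line_free _ _ K(3)[OF inm]]) (use lm l0 l01 in auto)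
  have "11/5 \<in> {1<..<l1}" using l0 l01 by auto
  then obtain LX where LX: "continuous_on (strip 1 (12/5)) LX" "LX (Complex (11/5) y) = sX (11/5)"
    "\<And>u. u \<in> strip 1 (12/5) \<Longrightarrow> ?F (LX u) = exp u"
    using strip_lift[OF hom(1) tf1 in1 sX(3)] by blast
  have X: "LX (Complex (11/5) y) \<in> component {z. T (?F z) \<in> ?V} ?c"
    using reach[OF K(1,3,4) sX(1,3,2)] LX(2) by simp
  let ?D = "component {z. cmod (expid z) < rad M} (K (Complex lm y))"
  have KD: "cmod (expid (K (Complex lm y))) < rad M"
    using K(3)[OF inm] lm lessM[of "K (Complex lm y)"] by (simp add: e0(2)[symmetric])
  have injD: "inj_on expid ?D" by (rule inj_on_noncentral[OF KD K(2)[OF inm]])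
  have LXD: "LX ` strip 1 (12/5) \<subseteq> ?D"
  proof -
    have "sX ` {1<..<l1} \<union> LX ` strip 1 (12/5) \<subseteq> ?D"
    proof (rule component_superset)
      show "connected (sX ` {1<..<l1} \<union> LX ` strip 1 (12/5))"
      proof (rule connected_Un)
        show "connected (sX ` {1<..<l1})" by (intro connected_continuous_image sX) auto
        show "connected (LX ` strip 1 (12/5))" by (intro connected_continuous_image LX convex_connected convex_strip)
        show "sX ` {1<..<l1} \<inter> LX ` strip 1 (12/5) \<noteq> {}"
          using \<open>11/5 \<in> {1<..<l1}\<close> in1[of y] LX(2) by (metis IntI empty_iff imageI)
      qed
      have "cmod (?F (sX x)) < exp l1" if "x \<in> {1<..<l1}" for x using sX(3)[OF that] that by simp
      moreover have "cmod (?F (LX u)) < exp l1" if "u \<in> strip 1 (12/5)" for u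
        using LX(3)[OF that] that l0 l01 by (simp add: strip_def)
      ultimately show "sX ` {1<..<l1} \<union> LX ` strip 1 (12/5) \<subseteq> {z. cmod (expid z) < rad M}"
        using lessM e0(2) by auto
      show "K (Complex lm y) \<in> sX ` {1<..<l1} \<union> LX ` strip 1 (12/5)"
        using sX(2) lm l0 by (intro UnI1 image_eqI[of _ _ lm]) auto
      show "K (Complex lm y) \<in> ?D" using KD by simp
    qed
    then show ?thesis by blast
  qed
  have per: "LX (u + 2 * pi * \<i>) = LX u" if u: "u \<in> strip 1 (12/5)" for u
  proof -
    have u2: "u + 2 * pi * \<i> \<in> strip 1 (12/5)" using u by (simp add: strip_def)
    have "\<phi> (expid (LX (u + 2 * pi * \<i>))) = \<phi> (expid (LX u))" using LX(3)[OF u] LX(3)[OF u2] by (simp add: exp_add)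
    then have "expid (LX (u + 2 * pi * \<i>)) = expid (LX u)" using homeo_UNIV(1)[OF hom(1)] by metis
    then show ?thesis using injD LXD u u2 by (meson image_subset_iff inj_onD)
  qed
  have notA: "LX (Complex (11/5) \<theta>) \<notin> A"
  proof
    assume "LX (Complex (11/5) \<theta>) \<in> A"
    then have "LX (Complex (11/5) \<theta>) \<in> central M" using N(1) by (auto simp: M_def)
    then have c: "connected_component {z. cmod (expid z) < rad M} 0 (LX (Complex (11/5) \<theta>))" by (simp add: central_def)
    have "connected_component {z. cmod (expid z) < rad M} (K (Complex lm y)) (LX (Complex (11/5) \<theta>))"
      using LXD in1 by blast
    then have "K (Complex lm y) \<in> central M" unfolding central_def
      using connected_component_trans[OF c connected_component_sym] by simp
    then show False using K(2)[OF inm] by simp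
  qed
  show ?thesis
    by (rule that[OF T(1-4) y(1,2) e(1,2,4) _ onlytip LR(1,3,2) R LX(1,3) per X notA])
       (use Tw ereal in \<open>simp_all add: w_def\<close>)
qed

section \<open>Pulling a critical value across the circle\<close>

text \<open>
  Such a section would extend to the critical point and be an open embedding, so
  \<open>expid\<close> would be injective near a zero of its derivative.
\<close>

lemma no_section_over_punctured_disc:
  fixes \<phi> \<phi>i h h' g :: "complex \<Rightarrow> complex"
  assumes hom: "homeomorphism UNIV UNIV \<phi> \<phi>i" and V: "open V" "bounded V" and h: "homeomorphism (ball 0 1) V h h'"
    and p: "p \<in> ball 0 1" and only: "\<And>z. z \<in> component {z. \<phi> (expid z) \<in> V} (cpt k) \<Longrightarrow> \<phi> (expid z) = h p \<Longrightarrow> z = cpt k"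
    and tip: "\<phi> (expid (cpt k)) = h p"
    and g: "continuous_on (ball 0 1 - {p}) g" "\<And>x. x \<in> ball 0 1 - {p} \<Longrightarrow> \<phi> (expid (g x)) = h x"
      "\<And>x. x \<in> ball 0 1 - {p} \<Longrightarrow> g x \<in> component {z. \<phi> (expid z) \<in> V} (cpt k)"
  shows False
proof -
  let ?B = "ball (0::complex) 1" let ?c = "cpt k"
  define G where "G x = (if x = p then ?c else g x)" for x
  have hB: "h ` ?B = V" "continuous_on ?B h" using h by (auto simp: homeomorphism_def)
  have hp: "h p \<in> V" using hB p by blast
  have FG: "\<phi> (expid (G x)) = h x" if "x \<in> ?B" for x using that g(2) tip by (simp add: G_def)
  have "isCont G x" if x: "x \<in> ?B" for x
  proof (cases "x = p")
    case True
    have ev: "\<forall>\<^sub>F x in at p. x \<in> ?B - {p}" using p eventually_at_in_open[OF open_ball, of p 0 1] by simp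
    have "(g \<longlongrightarrow> ?c) (at p)"
    proof (rule tendsto_in_component[OF hom V hp only])
      show "\<forall>\<^sub>F x in at p. g x \<in> component {z. \<phi> (expid z) \<in> V} ?c" using ev by eventually_elim (rule g(3))
      have "(h \<longlongrightarrow> h p) (at p)" using hB(2) p by (simp add: continuous_on_eq_continuous_at isContD)
      moreover have "\<forall>\<^sub>F x in at p. \<phi> (expid (g x)) = h x" using ev by eventually_elim (rule g(2))
      ultimately show "((\<lambda>x. \<phi> (expid (g x))) \<longlongrightarrow> h p) (at p)" by (simp add: tendsto_cong)
    qed
    moreover have "\<forall>\<^sub>F x in at p. G x = g x" using ev by eventually_elim (simp add: G_def)
    ultimately show ?thesis using True by (simp add: isCont_def tendsto_cong G_def)
  next
    case False
    have o: "open (?B - {p})" by auto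
    have xB: "x \<in> ?B - {p}" using x False by simp
    have "isCont g x" using g(1) xB unfolding continuous_on_eq_continuous_at[OF o] by (rule bspec)
    moreover have "\<forall>\<^sub>F u in nhds x. G u = g u"
      using eventually_nhds_in_open[OF o xB] by eventually_elim (simp add: G_def)
    ultimately show ?thesis by (simp add: isCont_cong)
  qed
  then have cG: "continuous_on ?B G" by (intro continuous_at_imp_continuous_on) auto
  have hinj: "x = y" if "x \<in> ?B" "y \<in> ?B" "h x = h y" for x y
    using homeomorphism_apply1[OF h] that by metis
  have "inj_on G ?B" by (rule inj_onI) (use FG hinj in metis)
  then have "open (G ` ?B)" using cG by (intro invariance_of_domain) auto
  moreover have "inj_on expid (G ` ?B)"
  proof (rule inj_onI)
    fix a b assume "a \<in> G ` ?B" "b \<in> G ` ?B" "expid a = expid b"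
    then obtain x y where "x \<in> ?B" "y \<in> ?B" "a = G x" "b = G y" "h x = h y" using FG by (metis imageE)
    then show "a = b" using hinj by metis
  qed
  moreover have "?c \<in> G ` ?B" using p by (intro image_eqI[of _ _ p]) (simp_all add: G_def)
  ultimately have "deriv expid ?c \<noteq> 0" using holomorphic_injective_imp_regular[OF holomorphic_on_expid] by blast
  moreover have "deriv expid ?c = exp ?c + 1" by (intro DERIV_imp_deriv expid_has_field_derivative)
  moreover have "exp ?c + 1 = 0" using expid_crit_iff by blast
  ultimately show False by simp
qed

text \<open>
  The part of the lens in which the tip is moved. It reaches down to level 27/20, and around it
  there remains a margin of the lens through which lifts can be compared before and after the
  move.
\<close>

definition slot :: "real \<Rightarrow> real \<Rightarrow> complex set" where
  "slot y e = lens y e ` {\<zeta> \<in> ball 0 1. -35/38 < Re \<zeta> \<and> \<bar>Im \<zeta>\<bar> < 1/4}"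

lemma convex_slot_coords: "convex {\<zeta> \<in> ball 0 1. -35/38 < Re \<zeta> \<and> \<bar>Im \<zeta>\<bar> < 1/4}"
proof -
  have "{\<zeta> \<in> ball 0 1. -35/38 < Re \<zeta> \<and> \<bar>Im \<zeta>\<bar> < 1/4} = ball 0 1 \<inter> {\<zeta>. Re \<zeta> > -35/38} \<inter> {\<zeta>. Im \<zeta> < 1/4} \<inter> {\<zeta>. Im \<zeta> > -1/4}" by auto
  then show ?thesis
    by (simp only: convex_Int convex_ball convex_halfspace_Re_gt convex_halfspace_Im_lt convex_halfspace_Im_gt)
qed

lemma slot_angle:
  assumes e: "0 < e" "exp (Complex l t) \<in> slot y e"
  shows "\<exists>n::int. \<bar>t - y - 2 * pi * of_int n\<bar> < e / 4"
proof -
  obtain \<zeta> where z: "\<bar>Im \<zeta>\<bar> < 1/4" "exp (Complex l t) = exp (Complex (31/10 + 19/10 * Re \<zeta>) (y + e * Im \<zeta>))"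
    using e(2) by (auto simp: slot_def lens_def)
  then obtain n :: int where n: "Complex l t = Complex (31/10 + 19/10 * Re \<zeta>) (y + e * Im \<zeta>) + (of_int (2 * n) * pi) * \<i>"
    by (metis exp_eq)
  have "t - y - 2 * pi * of_int n = e * Im \<zeta>" using arg_cong[OF n, of Im] by simp
  moreover have "\<bar>e * Im \<zeta>\<bar> < e * (1/4)" unfolding abs_mult using z(1) e(1) by (simp add: mult_strict_left_mono)
  ultimately show ?thesis by (intro exI[of _ n]) simp
qed

lemma not_in_slot:
  assumes "0 < e" "y + e / 4 \<le> t" "t \<le> y + 2 * pi - e / 4"
  shows "exp (Complex l t) \<notin> slot y e" "exp (Complex l (t - 2 * pi)) \<notin> slot y e" "exp (Complex l (t + 2 * pi)) \<notin> slot y e"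
proof -
  have a: "exp (Complex l t) \<notin> slot y e"
  proof
    assume "exp (Complex l t) \<in> slot y e"
    then obtain n :: int where n: "\<bar>t - y - 2 * pi * of_int n\<bar> < e / 4" using slot_angle[OF assms(1)] by blast
    consider "n \<le> 0" | "1 \<le> n" by linarith
    then show False
    proof cases
      case 1
      then have "pi * real_of_int n \<le> 0" by (simp add: mult_nonneg_nonpos)
      then show False using n assms by linarith
    next
      case 2
      then have "pi * 1 \<le> pi * real_of_int n" by (intro mult_left_mono) auto
      then show False using n assms by linarith
    qed
  qed
  moreover have "exp (Complex l (t + 2 * pi)) = exp (Complex l t)" for t
    by (rule complex_eqI) (simp_all add: Re_exp Im_exp)
  moreover from this[of "t - 2 * pi"] have "exp (Complex l (t - 2 * pi)) = exp (Complex l t)" by simp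
  ultimately show "exp (Complex l t) \<notin> slot y e" "exp (Complex l (t - 2 * pi)) \<notin> slot y e" "exp (Complex l (t + 2 * pi)) \<notin> slot y e"
    by auto
qed

lemma not_in_slot_inj:
  assumes "0 < e" "e \<le> 1" "\<zeta> \<in> ball 0 1" "Re \<zeta> \<le> -35/38 \<or> 1/4 \<le> \<bar>Im \<zeta>\<bar>"
  shows "lens y e \<zeta> \<notin> slot y e"
proof (rule lens_homeo[OF assms(1,2), of y])
  assume inj: "inj_on (lens y e) (ball 0 1)"
  show ?thesis
  proof
    assume "lens y e \<zeta> \<in> slot y e"
    then obtain x where x: "lens y e \<zeta> = lens y e x" "x \<in> ball 0 1" "-35/38 < Re x" "\<bar>Im x\<bar> < 1/4" unfolding slot_def by auto
    then have "\<zeta> = x" using inj assms(3) by (meson inj_onD)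
    then show False using x assms(4) by auto
  qed
qed

lemma small_ball: "(a::real)\<^sup>2 + b\<^sup>2 < 1 \<Longrightarrow> Complex a b \<in> ball 0 1"
  using real_sqrt_less_mono[of "a\<^sup>2 + b\<^sup>2" 1] by (simp add: cmod_def)

text \<open>
  Going around the tip interchanges the two sheets. If the lift \<open>s1\<close> that passes
  the tip on the right agreed at both ends with the lift \<open>sL\<close> that passes it on the
  left, then the lifts over four half discs would fit together to a section over the punctured
  disc.
\<close>

lemma sheets_swap:
  fixes \<phi> \<phi>i sL s1 :: "complex \<Rightarrow> complex"
  defines "X \<equiv> {\<zeta> \<in> ball 0 1. Re \<zeta> < 0 \<and> (Re \<zeta> \<le> -35/38 \<or> 1/4 \<le> \<bar>Im \<zeta>\<bar>)}" and "p \<equiv> Complex (-16/19) 0"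
    and "q1 \<equiv> Complex (-9/19) (-3/8)" and "q2 \<equiv> Complex (-9/19) (3/8)"
  assumes hom: "homeomorphism UNIV UNIV \<phi> \<phi>i" and e: "0 < e" "e \<le> 1"
    and tip: "\<phi> (cval k) = lens y e p" "\<And>t. t \<in> tips \<phi> \<Longrightarrow> t \<in> lens y e ` ball 0 1 \<Longrightarrow> t = lens y e p"
    and only: "\<And>z. z \<in> component {z. \<phi> (expid z) \<in> lens y e ` ball 0 1} (cpt k) \<Longrightarrow> \<phi> (expid z) = lens y e p \<Longrightarrow> z = cpt k"
    and sL: "continuous_on X sL" "\<And>\<zeta>. \<zeta> \<in> X \<Longrightarrow> \<phi> (expid (sL \<zeta>)) = lens y e \<zeta>"
      "sL q1 \<in> component {z. \<phi> (expid z) \<in> lens y e ` ball 0 1} (cpt k)"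
    and s1: "continuous_on {\<zeta> \<in> ball 0 1. Re \<zeta> > Re p} s1" "\<And>\<zeta>. \<zeta> \<in> ball 0 1 \<Longrightarrow> Re \<zeta> > Re p \<Longrightarrow> \<phi> (expid (s1 \<zeta>)) = lens y e \<zeta>"
      "s1 q1 = sL q1"
  shows "s1 q2 \<noteq> sL q2"
proof
  assume eq2: "s1 q2 = sL q2"
  let ?B = "ball (0::complex) 1" let ?h = "lens y e" let ?V = "?h ` ?B"
  obtain h' where h': "homeomorphism ?B ?V ?h h'" "\<And>U. open U \<Longrightarrow> U \<subseteq> ?B \<Longrightarrow> open (?h ` U)" "bounded ?V"
    "inj_on ?h ?B" "continuous_on UNIV ?h"
    using lens_homeo[OF e] by metis
  have p: "p \<in> ?B" unfolding p_def by (rule small_ball) (simp add: power2_eq_square)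
  have qB: "q1 \<in> ?B" "q2 \<in> ?B" unfolding q1_def q2_def by (rule small_ball; simp add: power2_eq_square)+
  have nt: "?h \<zeta> \<notin> tips \<phi>" if "\<zeta> \<in> ?B" "\<zeta> \<noteq> p" for \<zeta>
    using tip(2)[of "?h \<zeta>"] that p h'(4) unfolding inj_on_def by blast
  have lift: "\<exists>s. continuous_on W s \<and> s a = z \<and> (\<forall>\<zeta>\<in>W. \<phi> (expid (s \<zeta>)) = ?h \<zeta>)"
    if W: "open W" "convex W" "W \<subseteq> ?B - {p}" "a \<in> W" "\<phi> (expid z) = ?h a" for W a z
  proof (rule lift_tipfree[OF hom, of "?h ` W" W a ?h z])
    show "open (?h ` W)" using W by (intro h') auto
    have "continuous_on W ?h" using h'(5) by (rule continuous_on_subset) simp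
    then show "continuous_on W ?h" "connected (?h ` W)" using W(2) by (auto intro: connected_continuous_image convex_connected)
    show "bounded (?h ` W)" using h'(3) by (rule bounded_subset) (use W(3) in auto)
    show "?h ` W \<inter> tips \<phi> = {}" using nt W(3) by blast
  qed (use W in auto)
  have uniq: "s \<zeta> = s' \<zeta>" if W: "convex W" "W \<subseteq> ?B - {p}" "continuous_on W s" "continuous_on W s'"
      "\<And>\<zeta>. \<zeta> \<in> W \<Longrightarrow> \<phi> (expid (s \<zeta>)) = ?h \<zeta>" "\<And>\<zeta>. \<zeta> \<in> W \<Longrightarrow> \<phi> (expid (s' \<zeta>)) = ?h \<zeta>" "a \<in> W" "s a = s' a" "\<zeta> \<in> W" for W s s' a \<zeta>
  proof (rule lift_unique[OF hom convex_connected[OF W(1)] W(3,4) _ _ W(7,8,9)])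
    fix u assume u: "u \<in> W"
    show "\<phi> (expid (s u)) = \<phi> (expid (s' u))" using W(5)[OF u] W(6)[OF u] by simp
    have "u \<in> ?B" "u \<noteq> p" using W(2) u by blast+
    then show "\<phi> (expid (s u)) \<notin> tips \<phi>" unfolding W(5)[OF u] by (rule nt)
  qed
  define W1 W2 W3 W4 where "W1 = ?B \<inter> {\<zeta>. Re \<zeta> > -16/19}" and "W2 = ?B \<inter> {\<zeta>. Im \<zeta> < 0}"
    and "W3 = ?B \<inter> {\<zeta>. Im \<zeta> > 0}" and "W4 = ?B \<inter> {\<zeta>. Re \<zeta> < -16/19}"
  note Wd = W1_def W2_def W3_def W4_def
  have oW: "open W1" "open W2" "open W3" "open W4" unfolding Wd
    by (intro open_Int open_ball open_halfspace_Re_gt open_halfspace_Re_lt open_halfspace_Im_gt open_halfspace_Im_lt)+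
  have cW: "convex W1" "convex W2" "convex W3" "convex W4" unfolding Wd
    by (intro convex_Int convex_ball convex_halfspace_Re_gt convex_halfspace_Re_lt convex_halfspace_Im_gt convex_halfspace_Im_lt)+
  have Wp: "W1 \<subseteq> ?B - {p}" "W2 \<subseteq> ?B - {p}" "W3 \<subseteq> ?B - {p}" "W4 \<subseteq> ?B - {p}" by (auto simp: Wd p_def)
  have s1W: "continuous_on W1 s1" "\<And>\<zeta>. \<zeta> \<in> W1 \<Longrightarrow> \<phi> (expid (s1 \<zeta>)) = ?h \<zeta>"
    using s1(1,2) by (auto simp: W1_def p_def Int_def)
  have qX: "q1 \<in> X" "q2 \<in> X" using qB by (auto simp: X_def q1_def q2_def)
  have qW: "q1 \<in> W1" "q1 \<in> W2" "q2 \<in> W1" "q2 \<in> W3" using qB by (auto simp: Wd q1_def q2_def)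
  obtain s2 where s2: "continuous_on W2 s2" "s2 q1 = sL q1" "\<And>\<zeta>. \<zeta> \<in> W2 \<Longrightarrow> \<phi> (expid (s2 \<zeta>)) = ?h \<zeta>"
    using lift[OF oW(2) cW(2) Wp(2) qW(2) sL(2)[OF qX(1)]] by blast
  obtain s3 where s3: "continuous_on W3 s3" "s3 q2 = sL q2" "\<And>\<zeta>. \<zeta> \<in> W3 \<Longrightarrow> \<phi> (expid (s3 \<zeta>)) = ?h \<zeta>"
    using lift[OF oW(3) cW(3) Wp(3) qW(4) sL(2)[OF qX(2)]] by blast
  \<comment> \<open>Points of the disc to the left of the slot, with imaginary parts beyond those of the slot.\<close>
  define m1 m2 where "m1 = Complex (-355/380) (-3/10)" and "m2 = Complex (-355/380) (3/10)"
  have mB: "m1 \<in> ?B" "m2 \<in> ?B" unfolding m1_def m2_def by (rule small_ball; simp add: power2_eq_square)+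
  have mX: "m1 \<in> X" "m1 \<in> W4" "m2 \<in> X" "m2 \<in> W4" "m1 \<in> W2" "m2 \<in> W3" using mB by (auto simp: X_def Wd m1_def m2_def)
  obtain s4 where s4: "continuous_on W4 s4" "s4 m1 = sL m1" "\<And>\<zeta>. \<zeta> \<in> W4 \<Longrightarrow> \<phi> (expid (s4 \<zeta>)) = ?h \<zeta>"
    using lift[OF oW(4) cW(4) Wp(4) mX(2) sL(2)[OF mX(1)]] by blast
  have a12: "s1 \<zeta> = s2 \<zeta>" if "\<zeta> \<in> W1 \<inter> W2" for \<zeta>
    by (rule uniq[of "W1 \<inter> W2" s1 s2 q1]) (use that cW Wp s1W s2 s1(3) qW in \<open>auto intro: convex_Int continuous_on_subset\<close>)
  have a13: "s1 \<zeta> = s3 \<zeta>" if "\<zeta> \<in> W1 \<inter> W3" for \<zeta>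
    by (rule uniq[of "W1 \<inter> W3" s1 s3 q2]) (use that cW Wp s1W s3 eq2 qW in \<open>auto intro: convex_Int continuous_on_subset\<close>)
  have L2: "s2 m1 = sL m1"
    by (rule uniq[of "?B \<inter> {\<zeta>. Re \<zeta> < 0} \<inter> {\<zeta>. Im \<zeta> < -1/4}" s2 sL q1])
       (use s2 sL qB mB in \<open>auto intro!: convex_Int convex_halfspace_Re_lt convex_halfspace_Im_lt intro: continuous_on_subset simp: X_def Wd p_def q1_def m1_def\<close>)
  have cv3: "convex (?B \<inter> {\<zeta>. Re \<zeta> < 0} \<inter> {\<zeta>. Im \<zeta> > 1/4})"
    by (intro convex_Int convex_ball convex_halfspace_Re_lt convex_halfspace_Im_gt)
  have L3: "s3 m2 = sL m2"
    by (rule uniq[of "?B \<inter> {\<zeta>. Re \<zeta> < 0} \<inter> {\<zeta>. Im \<zeta> > 1/4}" s3 sL q2])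
       (use cv3 s3 sL qB mB in \<open>auto intro: continuous_on_subset simp: X_def Wd p_def q2_def m2_def\<close>)
  have L4: "s4 m2 = sL m2"
    by (rule uniq[of "?B \<inter> {\<zeta>. Re \<zeta> < -35/38}" s4 sL m1])
       (use s4 sL qB mB in \<open>auto intro!: convex_Int convex_halfspace_Re_lt intro: continuous_on_subset simp: X_def Wd p_def m1_def m2_def\<close>)
  have a42: "s4 \<zeta> = s2 \<zeta>" if "\<zeta> \<in> W4 \<inter> W2" for \<zeta>
    by (rule uniq[of "W4 \<inter> W2" s4 s2 m1]) (use that cW Wp s4 s2 L2 mX in \<open>auto intro: convex_Int continuous_on_subset\<close>)
  have a43: "s4 \<zeta> = s3 \<zeta>" if "\<zeta> \<in> W4 \<inter> W3" for \<zeta>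
    by (rule uniq[of "W4 \<inter> W3" s4 s3 m2]) (use that cW Wp s4 s3 L3 L4 mX in \<open>auto intro: convex_Int continuous_on_subset\<close>)
  define g where "g \<zeta> = (if \<zeta> \<in> W1 then s1 \<zeta> else if \<zeta> \<in> W2 then s2 \<zeta> else if \<zeta> \<in> W3 then s3 \<zeta> else s4 \<zeta>)" for \<zeta>
  have g1: "g \<zeta> = s1 \<zeta>" if "\<zeta> \<in> W1" for \<zeta> using that by (simp add: g_def)
  have g2: "g \<zeta> = s2 \<zeta>" if "\<zeta> \<in> W2" for \<zeta> using that a12 by (simp add: g_def)
  have g3: "g \<zeta> = s3 \<zeta>" if "\<zeta> \<in> W3" for \<zeta> using that a13 by (auto simp: g_def W2_def W3_def)
  have g4: "g \<zeta> = s4 \<zeta>" if "\<zeta> \<in> W4" for \<zeta> using that a42 a43 by (auto simp: g_def W1_def W4_def)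
  have U: "?B - {p} = W1 \<union> W2 \<union> W3 \<union> W4"
  proof
    show "?B - {p} \<subseteq> W1 \<union> W2 \<union> W3 \<union> W4"
    proof
      fix x assume x: "x \<in> ?B - {p}"
      then have "\<not> (Re x = -16/19 \<and> Im x = 0)" by (auto simp: p_def complex_eq_iff)
      then consider "Re x > -16/19" | "Re x < -16/19" | "Im x < 0" | "Im x > 0" by linarith
      then show "x \<in> W1 \<union> W2 \<union> W3 \<union> W4" using x by cases (auto simp: Wd)
    qed
  qed (use Wp in auto)
  have cg: "continuous_on (?B - {p}) g"
    unfolding U
  proof (intro continuous_on_open_Un oW open_Un)
    show "continuous_on W1 g" using s1W(1) by (subst continuous_on_cong[OF refl g1])
    show "continuous_on W2 g" using s2(1) by (subst continuous_on_cong[OF refl g2])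
    show "continuous_on W3 g" using s3(1) by (subst continuous_on_cong[OF refl g3])
    show "continuous_on W4 g" using s4(1) by (subst continuous_on_cong[OF refl g4])
  qed
  have Fg: "\<phi> (expid (g \<zeta>)) = ?h \<zeta>" if "\<zeta> \<in> ?B - {p}" for \<zeta>
    using that s1W(2) s2(3) s3(3) s4(3) g1 g2 g3 g4 unfolding U by (elim UnE) simp_all
  have "g ` (?B - {p}) \<subseteq> component {z. \<phi> (expid z) \<in> ?V} (cpt k)"
  proof (rule component_superset)
    have "connected (?B - {p})" by (rule connected_open_delete) auto
    then show "connected (g ` (?B - {p}))" using cg by (rule connected_continuous_image[rotated])
    show "g ` (?B - {p}) \<subseteq> {z. \<phi> (expid z) \<in> ?V}" by (rule image_subsetI) (use Fg in auto)
    show "sL q1 \<in> g ` (?B - {p})" using g1[OF qW(1)] s1(3) Wp(1) qW(1) by (metis imageI subsetD)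
  qed (rule sL(3))
  then have gV: "g \<zeta> \<in> component {z. \<phi> (expid z) \<in> ?V} (cpt k)" if "\<zeta> \<in> ?B - {p}" for \<zeta> using that by (metis image_subset_iff)
  have oV: "open ?V" using h'(2) by auto
  show False
    by (rule no_section_over_punctured_disc[OF hom oV h'(3,1) p only _ cg Fg gV]) (use tip(1) in \<open>simp_all add: expid_cpt\<close>)
qed

text \<open>
  If the lift of the arc does not pass through the component of the critical point, then the
  lens lifts to that sheet, and the arc can be deformed inside the lens by the inverse of the
  move.
\<close>

lemma edge_persists:
  fixes \<phi> \<phi>i \<psi> \<psi>i :: "complex \<Rightarrow> complex"
  assumes hom: "homeomorphism UNIV UNIV \<phi> \<phi>i" "gap \<phi>" and \<theta>: "0 < \<theta>" "\<theta> < pi / 2"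
    and y: "pi / 2 < y" "y < pi" "0 < e" "e < 1/4" "e < y - pi / 2"
    and tip: "\<phi> (cval k) = lens y e 0" "\<And>t. t \<in> tips \<phi> \<Longrightarrow> t \<in> lens y e ` ball 0 1 \<Longrightarrow> t = lens y e 0"
    and \<psi>: "homeomorphism UNIV UNIV \<psi> \<psi>i" "\<And>w. w \<notin> slot y e \<Longrightarrow> \<psi> w = w" "\<And>w. w \<in> slot y e \<Longrightarrow> \<psi>i w \<in> slot y e"
    and edge: "edge \<phi> \<theta> a b"
    and avoid: "\<And>c. arclift \<phi> \<theta> y a c \<Longrightarrow> c \<notin> component {z. \<phi> (expid z) \<in> lens y e ` ball 0 1} (cpt k)"
  shows "edge (\<psi> \<circ> \<phi>) \<theta> a b"
proof -
  let ?F = "\<lambda>z. \<phi> (expid z)"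
  let ?B = "ball (0::complex) 1" let ?h = "lens y e" let ?V = "?h ` ?B"
  have e1: "e \<le> 1" using y by simp
  have iv: "t \<in> {y - e/2<..<y + e/2} \<longleftrightarrow> \<bar>t - y\<bar> < e / 2" for t
    unfolding greaterThanLessThan_iff by linarith
  obtain h' where h': "homeomorphism ?B ?V ?h h'" "\<And>U. open U \<Longrightarrow> U \<subseteq> ?B \<Longrightarrow> open (?h ` U)" "bounded ?V"
    "inj_on ?h ?B" "continuous_on UNIV ?h"
    using lens_homeo[OF y(3) e1] by metis
  have h'h: "h' (?h \<zeta>) = \<zeta>" if "\<zeta> \<in> ?B" for \<zeta> using homeomorphism_apply1[OF h'(1)] that by simp
  have hh': "?h (h' w) = w" "h' w \<in> ?B" if "w \<in> ?V" for w
    using homeomorphism_apply2[OF h'(1)] homeomorphism_image2[OF h'(1)] that by auto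
  have slotV: "slot y e \<subseteq> ?V" by (auto simp: slot_def)
  have \<psi>i: "\<psi>i w = w" if "w \<notin> slot y e" for w using \<psi>(2)[OF that] homeo_UNIV(1)[OF \<psi>(1), of w] by simp
  obtain m where m: "continuous_on {\<theta>..2 * pi - \<theta>} m" "\<And>x. x \<in> {\<theta>..2 * pi - \<theta>} \<Longrightarrow> ?F (m x) = exp (Complex (11/5) x)"
    "m \<theta> = a" "m (2 * pi - \<theta>) = b" using edge unfolding arclift_def by auto
  have Fa: "?F a = exp (Complex (11/5) \<theta>)" using m(2)[of \<theta>] m(3) \<theta> by auto
  have in1: "Complex (11/5) x \<in> strip 1 (12/5)" for x by (simp add: strip_def)
  have tf1: "ann 1 (12/5) \<inter> tips \<phi> = {}" by (rule gap_ann[OF hom(2)]) auto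
  obtain K where K: "continuous_on (strip 1 (12/5)) K" "K (Complex (11/5) \<theta>) = a" "\<And>u. u \<in> strip 1 (12/5) \<Longrightarrow> ?F (K u) = exp u"
    using strip_lift[OF hom(1) tf1 in1 Fa] by blast
  define ll where "ll x = K (Complex (11/5) x)" for x
  have arc: "arclift \<phi> s t (ll s) (ll t)" for s t
    using strip_lift_arclift[OF K(1,3), of s t 0] by (simp add: ll_def)
  have l: "continuous_on UNIV ll" "\<And>x. ?F (ll x) = exp (Complex (11/5) x)" "ll \<theta> = a" unfolding ll_def
    using K(2,3) in1 by (auto intro!: continuous_on_compose2[OF K(1)] continuous_intros)
  have lb: "ll (2 * pi - \<theta>) = b"
    using arclift_unique_right[OF hom _ _ edge, of "ll (2 * pi - \<theta>)"] arc[of \<theta> "2 * pi - \<theta>"] l(3) \<theta> by simp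
  have ny: "ll y \<notin> component {z. ?F z \<in> ?V} (cpt k)" using avoid arc[of \<theta> y] l(3) by simp
  define \<zeta> where "\<zeta> t = Complex (-9/19) ((t - y) / e)" for t
  have hz: "?h (\<zeta> t) = exp (Complex (11/5) t)" for t using y(3) by (simp add: \<zeta>_def lens_def)
  have zB: "\<zeta> t \<in> ?B" if "\<bar>t - y\<bar> < e / 2" for t
  proof -
    have "\<bar>(t - y) / e\<bar> \<le> 1/2" using that y(3) by (simp add: abs_divide divide_le_eq)
    then have "((t - y) / e)\<^sup>2 \<le> (1/2)\<^sup>2" by (metis abs_ge_zero power2_abs power_mono)
    then show ?thesis unfolding \<zeta>_def by (intro small_ball) (simp add: power2_eq_square)
  qed
  obtain s where s: "continuous_on ?B s" "s (\<zeta> y) = ll y" "\<And>u. u \<in> ?B \<Longrightarrow> ?F (s u) = ?h u"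
  proof (rule lift_through_component[OF hom(1), of ?V ?B "\<zeta> y" ?h "ll y"])
    show "open ?V" using h'(2) by auto
    have "continuous_on ?B ?h" using h'(5) by (rule continuous_on_subset) simp
    then show "continuous_on ?B ?h" "connected ?V" by (auto intro: connected_continuous_image)
    show "?F (ll y) = ?h (\<zeta> y)" using l(2) hz by simp
    fix z assume z: "z \<in> component {z. ?F z \<in> ?V} (ll y)"
    show "exp z + 1 \<noteq> 0"
    proof
      assume "exp z + 1 = 0"
      then obtain j where j: "z = cpt j" using expid_crit_iff by blast
      have "?F z \<in> ?V" using z connected_component_subset by blast
      then have "\<phi> (cval j) = \<phi> (cval k)" using tip(2)[of "\<phi> (cval j)"] tip(1) by (simp add: j expid_cpt)
      then have "j = k" using homeo_UNIV(5)[OF hom(1)] inj_cval by (simp add: inj_eq)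
      then have "ll y \<in> component {z. ?F z \<in> ?V} (cpt k)" using z j connected_component_sym by (metis mem_Collect_eq)
      then show False using ny by simp
    qed
  qed (use h'(3) zB[of y] y in auto)
  have agree: "s (\<zeta> t) = ll t" if t: "\<bar>t - y\<bar> < e / 2" for t
  proof (rule lift_unique[OF hom(1), of "{y - e/2<..<y + e/2}" "\<lambda>t. s (\<zeta> t)" ll y])
    have i: "t \<in> {y - e/2<..<y + e/2} \<longleftrightarrow> \<bar>t - y\<bar> < e / 2" for t
      unfolding greaterThanLessThan_iff by linarith
    show "continuous_on {y - e/2<..<y + e/2} (\<lambda>t. s (\<zeta> t))"
    proof (rule continuous_on_compose2[OF s(1)])
      show "continuous_on {y - e/2<..<y + e/2} \<zeta>" unfolding \<zeta>_def using y(3) by (intro continuous_intros) auto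
    qed (use zB i in blast)
    show "continuous_on {y - e/2<..<y + e/2} ll" using l(1) by (rule continuous_on_subset) simp
    fix u assume "u \<in> {y - e/2<..<y + e/2}"
    then have u: "?F (s (\<zeta> u)) = exp (Complex (11/5) u)" using s(3) zB i hz by metis
    then show "?F (s (\<zeta> u)) = ?F (ll u)" using l(2) by simp
    have "exp (Complex (11/5) u) \<in> ann 1 (12/5)" by (simp add: ann_def)
    then show "?F (s (\<zeta> u)) \<notin> tips \<phi>" using u tf1 by auto
  next
    show "t \<in> {y - e/2<..<y + e/2}" "y \<in> {y - e/2<..<y + e/2}" using t y(3) unfolding greaterThanLessThan_iff by linarith+
  qed (use s(2) in auto)
  define E where "E t = exp (Complex (11/5) t)" for t
  have EV: "\<psi>i (E t) \<in> ?V" if "\<bar>t - y\<bar> < e / 2" for t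
  proof (cases "E t \<in> slot y e")
    case True
    then show ?thesis using \<psi>(3) slotV by blast
  next
    case False
    then have "\<psi>i (E t) = ?h (\<zeta> t)" using \<psi>i hz[of t] by (simp add: E_def)
    then show ?thesis using zB[OF that] by simp
  qed
  define ll1 where "ll1 t = (if \<bar>t - y\<bar> < e / 2 then s (h' (\<psi>i (E t))) else ll t)" for t
  have far: "E t \<notin> slot y e" if "e / 4 \<le> \<bar>t - y\<bar>" "t \<in> {\<theta>..2 * pi - \<theta>}" for t
  proof (cases "y \<le> t")
    case True
    then show ?thesis unfolding E_def using that y \<theta> by (intro not_in_slot) auto
  next
    case False
    then show ?thesis unfolding E_def using not_in_slot(2)[of e y "t + 2 * pi"] that y \<theta> by auto
  qed
  have near: "ll1 t = ll t" if "e / 4 \<le> \<bar>t - y\<bar>" "t \<in> {\<theta>..2 * pi - \<theta>}" for t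
  proof (cases "\<bar>t - y\<bar> < e / 2")
    case True
    have "\<psi>i (E t) = ?h (\<zeta> t)" using \<psi>i[OF far[OF that]] hz by (simp add: E_def)
    then show ?thesis using agree[OF True] h'h[OF zB[OF True]] True by (simp add: ll1_def)
  qed (simp add: ll1_def)
  have near2: "ll1 t = ll t" if t: "t \<notin> {y - e/4..y + e/4}" for t
  proof (cases "\<bar>t - y\<bar> < e / 2")
    case True
    have "t \<in> {\<theta>..2 * pi - \<theta>}" using True y \<theta> pi_gt3 unfolding atLeastAtMost_iff by (intro conjI; linarith)
    moreover have "e / 4 \<le> \<bar>t - y\<bar>" using t unfolding atLeastAtMost_iff by linarith
    ultimately show ?thesis using near by blast
  qed (simp add: ll1_def)
  have c1: "continuous_on {y - e/2<..<y + e/2} (\<lambda>t. s (h' (\<psi>i (E t))))"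
  proof (rule continuous_on_compose2[OF s(1)])
    show "continuous_on {y - e/2<..<y + e/2} (\<lambda>t. h' (\<psi>i (E t)))"
    proof (rule continuous_on_compose2[of ?V h'])
      show "continuous_on ?V h'" using h'(1) by (simp add: homeomorphism_def)
      show "continuous_on {y - e/2<..<y + e/2} (\<lambda>t. \<psi>i (E t))" unfolding E_def
        by (rule continuous_on_compose2[OF homeo_UNIV(4)[OF \<psi>(1), of UNIV]]) (auto intro!: continuous_intros)
      show "(\<lambda>t. \<psi>i (E t)) ` {y - e/2<..<y + e/2} \<subseteq> ?V" by (rule image_subsetI, rule EV, simp only: iv)
    qed
    show "(\<lambda>t. h' (\<psi>i (E t))) ` {y - e/2<..<y + e/2} \<subseteq> ?B" by (rule image_subsetI, rule hh'(2), rule EV, simp only: iv)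
  qed
  have "continuous_on ({y - e/2<..<y + e/2} \<union> - {y - e/4..y + e/4}) ll1"
  proof (rule continuous_on_open_Un)
    show "continuous_on {y - e/2<..<y + e/2} ll1"
      by (rule continuous_on_cong[THEN iffD1, OF refl _ c1]) (simp only: iv ll1_def if_True)
    have "continuous_on (- {y - e/4..y + e/4}) ll" using l(1) by (rule continuous_on_subset) simp
    then show "continuous_on (- {y - e/4..y + e/4}) ll1"
      by (rule continuous_on_cong[THEN iffD1, OF refl, rotated]) (simp add: near2)
  qed auto
  moreover have "{\<theta>..2 * pi - \<theta>} \<subseteq> {y - e/2<..<y + e/2} \<union> - {y - e/4..y + e/4}" using y(3) by auto
  ultimately have "continuous_on {\<theta>..2 * pi - \<theta>} ll1" by (rule continuous_on_subset)
  moreover have "(\<psi> \<circ> \<phi>) (expid (ll1 t)) = exp (Complex (11/5) t)" if t: "t \<in> {\<theta>..2 * pi - \<theta>}" for t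
  proof (cases "\<bar>t - y\<bar> < e / 2")
    case True
    have "?F (ll1 t) = \<psi>i (E t)" using True s(3) hh'[OF EV[OF True]] by (simp add: ll1_def)
    then show ?thesis using homeo_UNIV(2)[OF \<psi>(1)] by (simp add: E_def)
  next
    case False
    then have "E t \<notin> slot y e" using far[OF _ t] y(3) by auto
    then show ?thesis using False l(2) \<psi>(2) by (simp add: ll1_def E_def)
  qed
  moreover have "\<theta> \<notin> {y - e/4..y + e/4}" "2 * pi - \<theta> \<notin> {y - e/4..y + e/4}"
    using y \<theta> pi_gt3 unfolding atLeastAtMost_iff by linarith+
  then have "ll1 \<theta> = a" "ll1 (2 * pi - \<theta>) = b" using near2 l(3) lb by auto
  ultimately show ?thesis unfolding arclift_def by blast
qed

lemma slot_props:
  assumes "0 < e" "e \<le> 1"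
  shows "open (slot y e)" "connected (slot y e)" "bounded (slot y e)" "slot y e \<subseteq> lens y e ` ball 0 1"
proof -
  obtain h' where h': "homeomorphism (ball 0 1) (lens y e ` ball 0 1) (lens y e) h'"
    "\<And>U. open U \<Longrightarrow> U \<subseteq> ball 0 1 \<Longrightarrow> open (lens y e ` U)" "bounded (lens y e ` ball 0 1)"
    "inj_on (lens y e) (ball 0 1)" "continuous_on UNIV (lens y e)"
    using lens_homeo[OF assms] by metis
  let ?C = "{\<zeta> \<in> ball 0 1. -35/38 < Re \<zeta> \<and> \<bar>Im \<zeta>\<bar> < 1/4}"
  have "?C = ball 0 1 \<inter> {\<zeta>. Re \<zeta> > -35/38} \<inter> {\<zeta>. Im \<zeta> < 1/4} \<inter> {\<zeta>. Im \<zeta> > -1/4}" by auto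
  then have "open ?C"
    by (simp only: open_Int open_ball open_halfspace_Re_gt open_halfspace_Im_lt open_halfspace_Im_gt)
  then show "open (slot y e)" unfolding slot_def by (intro h'(2)) auto
  show "connected (slot y e)" unfolding slot_def
    by (intro connected_continuous_image continuous_on_subset[OF h'(5)] convex_connected convex_slot_coords) simp
  show V: "slot y e \<subseteq> lens y e ` ball 0 1" unfolding slot_def by (intro image_mono) auto
  show "bounded (slot y e)" using h'(3) V by (rule bounded_subset)
qed

lemma slot_level:
  assumes "w \<in> slot y e" shows "27/20 < lev w"
  using assms unfolding slot_def by (auto simp: lev_lens)

lemma slot_left:
  assumes "w \<in> slot y e" "pi / 2 < y" "y < pi" "0 < e" "e < 1/4" "e < y - pi / 2"
  shows "Re w < 0"
proof -
  obtain \<zeta> where z: "\<bar>Im \<zeta>\<bar> < 1/4" "w = exp (Complex (31/10 + 19/10 * Re \<zeta>) (y + e * Im \<zeta>))"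
    using assms(1) unfolding slot_def lens_def by auto
  have "\<bar>e * Im \<zeta>\<bar> \<le> e * 1" unfolding abs_mult using z(1) assms(4) by (intro mult_mono) auto
  then have a: "pi / 2 < y + e * Im \<zeta>" "y + e * Im \<zeta> < 3 * pi / 2" using assms pi_gt3 by linarith+
  then have "0 < sin (y + e * Im \<zeta> - pi / 2)" by (intro sin_gt_zero) auto
  then have "cos (y + e * Im \<zeta>) < 0" by (simp add: sin_diff)
  then show ?thesis by (simp add: z(2) Re_exp mult_pos_neg)
qed

text \<open>
  An edge whose lift passes through the component of the critical point would give a third point
  there, besides those of \<open>LR\<close> and \<open>LX\<close>; so all edges starting in
  \<open>A\<close>, other than at \<open>aR\<close>, persist. The lift \<open>K\<close> of the
  new map starts at \<open>a0\<close>, passes \<open>b0\<close> and enters the sheet of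
  \<open>aR\<close>. Since it now passes the tip on the other side, it leaves the lens on the
  sheet \<open>LX\<close>, and comes back to the lens after one more turn because
  \<open>LX\<close> is periodic. On both visits it can descend to the tip.
\<close>

lemma pull_tip:
  fixes \<phi> \<phi>i LR LX :: "complex \<Rightarrow> complex"
  assumes hom: "homeomorphism UNIV UNIV \<phi> \<phi>i" "gap \<phi>" and \<theta>: "0 < \<theta>" "\<theta> < pi / 2"
    and y: "pi / 2 < y" "y < pi" "0 < e" "e < 1/4" "e < y - pi / 2"
    and tip: "\<phi> (cval k) = lens y e 0" "\<And>t. t \<in> tips \<phi> \<Longrightarrow> t \<in> lens y e ` ball 0 1 \<Longrightarrow> t = lens y e 0"
    and LR: "continuous_on (strip 1 (12/5)) LR" "\<And>u. u \<in> strip 1 (12/5) \<Longrightarrow> \<phi> (expid (LR u)) = exp u"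
    "LR (Complex (11/5) \<theta>) = aR" "LR (Complex (11/5) y) \<in> component {z. \<phi> (expid z) \<in> lens y e ` ball 0 1} (cpt k)"
    and LX: "continuous_on (strip 1 (12/5)) LX" "\<And>u. u \<in> strip 1 (12/5) \<Longrightarrow> \<phi> (expid (LX u)) = exp u"
    "\<And>u. u \<in> strip 1 (12/5) \<Longrightarrow> LX (u + 2 * pi * \<i>) = LX u"
    "LX (Complex (11/5) y) \<in> component {z. \<phi> (expid z) \<in> lens y e ` ball 0 1} (cpt k)" "LX (Complex (11/5) \<theta>) \<notin> A"
    and A: "aR \<in> A" "a0 \<in> A" "a0 \<noteq> aR" and E0: "edge \<phi> \<theta> a0 b0" "arclift \<phi> (-\<theta>) \<theta> b0 aR"
  obtains \<psi> \<psi>i K where "homeomorphism UNIV UNIV \<psi> \<psi>i" "plane_homeo \<psi>" "\<And>w. w \<notin> slot y e \<Longrightarrow> \<psi> w = w"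
    "\<And>w. w \<in> slot y e \<Longrightarrow> \<psi> w \<in> slot y e" "\<psi> (\<phi> (cval k)) = exp (Complex (3/2) y)"
    "\<And>a b. edge \<phi> \<theta> a b \<Longrightarrow> a \<in> A \<Longrightarrow> a \<noteq> aR \<Longrightarrow> edge (\<psi> \<circ> \<phi>) \<theta> a b"
    "continuous_on (strip (3/2) (12/5)) K" "\<And>u. u \<in> strip (3/2) (12/5) \<Longrightarrow> \<psi> (\<phi> (expid (K u))) = exp u"
    "K (Complex (11/5) \<theta>) = a0" "K (Complex (11/5) (2 * pi - \<theta>)) = b0"
    "(K \<longlongrightarrow> cpt k) (at (Complex (3/2) (2 * pi + y)) within strip (3/2) (12/5))"
    "(K \<longlongrightarrow> cpt k) (at (Complex (3/2) (4 * pi + y)) within strip (3/2) (12/5))"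
proof -
  let ?F = "\<lambda>z. \<phi> (expid z)"
  let ?B = "ball (0::complex) 1" let ?h = "lens y e" let ?V = "?h ` ?B"
  have e1: "e \<le> 1" using y by simp
  obtain h' where h': "homeomorphism ?B ?V ?h h'" "\<And>U. open U \<Longrightarrow> U \<subseteq> ?B \<Longrightarrow> open (?h ` U)" "bounded ?V"
    "inj_on ?h ?B" "continuous_on UNIV ?h"
    using lens_homeo[OF y(3) e1] by metis
  have oV: "open ?V" using h'(2) by auto
  note sp = slot_props[OF y(3) e1, of y]
  define p where "p = Complex (-16/19) 0"
  have pB: "p \<in> ?B" unfolding p_def by (rule small_ball) (simp add: power2_eq_square)
  have hp: "?h p = exp (Complex (3/2) y)" by (simp add: p_def lens_def)
  have p0s: "?h 0 \<in> slot y e" unfolding slot_def by (rule imageI) simp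
  have ps: "?h p \<in> slot y e" unfolding slot_def using pB by (intro imageI) (simp add: p_def)
  obtain \<psi> \<psi>i where \<psi>: "homeomorphism UNIV UNIV \<psi> \<psi>i" "plane_homeo \<psi>" "\<And>i. i \<in> {0::nat} \<Longrightarrow> \<psi> ((\<lambda>_. ?h 0) i) = (\<lambda>_. ?h p) i"
    "\<And>w. w \<notin> slot y e \<Longrightarrow> \<psi> w = w" "\<And>w. w \<notin> slot y e \<Longrightarrow> \<psi>i w = w"
    "\<And>w. w \<in> slot y e \<Longrightarrow> \<psi> w \<in> slot y e" "\<And>w. w \<in> slot y e \<Longrightarrow> \<psi>i w \<in> slot y e"
    by (rule move_points[OF sp(1,2,3), of "{0::nat}" "\<lambda>_. ?h 0" "\<lambda>_. ?h p"]) (use p0s ps in \<open>auto simp: pairwise_def\<close>)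
  note hp\<psi> = homeo_UNIV[OF \<psi>(1)]
  have \<psi>0: "\<psi> (?h 0) = ?h p" using \<psi>(3) by simp
  have \<psi>V: "\<psi> w \<in> ?V \<longleftrightarrow> w \<in> ?V" for w using \<psi>(4,6) sp(4) by (metis subsetD)
  define Vt where "Vt = component {z. ?F z \<in> ?V} (cpt k)"
  note two = disc_two_sheets[OF hom(1) oV h'(3,1) tip(1)[symmetric] tip(2) Vt_def]
  define F1 where "F1 z = \<psi> (?F z)" for z
  have hom1: "homeomorphism UNIV UNIV (\<psi> \<circ> \<phi>) (\<phi>i \<circ> \<psi>i)" using hom(1) \<psi>(1) by (rule homeomorphism_compose)
  have Vt1: "component {z. (\<psi> \<circ> \<phi>) (expid z) \<in> ?V} (cpt k) = Vt" unfolding Vt_def by (simp add: \<psi>V)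
  have only1: "z = cpt k" if "z \<in> Vt" "\<psi> (?F z) = ?h p" for z
  proof (rule two(1)[OF _ _ that(1)])
    show "?F z = ?h 0" using that(2) \<psi>0 hp\<psi>(1) by metis
  qed auto
  define lr lx where "lr t = LR (Complex (11/5) t)" and "lx t = LX (Complex (11/5) t)" for t
  have in1: "Complex (11/5) x \<in> strip 1 (12/5)" for x by (simp add: strip_def)
  have Flr: "?F (lr t) = exp (Complex (11/5) t)" "?F (lx t) = exp (Complex (11/5) t)" for t
    using LR(2) LX(2) in1 by (auto simp: lr_def lx_def)
  have clr: "continuous_on S lr" "continuous_on S lx" for S unfolding lr_def lx_def
    using in1 by (auto intro!: continuous_on_compose2[OF LR(1)] continuous_on_compose2[OF LX(1)] continuous_intros)
  have tf1: "ann 1 (12/5) \<inter> tips \<phi> = {}" by (rule gap_ann[OF hom(2)]) auto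
  have lrx: "lr t \<noteq> lx t" for t
  proof
    assume eq: "lr t = lx t"
    have "lr \<theta> = lx \<theta>"
    proof (rule lift_unique[OF hom(1), of UNIV lr lx t])
      fix u
      show "?F (lr u) = ?F (lx u)" using Flr by simp
      have "exp (Complex (11/5) u) \<in> ann 1 (12/5)" by (simp add: ann_def)
      then show "?F (lr u) \<notin> tips \<phi>" using Flr(1)[of u] tf1 by auto
    qed (use clr eq in auto)
    then show False using LR(3) LX(5) A(1) by (simp add: lr_def lx_def)
  qed
  have arcs: "arclift \<phi> s t (lr s) (lr t)" "arclift \<phi> s t (lx s) (lx t)" for s t
    using strip_lift_arclift[OF LR(1,2), of s t 0] strip_lift_arclift[OF LX(1,2), of s t 0] by (simp_all add: lr_def lx_def)
  have persist: "edge (\<psi> \<circ> \<phi>) \<theta> a b" if ab: "edge \<phi> \<theta> a b" "a \<in> A" "a \<noteq> aR" for a b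
  proof (rule edge_persists[OF hom \<theta> y tip \<psi>(1,4,7) ab(1)])
    fix c assume c: "arclift \<phi> \<theta> y a c"
    show "c \<notin> component {z. ?F z \<in> ?V} (cpt k)"
    proof
      assume cV: "c \<in> component {z. ?F z \<in> ?V} (cpt k)"
      have "y \<in> {\<theta>..y}" using \<theta> y by auto
      then have Fc: "?F c = exp (Complex (11/5) y)" using c unfolding arclift_def by metis
      have "c = lr y \<or> lr y = lx y \<or> c = lx y"
        using two(2)[of c "lr y" "lx y"] cV LR(4) LX(4) Fc Flr unfolding Vt_def lr_def lx_def by auto
      then have "a = lr \<theta> \<or> a = lx \<theta>"
        using arclift_unique_left[OF hom _ c, of "lr \<theta>"] arclift_unique_left[OF hom _ c, of "lx \<theta>"] arcs[of \<theta> y] lrx \<theta> y by auto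
      then show False using ab LR(3) LX(5) by (auto simp: lr_def lx_def)
    qed
  qed auto
  have tf2: "ann (3/2) (12/5) \<inter> tips (\<psi> \<circ> \<phi>) = {}"
  proof -
    have "t \<notin> ann (3/2) (12/5)" if t: "t \<in> tips (\<psi> \<circ> \<phi>)" for t
    proof
      assume a: "t \<in> ann (3/2) (12/5)"
      obtain s where s: "s \<in> tips \<phi>" "t = \<psi> s" using t by auto
      show False
      proof (cases "s \<in> slot y e")
        case True
        then have "s = ?h 0" using tip(2)[OF s(1)] sp(4) by blast
        then have "lev t = 3/2" using s(2) \<psi>0 hp by simp
        then show False using a by (simp add: ann_iff)
      next
        case False
        then have "t = s" using \<psi>(4) s(2) by simp
        then have "s \<in> ann 1 (12/5)" using a by (simp add: ann_iff)
        then show False using s(1) tf1 by blast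
      qed
    qed
    then show ?thesis by blast
  qed
  have in2: "Complex (11/5) x \<in> strip (3/2) (12/5)" for x by (simp add: strip_def)
  have nsl: "exp (Complex l t) \<notin> slot y e" if "y + e / 4 \<le> t" "t \<le> y + 2 * pi - e / 4" for l t
    using not_in_slot(1)[OF y(3) that] .
  have nsl2: "exp (Complex l t) \<notin> slot y e" if "y - 2 * pi + e / 4 \<le> t" "t \<le> y - e / 4" for l t
    using not_in_slot(2)[OF y(3), of y "t + 2 * pi"] that by simp
  have shift: "exp (Complex l (t + 2 * pi)) = exp (Complex l t)" for l t
    by (rule complex_eqI) (simp_all add: Re_exp Im_exp)
  have shift': "exp (Complex l (t - 2 * pi)) = exp (Complex l t)" for l t using shift[of l "t - 2 * pi"] by simp
  have Fa0: "?F a0 = exp (Complex (11/5) \<theta>)" using E0(1) \<theta> unfolding arclift_def by force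
  have "(\<psi> \<circ> \<phi>) (expid a0) = exp (Complex (11/5) \<theta>)" using nsl2[of \<theta>] y \<theta> by (simp add: Fa0 \<psi>(4))
  then obtain K where K: "continuous_on (strip (3/2) (12/5)) K" "K (Complex (11/5) \<theta>) = a0"
    "\<And>u. u \<in> strip (3/2) (12/5) \<Longrightarrow> (\<psi> \<circ> \<phi>) (expid (K u)) = exp u"
    using strip_lift[OF hom1 tf2 in2] by blast
  define kk where "kk t = K (Complex (11/5) t)" for t
  have ckk: "continuous_on S kk" for S unfolding kk_def
    using in2 by (auto intro!: continuous_on_compose2[OF K(1)] continuous_intros)
  have Fkk: "(\<psi> \<circ> \<phi>) (expid (kk t)) = exp (Complex (11/5) t)" for t using K(3) in2 unfolding kk_def by blast
  have nt: "exp (Complex (11/5) t) \<notin> tips (\<psi> \<circ> \<phi>)" for t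
  proof -
    have "exp (Complex (11/5) t) \<in> ann (3/2) (12/5)" by (simp add: ann_def)
    then show ?thesis using tf2 by blast
  qed
  have cmp: "m x = kk x" if m: "continuous_on {s..t} m" "\<And>x. x \<in> {s..t} \<Longrightarrow> (\<psi> \<circ> \<phi>) (expid (m x)) = exp (Complex (11/5) x)"
      "s \<le> t" "m s = kk s" "x \<in> {s..t}" for m s t x
  proof (rule lift_unique[OF hom1, of "{s..t}" m kk s])
    show "(\<psi> \<circ> \<phi>) (expid (m u)) \<notin> tips (\<psi> \<circ> \<phi>)" if "u \<in> {s..t}" for u using m(2)[OF that] nt by simp
  qed (use m Fkk ckk in auto)
  have kb: "kk (2 * pi - \<theta>) = b0"
  proof -
    obtain m where m: "continuous_on {\<theta>..2 * pi - \<theta>} m" "\<And>x. x \<in> {\<theta>..2 * pi - \<theta>} \<Longrightarrow> (\<psi> \<circ> \<phi>) (expid (m x)) = exp (Complex (11/5) x)"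
      "m \<theta> = a0" "m (2 * pi - \<theta>) = b0" using persist[OF E0(1) A(2,3)] unfolding arclift_def by auto
    show ?thesis using cmp[OF m(1,2), of "2 * pi - \<theta>"] m(3,4) K(2) \<theta> by (auto simp: kk_def)
  qed
  have kR: "kk (2 * pi + \<theta>) = aR"
  proof -
    obtain m where m: "continuous_on {-\<theta>..\<theta>} m" "\<And>x. x \<in> {-\<theta>..\<theta>} \<Longrightarrow> ?F (m x) = exp (Complex (11/5) x)"
      "m (-\<theta>) = b0" "m \<theta> = aR" using E0(2) unfolding arclift_def by auto
    have "(\<lambda>x. m (x - 2 * pi)) (2 * pi + \<theta>) = kk (2 * pi + \<theta>)"
    proof (rule cmp[of "2 * pi - \<theta>" "2 * pi + \<theta>"])
      show "continuous_on {2 * pi - \<theta>..2 * pi + \<theta>} (\<lambda>x. m (x - 2 * pi))"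
        by (rule continuous_on_compose2[OF m(1)]) (auto intro!: continuous_intros)
      fix x assume x: "x \<in> {2 * pi - \<theta>..2 * pi + \<theta>}"
      then have "?F (m (x - 2 * pi)) = exp (Complex (11/5) x)" using m(2)[of "x - 2 * pi"] shift' by auto
      moreover have "exp (Complex (11/5) x) \<notin> slot y e" using x y \<theta> pi_gt3 by (intro nsl) auto
      ultimately show "(\<psi> \<circ> \<phi>) (expid (m (x - 2 * pi))) = exp (Complex (11/5) x)" using \<psi>(4) by simp
    qed (use m(3) kb \<theta> in auto)
    then show ?thesis using m(4) by simp
  qed
  have kr: "kk (2 * pi + (y - 3 * e / 8)) = lr (y - 3 * e / 8)"
  proof -
    have "(\<lambda>x. lr (x - 2 * pi)) (2 * pi + (y - 3 * e / 8)) = kk (2 * pi + (y - 3 * e / 8))"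
    proof (rule cmp[of "2 * pi + \<theta>" "2 * pi + (y - 3 * e / 8)"])
      show "continuous_on {2 * pi + \<theta>..2 * pi + (y - 3 * e / 8)} (\<lambda>x. lr (x - 2 * pi))"
        by (rule continuous_on_compose2[OF clr(1)[of UNIV]]) (auto intro!: continuous_intros)
      fix x assume x: "x \<in> {2 * pi + \<theta>..2 * pi + (y - 3 * e / 8)}"
      then have "exp (Complex (11/5) x) \<notin> slot y e" using y \<theta> pi_gt3 by (intro nsl) auto
      then show "(\<psi> \<circ> \<phi>) (expid (lr (x - 2 * pi))) = exp (Complex (11/5) x)" using \<psi>(4) Flr shift' by simp
    qed (use kR LR(3) \<theta> y in \<open>auto simp: lr_def\<close>)
    then show ?thesis by simp
  qed
  define \<zeta> where "\<zeta> t = Complex (-9/19) ((t - y) / e)" for t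
  have hz: "?h (\<zeta> t) = exp (Complex (11/5) t)" for t using y(3) by (simp add: \<zeta>_def lens_def)
  define I where "I = {y - e/2<..<y + e/2}"
  have iI: "y \<in> I" "y - 3 * e / 8 \<in> I" "y + 3 * e / 8 \<in> I" using y(3) by (auto simp: I_def)
  have Ib: "\<bar>(t - y) / e\<bar> \<le> 1/2" if "t \<in> I" for t
  proof -
    have "\<bar>t - y\<bar> \<le> e / 2" using that unfolding I_def greaterThanLessThan_iff by linarith
    then show ?thesis using y(3) by (simp add: abs_divide divide_le_eq)
  qed
  have strB: "exp (Complex l t) \<in> ?V" if "3/2 < l" "l < 12/5" "t \<in> I" for l t
  proof (rule image_eqI)
    define a b where "a = (l - 31/10) * 10/19" and "b = (t - y) / e"
    have "\<bar>b\<bar> \<le> 1/2" unfolding b_def by (rule Ib[OF that(3)])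
    then have "b\<^sup>2 \<le> (1/2)\<^sup>2" by (metis abs_ge_zero power2_abs power_mono)
    moreover have "a \<le> 16/19" "-(16/19) \<le> a" using that(1,2) unfolding a_def by (simp_all add: field_simps)
    then have "\<bar>a\<bar> \<le> 16/19" by simp
    then have "a\<^sup>2 \<le> (16/19)\<^sup>2" by (metis abs_ge_zero power2_abs power_mono)
    ultimately show "Complex a b \<in> ?B" by (intro small_ball) (simp add: power2_eq_square)
    have "31/10 + 19/10 * a = l" unfolding a_def by (simp add: field_simps)
    moreover have "y + e * b = t" using y(3) by (simp add: b_def)
    ultimately show "exp (Complex l t) = ?h (Complex a b)" unfolding lens_def complex.sel by simp
  qed
  have zB: "\<zeta> t \<in> ?B" if "t \<in> I" for t
  proof -
    have "\<bar>(t - y) / e\<bar> \<le> 1/2" by (rule Ib[OF that])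
    then have "((t - y) / e)\<^sup>2 \<le> (1/2)\<^sup>2" by (metis abs_ge_zero power2_abs power_mono)
    then show ?thesis unfolding \<zeta>_def by (intro small_ball) (simp add: power2_eq_square)
  qed
  have c\<zeta>: "continuous_on I \<zeta>" unfolding \<zeta>_def using y(3) by (intro continuous_intros) auto
  have EV: "exp (Complex (11/5) t) \<in> ?V" if "t \<in> I" for t using that by (intro strB) auto
  have inVt: "m t \<in> Vt" if m: "continuous_on I m" "\<And>x. x \<in> I \<Longrightarrow> ?F (m x) \<in> ?V" "x0 \<in> I" "m x0 \<in> Vt" "t \<in> I" for m x0 t
  proof -
    have "m ` I \<subseteq> component {z. ?F z \<in> ?V} (cpt k)"
    proof (rule component_superset)
      show "connected (m ` I)" by (intro connected_continuous_image m) (auto simp: I_def)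
      show "m ` I \<subseteq> {z. ?F z \<in> ?V}" by (rule image_subsetI) (use m(2) in simp)
      show "m x0 \<in> m ` I" using m(3) by simp
      show "m x0 \<in> component {z. ?F z \<in> ?V} (cpt k)" using m(4) by (simp add: Vt_def)
    qed
    then show ?thesis using m(5) unfolding Vt_def by (metis image_subset_iff)
  qed
  have lrV: "lr t \<in> Vt" "lx t \<in> Vt" if "t \<in> I" for t
    using inVt[of lr y t] inVt[of lx y t] clr Flr EV iI that LR(4) LX(4) by (simp_all add: Vt_def lr_def lx_def)
  \<comment> \<open>The new lift passes outside the tip, the old one inside; so they leave the lens on different sheets.\<close>
  have kkV: "kk (2 * pi + t) \<in> Vt" if t: "t \<in> I" for t
  proof (rule inVt[of "\<lambda>t. kk (2 * pi + t)" "y - 3 * e / 8"])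
    show "continuous_on I (\<lambda>t. kk (2 * pi + t))" by (rule continuous_on_compose2[OF ckk[of UNIV]]) (auto intro!: continuous_intros)
    show "kk (2 * pi + (y - 3 * e / 8)) \<in> Vt" using lrV iI by (simp only: kr)
    fix x assume "x \<in> I"
    then have "\<psi> (?F (kk (2 * pi + x))) \<in> ?V" using Fkk[of "2 * pi + x"] EV shift[of "11/5" x] by (simp add: add.commute)
    then show "?F (kk (2 * pi + x)) \<in> ?V" using \<psi>V by simp
  qed (use iI t in auto)
  have swap: "kk (2 * pi + (y + 3 * e / 8)) \<noteq> lr (y + 3 * e / 8)"
  proof -
    define U where "U = ?B \<inter> {\<zeta>. Re \<zeta> < 0}"
    have U: "open U" "convex U" unfolding U_def
      by (intro open_Int open_ball open_halfspace_Re_lt convex_Int convex_ball convex_halfspace_Re_lt)+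
    have zU: "\<zeta> t \<in> U" if "t \<in> I" for t using zB[OF that] by (simp add: U_def \<zeta>_def)
    have ch: "continuous_on S ?h" for S using h'(5) by (rule continuous_on_subset) simp
    have tfU: "?h ` U \<inter> tips \<phi> = {}"
    proof -
      have "?h x \<notin> tips \<phi>" if "x \<in> U" for x
      proof
        assume "?h x \<in> tips \<phi>"
        then have "?h x = ?h 0" using that by (intro tip(2)) (auto simp: U_def)
        then have "x = 0" using h'(4) that unfolding U_def inj_on_def by auto
        then show False using that by (simp add: U_def)
      qed
      then show ?thesis by blast
    qed
    obtain sL where sL: "continuous_on U sL" "sL (\<zeta> y) = lr y" "\<And>u. u \<in> U \<Longrightarrow> ?F (sL u) = ?h u"
    proof (rule lift_tipfree[OF hom(1), of "?h ` U" U "\<zeta> y" ?h "lr y"])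
      show "open (?h ` U)" using U by (intro h'(2)) (auto simp: U_def)
      show "connected (?h ` U)" using U(2) by (intro connected_continuous_image ch convex_connected)
      show "bounded (?h ` U)" using h'(3) by (rule bounded_subset) (auto simp: U_def)
      show "?F (lr y) = ?h (\<zeta> y)" using Flr hz by simp
    qed (use U tfU zU iI ch in auto)
    have sLlr: "sL (\<zeta> t) = lr t" if t: "t \<in> I" for t
    proof (rule lift_unique[OF hom(1), of I "\<lambda>t. sL (\<zeta> t)" lr y])
      show "continuous_on I (\<lambda>t. sL (\<zeta> t))" by (rule continuous_on_compose2[OF sL(1) c\<zeta>]) (use zU in blast)
      fix u assume u: "u \<in> I"
      show "?F (sL (\<zeta> u)) = ?F (lr u)" using sL(3)[OF zU[OF u]] hz Flr by simp
      show "?F (sL (\<zeta> u)) \<notin> tips \<phi>" using sL(3)[OF zU[OF u]] tfU zU[OF u] by auto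
    qed (use clr iI t sL(2) in \<open>auto simp: I_def\<close>)
    define W where "W = ?B \<inter> {\<zeta>. Re \<zeta> > -16/19}"
    have W: "open W" "convex W" unfolding W_def
      by (intro open_Int open_ball open_halfspace_Re_gt convex_Int convex_ball convex_halfspace_Re_gt)+
    have zW: "\<zeta> t \<in> W" if "t \<in> I" for t using zB[OF that] by (simp add: W_def \<zeta>_def)
    have tip1: "t = ?h p" if t: "t \<in> tips (\<psi> \<circ> \<phi>)" "t \<in> ?V" for t
    proof -
      obtain s where s: "s \<in> tips \<phi>" "t = \<psi> s" using t(1) by auto
      then have "s = ?h 0" using t(2) \<psi>V by (intro tip(2)) auto
      then show ?thesis using s \<psi>0 by simp
    qed
    have tfW: "?h ` W \<inter> tips (\<psi> \<circ> \<phi>) = {}"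
    proof -
      have "?h x \<notin> tips (\<psi> \<circ> \<phi>)" if "x \<in> W" for x
      proof
        assume "?h x \<in> tips (\<psi> \<circ> \<phi>)"
        then have "?h x = ?h p" using that by (intro tip1) (auto simp: W_def)
        then have "x = p" using h'(4) that pB unfolding W_def inj_on_def by auto
        then show False using that by (simp add: W_def p_def)
      qed
      then show ?thesis by blast
    qed
    have q1: "\<zeta> (y - 3 * e / 8) = Complex (-9/19) (-3/8)" "\<zeta> (y + 3 * e / 8) = Complex (-9/19) (3/8)"
      using y(3) by (simp_all add: \<zeta>_def)
    obtain s1 where s1: "continuous_on W s1" "s1 (\<zeta> (y - 3 * e / 8)) = lr (y - 3 * e / 8)"
        "\<And>u. u \<in> W \<Longrightarrow> (\<psi> \<circ> \<phi>) (expid (s1 u)) = ?h u"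
    proof (rule lift_tipfree[OF hom1, of "?h ` W" W "\<zeta> (y - 3 * e / 8)" ?h "lr (y - 3 * e / 8)"])
      show "open (?h ` W)" using W by (intro h'(2)) (auto simp: W_def)
      show "connected (?h ` W)" using W(2) by (intro connected_continuous_image ch convex_connected)
      show "bounded (?h ` W)" using h'(3) by (rule bounded_subset) (auto simp: W_def)
      have "exp (Complex (11/5) (y - 3 * e / 8)) \<notin> slot y e" using y by (intro nsl2) auto
      then show "(\<psi> \<circ> \<phi>) (expid (lr (y - 3 * e / 8))) = ?h (\<zeta> (y - 3 * e / 8))"
        using Flr hz \<psi>(4) by simp
    qed (use W tfW zW iI ch in auto)
    have s1kk: "s1 (\<zeta> t) = kk (2 * pi + t)" if t: "t \<in> I" for t
    proof (rule lift_unique[OF hom1, of I "\<lambda>t. s1 (\<zeta> t)" "\<lambda>t. kk (2 * pi + t)" "y - 3 * e / 8"])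
      show "continuous_on I (\<lambda>t. s1 (\<zeta> t))" by (rule continuous_on_compose2[OF s1(1) c\<zeta>]) (use zW in blast)
      show "continuous_on I (\<lambda>t. kk (2 * pi + t))" by (rule continuous_on_compose2[OF ckk[of UNIV]]) (auto intro!: continuous_intros)
      show "s1 (\<zeta> (y - 3 * e / 8)) = kk (2 * pi + (y - 3 * e / 8))" unfolding s1(2) kr ..
      fix u assume u: "u \<in> I"
      show "(\<psi> \<circ> \<phi>) (expid (s1 (\<zeta> u))) = (\<psi> \<circ> \<phi>) (expid (kk (2 * pi + u)))"
        unfolding s1(3)[OF zW[OF u]] Fkk hz using shift[of "11/5" u] by (simp add: add.commute)
      show "(\<psi> \<circ> \<phi>) (expid (s1 (\<zeta> u))) \<notin> tips (\<psi> \<circ> \<phi>)" unfolding s1(3)[OF zW[OF u]] hz by (rule nt)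
    qed (use iI t in \<open>auto simp: I_def\<close>)
    have "s1 (\<zeta> (y + 3 * e / 8)) \<noteq> sL (\<zeta> (y + 3 * e / 8))"
      unfolding q1(2)
    proof (rule sheets_swap[OF hom1 y(3) e1, of k y])
      let ?X = "{\<zeta> \<in> ?B. Re \<zeta> < 0 \<and> (Re \<zeta> \<le> - 35 / 38 \<or> 1 / 4 \<le> \<bar>Im \<zeta>\<bar>)}"
      show "(\<psi> \<circ> \<phi>) (cval k) = ?h (Complex (- 16 / 19) 0)" using tip(1) \<psi>0 by (simp add: p_def)
      show "t = ?h (Complex (- 16 / 19) 0)" if "t \<in> tips (\<psi> \<circ> \<phi>)" "t \<in> ?V" for t using tip1[OF that] by (simp add: p_def)
      show "z = cpt k" if "z \<in> component {z. (\<psi> \<circ> \<phi>) (expid z) \<in> ?V} (cpt k)" "(\<psi> \<circ> \<phi>) (expid z) = ?h (Complex (- 16 / 19) 0)" for z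
        using only1[of z] that unfolding Vt1 by (simp add: p_def)
      show "continuous_on ?X sL" using sL(1) by (rule continuous_on_subset) (auto simp: U_def)
      show "(\<psi> \<circ> \<phi>) (expid (sL \<xi>)) = ?h \<xi>" if "\<xi> \<in> ?X" for \<xi>
      proof -
        have "?h \<xi> \<notin> slot y e" using that by (intro not_in_slot_inj y(3) e1) auto
        moreover have "?F (sL \<xi>) = ?h \<xi>" using that by (intro sL(3)) (auto simp: U_def)
        ultimately show ?thesis using \<psi>(4) by simp
      qed
      show "sL (Complex (- 9 / 19) (- 3 / 8)) \<in> component {z. (\<psi> \<circ> \<phi>) (expid z) \<in> ?V} (cpt k)"
        unfolding Vt1 q1(1)[symmetric] sLlr[OF iI(2)] by (rule lrV(1)[OF iI(2)])
      show "continuous_on {\<zeta> \<in> ?B. Re (Complex (- 16 / 19) 0) < Re \<zeta>} s1"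
        using s1(1) by (rule continuous_on_subset) (auto simp: W_def)
      show "(\<psi> \<circ> \<phi>) (expid (s1 \<xi>)) = ?h \<xi>" if "\<xi> \<in> ?B" "Re (Complex (- 16 / 19) 0) < Re \<xi>" for \<xi>
        using that by (intro s1(3)) (auto simp: W_def)
      show "s1 (Complex (- 9 / 19) (- 3 / 8)) = sL (Complex (- 9 / 19) (- 3 / 8))"
        unfolding q1(1)[symmetric] s1(2) sLlr[OF iI(2)] ..
    qed
    then show ?thesis unfolding sLlr[OF iI(3)] s1kk[OF iI(3)] .
  qed
  have kx: "kk (2 * pi + (y + 3 * e / 8)) = lx (y + 3 * e / 8)"
  proof -
    have "exp (Complex (11/5) (y + 3 * e / 8)) \<notin> slot y e" using y pi_gt3 by (intro nsl) auto
    moreover have "\<psi> (?F (kk (2 * pi + (y + 3 * e / 8)))) = exp (Complex (11/5) (y + 3 * e / 8))"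
      using Fkk[of "2 * pi + (y + 3 * e / 8)"] shift[of "11/5" "y + 3 * e / 8"] by (simp add: add.commute)
    ultimately have "?F (kk (2 * pi + (y + 3 * e / 8))) = exp (Complex (11/5) (y + 3 * e / 8))"
      using \<psi>(5) hp\<psi>(1) by metis
    then have "kk (2 * pi + (y + 3 * e / 8)) = lr (y + 3 * e / 8) \<or> lr (y + 3 * e / 8) = lx (y + 3 * e / 8)
        \<or> kk (2 * pi + (y + 3 * e / 8)) = lx (y + 3 * e / 8)"
      using Flr by (intro two(2) kkV lrV iI) auto
    then show ?thesis using swap lrx by blast
  qed
  have kx2: "kk (4 * pi + (y - 3 * e / 8)) = lx (y - 3 * e / 8)"
  proof -
    have "(\<lambda>x. lx (x - 2 * pi)) (4 * pi + (y - 3 * e / 8)) = kk (4 * pi + (y - 3 * e / 8))"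
    proof (rule cmp[of "2 * pi + (y + 3 * e / 8)" "4 * pi + (y - 3 * e / 8)"])
      show "continuous_on {2 * pi + (y + 3 * e / 8)..4 * pi + (y - 3 * e / 8)} (\<lambda>x. lx (x - 2 * pi))"
        by (rule continuous_on_compose2[OF clr(2)[of UNIV]]) (auto intro!: continuous_intros)
      fix x assume x: "x \<in> {2 * pi + (y + 3 * e / 8)..4 * pi + (y - 3 * e / 8)}"
      then have "exp (Complex (11/5) (x - 2 * pi)) \<notin> slot y e" using y by (intro nsl) auto
      then show "(\<psi> \<circ> \<phi>) (expid (lx (x - 2 * pi))) = exp (Complex (11/5) x)" using \<psi>(4) Flr shift' by simp
    qed (use kx y pi_gt3 in auto)
    moreover have "lx (2 * pi + t) = lx t" for t
    proof -
      have "Complex (11/5) t + 2 * pi * \<i> = Complex (11/5) (2 * pi + t)" by (simp add: complex_eq_iff)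
      then show ?thesis using LX(3)[OF in1[of t]] by (simp add: lx_def)
    qed
    from this[of "y - 3 * e / 8"] have "lx (4 * pi + (y - 3 * e / 8) - 2 * pi) = lx (y - 3 * e / 8)" by (simp add: algebra_simps)
    ultimately show ?thesis by simp
  qed
  have lim: "(K \<longlongrightarrow> cpt k) (at (Complex (3/2) (c + y)) within strip (3/2) (12/5))"
    if c: "kk (c + (y - 3 * e / 8)) \<in> Vt" "\<And>l t. exp (Complex l (c + t)) = exp (Complex l t)" for c
  proof -
    define H where "H = strip (3/2) (12/5) \<inter> {u. Im u > c + y - e / 2} \<inter> {u. Im u < c + y + e / 2}"
    have cH: "convex H" unfolding H_def by (intro convex_Int convex_strip convex_halfspace_Im_gt convex_halfspace_Im_lt)
    have eH: "exp u \<in> ?V" if "u \<in> H" for u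
    proof -
      have "exp (Complex (Re u) (Im u - c)) \<in> ?V" using that by (intro strB) (auto simp: H_def strip_def I_def)
      moreover have "exp u = exp (Complex (Re u) (Im u - c))" using c(2)[of "Re u" "Im u - c"] by simp
      ultimately show ?thesis by simp
    qed
    have "K ` H \<subseteq> component {z. (\<psi> \<circ> \<phi>) (expid z) \<in> ?V} (cpt k)"
    proof (rule component_superset)
      show "connected (K ` H)"
        by (intro connected_continuous_image continuous_on_subset[OF K(1)] convex_connected cH) (auto simp: H_def)
      show "K ` H \<subseteq> {z. (\<psi> \<circ> \<phi>) (expid z) \<in> ?V}"
      proof (rule image_subsetI)
        fix u assume u: "u \<in> H"
        then have "(\<psi> \<circ> \<phi>) (expid (K u)) = exp u" by (intro K(3)) (simp add: H_def)
        then show "K u \<in> {z. (\<psi> \<circ> \<phi>) (expid z) \<in> ?V}" using eH[OF u] by simp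
      qed
      show "kk (c + (y - 3 * e / 8)) \<in> K ` H" unfolding kk_def using y(3) in2 by (intro imageI) (simp add: H_def)
      show "kk (c + (y - 3 * e / 8)) \<in> component {z. (\<psi> \<circ> \<phi>) (expid z) \<in> ?V} (cpt k)" unfolding Vt1 by (rule c(1))
    qed
    then have KH: "K u \<in> component {z. (\<psi> \<circ> \<phi>) (expid z) \<in> ?V} (cpt k)" if "u \<in> H" for u using that by (metis image_subset_iff)
    have evS: "\<forall>\<^sub>F u in at (Complex (3/2) (c + y)) within strip (3/2) (12/5). u \<in> strip (3/2) (12/5)"
      by (simp add: eventually_at_filter)
    have "open ({u. Im u > c + y - e / 2} \<inter> {u. Im u < c + y + e / 2})"
      by (intro open_Int open_halfspace_Im_gt open_halfspace_Im_lt)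
    then have "\<forall>\<^sub>F u in at (Complex (3/2) (c + y)) within strip (3/2) (12/5). u \<in> {u. Im u > c + y - e / 2} \<inter> {u. Im u < c + y + e / 2}"
      using y(3) by (intro topological_tendstoD[OF tendsto_ident_at]) auto
    with evS have evH: "\<forall>\<^sub>F u in at (Complex (3/2) (c + y)) within strip (3/2) (12/5). u \<in> H"
      by eventually_elim (simp add: H_def)
    show ?thesis
    proof (rule tendsto_in_component[OF hom1 oV h'(3), of "?h p"])
      show "?h p \<in> ?V" using pB by simp
      show "z = cpt k" if "z \<in> component {z. (\<psi> \<circ> \<phi>) (expid z) \<in> ?V} (cpt k)" "(\<psi> \<circ> \<phi>) (expid z) = ?h p" for z
        using only1[of z] that unfolding Vt1 by simp
      show "\<forall>\<^sub>F u in at (Complex (3/2) (c + y)) within strip (3/2) (12/5). K u \<in> component {z. (\<psi> \<circ> \<phi>) (expid z) \<in> ?V} (cpt k)"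
        using evH by eventually_elim (rule KH)
      have "exp (Complex (3/2) (c + y)) = ?h p" using c(2) hp by simp
      moreover have "(exp \<longlongrightarrow> exp (Complex (3/2) (c + y))) (at (Complex (3/2) (c + y)) within strip (3/2) (12/5))"
        by (intro tendsto_intros)
      moreover have "\<forall>\<^sub>F u in at (Complex (3/2) (c + y)) within strip (3/2) (12/5). (\<psi> \<circ> \<phi>) (expid (K u)) = exp u"
        using evS by eventually_elim (rule K(3))
      ultimately show "((\<lambda>u. (\<psi> \<circ> \<phi>) (expid (K u))) \<longlongrightarrow> ?h p) (at (Complex (3/2) (c + y)) within strip (3/2) (12/5))"
        by (simp add: tendsto_cong)
    qed
  qed
  have lim1: "(K \<longlongrightarrow> cpt k) (at (Complex (3/2) (2 * pi + y)) within strip (3/2) (12/5))"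
  proof (rule lim)
    show "kk (2 * pi + (y - 3 * e / 8)) \<in> Vt" by (rule kkV[OF iI(2)])
    show "exp (Complex l (2 * pi + t)) = exp (Complex l t)" for l t using shift[of l t] by (simp add: add.commute)
  qed
  have lim2: "(K \<longlongrightarrow> cpt k) (at (Complex (3/2) (4 * pi + y)) within strip (3/2) (12/5))"
  proof (rule lim)
    show "kk (4 * pi + (y - 3 * e / 8)) \<in> Vt" unfolding kx2 by (rule lrV(2)[OF iI(2)])
    show "exp (Complex l (4 * pi + t)) = exp (Complex l t)" for l t
      using shift[of l t] shift[of l "t + 2 * pi"] by (simp add: add.commute algebra_simps)
  qed
  show ?thesis
    by (rule that[OF \<psi>(1,2,4,6) _ persist K(1) _ K(2) _ lim1 lim2])
       (use tip(1) \<psi>0 hp K(3) kb in \<open>simp_all add: kk_def\<close>)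
qed

section \<open>Removing an edge\<close>

text \<open>
  No tip lies on the boundary of the cell. This survives all stages and allows the tips inside
  and outside the cell to be moved separately.
\<close>

definition clean :: "real \<Rightarrow> (complex \<Rightarrow> complex) \<Rightarrow> bool" where
  "clean \<kappa> \<phi> \<longleftrightarrow> (\<forall>t\<in>tips \<phi>. t \<in> ccell \<kappa> \<longrightarrow> t \<in> cell \<kappa>)"

text \<open>
  The modifications of one cell, in standard position. They fix the unit disc pointwise, and the
  charts below transport all other cells into it; the condition on levels includes the origin
  since \<open>ln 0 = 0\<close>.
\<close>

definition admissible :: "real \<Rightarrow> (complex \<Rightarrow> complex) \<Rightarrow> bool" where
  "admissible \<kappa> \<Psi> \<longleftrightarrow> plane_homeo \<Psi> \<and> (\<forall>w. lev w \<le> 0 \<longrightarrow> \<Psi> w = w) \<and> \<Psi> ` cell \<kappa> \<subseteq> cell \<kappa>"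

lemma admissible_comp:
  assumes "admissible \<kappa> f" "admissible \<kappa> g" shows "admissible \<kappa> (g \<circ> f)"
  using assms unfolding admissible_def by (auto intro: plane_homeo_comp simp: image_subset_iff)

lemma admissible_same:
  assumes "admissible \<kappa> \<Psi>" "same \<phi> \<kappa> x y" shows "same (\<Psi> \<circ> \<phi>) \<kappa> x y"
proof -
  have "{z. \<phi> (expid z) \<in> cell \<kappa>} \<subseteq> {z. (\<Psi> \<circ> \<phi>) (expid z) \<in> cell \<kappa>}" using assms(1) by (auto simp: admissible_def)
  then show ?thesis using assms(2) connected_component_mono unfolding same_def by blast
qed

text \<open>
  The amount of the radial push: full in the direction of the positive axis, and zero at angles
  larger than \<open>\<theta>\<close>, where the edges run.
\<close>

definition facing :: "real \<Rightarrow> complex \<Rightarrow> real" where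
  "facing \<theta> w = max 0 ((Re w / cmod w - cos \<theta>) / (1 - cos \<theta>))"

lemma facing:
  assumes "0 < \<theta>" "\<theta> < pi"
  shows "continuous_on (-{0}) (facing \<theta>)" "\<And>w. 0 \<le> facing \<theta> w \<and> facing \<theta> w \<le> 1"
    "\<And>w c. c > 0 \<Longrightarrow> facing \<theta> (of_real c * w) = facing \<theta> w"
    "facing \<theta> (exp (of_real x)) = 1" "cos t \<le> cos \<theta> \<Longrightarrow> facing \<theta> (exp (Complex x t)) = 0"
proof -
  have c1: "cos \<theta> < 1" using cos_monotone_0_pi[of 0 \<theta>] assms by simp
  show "continuous_on (-{0}) (facing \<theta>)" unfolding facing_def using c1 by (intro continuous_intros) auto
  show "0 \<le> facing \<theta> w \<and> facing \<theta> w \<le> 1" for w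
  proof -
    have "Re w / cmod w \<le> 1" using complex_Re_le_cmod[of w] by (cases "w = 0") (auto simp: divide_le_eq)
    then show ?thesis using c1 by (auto simp: facing_def divide_le_eq)
  qed
  show "facing \<theta> (of_real c * w) = facing \<theta> w" if "c > 0" for w c
    using that by (simp add: facing_def norm_mult)
  show "facing \<theta> (exp (of_real x)) = 1"
    using c1 by (simp add: facing_def Re_exp)
  show "facing \<theta> (exp (Complex x t)) = 0" if "cos t \<le> cos \<theta>"
    using c1 that by (simp add: facing_def Re_exp divide_nonpos_pos)
qed

text \<open>
  The twist \<open>\<tau>\<close> lives on levels between 13/10 and 19/10 and turns the tip at
  level 3/2 and angle \<open>\<beta>\<close> to the positive axis. The push then carries it to
  level 13/5 inside the cell. Read backwards, the radial segment of the cell below the new tip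
  becomes a spiral ending at angle \<open>\<beta>\<close>, up to full turns.
\<close>

lemma sector_push:
  assumes \<theta>: "0 < \<theta>" "\<theta> < pi / 2" "0 < \<kappa>" "\<kappa> < cos \<theta>"
  obtains S \<tau> where "plane_homeo S" "continuous_on UNIV \<tau>" "\<And>l. 19/10 \<le> l \<Longrightarrow> \<tau> l = 0" "\<tau> (3/2) = - \<beta>"
    "\<And>w. lev w \<le> 13/10 \<Longrightarrow> S w = w"
    "\<And>w. w \<in> cell \<kappa> \<Longrightarrow> S w \<in> cell \<kappa>"
    "\<And>w. 12/5 < lev w \<Longrightarrow> 12/5 < lev (S w)" "\<And>w. 3 < lev w \<Longrightarrow> 3 < lev (S w)"
    "\<And>w. 2 \<le> lev w \<Longrightarrow> \<kappa> * cmod (S w) \<le> Re (S w) \<Longrightarrow> \<kappa> * cmod w \<le> Re w"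
    "\<And>x t. cos t \<le> cos \<theta> \<Longrightarrow> S (exp (Complex (11/5) t)) = exp (Complex (11/5) t)"
    "S (exp (Complex (3/2) \<beta>)) = exp (13/5)"
    "\<And>x n::int. 3/2 < x \<Longrightarrow> x < 12/5 \<Longrightarrow> S (exp (Complex x (2 * pi * of_int n - \<tau> x))) \<in> cell \<kappa>"
proof -
  define \<tau> where "\<tau> l = - \<beta> * max 0 (min ((l - 13/10) * 5) ((19/10 - l) * (5/2)))" for l :: real
  have c\<tau>: "continuous_on UNIV \<tau>" unfolding \<tau>_def by (intro continuous_intros)
  have \<tau>0: "\<tau> l = 0" if "l \<le> 13/10 \<or> 19/10 \<le> l" for l using that by (auto simp: \<tau>_def max_def min_def)
  have \<tau>1: "\<tau> (3/2) = -\<beta>" by (simp add: \<tau>_def)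
  define f where "f = radial (\<lambda>w. outw (7/5) (3/2) (13/5) 3 (facing \<theta> w))"
  have par: "7/5 < (3/2::real)" "3/2 < (13/5::real)" "13/5 < (3::real)" by auto
  have \<theta>pi: "\<theta> < pi" using \<theta> by simp
  note fc = facing[OF \<theta>(1) \<theta>pi]
  have hf: "homeomorphism UNIV UNIV f (radial (\<lambda>w. inw (7/5) (3/2) (13/5) 3 (facing \<theta> w)))" "plane_homeo f"
    unfolding f_def using radial_homeo[OF par fc(1,2,3)] by blast+
  let ?o = "outw (7/5) (3/2) (13/5) 3"
  have \<tau>neg: "\<And>l. l \<le> 0 \<Longrightarrow> \<tau> l = 0" using \<tau>0 by simp
  note tw = plane_homeo_twist[OF c\<tau> \<tau>neg]
  define S where "S = f \<circ> twist \<tau>"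
  have ofix: "?o (facing \<theta> w) l = l" if "l \<le> 7/5 \<or> 3 \<le> l" for w l using outw_fix[OF par] fc(2) that by blast
  have oge: "l \<le> ?o (facing \<theta> w) l" for w l by (rule outw_ge)
  have olt: "?o (facing \<theta> w) l < 3" if "l < 3" for w l
    using outw_strict_mono[OF par _ _ that, of "facing \<theta> w"] fc(2)[of w] ofix[of 3 w] by simp
  have Stop: "S w = f w" if "2 \<le> lev w" for w
    using twist_id[of \<tau> w] \<tau>0 that by (simp add: S_def)
  have lf: "lev (f w) = ?o (facing \<theta> w) (lev w)" if "w \<noteq> 0" for w using that by (simp add: f_def ln_cmod_radial)
  have dir: "\<exists>c>0. f w = of_real c * w" for w
    by (rule exI[of _ "exp (?o (facing \<theta> w) (lev w) - lev w)"]) (simp add: f_def radial_def mult.commute)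
  have dir2: "\<kappa> * cmod (f w) < Re (f w) \<longleftrightarrow> \<kappa> * cmod w < Re w" "\<kappa> * cmod (f w) \<le> Re (f w) \<longleftrightarrow> \<kappa> * cmod w \<le> Re w"
      "f w \<noteq> 0 \<longleftrightarrow> w \<noteq> 0" for w
  proof -
    obtain c where c: "c > 0" "f w = of_real c * w" using dir by blast
    have *: "\<kappa> * cmod (f w) = c * (\<kappa> * cmod w)" "Re (f w) = c * Re w" using c by (simp_all add: norm_mult)
    show "\<kappa> * cmod (f w) < Re (f w) \<longleftrightarrow> \<kappa> * cmod w < Re w"
      unfolding * by (rule mult_less_cancel_left_pos[OF c(1)])
    show "\<kappa> * cmod (f w) \<le> Re (f w) \<longleftrightarrow> \<kappa> * cmod w \<le> Re w"
      unfolding * by (rule mult_le_cancel_left_pos[OF c(1)])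
    show "f w \<noteq> 0 \<longleftrightarrow> w \<noteq> 0" using c by simp
  qed
  have \<kappa>1: "\<kappa> < 1" using \<theta>(4) cos_le_one[of \<theta>] by linarith
  have fexp: "f (exp (of_real x)) = exp (of_real (?o 1 x))" for x
    unfolding f_def by (subst radial_eq) (simp_all add: fc(4)[unfolded exp_of_real] exp_of_real)
  have Sx: "S (exp (Complex x (2 * pi * of_int n - \<tau> x))) = exp (of_real (?o 1 x))" for x and n :: int
  proof -
    have "twist \<tau> (exp (Complex x (2 * pi * of_int n - \<tau> x))) = exp (Complex x (2 * pi * of_int n))"
      unfolding twist_exp by (rule arg_cong[of _ _ exp]) (simp add: complex_eq_iff)
    also have "\<dots> = exp (of_real x)"
      by (rule complex_eqI) (simp_all add: Re_exp Im_exp cos_int_2pin sin_int_2pin)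
    finally show ?thesis by (simp add: S_def fexp)
  qed
  show ?thesis
  proof (rule that[of S \<tau>])
    show "plane_homeo S" unfolding S_def using tw(2) hf(2) by (rule plane_homeo_comp)
    show "continuous_on UNIV \<tau>" by fact
    show "\<tau> l = 0" if "19/10 \<le> l" for l using \<tau>0 that by simp
    show "\<tau> (3/2) = -\<beta>" by fact
    show "S w = w" if "lev w \<le> 13/10" for w
    proof -
      have "twist \<tau> w = w" using that \<tau>0 by (intro twist_id) simp
      then show ?thesis using that by (simp add: S_def f_def radial_id ofix)
    qed
    show "S w \<in> cell \<kappa>" if "w \<in> cell \<kappa>" for w
    proof -
      have w: "w \<noteq> 0" "2 < lev w" "lev w < 3" "\<kappa> * cmod w < Re w" using that by (auto simp: cell_def)
      then show ?thesis using Stop[of w] lf[of w] dir2[of w] olt[of "lev w" w] oge[of "lev w" w] by (auto simp: cell_def)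
    qed
    show "12/5 < lev (S w)" if "12/5 < lev w" for w
    proof -
      have "w \<noteq> 0" using that by auto
      then show ?thesis using Stop[of w] lf[of w] oge[of "lev w" w] that by auto
    qed
    show "3 < lev (S w)" if "3 < lev w" for w
    proof -
      have "w \<noteq> 0" using that by auto
      then show ?thesis using Stop[of w] lf[of w] oge[of "lev w" w] that by auto
    qed
    show "\<kappa> * cmod w \<le> Re w" if "2 \<le> lev w" "\<kappa> * cmod (S w) \<le> Re (S w)" for w
      using Stop[OF that(1)] dir2(2)[of w] that(2) by simp
    show "S (exp (Complex (11/5) t)) = exp (Complex (11/5) t)" if "cos t \<le> cos \<theta>" for x t
    proof -
      have "S (exp (Complex (11/5) t)) = f (exp (Complex (11/5) t))" by (rule Stop) simp
      also have "\<dots> = exp (Complex (11/5) t)"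
        unfolding f_def by (rule radial_id) (simp add: fc(5)[OF that] outw_0)
      finally show ?thesis .
    qed
    have o1: "?o 1 (3/2) = 13/5" by (rule outw_1[OF par])
    show "S (exp (Complex (3/2) \<beta>)) = exp (13/5)" using Sx[of "3/2" 0] \<tau>1 unfolding o1 by simp
    show "S (exp (Complex x (2 * pi * of_int n - \<tau> x))) \<in> cell \<kappa>" if "3/2 < x" "x < 12/5" for x and n :: int
    proof -
      have "13/5 < ?o 1 x" "?o 1 x < 3"
        using outw_strict_mono[OF par, of 1 "3/2" x] outw_strict_mono[OF par, of 1 x 3] outw_1[OF par] outw_fix[OF par, of 1 3] that by auto
      then show ?thesis unfolding Sx using \<kappa>1 by (simp add: exp_in_cell)
    qed
  qed
qed

text \<open>
  The two preimages of the radial segment in the cell, one starting near \<open>a0\<close> and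
  one near \<open>b0\<close>, follow the lift \<open>K\<close> to the critical point at the
  angles \<open>2\<pi> + y\<close> and \<open>4\<pi> + y\<close>. So both are in the component
  of the critical point over the cell.
\<close>

lemma remove_edge:
  assumes hom: "plane_homeo \<phi>" "gap \<phi>" "clean \<kappa> \<phi>" and \<theta>: "0 < \<theta>" "\<theta> < pi / 2" "0 < \<kappa>" "\<kappa> < cos \<theta>"
    and L: "finite L" "\<And>a b. (a, b) \<in> L \<Longrightarrow> edge \<phi> \<theta> a b" and e0: "(a0, b0) \<in> L" "arclift \<phi> (-\<theta>) \<theta> b0 aR" "aR \<notin> fst ` L"
  obtains \<Psi> where "admissible \<kappa> \<Psi>" "gap (\<Psi> \<circ> \<phi>)" "clean \<kappa> (\<Psi> \<circ> \<phi>)"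
    "\<And>a b. (a, b) \<in> L \<Longrightarrow> edge (\<Psi> \<circ> \<phi>) \<theta> a b" "same (\<Psi> \<circ> \<phi>) \<kappa> a0 b0"
proof -
  obtain \<phi>i where h: "homeomorphism UNIV UNIV \<phi> \<phi>i" using hom(1) unfolding plane_homeo_def by auto
  define A where "A = insert aR (fst ` L)"
  have A: "finite A" "aR \<in> A" using L(1) by (auto simp: A_def)
  have a0A: "a0 \<in> A" "a0 \<noteq> aR" using e0(1,3) by (force simp: A_def)+
  have FaR: "\<phi> (expid aR) = exp (Complex (11/5) \<theta>)" using e0(2) \<theta>(1) unfolding arclift_def by force
  obtain T Ti y e k LR LX where T: "homeomorphism UNIV UNIV T Ti" "plane_homeo T" "\<And>w. lev w \<le> 3 \<Longrightarrow> T w = w" "\<And>w. 3 < lev w \<Longrightarrow> 3 < lev (T w)"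
    and y: "pi / 2 < y" "y < pi" "0 < e" "e < 1/4" "e < y - pi / 2"
    and tip: "T (\<phi> (cval k)) = lens y e 0" "\<And>t. t \<in> tips (T \<circ> \<phi>) \<Longrightarrow> t \<in> lens y e ` ball 0 1 \<Longrightarrow> t = lens y e 0"
    and LR: "continuous_on (strip 1 (12/5)) LR" "\<And>u. u \<in> strip 1 (12/5) \<Longrightarrow> \<phi> (expid (LR u)) = exp u"
    "LR (Complex (11/5) \<theta>) = aR" "LR (Complex (11/5) y) \<in> component {z. T (\<phi> (expid z)) \<in> lens y e ` ball 0 1} (cpt k)"
    and LX: "continuous_on (strip 1 (12/5)) LX" "\<And>u. u \<in> strip 1 (12/5) \<Longrightarrow> \<phi> (expid (LX u)) = exp u"
    "\<And>u. u \<in> strip 1 (12/5) \<Longrightarrow> LX (u + 2 * pi * \<i>) = LX u"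
    "LX (Complex (11/5) y) \<in> component {z. T (\<phi> (expid z)) \<in> lens y e ` ball 0 1} (cpt k)" "LX (Complex (11/5) \<theta>) \<notin> A"
    by (rule outer_step[OF h hom(1,2) A FaR \<theta>(1,2)]) blast
  define \<phi>o where "\<phi>o = T \<circ> \<phi>"
  have ho: "homeomorphism UNIV UNIV \<phi>o (\<phi>i \<circ> Ti)" unfolding \<phi>o_def using h T(1) by (rule homeomorphism_compose)
  have Ts: "T (exp u) = exp u" if "Re u \<le> 3" for u using that by (intro T(3)) simp
  have tipso: "t \<in> tips \<phi> \<and> lev t \<le> 3 \<or> 3 < lev t" if "t \<in> tips \<phi>o" for t
  proof -
    obtain s where s: "s \<in> tips \<phi>" "t = T s" using \<open>t \<in> tips \<phi>o\<close> unfolding \<phi>o_def by auto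
    show ?thesis by (cases "lev s \<le> 3") (use T(3,4)[of s] s in auto)
  qed
  have go: "gap \<phi>o" unfolding gap_def
  proof (intro ballI impI)
    fix t assume "t \<in> tips \<phi>o" "t \<noteq> 0"
    then show "\<not> (1 \<le> lev t \<and> lev t \<le> 12/5)" using tipso[of t] hom(2) unfolding gap_def by auto
  qed
  have eo: "arclift \<phi>o s t a b" if "arclift \<phi> s t a b" for s t a b
    using that Ts unfolding arclift_def \<phi>o_def by auto
  have LRo: "\<phi>o (expid (LR u)) = exp u" if "u \<in> strip 1 (12/5)" for u using LR(2)[OF that] Ts[of u] that by (simp add: \<phi>o_def strip_def)
  have LXo: "\<phi>o (expid (LX u)) = exp u" if "u \<in> strip 1 (12/5)" for u using LX(2)[OF that] Ts[of u] that by (simp add: \<phi>o_def strip_def)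
  have tipo: "\<phi>o (cval k) = lens y e 0" "\<And>t. t \<in> tips \<phi>o \<Longrightarrow> t \<in> lens y e ` ball 0 1 \<Longrightarrow> t = lens y e 0"
    using tip by (auto simp: \<phi>o_def)
  obtain \<psi> \<psi>i K where P: "homeomorphism UNIV UNIV \<psi> \<psi>i" "plane_homeo \<psi>" "\<And>w. w \<notin> slot y e \<Longrightarrow> \<psi> w = w"
    "\<And>w. w \<in> slot y e \<Longrightarrow> \<psi> w \<in> slot y e" "\<psi> (\<phi>o (cval k)) = exp (Complex (3/2) y)"
    "\<And>a b. edge \<phi>o \<theta> a b \<Longrightarrow> a \<in> A \<Longrightarrow> a \<noteq> aR \<Longrightarrow> edge (\<psi> \<circ> \<phi>o) \<theta> a b"
    and K: "continuous_on (strip (3/2) (12/5)) K" "\<And>u. u \<in> strip (3/2) (12/5) \<Longrightarrow> \<psi> (\<phi>o (expid (K u))) = exp u"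
    "K (Complex (11/5) \<theta>) = a0" "K (Complex (11/5) (2 * pi - \<theta>)) = b0"
    "(K \<longlongrightarrow> cpt k) (at (Complex (3/2) (2 * pi + y)) within strip (3/2) (12/5))"
    "(K \<longlongrightarrow> cpt k) (at (Complex (3/2) (4 * pi + y)) within strip (3/2) (12/5))"
    by (rule pull_tip[OF ho go \<theta>(1,2) y tipo LR(1) LRo LR(3) _ LX(1) LXo LX(3) _ LX(5) A(2) a0A eo[OF L(2)[OF e0(1)]] eo[OF e0(2)]])
       (use LR(4) LX(4) in \<open>simp_all add: \<phi>o_def\<close>)
  define \<beta> where "\<beta> = 2 * pi + y"
  obtain S \<tau> where S: "plane_homeo S" "continuous_on UNIV \<tau>" "\<And>l. 19/10 \<le> l \<Longrightarrow> \<tau> l = 0" "\<tau> (3/2) = - \<beta>"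
    "\<And>w. lev w \<le> 13/10 \<Longrightarrow> S w = w"
    "\<And>w. w \<in> cell \<kappa> \<Longrightarrow> S w \<in> cell \<kappa>"
    "\<And>w. 12/5 < lev w \<Longrightarrow> 12/5 < lev (S w)" "\<And>w. 3 < lev w \<Longrightarrow> 3 < lev (S w)"
    "\<And>w. 2 \<le> lev w \<Longrightarrow> \<kappa> * cmod (S w) \<le> Re (S w) \<Longrightarrow> \<kappa> * cmod w \<le> Re w"
    "\<And>x t. cos t \<le> cos \<theta> \<Longrightarrow> S (exp (Complex (11/5) t)) = exp (Complex (11/5) t)"
    "S (exp (Complex (3/2) \<beta>)) = exp (13/5)"
    "\<And>x n::int. 3/2 < x \<Longrightarrow> x < 12/5 \<Longrightarrow> S (exp (Complex x (2 * pi * of_int n - \<tau> x))) \<in> cell \<kappa>"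
    by (rule sector_push[OF \<theta>, of \<beta>]) blast
  define \<Psi> where "\<Psi> = S \<circ> \<psi> \<circ> T"
  have \<kappa>1: "\<kappa> < 1" using \<theta>(4) cos_le_one[of \<theta>] by linarith
  have \<psi>low: "\<psi> w = w" if "lev w \<le> 27/20" for w using P(3)[of w] slot_level[of w y e] that by auto
  have \<psi>right: "\<psi> w = w" if "\<kappa> * cmod w \<le> Re w" for w
  proof (rule P(3))
    have "0 \<le> \<kappa> * cmod w" using \<theta>(3) by simp
    then show "w \<notin> slot y e" using slot_left[OF _ y, of w] that by auto
  qed
  have adm: "admissible \<kappa> \<Psi>" unfolding admissible_def
  proof (intro conjI allI impI image_subsetI)
    show "plane_homeo \<Psi>" unfolding \<Psi>_def by (intro plane_homeo_comp T(2) P(2) S(1))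
    show "\<Psi> w = w" if "lev w \<le> 0" for w using that T(3)[of w] \<psi>low[of w] S(5)[of w] by (simp add: \<Psi>_def)
    show "\<Psi> w \<in> cell \<kappa>" if "w \<in> cell \<kappa>" for w
      using that T(3)[of w] \<psi>right[of w] S(6)[of w] by (simp add: \<Psi>_def cell_def)
  qed
  have Fk: "S (\<psi> (\<phi>o (cval k))) = exp (13/5)"
  proof -
    have "exp (Complex (3/2) y) = exp (Complex (3/2) \<beta>)" by (rule complex_eqI) (simp_all add: Re_exp Im_exp \<beta>_def cos_add sin_add)
    then show ?thesis using P(5) S(11) by simp
  qed
  have kcell: "exp (13/5) \<in> cell \<kappa>" using exp_in_cell[of "13/5" \<kappa>] \<kappa>1 by simp
  have tips3: "t = exp (13/5) \<or> (\<exists>s\<in>tips \<phi>o. t = S s \<and> (s = 0 \<or> lev s < 1 \<or> 12/5 < lev s))" if t3: "t \<in> tips (\<Psi> \<circ> \<phi>)" for t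
  proof -
    obtain s where s: "s \<in> tips \<phi>o" "t = S (\<psi> s)" using t3 unfolding \<Psi>_def \<phi>o_def by auto
    show ?thesis
    proof (cases "s \<in> slot y e")
      case True
      have "slot y e \<subseteq> lens y e ` ball 0 1" using y by (intro slot_props(4)) auto
      then have "s = lens y e 0" using tipo(2)[OF s(1)] True by blast
      then show ?thesis using Fk s(2) tipo(1) by simp
    next
      case False
      then have "t = S s" using P(3) s(2) by simp
      moreover have "s = 0 \<or> lev s < 1 \<or> 12/5 < lev s" using go s(1) unfolding gap_def by force
      ultimately show ?thesis using s(1) by blast
    qed
  qed
  have S0: "S 0 = 0" using S(5)[of 0] by simp
  have gap3: "gap (\<Psi> \<circ> \<phi>)" unfolding gap_def
  proof (intro ballI impI)
    fix t assume t: "t \<in> tips (\<Psi> \<circ> \<phi>)" "t \<noteq> 0"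
    consider "t = exp (13/5)" | s where "t = S s" "s = 0 \<or> lev s < 1 \<or> 12/5 < lev s" using tips3[OF t(1)] by blast
    then show "\<not> (1 \<le> lev t \<and> lev t \<le> 12/5)"
    proof cases
      case 1
      then show ?thesis using lev_exp[of "13/5"] by simp
    next
      case 2
      then show ?thesis using t(2) S0 S(5)[of s] S(7)[of s] by auto
    qed
  qed
  have clean3: "clean \<kappa> (\<Psi> \<circ> \<phi>)" unfolding clean_def
  proof (intro ballI impI)
    fix t assume t: "t \<in> tips (\<Psi> \<circ> \<phi>)" "t \<in> ccell \<kappa>"
    consider "t = exp (13/5)" | s where "s \<in> tips \<phi>o" "t = S s" "s = 0 \<or> lev s < 1 \<or> 12/5 < lev s" using tips3[OF t(1)] by blast
    then show "t \<in> cell \<kappa>"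
    proof cases
      case 1
      then show ?thesis using kcell by simp
    next
      case 2
      have lt: "2 \<le> lev t" "lev t \<le> 3" "\<kappa> * cmod t \<le> Re t" "t \<noteq> 0" using t(2) by (auto simp: ccell_def)
      have s0: "s \<noteq> 0" using 2(2) S0 lt(4) by auto
      have "\<not> lev s < 1" using S(5)[of s] 2(2) lt(1) by auto
      then have s2: "12/5 < lev s" using 2(3) s0 by auto
      have s3: "lev s \<le> 3" using S(8)[of s] 2(2) lt(2) by force
      then have "s \<in> tips \<phi>" using tipso[OF 2(1)] by auto
      moreover have "\<kappa> * cmod s \<le> Re s" using S(9)[of s] s2 lt(3) 2(2) by simp
      then have "s \<in> ccell \<kappa>" using s0 s2 s3 by (simp add: ccell_def)
      ultimately have "s \<in> cell \<kappa>" using hom(3) unfolding clean_def by blast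
      then show ?thesis using S(6) 2(2) by simp
    qed
  qed
  have edges: "edge (\<Psi> \<circ> \<phi>) \<theta> a b" if ab: "(a, b) \<in> L" for a b
  proof -
    have "edge (\<psi> \<circ> \<phi>o) \<theta> a b" using ab e0(3) by (intro P(6) eo L(2)) (force simp: A_def)+
    then obtain l where l: "continuous_on {\<theta>..2 * pi - \<theta>} l" "\<And>x. x \<in> {\<theta>..2 * pi - \<theta>} \<Longrightarrow> (\<psi> \<circ> \<phi>o) (expid (l x)) = exp (Complex (11/5) x)"
      "l \<theta> = a" "l (2 * pi - \<theta>) = b" unfolding arclift_def by auto
    have Sf: "S (exp (Complex (11/5) x)) = exp (Complex (11/5) x)" if x: "x \<in> {\<theta>..2 * pi - \<theta>}" for x
    proof (rule S(10))
      show "cos x \<le> cos \<theta>"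
      proof (cases "x \<le> pi")
        case True
        then show ?thesis using x \<theta> by (intro cos_monotone_0_pi_le) auto
      next
        case False
        then have "cos (2 * pi - x) \<le> cos \<theta>" using x \<theta> by (intro cos_monotone_0_pi_le) auto
        then show ?thesis by simp
      qed
    qed
    have "(\<Psi> \<circ> \<phi>) (expid (l x)) = exp (Complex (11/5) x)" if "x \<in> {\<theta>..2 * pi - \<theta>}" for x
      using l(2)[OF that] Sf[OF that] by (simp add: \<Psi>_def \<phi>o_def)
    then show ?thesis using l(1,3,4) unfolding arclift_def by blast
  qed
  \<comment> \<open>The curve \<open>g\<close> is the preimage under the twist of the radial segment below the pushed tip.\<close>
  let ?G = "\<lambda>z. (\<Psi> \<circ> \<phi>) (expid z)"
  obtain \<Psi>i where \<Psi>i: "homeomorphism UNIV UNIV \<Psi> \<Psi>i" using adm unfolding admissible_def plane_homeo_def by blast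
  have oG: "open {z. ?G z \<in> cell \<kappa>}"
    by (rule open_vimage_homeo[OF homeomorphism_compose[OF h \<Psi>i] open_cell])
  have GK: "?G (K u) = S (exp u)" if "u \<in> strip (3/2) (12/5)" for u
    using K(2)[OF that] by (simp add: \<Psi>_def \<phi>o_def)
  have Gc: "?G (cpt k) \<in> cell \<kappa>" using Fk kcell by (simp add: \<Psi>_def \<phi>o_def expid_cpt)
  have joined: "same (\<Psi> \<circ> \<phi>) \<kappa> (cpt k) (K (Complex (11/5) (2 * pi * of_int n + t)))"
    if n: "(K \<longlongrightarrow> cpt k) (at (Complex (3/2) (2 * pi * of_int n + \<beta>)) within strip (3/2) (12/5))" and t: "t \<in> {-\<theta>..\<theta>}" for n :: int and t
  proof -
    define g where "g x = Complex x (2 * pi * of_int n - \<tau> x)" for x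
    define A2 where "A2 = (\<lambda>t. Complex (11/5) (2 * pi * of_int n + t)) ` {-\<theta>..\<theta>}"
    define \<Gamma> where "\<Gamma> = g ` {3/2<..<12/5} \<union> A2"
    have g11: "g (11/5) = Complex (11/5) (2 * pi * of_int n + 0)" using S(3) by (simp add: g_def)
    have cg: "continuous_on X g" for X unfolding g_def by (intro continuous_intros continuous_on_subset[OF S(2)]) auto
    have \<Gamma>s: "\<Gamma> \<subseteq> strip (3/2) (12/5)" by (auto simp: \<Gamma>_def g_def A2_def strip_def)
    have con\<Gamma>: "connected \<Gamma>" unfolding \<Gamma>_def
    proof (rule connected_Un)
      show "connected (g ` {3/2<..<12/5})" by (intro connected_continuous_image cg) auto
      show "connected A2" unfolding A2_def by (intro connected_continuous_image continuous_intros) auto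
      have "g (11/5) \<in> g ` {3/2<..<12/5}" by (intro imageI) auto
      moreover have "g (11/5) \<in> A2" unfolding g11 A2_def using \<theta>(1) by (intro imageI) auto
      ultimately show "g ` {3/2<..<12/5} \<inter> A2 \<noteq> {}" by blast
    qed
    have cellA: "S (exp u) \<in> cell \<kappa>" if "u \<in> \<Gamma>" for u
    proof -
      from that consider x where "3/2 < x" "x < 12/5" "u = g x" | s where "s \<in> {-\<theta>..\<theta>}" "u = Complex (11/5) (2 * pi * of_int n + s)"
        unfolding \<Gamma>_def A2_def by auto
      then show ?thesis
      proof cases
        case 1
        then show ?thesis using S(12) by (simp add: g_def)
      next
        case 2
        have "cos \<theta> \<le> cos \<bar>s\<bar>" using 2(1) \<theta> by (intro cos_monotone_0_pi_le) auto
        then have "\<kappa> < cos (2 * pi * of_int n + s)" using \<theta>(4) by (simp add: cos_add cos_int_2pin sin_int_2pin)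
        then have "exp u \<in> cell \<kappa>" using 2(2) by (simp add: exp_in_cell)
        then show ?thesis by (rule S(6))
      qed
    qed
    have lim: "((\<lambda>x. K (g x)) \<longlongrightarrow> cpt k) (at_right (3/2))"
    proof (rule filterlim_compose[OF n])
      have "isCont g (3/2)" using cg[of UNIV] by (simp add: continuous_on_eq_continuous_at)
      then have "(g \<longlongrightarrow> g (3/2)) (at_right (3/2))" unfolding isCont_def by (rule filterlim_mono[OF _ order_refl at_le]) simp
      moreover have "g (3/2) = Complex (3/2) (2 * pi * of_int n + \<beta>)" using S(4) by (simp add: g_def)
      moreover have "\<forall>\<^sub>F x in at_right (3/2). x \<in> {3/2<..<12/5::real}" by (rule eventually_at_right_real) simp
      then have "\<forall>\<^sub>F x in at_right (3/2). g x \<in> strip (3/2) (12/5) \<and> g x \<noteq> Complex (3/2) (2 * pi * of_int n + \<beta>)"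
        by eventually_elim (auto simp: g_def strip_def)
      ultimately show "LIM x at_right (3/2). g x :> at (Complex (3/2) (2 * pi * of_int n + \<beta>)) within strip (3/2) (12/5)"
        unfolding filterlim_at by simp
    qed
    have "open (component {z. ?G z \<in> cell \<kappa>} (cpt k))" using oG by (rule open_connected_component)
    moreover have "cpt k \<in> component {z. ?G z \<in> cell \<kappa>} (cpt k)" using Gc by simp
    ultimately have "\<forall>\<^sub>F x in at_right (3/2). K (g x) \<in> component {z. ?G z \<in> cell \<kappa>} (cpt k)" using lim topological_tendstoD by blast
    moreover have "\<forall>\<^sub>F x in at_right (3/2). x \<in> {3/2<..<12/5::real}" by (rule eventually_at_right_real) simp
    ultimately have "\<forall>\<^sub>F x in at_right (3/2). x \<in> {3/2<..<12/5::real} \<and> K (g x) \<in> component {z. ?G z \<in> cell \<kappa>} (cpt k)" by eventually_elim simp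
    then obtain x where x: "x \<in> {3/2<..<12/5}" "K (g x) \<in> component {z. ?G z \<in> cell \<kappa>} (cpt k)"
      by (metis (mono_tags, lifting) eventually_happens' trivial_limit_at_right_real)
    have "K ` \<Gamma> \<subseteq> component {z. ?G z \<in> cell \<kappa>} (cpt k)"
    proof (rule component_superset)
      show "connected (K ` \<Gamma>)" by (intro connected_continuous_image continuous_on_subset[OF K(1) \<Gamma>s] con\<Gamma>)
      show "K ` \<Gamma> \<subseteq> {z. ?G z \<in> cell \<kappa>}"
      proof (rule image_subsetI)
        fix u assume u: "u \<in> \<Gamma>"
        then have "?G (K u) = S (exp u)" using \<Gamma>s by (intro GK) blast
        then show "K u \<in> {z. ?G z \<in> cell \<kappa>}" using cellA[OF u] by simp
      qed
      show "K (g x) \<in> K ` \<Gamma>" using x(1) by (intro imageI) (simp add: \<Gamma>_def)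
    qed (rule x(2))
    moreover have "Complex (11/5) (2 * pi * of_int n + t) \<in> \<Gamma>" using t by (simp add: \<Gamma>_def A2_def)
    ultimately show ?thesis unfolding same_def by blast
  qed
  have "same (\<Psi> \<circ> \<phi>) \<kappa> (cpt k) (K (Complex (11/5) (2 * pi * of_int 0 + \<theta>)))"
    by (rule joined) (use K(5) \<theta>(1) in \<open>simp_all add: \<beta>_def\<close>)
  then have 1: "same (\<Psi> \<circ> \<phi>) \<kappa> (cpt k) a0" using K(3) by simp
  have "same (\<Psi> \<circ> \<phi>) \<kappa> (cpt k) (K (Complex (11/5) (2 * pi * of_int 1 + (- \<theta>))))"
    by (rule joined) (use K(6) \<theta>(1) in \<open>simp_all add: \<beta>_def\<close>)
  then have 2: "same (\<Psi> \<circ> \<phi>) \<kappa> (cpt k) b0" using K(4) by simp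
  show ?thesis
    by (rule that[OF adm gap3 clean3 edges same_trans[OF same_sym[OF 1] 2]])
qed

lemma join_by_edges:
  assumes "plane_homeo \<phi>" "gap \<phi>" "clean \<kappa> \<phi>" and \<theta>: "0 < \<theta>" "\<theta> < pi / 2" "0 < \<kappa>" "\<kappa> < cos \<theta>"
    and "finite L" "\<And>a b. (a, b) \<in> L \<Longrightarrow> edge \<phi> \<theta> a b" "(p, q) \<in> link \<phi> \<kappa> L" "\<phi> (expid p) \<in> cell \<kappa>"
  shows "\<exists>\<Psi>. admissible \<kappa> \<Psi> \<and> clean \<kappa> (\<Psi> \<circ> \<phi>) \<and> same (\<Psi> \<circ> \<phi>) \<kappa> p q"
  using assms(1-3,8-11)
proof (induction "card L" arbitrary: L \<phi>)
  case 0
  then have "L = {}" by simp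
  have "(p, q) \<in> {(x, y). same \<phi> \<kappa> x y}\<^sup>*" using 0(7) \<open>L = {}\<close> by (simp add: link_def)
  then have "same \<phi> \<kappa> p q"
  proof (induction rule: rtrancl_induct)
    case base
    then show ?case using 0(8) by (simp add: same_def)
  next
    case (step a b)
    then show ?case using same_trans by blast
  qed
  moreover have "admissible \<kappa> id" by (simp add: admissible_def plane_homeo_id)
  ultimately have "admissible \<kappa> id \<and> clean \<kappa> (id \<circ> \<phi>) \<and> same (id \<circ> \<phi>) \<kappa> p q"
    using 0(4) unfolding id_o by (intro conjI)
  then show ?case by (rule exI[of _ id])
next
  case (Suc n)
  note prems = Suc.prems
  obtain \<phi>i where h: "homeomorphism UNIV UNIV \<phi> \<phi>i" using prems(1) unfolding plane_homeo_def by auto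
  show ?case
  proof (cases "\<exists>a0 b0 aR. (a0, b0) \<in> L \<and> arclift \<phi> (-\<theta>) \<theta> b0 aR \<and> aR \<notin> fst ` L")
    case True
    then obtain a0 b0 aR where e: "(a0, b0) \<in> L" "arclift \<phi> (-\<theta>) \<theta> b0 aR" "aR \<notin> fst ` L" by blast
    obtain \<Psi> where \<Psi>: "admissible \<kappa> \<Psi>" "gap (\<Psi> \<circ> \<phi>)" "clean \<kappa> (\<Psi> \<circ> \<phi>)"
      "\<And>a b. (a, b) \<in> L \<Longrightarrow> edge (\<Psi> \<circ> \<phi>) \<theta> a b" "same (\<Psi> \<circ> \<phi>) \<kappa> a0 b0"
      by (rule remove_edge[OF prems(1-3) \<theta> prems(4,5) e], assumption, (rule that; assumption))
    define L' where "L' = L - {(a0, b0)}"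
    have "(p, q) \<in> link (\<Psi> \<circ> \<phi>) \<kappa> L'"
    proof (rule link_closed[OF prems(6)])
      fix x y
      show "(x, y) \<in> link (\<Psi> \<circ> \<phi>) \<kappa> L'" if "same \<phi> \<kappa> x y" using admissible_same[OF \<Psi>(1) that] by (rule link_same)
      show "(x, y) \<in> link (\<Psi> \<circ> \<phi>) \<kappa> L'" if "(x, y) \<in> L"
      proof (cases "(x, y) = (a0, b0)")
        case True
        then show ?thesis using link_same[OF \<Psi>(5)] by simp
      next
        case False
        then show ?thesis using that by (intro link_edge) (simp add: L'_def)
      qed
    qed
    moreover have "n = card L'" using Suc.hyps(2) prems(4) e(1) by (simp add: L'_def)
    moreover have "finite L'" using prems(4) by (simp add: L'_def)
    moreover have "\<And>a b. (a, b) \<in> L' \<Longrightarrow> edge (\<Psi> \<circ> \<phi>) \<theta> a b" using \<Psi>(4) by (simp add: L'_def)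
    moreover have "plane_homeo (\<Psi> \<circ> \<phi>)" using prems(1) \<Psi>(1) by (simp add: admissible_def plane_homeo_comp)
    moreover have "(\<Psi> \<circ> \<phi>) (expid p) \<in> cell \<kappa>" using prems(7) \<Psi>(1) by (auto simp: admissible_def)
    ultimately obtain \<Psi>' where \<Psi>': "admissible \<kappa> \<Psi>'" "clean \<kappa> (\<Psi>' \<circ> (\<Psi> \<circ> \<phi>))" "same (\<Psi>' \<circ> (\<Psi> \<circ> \<phi>)) \<kappa> p q"
      using Suc.hyps(1)[of L' "\<Psi> \<circ> \<phi>"] \<Psi>(2,3) by blast
    then show ?thesis using admissible_comp[OF \<Psi>(1) \<Psi>'(1)] by (intro exI[of _ "\<Psi>' \<circ> \<Psi>"]) (simp add: o_assoc)
  next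
    case False
    have "L \<noteq> {}" using Suc.hyps(2) by auto
    then obtain e where e: "e \<in> L" by blast
    have cl: "\<exists>b'. (a', b') \<in> L" if "(a, b) \<in> L" "arclift \<phi> (-\<theta>) \<theta> b a'" for a b a'
      using False that by force
    have \<theta>pi: "\<theta> < pi" using \<theta> by simp
    have red: "e \<in> link \<phi> \<kappa> (L - {e})"
      by (rule redundant_edge[OF h prems(2) \<theta>(1) \<theta>pi \<theta>(4) prems(4,5) cl e])
    have "(p, q) \<in> link \<phi> \<kappa> (L - {e})"
      if *: "e \<in> link \<phi> \<kappa> (L - {e})"
    proof (rule link_closed[OF prems(6)])
      fix x y
      show "(x, y) \<in> link \<phi> \<kappa> (L - {e})" if "same \<phi> \<kappa> x y" using that by (rule link_same)
      show "(x, y) \<in> link \<phi> \<kappa> (L - {e})" if "(x, y) \<in> L"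
        using * that by (cases "(x, y) = e") (auto intro: link_edge)
    qed
    then show ?thesis using red Suc.hyps(2) e prems by (intro Suc.hyps(1)[of "L - {e}"]) auto
  qed
qed

section \<open>Joining two points over a cell\<close>

text \<open>
  The cell is one of these sets, and by negation so is the annulus sector complementary to it;
  both are images of rectangles under the exponential function.
\<close>

definition sect :: "real \<Rightarrow> real \<Rightarrow> real \<Rightarrow> complex set" where
  "sect a b c = {w. w \<noteq> 0 \<and> a < lev w \<and> lev w < b \<and> c * cmod w < Re w}"

lemma connected_sect:
  assumes "-1 < c" "c < 1" shows "connected (sect a b c)"
proof -
  define R where "R = strip a b \<inter> {u. Im u < arccos c} \<inter> {u. Im u > - arccos c}"
  have "convex R" unfolding R_def
    by (intro convex_Int convex_strip convex_halfspace_Im_lt convex_halfspace_Im_gt)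
  have lt: "c < cos x \<longleftrightarrow> \<bar>x\<bar> < arccos c" if "\<bar>x\<bar> \<le> pi" for x
  proof -
    have "cos x = cos \<bar>x\<bar>" by simp
    moreover have "c = cos (arccos c)" using assms by simp
    moreover have "0 \<le> arccos c" "arccos c \<le> pi" using assms by (auto intro: arccos_lbound arccos_ubound)
    ultimately show ?thesis using cos_mono_less_eq[of "arccos c" "\<bar>x\<bar>"] that by auto
  qed
  have ex: "exp u \<in> sect a b c \<longleftrightarrow> a < Re u \<and> Re u < b \<and> c < cos (Im u)" for u
  proof -
    have "c * exp (Re u) < exp (Re u) * cos (Im u) \<longleftrightarrow> c < cos (Im u)" by (subst mult.commute) simp
    then show ?thesis by (auto simp: sect_def Re_exp)
  qed
  have "exp ` R = sect a b c"
  proof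
    show "exp ` R \<subseteq> sect a b c"
    proof (rule image_subsetI)
      fix u assume u: "u \<in> R"
      have "arccos c \<le> pi" using assms by (intro arccos_ubound) auto
      then have "\<bar>Im u\<bar> < arccos c" "\<bar>Im u\<bar> \<le> pi" using u by (auto simp: R_def)
      then show "exp u \<in> sect a b c" using u lt by (auto simp: ex R_def strip_def)
    qed
    show "sect a b c \<subseteq> exp ` R"
    proof
      fix w assume w: "w \<in> sect a b c"
      then have e: "w = exp (Ln w)" by (simp add: sect_def)
      then have "exp (Ln w) \<in> sect a b c" using w by simp
      moreover have "\<bar>Im (Ln w)\<bar> \<le> pi" using w mpi_less_Im_Ln[of w] Im_Ln_le_pi[of w] by (auto simp: sect_def)
      ultimately have "\<bar>Im (Ln w)\<bar> < arccos c" "a < Re (Ln w)" "Re (Ln w) < b" using lt unfolding ex by auto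
      then have "Ln w \<in> R" unfolding R_def strip_def by (simp add: abs_less_iff)
      then show "w \<in> exp ` R" using e by (metis imageI)
    qed
  qed
  moreover have "connected (exp ` R)" using \<open>convex R\<close> by (intro connected_continuous_image continuous_intros convex_connected)
  ultimately show ?thesis by simp
qed

lemma cell_sect: "cell \<kappa> = sect 2 3 \<kappa>" by (simp add: cell_def sect_def)

lemma connected_cell: "0 < \<kappa> \<Longrightarrow> \<kappa> < 1 \<Longrightarrow> connected (cell \<kappa>)"
  unfolding cell_sect by (intro connected_sect) auto

lemma bounded_cell: "bounded (cell \<kappa>)"
  by (rule bounded_subset[OF ann_props(3)[of 2 3]]) (auto simp: cell_def ann_iff)

lemma closed_ccell: "closed (ccell \<kappa>)"
proof -
  have "ccell \<kappa> = {w. exp 2 \<le> cmod w} \<inter> {w. cmod w \<le> exp 3} \<inter> {w. \<kappa> * cmod w \<le> Re w}"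
  proof (rule set_eqI)
    show "w \<in> ccell \<kappa> \<longleftrightarrow> w \<in> {w. exp 2 \<le> cmod w} \<inter> {w. cmod w \<le> exp 3} \<inter> {w. \<kappa> * cmod w \<le> Re w}" for w
      using le_lev_iff[of w 2] lev_le_iff[of w 3] by (cases "w = 0") (auto simp: ccell_def not_le)
  qed
  moreover have "closed ({w. exp 2 \<le> cmod w} \<inter> {w. cmod w \<le> exp 3} \<inter> {w. \<kappa> * cmod w \<le> Re w})"
    by (intro closed_Int closed_Collect_le continuous_intros)
  ultimately show ?thesis by simp
qed

lemma cell_ccell: "cell \<kappa> \<subseteq> ccell \<kappa>" by (auto simp: cell_def ccell_def)

text \<open>
  A union of the part below the cell, the part above it, and the complementary sector, which
  meets both.
\<close>

lemma connected_outside_ccell: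
  assumes "0 < \<kappa>" "\<kappa> < 1" "3 < d"
  shows "connected (ann 0 d - ccell \<kappa>)"
proof -
  let ?A3 = "uminus ` sect 0 d (-\<kappa>)"
  have A3: "w \<in> ?A3 \<longleftrightarrow> w \<noteq> 0 \<and> 0 < lev w \<and> lev w < d \<and> Re w < \<kappa> * cmod w" for w
  proof -
    have "w \<in> ?A3 \<longleftrightarrow> -w \<in> sect 0 d (-\<kappa>)" by (metis (no_types, lifting) add.inverse_inverse image_iff)
    then show ?thesis by (auto simp: sect_def)
  qed
  have "ann 0 d - ccell \<kappa> = (ann 0 2 \<union> ?A3) \<union> (ann 3 d \<union> ?A3)"
  proof (rule set_eqI)
    fix w :: complex
    define l where "l = lev w"
    show "w \<in> ann 0 d - ccell \<kappa> \<longleftrightarrow> w \<in> (ann 0 2 \<union> ?A3) \<union> (ann 3 d \<union> ?A3)"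
      unfolding Un_iff Diff_iff A3 ann_iff ccell_def mem_Collect_eq l_def[symmetric] using assms(3) by auto
  qed
  moreover have cA3: "connected ?A3" using assms by (intro connected_continuous_image connected_sect continuous_intros) auto
  moreover have "- exp (of_real x) \<in> ?A3" if "0 < x" "x < d" for x
    unfolding A3 using that assms(1) by (simp add: Re_exp) (smt (verit) exp_gt_zero mult_pos_pos)
  from this[of 1] this[of "(3 + d) / 2"]
  have m: "- exp (of_real 1) \<in> ?A3" "- exp (of_real ((3 + d) / 2)) \<in> ?A3" using assms(3) by auto
  moreover have "- exp (of_real 1) \<in> ann 0 2" "- exp (of_real ((3 + d) / 2)) \<in> ann 3 d" using assms(3) by (simp_all add: ann_iff)
  ultimately have "connected (ann 0 2 \<union> ?A3)" "connected (ann 3 d \<union> ?A3)"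
    by (intro connected_Un ann_props cA3; blast)+
  moreover have "(ann 0 2 \<union> ?A3) \<inter> (ann 3 d \<union> ?A3) \<noteq> {}" using m(1) by blast
  ultimately show ?thesis unfolding \<open>ann 0 d - ccell \<kappa> = (ann 0 2 \<union> ?A3) \<union> (ann 3 d \<union> ?A3)\<close> by (rule connected_Un)
qed

lemma gather_tips:
  assumes "plane_homeo \<phi>" and S: "open S" "connected S" "bounded S" and U: "open U" "U \<noteq> {}" "U \<subseteq> S"
  obtains m where "plane_homeo m" "\<And>w. w \<notin> S \<Longrightarrow> m w = w" "\<And>w. w \<in> S \<Longrightarrow> m w \<in> S"
    "\<And>t. t \<in> tips \<phi> \<Longrightarrow> t \<in> S \<Longrightarrow> m t \<in> U"
proof -
  obtain \<phi>i where h: "homeomorphism UNIV UNIV \<phi> \<phi>i" using assms(1) unfolding plane_homeo_def by blast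
  define K where "K = {t \<in> tips \<phi>. t \<in> S}"
  have fK: "finite K" unfolding K_def by (rule finite_tips_bounded[OF h S(3)])
  have "infinite U" using uncountable_open_set[OF U(1,2)] countable_finite by blast
  then obtain W where W: "W \<subseteq> U" "finite W" "card W = card K" using infinite_arbitrarily_large by blast
  then obtain g where g: "bij_betw g K W" using finite_same_card_bij[OF fK] by metis
  obtain m mi where m: "homeomorphism UNIV UNIV m mi" "plane_homeo m" "\<And>i. i \<in> K \<Longrightarrow> m i = g i"
    "\<And>w. w \<notin> S \<Longrightarrow> m w = w" "\<And>w. w \<notin> S \<Longrightarrow> mi w = w" "\<And>w. w \<in> S \<Longrightarrow> m w \<in> S" "\<And>w. w \<in> S \<Longrightarrow> mi w \<in> S"
  proof (rule move_points[OF S fK, of "\<lambda>i. i" g])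
    show "i \<in> S \<and> g i \<in> S" if "i \<in> K" for i
      using that bij_betwE[OF g] W(1) U(3) by (auto simp: K_def)
    show "pairwise (\<lambda>i j. i \<noteq> j \<and> g i \<noteq> g j) K"
      using bij_betw_imp_inj_on[OF g] by (auto simp: pairwise_def inj_on_def)
  qed auto
  have "m t \<in> U" if "t \<in> tips \<phi>" "t \<in> S" for t
  proof -
    have "t \<in> K" using that by (simp add: K_def)
    then show ?thesis using m(3)[of t] bij_betwE[OF g] W(1) by auto
  qed
  then show ?thesis using that m(2,4,6) by blast
qed

lemma tipless_levels:
  assumes "plane_homeo \<phi>"
  obtains d d' where "D < d" "d < d'" "\<And>t. t \<in> tips \<phi> \<Longrightarrow> \<not> (d \<le> lev t \<and> lev t \<le> d')"
proof -
  obtain \<phi>i where h: "homeomorphism UNIV UNIV \<phi> \<phi>i" using assms(1) unfolding plane_homeo_def by blast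
  define X where "X = lev ` {t \<in> tips \<phi>. t \<in> cball 0 (exp (D + 1))}"
  have fX: "finite X" unfolding X_def by (intro finite_imageI finite_tips_bounded[OF h]) simp
  have "infinite ({D<..<D+1} - X)" using fX by (simp add: infinite_Ioo)
  then obtain d where d: "d \<in> {D<..<D+1} - X" by (metis finite.emptyI ex_in_conv)
  have "open ({D<..<D+1} - X)" using fX by (intro open_Diff finite_imp_closed) auto
  then obtain \<epsilon> where \<epsilon>: "\<epsilon> > 0" "ball d \<epsilon> \<subseteq> {D<..<D+1} - X" using d open_contains_ball by blast
  show ?thesis
  proof (rule that[of d "d + \<epsilon> / 2"])
    show "D < d" "d < d + \<epsilon> / 2" using d \<epsilon>(1) by auto
    fix t assume t: "t \<in> tips \<phi>"
    show "\<not> (d \<le> lev t \<and> lev t \<le> d + \<epsilon> / 2)"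
    proof
      assume a: "d \<le> lev t \<and> lev t \<le> d + \<epsilon> / 2"
      then have "lev t \<in> ball d \<epsilon>" using \<epsilon>(1) by (simp add: dist_real_def)
      then have lt: "lev t \<in> {D<..<D+1} - X" using \<epsilon>(2) by blast
      have "cmod t \<le> exp (D + 1)"
      proof (cases "t = 0")
        case False
        then show ?thesis using lt lev_le_iff[of t "D + 1"] by auto
      qed simp
      then have "lev t \<in> X" using t by (auto simp: X_def)
      then show False using lt by simp
    qed
  qed
qed

text \<open>
  The disc of level \<open>d\<close> shrinks to the disc of level 23/10, while the cell stays
  inside itself. Moving tips is avoided by choosing \<open>d\<close> and \<open>d'\<close> with
  no tip between them.
\<close>

lemma compress:
  assumes "3 < d" "d < d'"
  obtains f where "plane_homeo f" "\<And>w. lev w \<le> 2 \<Longrightarrow> f w = w" "\<And>w. d' \<le> lev w \<Longrightarrow> f w = w"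
    "\<And>w. lev w < d \<Longrightarrow> lev (f w) < 23/10" "\<And>w \<kappa>. w \<in> cell \<kappa> \<Longrightarrow> f w \<in> cell \<kappa>"
proof -
  define g where "g = radial (\<lambda>w. outw 2 (23/10) d d' ((\<lambda>_. 1) w))"
  define f where "f = radial (\<lambda>w. inw 2 (23/10) d d' ((\<lambda>_. 1) w))"
  have par: "2 < (23/10::real)" "23/10 < d" "d < d'" using assms by auto
  have gf: "homeomorphism UNIV UNIV g f" "plane_homeo g" unfolding f_def g_def
    by (rule radial_homeo[OF par]; simp)+
  let ?i = "inw 2 (23/10) d d' 1" and ?o = "outw 2 (23/10) d d' 1"
  have oi: "?o (?i l) = l" "?i (?o l) = l" for l using outw_inw[OF par] by simp_all
  have ofix: "?o l = l" if "l \<le> 2 \<or> d' \<le> l" for l using outw_fix[OF par] that by simp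
  have ifix: "?i l = l" if "l \<le> 2 \<or> d' \<le> l" for l using oi(2)[of l] ofix[OF that] by simp
  have lv: "lev (f w) = ?i (lev w)" if "w \<noteq> 0" for w using that by (simp add: f_def ln_cmod_radial)
  have o23: "?o (23/10) = d" by (rule outw_1[OF par])
  have ilt: "?i l < 23/10" if "l < d" for l
  proof (rule ccontr)
    assume "\<not> ?i l < 23/10"
    have "?o (23/10) \<le> ?o (?i l)"
    proof (cases "?i l = 23/10")
      case False
      then have "23/10 < ?i l" using \<open>\<not> ?i l < 23/10\<close> by linarith
      then show ?thesis using outw_strict_mono[OF par, of 1 "23/10" "?i l"] by simp
    qed (simp only: order_refl)
    then show False using oi o23 that by simp
  qed
  have igt: "2 < ?i l" if "2 < l" for l
  proof (rule ccontr)
    assume "\<not> 2 < ?i l"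
    then have "?o (?i l) = ?i l" by (intro ofix) simp
    then show False using oi(1)[of l] that \<open>\<not> 2 < ?i l\<close> by simp
  qed
  have ile: "?i l \<le> l" for l using outw_ge[of "?i l" 2 "23/10" d d' 1] oi(1) by simp
  show ?thesis
  proof (rule that[of f])
    show "plane_homeo f" by (rule plane_homeo_inverse[OF gf])
    show "f w = w" if "lev w \<le> 2" for w unfolding f_def by (rule radial_id) (simp add: ifix that)
    show "f w = w" if "d' \<le> lev w" for w unfolding f_def by (rule radial_id) (simp add: ifix that)
    show "lev (f w) < 23/10" if "lev w < d" for w
    proof (cases "w = 0")
      case True
      then show ?thesis by (simp add: f_def)
    next
      case False
      then show ?thesis using lv ilt that by simp
    qed
    show "f w \<in> cell \<kappa>" if "w \<in> cell \<kappa>" for w \<kappa>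
    proof -
      have w: "w \<noteq> 0" "2 < lev w" "lev w < 3" "\<kappa> * cmod w < Re w" using that by (auto simp: cell_def)
      obtain c where c: "c > 0" "f w = of_real c * w"
        by (rule that[of "exp (?i (lev w) - lev w)"]) (simp_all add: f_def radial_def mult.commute)
      have *: "\<kappa> * cmod (f w) = c * (\<kappa> * cmod w)" "Re (f w) = c * Re w" using c by (simp_all add: norm_mult)
      have "\<kappa> * cmod (f w) < Re (f w)" unfolding * using mult_less_cancel_left_pos[OF c(1)] w(4) by blast
      moreover have "f w \<noteq> 0" using c w(1) by simp
      ultimately show ?thesis using lv[OF w(1)] igt[OF w(2)] ile[of "lev w"] w(3) by (simp add: cell_def)
    qed
  qed
qed

text \<open>
  The image of a path from \<open>p\<close> to \<open>q\<close> is bounded; after compression it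
  lies in the disc of level 23/10. The tips are brought below level 1 or above level 12/5
  without leaving the cell or entering it, which creates the gap. Then \<open>p\<close> and
  \<open>q\<close> are linked by edges.
\<close>

lemma join_two_points:
  assumes \<phi>: "plane_homeo \<phi>" "clean \<kappa> \<phi>" and \<kappa>: "0 < \<kappa>" "\<kappa> < 1"
    and pq: "\<phi> (expid p) \<in> cell \<kappa>" "\<phi> (expid q) \<in> cell \<kappa>"
  shows "\<exists>\<Psi>. admissible \<kappa> \<Psi> \<and> clean \<kappa> (\<Psi> \<circ> \<phi>) \<and> same (\<Psi> \<circ> \<phi>) \<kappa> p q"
proof -
  obtain \<phi>i where h: "homeomorphism UNIV UNIV \<phi> \<phi>i" using \<phi>(1) unfolding plane_homeo_def by blast
  have "bounded ((\<lambda>z. \<phi> (expid z)) ` closed_segment p q)"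
    by (intro compact_imp_bounded compact_continuous_image continuous_on_homeo_expid[OF h]) auto
  then obtain R where R: "R > 0" "\<And>z. z \<in> closed_segment p q \<Longrightarrow> cmod (\<phi> (expid z)) < R"
    unfolding bounded_pos_less by auto
  obtain d d' where d: "max 3 (ln R) < d" "d < d'" "\<And>t. t \<in> tips \<phi> \<Longrightarrow> \<not> (d \<le> lev t \<and> lev t \<le> d')"
    using tipless_levels[OF \<phi>(1)] by metis
  have "exp (ln R) < exp d" using d(1) by simp
  then have d3: "3 < d" "R < exp d" using d(1) R(1) by simp_all
  have seg: "lev (\<phi> (expid z)) < d" if "z \<in> closed_segment p q" for z
  proof (cases "\<phi> (expid z) = 0")
    case False
    then show ?thesis using R(2)[OF that] d3 lev_less_iff[of "\<phi> (expid z)" d] by simp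
  qed (use d3 in simp)
  \<comment> \<open>The target has to avoid the annulus of the gap and the cell.\<close>
  define S1 where "S1 = ann 0 d - ccell \<kappa>"
  have S1: "open S1" "connected S1" "bounded S1" unfolding S1_def
    using ann_props[of 0 d] closed_ccell connected_outside_ccell[OF \<kappa> d3(1)] by (auto intro: bounded_subset)
  have U1: "ann 0 1 \<subseteq> S1" "ann 0 1 \<noteq> {}"
  proof -
    show "ann 0 1 \<subseteq> S1" using d3 by (auto simp: S1_def ann_iff ccell_def)
    have "exp (1/2) \<in> ann 0 1" using lev_exp[of "1/2"] by (simp add: ann_iff)
    then show "ann 0 1 \<noteq> {}" by blast
  qed
  obtain m1 where m1: "plane_homeo m1" "\<And>w. w \<notin> S1 \<Longrightarrow> m1 w = w" "\<And>w. w \<in> S1 \<Longrightarrow> m1 w \<in> S1"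
    "\<And>t. t \<in> tips \<phi> \<Longrightarrow> t \<in> S1 \<Longrightarrow> m1 t \<in> ann 0 1"
    by (rule gather_tips[OF \<phi>(1) S1 ann_props(1) U1(2,1)]) blast
  have m1cell: "m1 w = w" if "w \<in> cell \<kappa>" for w using that cell_ccell m1(2) by (auto simp: S1_def)
  have m1lev: "lev (m1 w) < d" if "lev w < d" for w
    using that m1(2)[of w] m1(3)[of w] by (cases "w \<in> S1") (auto simp: S1_def ann_iff)
  obtain f where f: "plane_homeo f" "\<And>w. lev w \<le> 2 \<Longrightarrow> f w = w" "\<And>w. d' \<le> lev w \<Longrightarrow> f w = w"
    "\<And>w. lev w < d \<Longrightarrow> lev (f w) < 23/10" "\<And>w \<kappa>. w \<in> cell \<kappa> \<Longrightarrow> f w \<in> cell \<kappa>"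
    using compress[OF d3(1) d(2)] by metis
  define \<phi>1 where "\<phi>1 = f \<circ> m1 \<circ> \<phi>"
  have ph1: "plane_homeo \<phi>1" unfolding \<phi>1_def by (intro plane_homeo_comp \<phi>(1) m1(1) f(1))
  have tips1: "lev t < 1 \<or> t \<in> cell \<kappa> \<or> 3 < lev t" if t: "t \<in> tips \<phi>1" for t
  proof -
    obtain s where s: "s \<in> tips \<phi>" "t = f (m1 s)" using t unfolding \<phi>1_def by auto
    have "0 < lev s \<Longrightarrow> s \<noteq> 0" by auto
    then consider "s \<in> S1" | "s \<in> ccell \<kappa>" | "lev s \<le> 0" | "d \<le> lev s"
      unfolding S1_def Diff_iff ann_iff by (metis linorder_not_le)
    then show ?thesis
    proof cases
      case 1
      then have "m1 s \<in> ann 0 1" by (rule m1(4)[OF s(1)])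
      then show ?thesis using f(2)[of "m1 s"] s(2) by (auto simp: ann_iff)
    next
      case 2
      then have "s \<in> cell \<kappa>" using \<phi>(2) s(1) unfolding clean_def by blast
      then show ?thesis using m1cell f(5) s(2) by simp
    next
      case 3
      have "s \<notin> S1" unfolding S1_def Diff_iff ann_iff using 3 by linarith
      then show ?thesis using m1(2)[of s] f(2)[of s] s(2) 3 by auto
    next
      case 4
      then have "d' < lev s" using d(3)[OF s(1)] by auto
      moreover have "s \<notin> S1" unfolding S1_def Diff_iff ann_iff using 4 by linarith
      ultimately show ?thesis using m1(2)[of s] f(3)[of s] s(2) d(2) d3 by auto
    qed
  qed
  \<comment> \<open>The compression may have brought tips of the cell into the gap; they are moved up inside the cell.\<close>
  define U2 where "U2 = cell \<kappa> \<inter> ann (12/5) 4"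
  have U2: "open U2" "U2 \<noteq> {}" "U2 \<subseteq> cell \<kappa>"
  proof -
    show "open U2" unfolding U2_def by (intro open_Int open_cell ann_props)
    have "exp (5/2) \<in> U2" using exp_in_cell[of "5/2" \<kappa>] \<kappa>(2) lev_exp[of "5/2"] by (simp add: U2_def ann_iff)
    then show "U2 \<noteq> {}" by blast
  qed (simp add: U2_def)
  obtain m2 where m2: "plane_homeo m2" "\<And>w. w \<notin> cell \<kappa> \<Longrightarrow> m2 w = w" "\<And>w. w \<in> cell \<kappa> \<Longrightarrow> m2 w \<in> cell \<kappa>"
    "\<And>t. t \<in> tips \<phi>1 \<Longrightarrow> t \<in> cell \<kappa> \<Longrightarrow> m2 t \<in> U2"
    by (rule gather_tips[OF ph1 open_cell connected_cell[OF \<kappa>] bounded_cell U2]) blast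
  define \<Psi>0 where "\<Psi>0 = m2 \<circ> f \<circ> m1"
  define \<phi>0 where "\<phi>0 = \<Psi>0 \<circ> \<phi>"
  have \<phi>0: "\<phi>0 = m2 \<circ> \<phi>1" by (simp add: \<phi>0_def \<Psi>0_def \<phi>1_def o_assoc)
  have adm: "admissible \<kappa> \<Psi>0" unfolding admissible_def
  proof (intro conjI allI impI image_subsetI)
    show "plane_homeo \<Psi>0" unfolding \<Psi>0_def by (intro plane_homeo_comp m1(1) m2(1) f(1))
    show "\<Psi>0 w = w" if "lev w \<le> 0" for w
    proof -
      have "w \<notin> S1" "w \<notin> cell \<kappa>" using that by (auto simp: S1_def ann_iff cell_def)
      then show ?thesis using m1(2)[of w] f(2)[of w] m2(2)[of w] that by (simp add: \<Psi>0_def)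
    qed
    show "\<Psi>0 w \<in> cell \<kappa>" if "w \<in> cell \<kappa>" for w using that m1cell f(5) m2(3) by (simp add: \<Psi>0_def)
  qed
  have ph0: "plane_homeo \<phi>0" unfolding \<phi>0 by (intro plane_homeo_comp ph1 m2(1))
  have tips0: "lev t < 1 \<or> t \<in> cell \<kappa> \<and> 12/5 < lev t \<or> 3 < lev t" if t: "t \<in> tips \<phi>0" for t
  proof -
    obtain s where s: "s \<in> tips \<phi>1" "t = m2 s" using t unfolding \<phi>0 by auto
    show ?thesis
    proof (cases "s \<in> cell \<kappa>")
      case True
      then have "t \<in> U2" using m2(4)[OF s(1)] s(2) by simp
      then show ?thesis by (auto simp: U2_def ann_iff)
    next
      case False
      then show ?thesis using m2(2) s tips1[OF s(1)] by auto
    qed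
  qed
  have gap0: "gap \<phi>0" unfolding gap_def
  proof (intro ballI impI)
    fix t assume "t \<in> tips \<phi>0"
    then show "\<not> (1 \<le> lev t \<and> lev t \<le> 12/5)" using tips0[of t] by auto
  qed
  have clean0: "clean \<kappa> \<phi>0" unfolding clean_def
  proof (intro ballI impI)
    fix t assume "t \<in> tips \<phi>0" "t \<in> ccell \<kappa>"
    then show "t \<in> cell \<kappa>" using tips0[of t] by (auto simp: ccell_def)
  qed
  \<comment> \<open>Any angle with cosine strictly between \<open>\<kappa>\<close> and 1 would do.\<close>
  define \<theta> where "\<theta> = arccos ((\<kappa> + 1) / 2)"
  have ct: "cos \<theta> = (\<kappa> + 1) / 2" unfolding \<theta>_def using \<kappa> by simp
  have "arccos 1 < \<theta>" "\<theta> < arccos 0" unfolding \<theta>_def using \<kappa> by (intro arccos_less_arccos; simp)+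
  then have \<theta>: "0 < \<theta>" "\<theta> < pi / 2" "\<kappa> < cos \<theta>" using ct \<kappa> by auto
  obtain \<phi>0i where h0: "homeomorphism UNIV UNIV \<phi>0 \<phi>0i" using ph0 unfolding plane_homeo_def by blast
  have cell0: "\<phi>0 (expid p) \<in> cell \<kappa>" "\<phi>0 (expid q) \<in> cell \<kappa>" using pq adm by (auto simp: admissible_def \<phi>0_def)
  have cc: "connected_component {y. \<phi>0 (expid y) \<in> ball 0 (exp (47/20)) \<union> cell \<kappa>} p q"
    unfolding connected_component_def
  proof (intro exI conjI)
    show "connected (closed_segment p q)" by simp
    show "closed_segment p q \<subseteq> {y. \<phi>0 (expid y) \<in> ball 0 (exp (47/20)) \<union> cell \<kappa>}"
    proof clarify
      fix z assume z: "z \<in> closed_segment p q" "\<phi>0 (expid z) \<notin> cell \<kappa>"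
      let ?w = "f (m1 (\<phi> (expid z)))"
      have lw: "lev ?w < 23/10" by (intro f(4) m1lev seg z)
      have "?w \<notin> cell \<kappa>" using z(2) m2(3) by (auto simp: \<phi>0_def \<Psi>0_def)
      then have "\<phi>0 (expid z) = ?w" using m2(2) by (simp add: \<phi>0_def \<Psi>0_def)
      moreover have "cmod ?w < exp (47/20)"
      proof (cases "?w = 0")
        case False
        have "lev ?w < 47/20" using lw by linarith
        then show ?thesis using lev_less_iff[OF False] by blast
      qed simp
      ultimately show "\<phi>0 (expid z) \<in> ball 0 (exp (47/20))" by simp
    qed
  qed auto
  have \<theta>pi: "\<theta> < pi" using \<theta> by simp
  obtain L where L: "finite L" "\<And>a b. (a, b) \<in> L \<Longrightarrow> edge \<phi>0 \<theta> a b" "(p, q) \<in> link \<phi>0 \<kappa> L"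
    by (rule initial_chain[OF h0 gap0 \<theta>(1) \<theta>pi \<kappa>(1) \<theta>(3) cell0 cc]) (rule that; assumption)
  obtain \<Psi> where \<Psi>: "admissible \<kappa> \<Psi>" "clean \<kappa> (\<Psi> \<circ> \<phi>0)" "same (\<Psi> \<circ> \<phi>0) \<kappa> p q"
    using join_by_edges[OF ph0 gap0 clean0 \<theta>(1,2) \<kappa>(1) \<theta>(3) L cell0(1)] by blast
  show ?thesis
    using admissible_comp[OF adm \<Psi>(1)] \<Psi>(2,3) by (intro exI[of _ "\<Psi> \<circ> \<Psi>0"]) (simp add: \<phi>0_def o_assoc)
qed

section \<open>Infinitely many domains\<close>

text \<open>
  The cells point in the directions \<open>2\<^sup>-\<^sup>j\<^sup>-\<^sup>1\<close> with half
  widths \<open>2\<^sup>-\<^sup>j\<^sup>-\<^sup>4\<close>, so the sector of doubled width around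
  one cell misses the others.
\<close>

lemma separated_angles:
  fixes i j :: nat
  assumes "i \<noteq> j"
  shows "2 * (1/2) ^ (i + 4) + (1/2) ^ (j + 4) \<le> \<bar>(1/2) ^ (j + 1) - (1/2::real) ^ (i + 1)\<bar>"
proof -
  have *: "2 * (1/2) ^ (i + 4) + 2 * (1/2) ^ (j + 4) \<le> (1/2) ^ (i + 1) - (1/2::real) ^ (j + 1)" if "i < j" for i j :: nat
  proof -
    have "(1/2::real) ^ (j + 1) \<le> (1/2) ^ (Suc i + 1)" using that by (intro power_decreasing) auto
    moreover have "(1/2::real) ^ (i + 4) = (1/2) ^ (i + 1) / 8" "(1/2::real) ^ (j + 4) = (1/2) ^ (j + 1) / 8"
      "(1/2::real) ^ (Suc i + 1) = (1/2) ^ (i + 1) / 2" by (simp_all add: power_add numeral_eq_Suc)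
    moreover have "(0::real) < (1/2) ^ (i + 1)" by simp
    ultimately show ?thesis by linarith
  qed
  \<comment> \<open>The stronger symmetric form covers both orders of the indices.\<close>
  have p: "(0::real) < (1/2) ^ (i + 4)" "(0::real) < (1/2) ^ (j + 4)" by simp_all
  show ?thesis using *[of i j] *[of j i] p assms by (cases "i < j") linarith+
qed

lemma direction_of_other_sector:
  assumes v: "cos \<delta> * cmod (cis (- \<theta>) * w) \<le> Re (cis (- \<theta>) * w)" "w \<noteq> 0"
    and \<delta>: "0 \<le> \<delta>" "\<delta> \<le> pi" and sep: "0 \<le> \<delta>'" "\<delta>' + \<delta> \<le> \<bar>\<theta> - \<theta>'\<bar>" "\<bar>\<theta> - \<theta>'\<bar> + \<delta> \<le> pi"
  shows "Re (cis (- \<theta>') * w) \<le> cos \<delta>' * cmod w"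
proof -
  define u where "u = cis (- \<theta>) * w"
  have cu: "cmod u = cmod w" "u \<noteq> 0" using v(2) by (simp_all add: u_def norm_mult)
  define \<alpha> where "\<alpha> = Arg u"
  have ru: "u = rcis (cmod w) \<alpha>" unfolding \<alpha>_def using rcis_cmod_Arg[of u] cu by simp
  have "\<bar>\<alpha>\<bar> \<le> pi" unfolding \<alpha>_def using Arg_bounded[of u] by auto
  moreover have "cos \<delta> \<le> cos \<bar>\<alpha>\<bar>"
  proof -
    have "cos \<delta> * cmod w \<le> cmod w * cos \<alpha>" using v(1) cu(1) ru unfolding u_def[symmetric] by (metis Re_rcis)
    then have "cmod w * cos \<delta> \<le> cmod w * cos \<alpha>" by (simp only: mult.commute)
    then have "cos \<delta> \<le> cos \<alpha>" using v(2) by simp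
    then show ?thesis by simp
  qed
  ultimately have \<alpha>: "\<bar>\<alpha>\<bar> \<le> \<delta>" using cos_mono_le_eq[of \<delta> "\<bar>\<alpha>\<bar>"] \<delta> by auto
  define \<beta> where "\<beta> = \<theta> - \<theta>' + \<alpha>"
  have "cis (- \<theta>') * w = cis (\<theta> - \<theta>') * u"
    unfolding u_def mult.assoc[symmetric] cis_mult by simp
  also have "\<dots> = rcis (cmod w) \<beta>" unfolding ru \<beta>_def cis_rcis_eq rcis_mult by simp
  finally have e: "Re (cis (- \<theta>') * w) = cmod w * cos \<beta>" by (simp only: Re_rcis)
  have b: "\<delta>' \<le> \<bar>\<beta>\<bar>" "\<bar>\<beta>\<bar> \<le> pi" using \<alpha> sep unfolding \<beta>_def by linarith+
  then have "cos \<bar>\<beta>\<bar> \<le> cos \<delta>'" using sep(1) by (intro cos_monotone_0_pi_le) auto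
  then have "cmod w * cos \<beta> \<le> cmod w * cos \<delta>'" by (intro mult_left_mono) auto
  then show ?thesis using e by (simp add: mult.commute)
qed

text \<open>
  Everything up to level 3 whose direction is far enough from the positive axis is pulled into
  the unit disc, while a narrow sector is fixed; between the two sectors the amount of the push
  varies continuously with the direction.
\<close>

lemma collapse_outside_sector:
  fixes \<kappa> \<kappa>' :: real
  assumes "\<kappa>' < \<kappa>"
  obtains f g where "homeomorphism UNIV UNIV f g" "plane_homeo f"
    "\<And>w. \<exists>c>0. f w = of_real c * w" "\<And>w. w \<noteq> 0 \<Longrightarrow> \<kappa> * cmod w \<le> Re w \<Longrightarrow> f w = w"
    "\<And>w. w \<noteq> 0 \<Longrightarrow> Re w \<le> \<kappa>' * cmod w \<Longrightarrow> lev w \<le> 3 \<Longrightarrow> lev (f w) \<le> 0"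
proof -
  define dr where "dr w = max 0 (min 1 ((\<kappa> - Re w / cmod w) / (\<kappa> - \<kappa>')))" for w
  have par: "-1 < (-1/2::real)" "-1/2 < (7/2::real)" "7/2 < (5::real)" by auto
  have dr: "continuous_on (-{0}) dr" "\<And>w. 0 \<le> dr w \<and> dr w \<le> 1" "\<And>w c. c > 0 \<Longrightarrow> dr (of_real c * w) = dr w"
  proof -
    show "continuous_on (-{0}) dr" unfolding dr_def using assms by (intro continuous_intros) auto
  qed (auto simp: dr_def norm_mult)
  define g where "g = radial (\<lambda>w. outw (-1) (-1/2) (7/2) 5 (dr w))"
  define f where "f = radial (\<lambda>w. inw (-1) (-1/2) (7/2) 5 (dr w))"
  have gf: "homeomorphism UNIV UNIV g f" "plane_homeo g" unfolding f_def g_def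
    by (rule radial_homeo[OF par dr]; assumption)+
  have oi: "outw (-1) (-1/2) (7/2) 5 (dr w) (inw (-1) (-1/2) (7/2) 5 (dr w) l) = l" for w l
    using outw_inw(1)[OF par] dr(2) by blast
  show ?thesis
  proof (rule that[of f g])
    show "homeomorphism UNIV UNIV f g" using gf(1) by (rule homeomorphism_symD)
    show "plane_homeo f" by (rule plane_homeo_inverse[OF gf])
    show "\<exists>c>0. f w = of_real c * w" for w
      by (rule exI[of _ "exp (inw (-1) (-1/2) (7/2) 5 (dr w) (lev w) - lev w)"]) (simp add: f_def radial_def mult.commute)
    show "f w = w" if "w \<noteq> 0" "\<kappa> * cmod w \<le> Re w" for w
    proof -
      have "\<kappa> \<le> Re w / cmod w" using that by (simp add: le_divide_eq)
      then have "(\<kappa> - Re w / cmod w) / (\<kappa> - \<kappa>') \<le> 0" using assms by (intro divide_nonpos_pos) auto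
      then have d0: "dr w = 0" by (simp add: dr_def)
      show ?thesis unfolding f_def by (rule radial_id) (use oi[of w "lev w"] outw_0[OF par] d0 in simp)
    qed
    show "lev (f w) \<le> 0" if w: "w \<noteq> 0" "Re w \<le> \<kappa>' * cmod w" "lev w \<le> 3" for w
    proof (rule ccontr)
      assume n: "\<not> lev (f w) \<le> 0"
      have "Re w / cmod w \<le> \<kappa>'" using w by (simp add: divide_le_eq)
      then have "1 \<le> (\<kappa> - Re w / cmod w) / (\<kappa> - \<kappa>')" using assms by (simp add: le_divide_eq)
      then have d1: "dr w = 1" by (simp add: dr_def)
      have "lev (f w) = inw (-1) (-1/2) (7/2) 5 (dr w) (lev w)" using w(1) by (simp add: f_def ln_cmod_radial)
      then have "-1/2 < inw (-1) (-1/2) (7/2) 5 1 (lev w)" using n d1 by simp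
      then have "outw (-1) (-1/2) (7/2) 5 1 (-1/2) < outw (-1) (-1/2) (7/2) 5 1 (inw (-1) (-1/2) (7/2) 5 1 (lev w))"
        by (intro outw_strict_mono[OF par]) auto
      then have "7/2 < lev w" using outw_1[OF par] oi[of w "lev w"] d1 by simp
      then show False using w(3) by simp
    qed
  qed
qed

text \<open>
  Each of countably many disjoint cells can be brought to standard position by a chart that
  collapses the others into the unit disc. A single cell can then be modified by an admissible
  map in its chart without affecting the others. The charts are clean because the critical
  values have negative real part while the cells lie in the right half plane.
\<close>

lemma standard_charts:
  obtains chart charti :: "nat \<Rightarrow> complex \<Rightarrow> complex" and \<kappa> :: "nat \<Rightarrow> real"
  where "\<And>i. homeomorphism UNIV UNIV (chart i) (charti i)" "\<And>i. plane_homeo (chart i)" "\<And>i. 0 < \<kappa> i \<and> \<kappa> i < 1"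
    "\<And>i. clean (\<kappa> i) (chart i)" "\<And>i j w. i \<noteq> j \<Longrightarrow> chart j w \<in> ccell (\<kappa> j) \<Longrightarrow> lev (chart i w) \<le> 0"
proof -
  define th de :: "nat \<Rightarrow> real" where "th j = (1/2) ^ (j + 1)" and "de j = (1/2) ^ (j + 4)" for j
  have th: "0 < th j" "th j \<le> 1/2" for j
  proof -
    have "(1/2::real) ^ (j + 1) \<le> (1/2) ^ 1" by (intro power_decreasing) auto
    then show "0 < th j" "th j \<le> 1/2" by (simp_all add: th_def)
  qed
  have de: "0 < de j" "de j \<le> 1/16" for j
  proof -
    have "(1/2::real) ^ (j + 4) \<le> (1/2) ^ 4" by (intro power_decreasing) auto
    then show "0 < de j" "de j \<le> 1/16" by (simp_all add: de_def power_numeral_reduce)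
  qed
  define \<kappa> where "\<kappa> j = cos (de j)" for j
  have pi3: "pi > 3" by (rule pi_gt3)
  have k12: "1/2 < \<kappa> j" "\<kappa> j < 1" for j
  proof -
    have "cos (pi / 3) < cos (de j)" using de[of j] pi3 by (intro cos_monotone_0_pi) auto
    then show "1/2 < \<kappa> j" by (simp add: \<kappa>_def cos_60)
    have "cos (de j) < cos 0" using de[of j] pi3 by (intro cos_monotone_0_pi) auto
    then show "\<kappa> j < 1" by (simp add: \<kappa>_def)
  qed
  have kk: "cos (2 * de j) < \<kappa> j" for j unfolding \<kappa>_def using de[of j] pi3 by (intro cos_monotone_0_pi) auto
  have "\<exists>f g. homeomorphism UNIV UNIV f g \<and> plane_homeo f \<and> (\<forall>w. \<exists>c>0. f w = of_real c * w) \<and>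
      (\<forall>w. w \<noteq> 0 \<and> \<kappa> j * cmod w \<le> Re w \<longrightarrow> f w = w) \<and>
      (\<forall>w. w \<noteq> 0 \<and> Re w \<le> cos (2 * de j) * cmod w \<and> lev w \<le> 3 \<longrightarrow> lev (f w) \<le> 0)" for j
    by (rule collapse_outside_sector[OF kk[of j]]) blast
  then obtain f g where f: "\<And>j. homeomorphism UNIV UNIV (f j) (g j)" "\<And>j. plane_homeo (f j)"
    "\<And>j w. \<exists>c>0. f j w = of_real c * w" "\<And>j w. w \<noteq> 0 \<Longrightarrow> \<kappa> j * cmod w \<le> Re w \<Longrightarrow> f j w = w"
    "\<And>j w. w \<noteq> 0 \<Longrightarrow> Re w \<le> cos (2 * de j) * cmod w \<Longrightarrow> lev w \<le> 3 \<Longrightarrow> lev (f j w) \<le> 0"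
    by metis
  have rot: "homeomorphism UNIV UNIV ((*) (cis (- t))) ((*) (cis t))" "plane_homeo ((*) (cis (- t)))" for t
  proof -
    have "cis (- t) * (cis t * w) = w" "cis t * (cis (- t) * w) = w" for w
      unfolding mult.assoc[symmetric] cis_mult by simp_all
    then show h: "homeomorphism UNIV UNIV ((*) (cis (- t))) ((*) (cis t))"
      by (intro homeomorphismI continuous_intros) auto
    then show "plane_homeo ((*) (cis (- t)))" unfolding plane_homeo_def by (auto simp: norm_mult)
  qed
  define chart where "chart j = f j \<circ> (*) (cis (- th j))" for j
  have fccell: "f j v = v \<and> v \<in> ccell (\<kappa> j)" if "f j v \<in> ccell (\<kappa> j)" for j v
  proof -
    obtain c where c: "c > 0" "f j v = of_real c * v" using f(3) by blast
    have *: "\<kappa> j * cmod (f j v) = c * (\<kappa> j * cmod v)" "Re (f j v) = c * Re v" using c by (simp_all add: norm_mult)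
    have "\<kappa> j * cmod (f j v) \<le> Re (f j v)" using that by (simp add: ccell_def)
    then have "\<kappa> j * cmod v \<le> Re v" unfolding * using mult_le_cancel_left_pos[OF c(1)] by blast
    moreover have "v \<noteq> 0" using that c(2) by (auto simp: ccell_def)
    ultimately have "f j v = v" by (intro f(4))
    then show ?thesis using that by simp
  qed
  show ?thesis
  proof (rule that[of chart "\<lambda>j. (*) (cis (th j)) \<circ> g j" \<kappa>])
    show "homeomorphism UNIV UNIV (chart i) ((*) (cis (th i)) \<circ> g i)" for i
      unfolding chart_def using rot(1) f(1) by (rule homeomorphism_compose)
    show "plane_homeo (chart i)" for i unfolding chart_def using rot(2) f(2) by (rule plane_homeo_comp)
    show "0 < \<kappa> i \<and> \<kappa> i < 1" for i using k12[of i] by auto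
    show "clean (\<kappa> i) (chart i)" for i unfolding clean_def
    proof (intro ballI impI)
      fix t assume "t \<in> tips (chart i)" "t \<in> ccell (\<kappa> i)"
      then obtain k where k: "chart i (cval k) \<in> ccell (\<kappa> i)" by auto
      define v where "v = cis (- th i) * cval k"
      have v: "v \<in> ccell (\<kappa> i)" using fccell[of i v] k by (simp add: chart_def v_def)
      have cv: "cmod v = cmod (cval k)" by (simp add: v_def norm_mult)
      have pos: "0 < cmod v" using v by (auto simp: ccell_def)
      have s: "0 \<le> sin (th i)" "sin (th i) \<le> 1/2"
        using th[of i] pi3 sin_x_le_x[of "th i"] by (auto intro: sin_ge_zero)
      have c: "0 \<le> cos (th i)" using th[of i] pi3 by (intro cos_ge_zero) auto
      have "Re v = cos (th i) * Re (cval k) + sin (th i) * Im (cval k)" by (simp add: v_def)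
      also have "\<dots> \<le> 0 + sin (th i) * cmod v"
        using c s abs_Im_le_cmod[of "cval k"] by (intro add_mono mult_left_mono) (auto simp: cval_def cv)
      also have "\<dots> \<le> 1/2 * cmod v" using mult_right_mono[OF s(2), of "cmod v"] by simp
      also have "\<dots> < \<kappa> i * cmod v" using k12(1) pos by (intro mult_strict_right_mono) auto
      finally have False using v by (simp add: ccell_def)
      then show "t \<in> cell (\<kappa> i)" ..
    qed
    fix i j :: nat and w
    assume ij: "i \<noteq> j" and w: "chart j w \<in> ccell (\<kappa> j)"
    have v: "cis (- th j) * w \<in> ccell (\<kappa> j)" using fccell[of j "cis (- th j) * w"] w by (simp add: chart_def)
    then have w0: "w \<noteq> 0" and lw: "lev w \<le> 3" by (auto simp: ccell_def norm_mult)
    have "Re (cis (- th i) * w) \<le> cos (2 * de i) * cmod w"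
    proof (rule direction_of_other_sector[of "de j" "th j"])
      show "cos (de j) * cmod (cis (- th j) * w) \<le> Re (cis (- th j) * w)" using v by (simp add: ccell_def \<kappa>_def)
      show "2 * de i + de j \<le> \<bar>th j - th i\<bar>" using separated_angles[OF ij] by (simp add: th_def de_def)
      show "\<bar>th j - th i\<bar> + de j \<le> pi" using th[of i] th[of j] de[of j] pi3 by linarith
    qed (use w0 de[of i] de[of j] pi3 in auto)
    then show "lev (chart i w) \<le> 0" unfolding chart_def comp_def
      by (intro f(5)) (use w0 lw in \<open>simp_all add: norm_mult\<close>)
  qed
qed

lemma simply_connected_cell:
  assumes "0 < \<kappa>" "\<kappa> < 1" shows "simply_connected (cell \<kappa>)" "cell \<kappa> \<noteq> {}"
proof -
  have ih: "homeomorphism (Ln ` cell \<kappa>) (cell \<kappa>) exp Ln"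
  proof (rule homeomorphismI)
    have "cell \<kappa> \<subseteq> - \<real>\<^sub>\<le>\<^sub>0"
    proof
      fix w assume w: "w \<in> cell \<kappa>"
      have "0 \<le> \<kappa> * cmod w" using assms by simp
      then have "0 < Re w" using w by (auto simp: cell_def)
      then show "w \<in> - \<real>\<^sub>\<le>\<^sub>0" by (auto simp: complex_nonpos_Reals_iff)
    qed
    then show "continuous_on (cell \<kappa>) Ln" by (intro continuous_on_Ln continuous_on_id) auto
  qed (auto simp: cell_def intro!: continuous_intros)
  have "Ln ` cell \<kappa> = strip 2 3 \<inter> {u. Im u < arccos \<kappa>} \<inter> {u. Im u > - arccos \<kappa>}"
    (is "_ = ?R")
  proof -
    have d: "0 \<le> arccos \<kappa>" "arccos \<kappa> \<le> pi" "\<kappa> = cos (arccos \<kappa>)"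
      using assms by (auto intro: arccos_lbound arccos_ubound)
    have lt: "\<kappa> < cos x \<longleftrightarrow> \<bar>x\<bar> < arccos \<kappa>" if "\<bar>x\<bar> \<le> pi" for x
    proof -
      have "cos x = cos \<bar>x\<bar>" by simp
      then show ?thesis using cos_mono_less_eq[of "arccos \<kappa>" "\<bar>x\<bar>"] that d by auto
    qed
    show ?thesis
    proof
      show "Ln ` cell \<kappa> \<subseteq> ?R"
      proof (rule image_subsetI)
        fix w assume w: "w \<in> cell \<kappa>"
        then have "exp (Ln w) \<in> cell \<kappa>" by (simp add: cell_def)
        then have "2 < Re (Ln w)" "Re (Ln w) < 3" "\<kappa> < cos (Im (Ln w))" unfolding exp_in_cell by auto
        moreover have "\<bar>Im (Ln w)\<bar> \<le> pi" using w mpi_less_Im_Ln[of w] Im_Ln_le_pi[of w] by (auto simp: cell_def)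
        ultimately show "Ln w \<in> ?R" using lt by (auto simp: strip_def abs_less_iff)
      qed
      show "?R \<subseteq> Ln ` cell \<kappa>"
      proof
        fix u assume u: "u \<in> ?R"
        then have i: "\<bar>Im u\<bar> < arccos \<kappa>" by auto
        then have "\<bar>Im u\<bar> < pi" using d by linarith
        then have "u = Ln (exp u)" "exp u \<in> cell \<kappa>" using u lt[of "Im u"] i by (auto simp: exp_in_cell strip_def)
        then show "u \<in> Ln ` cell \<kappa>" by (rule image_eqI)
      qed
    qed
  qed
  then have "convex (Ln ` cell \<kappa>)"
    by (simp add: convex_Int convex_strip convex_halfspace_Im_lt convex_halfspace_Im_gt)
  then have "simply_connected (Ln ` cell \<kappa>)" by (rule convex_imp_simply_connected)
  then show "simply_connected (cell \<kappa>)"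
    using homeomorphic_simply_connected_eq homeomorphic_def ih by blast
  have "exp (5/2) \<in> cell \<kappa>" using exp_in_cell[of "5/2" \<kappa>] assms by simp
  then show "cell \<kappa> \<noteq> {}" by blast
qed

text \<open>
  A loop is compact, hence lies in one of the sets.
\<close>

lemma simply_connected_increasing_union:
  fixes W :: "nat \<Rightarrow> complex set"
  assumes op: "\<And>n. open (W n)" and sc: "\<And>n. simply_connected (W n)" and inc: "\<And>n. W n \<subseteq> W (Suc n)"
  shows "simply_connected (\<Union>n. W n)"
  unfolding simply_connected_eq_contractible_loop_any
proof (intro allI impI)
  fix p a assume p: "path p \<and> path_image p \<subseteq> (\<Union>n. W n) \<and> pathfinish p = pathstart p \<and> a \<in> (\<Union>n. W n)"
  have mono: "W m \<subseteq> W n" if "m \<le> n" for m n using that inc by (rule lift_Suc_mono_le[rotated])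
  have "compact (path_image p)" using p by (simp add: compact_path_image)
  then obtain I where I: "finite I" "path_image p \<subseteq> (\<Union>n\<in>I. W n)"
    using p op compactE_image[of "path_image p" UNIV W] by (metis (no_types, lifting) subset_UNIV)
  obtain m where m: "a \<in> W m" using p by blast
  define N where "N = Max (insert m I)"
  have "W n \<subseteq> W N" if "n \<in> insert m I" for n using that I(1) by (intro mono) (simp add: N_def)
  then have N: "path_image p \<subseteq> W N" "a \<in> W N" using I(2) m by blast+
  have "homotopic_loops (W N) p (linepath a a)"
    using sc[of N] p N unfolding simply_connected_eq_contractible_loop_any by blast
  then show "homotopic_loops (\<Union>n. W n) p (linepath a a)" by (rule homotopic_loops_subset) blast
qed

text \<open>
  Conjugating with the chart of the \<open>i\<close>-th cell. Elsewhere the new map is the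
  identity, so cleanness with respect to the other cells is inherited.
\<close>

lemma stage:
  fixes chart charti :: "nat \<Rightarrow> complex \<Rightarrow> complex"
  assumes chart: "\<And>i. homeomorphism UNIV UNIV (chart i) (charti i)" "\<And>i. plane_homeo (chart i)" "\<And>i. 0 < \<kappa> i \<and> \<kappa> i < 1"
    "\<forall>i j w. i \<noteq> j \<longrightarrow> chart j w \<in> ccell (\<kappa> j) \<longrightarrow> lev (chart i w) \<le> 0"
    and \<phi>: "plane_homeo \<phi>" "\<And>i. clean (\<kappa> i) (chart i \<circ> \<phi>)"
  shows "\<exists>\<phi>'. plane_homeo \<phi>' \<and> (\<forall>j. clean (\<kappa> j) (chart j \<circ> \<phi>')) \<and>
    (\<forall>j w. chart j (\<phi> w) \<in> cell (\<kappa> j) \<longrightarrow> chart j (\<phi>' w) \<in> cell (\<kappa> j)) \<and>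
    (chart i (\<phi> (expid p)) \<in> cell (\<kappa> i) \<longrightarrow> chart i (\<phi> (expid q)) \<in> cell (\<kappa> i) \<longrightarrow>
       connected_component {z. chart i (\<phi>' (expid z)) \<in> cell (\<kappa> i)} p q)"
proof (cases "chart i (\<phi> (expid p)) \<in> cell (\<kappa> i) \<and> chart i (\<phi> (expid q)) \<in> cell (\<kappa> i)")
  case True
  note ch = homeo_UNIV[OF chart(1)]
  have away: "lev (chart i w) \<le> 0" if "i \<noteq> j" "chart j w \<in> ccell (\<kappa> j)" for i j w
    using chart(4) that by blast
  have "plane_homeo (chart i \<circ> \<phi>)" by (intro plane_homeo_comp \<phi>(1) chart(2))
  moreover have "(chart i \<circ> \<phi>) (expid p) \<in> cell (\<kappa> i)" "(chart i \<circ> \<phi>) (expid q) \<in> cell (\<kappa> i)" using True by auto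
  ultimately obtain \<Psi> where \<Psi>: "admissible (\<kappa> i) \<Psi>" "clean (\<kappa> i) (\<Psi> \<circ> (chart i \<circ> \<phi>))"
      "same (\<Psi> \<circ> (chart i \<circ> \<phi>)) (\<kappa> i) p q"
    using join_two_points[of "chart i \<circ> \<phi>" "\<kappa> i" p q] \<phi>(2) chart(3) by blast
  define \<Phi> where "\<Phi> = charti i \<circ> \<Psi> \<circ> chart i"
  have ci: "plane_homeo (charti i)" by (rule plane_homeo_inverse[OF chart(1,2)])
  have h\<Phi>: "plane_homeo \<Phi>" unfolding \<Phi>_def using \<Psi>(1) by (intro plane_homeo_comp ci chart(2)) (simp add: admissible_def)
  obtain \<Phi>i where \<Phi>i: "homeomorphism UNIV UNIV \<Phi> \<Phi>i" using h\<Phi> unfolding plane_homeo_def by blast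
  have on: "chart i (\<Phi> w) = \<Psi> (chart i w)" for w by (simp add: \<Phi>_def ch(2))
  have off: "\<Phi> w = w" if "lev (chart i w) \<le> 0" for w
    using that \<Psi>(1) ch(1) unfolding admissible_def by (simp add: \<Phi>_def)
  have bc: "w \<in> ccell (\<kappa> j)" if "w \<in> cell (\<kappa> j)" for w j using that by (auto simp: cell_def ccell_def)
  show ?thesis
  proof (intro exI[of _ "\<Phi> \<circ> \<phi>"] conjI allI impI)
    show "plane_homeo (\<Phi> \<circ> \<phi>)" by (intro plane_homeo_comp \<phi>(1) h\<Phi>)
    fix j
    show "clean (\<kappa> j) (chart j \<circ> (\<Phi> \<circ> \<phi>))"
    proof (cases "j = i")
      case True
      have "chart j \<circ> (\<Phi> \<circ> \<phi>) = \<Psi> \<circ> (chart i \<circ> \<phi>)" using on True by auto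
      then show ?thesis using \<Psi>(2) True by simp
    next
      case False
      show ?thesis unfolding clean_def
      proof (intro ballI impI)
        fix t assume t: "t \<in> tips (chart j \<circ> (\<Phi> \<circ> \<phi>))" "t \<in> ccell (\<kappa> j)"
        then obtain k where k: "t = chart j (\<Phi> (\<phi> (cval k)))" by auto
        have "\<Phi> (\<Phi> (\<phi> (cval k))) = \<Phi> (\<phi> (cval k))" using False t(2) unfolding k by (intro off away[of i j]) auto
        then have "\<Phi> (\<phi> (cval k)) = \<phi> (cval k)" using homeo_UNIV(1)[OF \<Phi>i] by metis
        then have "t \<in> tips (chart j \<circ> \<phi>)" using k by auto
        then show "t \<in> cell (\<kappa> j)" using t(2) \<phi>(2)[of j] unfolding clean_def by blast
      qed
    qed
    show "chart j ((\<Phi> \<circ> \<phi>) w) \<in> cell (\<kappa> j)" if w: "chart j (\<phi> w) \<in> cell (\<kappa> j)" for w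
    proof (cases "j = i")
      case True
      then show ?thesis using \<Psi>(1) w by (auto simp: on admissible_def)
    next
      case False
      have "\<Phi> (\<phi> w) = \<phi> w" using False bc[OF w] by (intro off away[of i j]) auto
      then show ?thesis using w by simp
    qed
  next
    show "connected_component {z. chart i ((\<Phi> \<circ> \<phi>) (expid z)) \<in> cell (\<kappa> i)} p q"
      using \<Psi>(3) unfolding same_def by (simp add: on)
  qed
qed (use \<phi> in blast)

text \<open>
  Every task occurs infinitely often, so in particular after both points have entered the
  preimage of the cell.
\<close>

lemma schedule:
  obtains e :: "nat \<Rightarrow> nat \<times> nat \<times> nat" where "\<And>N t. \<exists>n\<ge>N. e n = t"
proof (rule that[of "\<lambda>n. map_prod id prod_decode (prod_decode (snd (prod_decode n)))"])
  fix N :: nat and t :: "nat \<times> nat \<times> nat"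
  obtain i a b where t: "t = (i, a, b)" by (cases t)
  show "\<exists>n\<ge>N. map_prod id prod_decode (prod_decode (snd (prod_decode n))) = t"
    by (rule exI[of _ "prod_encode (N, prod_encode (i, prod_encode (a, b)))"]) (simp add: t le_prod_encode_1)
qed

lemma wada_domains_of_expid:
  "\<exists>U :: nat \<Rightarrow> complex set. disjoint_family U \<and>
     (\<forall>j. U j \<noteq> {} \<and> open (U j) \<and> connected (U j) \<and> simply_connected (U j) \<and> connected (expid -` U j))"
proof -
  obtain chart charti :: "nat \<Rightarrow> complex \<Rightarrow> complex" and \<kappa> :: "nat \<Rightarrow> real" where
    chart: "\<And>i. homeomorphism UNIV UNIV (chart i) (charti i)" "\<And>i. plane_homeo (chart i)" "\<And>i. 0 < \<kappa> i \<and> \<kappa> i < 1"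
    "\<And>i. clean (\<kappa> i) (chart i)" "\<And>i j w. i \<noteq> j \<Longrightarrow> chart j w \<in> ccell (\<kappa> j) \<Longrightarrow> lev (chart i w) \<le> 0"
    by (rule standard_charts) blast
  have chart5: "\<forall>i j w. i \<noteq> j \<longrightarrow> chart j w \<in> ccell (\<kappa> j) \<longrightarrow> lev (chart i w) \<le> 0" using chart(5) by blast
  obtain D :: "complex set" where D: "countable D" "\<And>X. open X \<Longrightarrow> X \<noteq> {} \<Longrightarrow> \<exists>d\<in>D. d \<in> X"
    by (rule countable_dense_setE) blast
  have "D \<noteq> {}" using D(2)[of UNIV] by auto
  define d where "d = from_nat_into D"
  have d: "\<exists>a. d a \<in> X" if "open X" "X \<noteq> {}" for X
    using D(2)[OF that] range_from_nat_into[OF \<open>D \<noteq> {}\<close> D(1)] unfolding d_def by (metis rangeE)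
  obtain e :: "nat \<Rightarrow> nat \<times> nat \<times> nat" where e: "\<And>N t. \<exists>n\<ge>N. e n = t" by (rule schedule) blast
  define P where "P \<phi> \<longleftrightarrow> plane_homeo \<phi> \<and> (\<forall>i. clean (\<kappa> i) (chart i \<circ> \<phi>))" for \<phi>
  define Q where "Q n \<phi> \<phi>' \<longleftrightarrow> (\<forall>j w. chart j (\<phi> w) \<in> cell (\<kappa> j) \<longrightarrow> chart j (\<phi>' w) \<in> cell (\<kappa> j)) \<and>
      (\<forall>i a b. e n = (i, a, b) \<longrightarrow> chart i (\<phi> (expid (d a))) \<in> cell (\<kappa> i) \<longrightarrow> chart i (\<phi> (expid (d b))) \<in> cell (\<kappa> i) \<longrightarrow>
       connected_component {z. chart i (\<phi>' (expid z)) \<in> cell (\<kappa> i)} (d a) (d b))" for n \<phi> \<phi>'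
  have "\<exists>\<phi>. \<forall>n. P (\<phi> n) \<and> Q n (\<phi> n) (\<phi> (Suc n))"
  proof (rule dependent_nat_choice)
    show "\<exists>\<phi>. P \<phi>" unfolding P_def using chart(4) plane_homeo_id by (intro exI[of _ id]) simp
    fix \<phi> n assume "P \<phi>"
    then have \<phi>: "plane_homeo \<phi>" "\<And>i. clean (\<kappa> i) (chart i \<circ> \<phi>)" by (auto simp: P_def)
    obtain i a b where en: "e n = (i, a, b)" by (cases "e n")
    show "\<exists>\<phi>'. P \<phi>' \<and> Q n \<phi> \<phi>'"
      using stage[of chart charti \<kappa> \<phi> i "d a" "d b", OF chart(1,2,3) chart5 \<phi>] unfolding P_def Q_def en by blast
  qed
  then obtain \<phi> where \<phi>: "\<And>n. P (\<phi> n)" "\<And>n. Q n (\<phi> n) (\<phi> (Suc n))" by blast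
  define W where "W i n = {w. chart i (\<phi> n w) \<in> cell (\<kappa> i)}" for i n
  have inc: "W i n \<subseteq> W i (Suc n)" for i n using \<phi>(2)[of n] unfolding Q_def W_def by blast
  have mono: "W i m \<subseteq> W i n" if "m \<le> n" for i m n using that inc by (rule lift_Suc_mono_le[rotated])
  have W: "open (W i n)" "simply_connected (W i n)" "W i n \<noteq> {}" for i n
  proof -
    obtain g where g: "homeomorphism UNIV UNIV (\<phi> n) g" using \<phi>(1)[of n] unfolding P_def plane_homeo_def by blast
    have hc: "homeomorphism UNIV UNIV (chart i \<circ> \<phi> n) (g \<circ> charti i)" using g chart(1) by (rule homeomorphism_compose)
    note hh = homeo_UNIV[OF hc]
    have "W i n = (chart i \<circ> \<phi> n) -` cell (\<kappa> i)" by (auto simp: W_def)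
    then show "open (W i n)" using open_vimage[OF open_cell hh(3)] by simp
    have im: "(chart i \<circ> \<phi> n) ` W i n = cell (\<kappa> i)"
    proof
      show "(chart i \<circ> \<phi> n) ` W i n \<subseteq> cell (\<kappa> i)" by (auto simp: W_def)
      show "cell (\<kappa> i) \<subseteq> (chart i \<circ> \<phi> n) ` W i n"
      proof
        fix x assume "x \<in> cell (\<kappa> i)"
        then have "(g \<circ> charti i) x \<in> W i n" using hh(2)[of x] by (simp add: W_def)
        then show "x \<in> (chart i \<circ> \<phi> n) ` W i n" using hh(2)[of x] by (intro image_eqI[of _ _ "(g \<circ> charti i) x"]) simp_all
      qed
    qed
    have "homeomorphism (W i n) (cell (\<kappa> i)) (chart i \<circ> \<phi> n) (g \<circ> charti i)"
      using hc by (rule homeomorphism_of_subsets[OF _ _ _ im]) auto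
    then have "W i n homeomorphic cell (\<kappa> i)" unfolding homeomorphic_def by blast
    then show "simply_connected (W i n)" using homeomorphic_simply_connected_eq simply_connected_cell(1) chart(3) by blast
    show "W i n \<noteq> {}" using im simply_connected_cell(2)[of "\<kappa> i"] chart(3)[of i] by blast
  qed
  define U where "U i = (\<Union>n. W i n)" for i
  have sc: "simply_connected (U i)" for i unfolding U_def by (intro simply_connected_increasing_union W inc)
  have oU: "open (U i)" for i unfolding U_def using W(1) by blast
  have "disjoint_family U" unfolding disjoint_family_on_def
  proof (intro ballI impI)
    fix i j :: nat assume ij: "i \<noteq> j"
    show "U i \<inter> U j = {}"
    proof (rule ccontr)
      assume "U i \<inter> U j \<noteq> {}"
      then obtain w m n where "w \<in> W i m" "w \<in> W j n" unfolding U_def by blast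
      then have "w \<in> W i (max m n)" "w \<in> W j (max m n)" using mono[of m "max m n" i] mono[of n "max m n" j] by auto
      then have "chart i (\<phi> (max m n) w) \<in> cell (\<kappa> i)" "chart j (\<phi> (max m n) w) \<in> ccell (\<kappa> j)"
        using cell_ccell unfolding W_def by blast+
      then show False using chart(5)[OF ij] unfolding cell_def by fastforce
    qed
  qed
  moreover have "connected (expid -` U i)" for i
    unfolding connected_iff_connected_component
  proof (intro ballI)
    let ?V = "expid -` U i"
    fix x y assume xy: "x \<in> ?V" "y \<in> ?V"
    have oV: "open ?V" using oU continuous_on_expid by (rule open_vimage)
    have near: "\<exists>a. connected_component ?V z (d a)" if "z \<in> ?V" for z
      using d[of "component ?V z"] open_connected_component[OF oV] that by (metis connected_component_refl empty_iff mem_Collect_eq)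
    obtain a b where ab: "connected_component ?V x (d a)" "connected_component ?V y (d b)" using near xy by blast
    then have "d a \<in> ?V" "d b \<in> ?V" using connected_component_in by metis+
    then obtain m n where mn: "expid (d a) \<in> W i m" "expid (d b) \<in> W i n" unfolding U_def by blast
    obtain N where N: "max m n \<le> N" "e N = (i, a, b)" using e by blast
    have "expid (d a) \<in> W i N" "expid (d b) \<in> W i N" using mn mono[of m N i] mono[of n N i] N(1) by auto
    then have "connected_component {z. chart i (\<phi> (Suc N) (expid z)) \<in> cell (\<kappa> i)} (d a) (d b)"
      using \<phi>(2)[of N] N(2) unfolding Q_def W_def by blast
    moreover have "{z. chart i (\<phi> (Suc N) (expid z)) \<in> cell (\<kappa> i)} \<subseteq> ?V" unfolding U_def W_def by blast
    ultimately have "connected_component ?V (d a) (d b)" using connected_component_of_subset by metis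
    then show "connected_component ?V x y" using ab connected_component_trans connected_component_sym by metis
  qed
  moreover have "U i \<noteq> {}" for i using W(3)[of i 0] unfolding U_def by blast
  ultimately show ?thesis using sc oU simply_connected_imp_connected by blast
qed

theorem theorem1p2:
  fixes f :: "complex \<Rightarrow> complex"
  assumes f: "\<And>z. f z = exp z + z"
  shows "\<exists>U :: nat \<Rightarrow> complex set.
           disjoint_family U \<and>
           (\<forall>j. plane_domain (U j) \<and> simply_connected (U j) \<and> connected (f -` U j))"
proof -
  have "f = expid" using f by (intro ext) (simp add: expid_def)
  then show ?thesis using wada_domains_of_expid unfolding plane_domain_def by simp
qed

end
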